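(* Let $\alpha<0$. Then the initial value problem $$\begin{cases} i\partial_t u+\partial_y^2u+\alpha\partial_x^4u=\pm|u|^2u, & t\in\mathbb{R},\ (x,y)\in\mathbb{T}^2,\\ u(0,x,y)=\phi(x,y),\end{cases}$$ (with either choice of sign) is locally well-posed for any given initial data $\phi\in H^s(\mathbb{T}^2)$ whenever $s>\tfrac14$.
   Context: $\mathbb{T}=\mathbb{R}/2\pi\mathbb{Z}$; $u$ is complex valued; $H^s(\mathbb{T}^2)$ is the usual $L^2$-based Sobolev space. Solutions are understood as solutions of the integral equation $u(t)=S(t)\phi\mp i\int_0^tS(t-t')|u(t')|^2u(t')\,dt'$, where $S(t)=e^{it(\partial_y^2+\alpha\partial_x^4)}$ is the Fourier multiplier $[S(t)f]^\wedge(n_1,n_2)=e^{-it(-\alpha n_1^4+n_2^2)}\widehat f(n_1,n_2)$, $(n_1,n_2)\in\mathbb{Z}^2$. Local well-posedness is in the usual sense: for each $\phi\in H^s(\mathbb{T}^2)$ there are $T>0$ and a solution $u\in C([-T,T];H^s(\mathbb{T}^2))$, which is unique in a suitable Banach space continuously embedded in $C([-T,T];H^s(\mathbb{T}^2))$ and depends continuously on the initial data. *)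

theory Defs
  imports "HOL-Analysis.Analysis"
begin

text \<open>
  The circle is identified with its fundamental domain \<open>[0, 2\<pi>)\<close>: a function on the two-torus is a
  map on \<open>real \<times> real\<close> of which only the values on \<open>[0, 2\<pi>) \<times> [0, 2\<pi>)\<close> matter.  Elements of
  function spaces are represented by functions, and equality of elements is equality
  almost everywhere with respect to \<open>torus2\<close>.
\<close>

definition torus :: "real measure" where
  "torus = restrict_space lborel {0..<2 * pi}"

definition torus2 :: "(real \<times> real) measure" where
  "torus2 = torus \<Otimes>\<^sub>M torus"

definition fourier_coeff :: "(real \<times> real \<Rightarrow> complex) \<Rightarrow> int \<times> int \<Rightarrow> complex" where
  "fourier_coeff f = (\<lambda>(n1, n2).
     (\<integral>(x, y). f (x, y) * exp (- \<i> * complex_of_real (of_int n1 * x + of_int n2 * y)) \<partial>torus2)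
       / complex_of_real ((2 * pi)\<^sup>2))"

definition sobolev_weight :: "real \<Rightarrow> int \<times> int \<Rightarrow> real" where
  "sobolev_weight s = (\<lambda>(n1, n2). (1 + (of_int n1)\<^sup>2 + (of_int n2)\<^sup>2) powr s)"

text \<open>
  The Sobolev space of order \<open>s\<close>, for \<open>s \<ge> 0\<close> only: its elements are then square integrable
  functions, and no distributions are needed.
\<close>

definition sobolev :: "real \<Rightarrow> (real \<times> real \<Rightarrow> complex) set" where
  "sobolev s = {f. f \<in> borel_measurable torus2 \<and>
     integrable torus2 (\<lambda>z. (cmod (f z))\<^sup>2) \<and>
     (\<lambda>n. sobolev_weight s n * (cmod (fourier_coeff f n))\<^sup>2) summable_on UNIV}"

definition sobolev_norm :: "real \<Rightarrow> (real \<times> real \<Rightarrow> complex) \<Rightarrow> real" where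
  "sobolev_norm s f =
     sqrt (\<Sum>\<^sub>\<infinity>n. sobolev_weight s n * (cmod (fourier_coeff f n))\<^sup>2)"

definition C_sobolev :: "real \<Rightarrow> real \<Rightarrow> (real \<Rightarrow> real \<times> real \<Rightarrow> complex) set" where
  "C_sobolev s T = {u. \<forall>t\<in>{-T..T}. u t \<in> sobolev s \<and>
     ((\<lambda>r. sobolev_norm s (\<lambda>z. u r z - u t z)) \<longlongrightarrow> 0) (at t within {-T..T})}"

definition C_sobolev_norm :: "real \<Rightarrow> real \<Rightarrow> (real \<Rightarrow> real \<times> real \<Rightarrow> complex) \<Rightarrow> real" where
  "C_sobolev_norm s T u = (SUP t\<in>{-T..T}. sobolev_norm s (u t))"

definition same_path ::
    "real \<Rightarrow> (real \<Rightarrow> real \<times> real \<Rightarrow> complex) \<Rightarrow> (real \<Rightarrow> real \<times> real \<Rightarrow> complex) \<Rightarrow> bool" where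
  "same_path T u v \<longleftrightarrow> (\<forall>t\<in>{-T..T}. AE z in torus2. u t z = v t z)"

text \<open>
  \<open>X\<close> with norm \<open>N\<close> is a complex Banach space continuously embedded in \<open>C([-T, T]; H\<^sup>s)\<close>.
  As \<open>X\<close> is a set of representatives, it is closed under \<open>same_path\<close>, and \<open>N\<close> vanishes exactly
  on the representatives of zero.
\<close>

definition banach_embedded_in_C_sobolev ::
    "real \<Rightarrow> real \<Rightarrow> (real \<Rightarrow> real \<times> real \<Rightarrow> complex) set \<Rightarrow>
      ((real \<Rightarrow> real \<times> real \<Rightarrow> complex) \<Rightarrow> real) \<Rightarrow> bool" where
  "banach_embedded_in_C_sobolev s T X N \<longleftrightarrow>
     X \<subseteq> C_sobolev s T \<and>
     (\<forall>u\<in>X. \<forall>v\<in>C_sobolev s T. same_path T u v \<longrightarrow> v \<in> X) \<and>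
     (\<lambda>t z. 0) \<in> X \<and>
     (\<forall>u\<in>X. \<forall>v\<in>X. (\<lambda>t z. u t z + v t z) \<in> X) \<and>
     (\<forall>c. \<forall>u\<in>X. (\<lambda>t z. c * u t z) \<in> X) \<and>
     (\<forall>u\<in>X. 0 \<le> N u) \<and>
     (\<forall>u\<in>X. N u = 0 \<longleftrightarrow> same_path T u (\<lambda>t z. 0)) \<and>
     (\<forall>c. \<forall>u\<in>X. N (\<lambda>t z. c * u t z) = cmod c * N u) \<and>
     (\<forall>u\<in>X. \<forall>v\<in>X. N (\<lambda>t z. u t z + v t z) \<le> N u + N v) \<and>
     (\<forall>w :: nat \<Rightarrow> real \<Rightarrow> real \<times> real \<Rightarrow> complex.
        (\<forall>k. w k \<in> X) \<and>
        (\<forall>\<epsilon>>0. \<exists>K. \<forall>j\<ge>K. \<forall>k\<ge>K. N (\<lambda>t z. w j t z - w k t z) < \<epsilon>) \<longrightarrow>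
        (\<exists>u\<in>X. (\<lambda>k. N (\<lambda>t z. w k t z - u t z)) \<longlonglongrightarrow> 0)) \<and>
     (\<exists>C. \<forall>u\<in>X. C_sobolev_norm s T u \<le> C * N u)"

text \<open>
  The multiplier \<open>S(t)\<close>, acting on families of Fourier coefficients, so that it also applies to
  distributions (\<open>S(t) f\<close> need not be a function when \<open>f\<close> is merely integrable).
\<close>

definition propagator :: "real \<Rightarrow> real \<Rightarrow> (int \<times> int \<Rightarrow> complex) \<Rightarrow> int \<times> int \<Rightarrow> complex" where
  "propagator \<alpha> t c = (\<lambda>(n1, n2).
     exp (- \<i> * complex_of_real (t * (- \<alpha> * (of_int n1) ^ 4 + (of_int n2)\<^sup>2))) * c (n1, n2))"

definition cubic :: "(real \<times> real \<Rightarrow> complex) \<Rightarrow> real \<times> real \<Rightarrow> complex" where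
  "cubic f = (\<lambda>z. complex_of_real ((cmod (f z))\<^sup>2) * f z)"

text \<open>
  Solutions on \<open>[-T, T]\<close> of the integral equation; the sign \<open>\<sigma>\<close> is that of the nonlinearity
  \<open>\<sigma> |u|\<^sup>2 u\<close> in the differential equation.  For small \<open>s\<close>, a function in \<open>H\<^sup>s\<close> need not have an
  integrable cube; \<open>u\<close> is therefore required to be in \<open>L\<^sup>3([-T, T] \<times> torus2)\<close>, so that the
  nonlinearity is an integrable function of time and space.  The equation is an equality of
  distributions on the torus, at each time, and is stated for each Fourier coefficient.  The interval
  integral is oriented, so negative times are covered.
\<close>

definition solution_on ::
    "real \<Rightarrow> real \<Rightarrow> real \<Rightarrow> real \<Rightarrow> (real \<times> real \<Rightarrow> complex) \<Rightarrow>
      (real \<Rightarrow> real \<times> real \<Rightarrow> complex) \<Rightarrow> bool" where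
  "solution_on \<alpha> \<sigma> s T \<phi> u \<longleftrightarrow>
     u \<in> C_sobolev s T \<and>
     (\<integral>\<^sup>+r\<in>{-T..T}. (\<integral>\<^sup>+z. ennreal ((cmod (u r z)) ^ 3) \<partial>torus2) \<partial>lborel) < \<infinity> \<and>
     (\<forall>t\<in>{-T..T}. \<forall>n.
        fourier_coeff (u t) n =
          propagator \<alpha> t (fourier_coeff \<phi>) n
          - \<i> * complex_of_real \<sigma> *
              (LBINT r=0..t. propagator \<alpha> (t - r) (fourier_coeff (cubic (u r))) n))"

text \<open>
  Local well-posedness in \<open>H\<^sup>s\<close>.  The space \<open>X T\<close> in which solutions are unique may depend on
  \<open>\<alpha>\<close>, \<open>\<sigma>\<close>, \<open>s\<close> and \<open>T\<close>, but not on the initial datum.  Continuous dependence means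
  that all data in some ball around \<open>\<phi>\<close> have solutions on the same interval \<open>[-T, T]\<close>, and that the
  solution map \<open>\<Phi>\<close> from this ball to \<open>C([-T, T]; H\<^sup>s)\<close> is continuous.
\<close>

definition locally_well_posed :: "real \<Rightarrow> real \<Rightarrow> real \<Rightarrow> bool" where
  "locally_well_posed \<alpha> \<sigma> s \<longleftrightarrow>
     (\<exists>X N. (\<forall>T>0. banach_embedded_in_C_sobolev s T (X T) (N T)) \<and>
       (\<forall>\<phi>\<in>sobolev s. \<exists>T>0. \<exists>\<delta>>0. \<exists>\<Phi>.
          let B = {\<psi> \<in> sobolev s. sobolev_norm s (\<lambda>z. \<psi> z - \<phi> z) < \<delta>} in
            (\<forall>\<psi>\<in>B. \<Phi> \<psi> \<in> X T \<and> solution_on \<alpha> \<sigma> s T \<psi> (\<Phi> \<psi>) \<and>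
               (\<forall>v\<in>X T. solution_on \<alpha> \<sigma> s T \<psi> v \<longrightarrow> same_path T v (\<Phi> \<psi>))) \<and>
            (\<forall>\<psi>\<in>B. \<forall>\<epsilon>>0. \<exists>\<eta>>0. \<forall>\<psi>'\<in>B. sobolev_norm s (\<lambda>z. \<psi>' z - \<psi> z) < \<eta> \<longrightarrow>
               C_sobolev_norm s T (\<lambda>t z. \<Phi> \<psi>' t z - \<Phi> \<psi> t z) < \<epsilon>)))"

end

theory Submission
  imports Defs "HOL-Library.Discrete_Functions"
begin

text \<open>
  In the interaction picture \<open>a(t) = S(-t) u(t)\<close> the free evolution is constant, and the solution is
  constructed in the space of paths \<open>a\<close> that are Hoelder continuous of exponent \<open>3/8\<close> with values in
  the weighted \<open>\<ell>\<^sup>2\<close> space of Fourier coefficients.  This space takes the place of Bourgain's.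

  For free waves whose second frequencies lie in a slab of width \<open>N\<close>, counting lattice points near the
  level sets of the phase, which is convex because \<open>\<alpha> < 0\<close>, bounds the fourth power of the \<open>L\<^sup>4\<close> norm on
  a time interval of length \<open>l \<le> 1\<close> by \<open>O((l N) powr (1/2))\<close>.  An almost orthogonal decomposition into
  slabs and a dyadic summation that converges for \<open>s > 1/4\<close> give a bilinear \<open>L\<^sup>2\<close> bound with one factor
  in \<open>L\<^sup>2\<close> and the other in \<open>H\<^sup>s\<close>.  Freezing the profiles on ever finer subintervals carries it over to
  Hoelder continuous profiles.  By duality, the integral of the cubic term over an interval of length \<open>l\<close>
  is \<open>O(l powr (1/2))\<close> in \<open>H\<^sup>s\<close>; as \<open>1/2 > 3/8\<close>, it is a Hoelder path with a small constant on short
  intervals, and the Picard iteration converges.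
\<close>

section \<open>Lattice point counts\<close>

text \<open>The exponent 3/8 is the midpoint of the admissible range. For profiles of Hoelder
  exponent \<gamma>, freezing on m subintervals gains m^(-2\<gamma>) in the squared increments and
  loses m^(1/2), so \<gamma> must exceed 1/4. The integrated cubic term has increments of size
  l^(1/2), so \<gamma> must stay below 1/2 to leave a small factor l^(1/2 - \<gamma>). In the
  trilinear estimate the dual function is only in \<open>L^2\<close>, without derivatives to spend.
  It is therefore paired with an input used at full regularity, and the derivatives of the output
  are charged to an input of comparable or larger frequency. For s between 1/4 and 1/3 a function in
  \<open>H^s\<close> need not be in \<open>L^3\<close> of the torus, so the cubic term need not be
  integrable at a given time. All products are therefore estimated on time times torus, and Fourier
  coefficients at single times occur only under a time integral, where a null set of bad times is
  harmless.\<close>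

lemma arctan_increment_ge:
  fixes x y :: real
  assumes "0 \<le> x" "x \<le> y"
  shows "(y - x) / (1 + y\<^sup>2) \<le> arctan y - arctan x"
proof (cases "x = y")
  case False
  with assms have "x < y" by simp
  then obtain z where z: "x < z" "z < y" "arctan y - arctan x = (y - x) * inverse (1 + z\<^sup>2)"
    using MVT2[of x y arctan "\<lambda>z. inverse (1 + z\<^sup>2)"] DERIV_arctan by blast
  have "z\<^sup>2 \<le> y\<^sup>2" using z assms by (intro power_mono) auto
  then have "inverse (1 + y\<^sup>2) \<le> inverse (1 + z\<^sup>2)"
    by (intro le_imp_inverse_le) (auto simp: add_pos_nonneg)
  then show ?thesis using z \<open>x < y\<close> by (simp add: divide_inverse mult_left_mono)
qed simp

text \<open>The integral test in telescoping form: each new term is at most \<open>L\<close> times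
  an increment of arctan, whose slope on a step is smallest at the right end. The summand 1 is the
  term at j = 0.\<close>

lemma sum_cauchy_density_nat:
  fixes L :: real
  assumes L: "L > 0"
  shows "(\<Sum>j\<le>n. 1 / (1 + (real j / L)\<^sup>2)) \<le> 1 + L * arctan (real n / L)"
proof (induction n)
  case (Suc n)
  have "(real (Suc n) / L - real n / L) / (1 + (real (Suc n) / L)\<^sup>2)
      \<le> arctan (real (Suc n) / L) - arctan (real n / L)"
    by (rule arctan_increment_ge) (use L in \<open>auto simp: divide_right_mono\<close>)
  moreover have "real (Suc n) / L - real n / L = 1 / L"
    by (simp add: diff_divide_distrib[symmetric])
  ultimately have "L * ((1 / L) / (1 + (real (Suc n) / L)\<^sup>2))
      \<le> L * (arctan (real (Suc n) / L) - arctan (real n / L))"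
    using L by (intro mult_left_mono) auto
  then have "1 / (1 + (real (Suc n) / L)\<^sup>2) \<le> L * (arctan (real (Suc n) / L) - arctan (real n / L))"
    using L by simp
  with Suc show ?case by (simp add: algebra_simps)
qed simp

lemma sum_cauchy_density_nat_set:
  fixes L :: real
  assumes L: "L > 0" and F: "finite (F :: nat set)"
  shows "(\<Sum>j\<in>F. 1 / (1 + (real j / L)\<^sup>2)) \<le> 1 + 2 * L"
proof -
  obtain n where n: "F \<subseteq> {..n}" using F finite_nat_iff_bounded_le by blast
  have "(\<Sum>j\<in>F. 1 / (1 + (real j / L)\<^sup>2)) \<le> (\<Sum>j\<le>n. 1 / (1 + (real j / L)\<^sup>2))"
    using n by (intro sum_mono2) (auto simp: add_nonneg_nonneg)
  also have "\<dots> \<le> 1 + L * arctan (real n / L)" by (rule sum_cauchy_density_nat[OF L])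
  also have "\<dots> \<le> 1 + L * 2"
    using L arctan_ubound[of "real n / L"] pi_half_less_two
    by (intro add_left_mono mult_left_mono) linarith+
  finally show ?thesis by (simp add: mult.commute)
qed

text \<open>The integers on either side of \<open>r\<close> are reindexed by their distance to the
  ceiling or the floor of \<open>r\<close>. That distance does not exceed the distance to
  \<open>r\<close>, so each side is dominated by the sum over the naturals, wherever
  \<open>r\<close> sits.\<close>

lemma sum_cauchy_density_int:
  fixes L r :: real
  assumes L: "L > 0" and F: "finite (F :: int set)"
  shows "(\<Sum>m\<in>F. 1 / (1 + ((of_int m - r) / L)\<^sup>2)) \<le> 2 + 4 * L"
proof -
  let ?f = "\<lambda>m. 1 / (1 + ((real_of_int m - r) / L)\<^sup>2)"
  have gen: "(\<Sum>m\<in>G. ?f m) \<le> 1 + 2 * L"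
    if G: "finite G" and inj: "inj_on g G" and g: "\<And>m. m \<in> G \<Longrightarrow> real (g m) \<le> \<bar>real_of_int m - r\<bar>"
    for G and g :: "int \<Rightarrow> nat"
  proof -
    have "(\<Sum>m\<in>G. ?f m) \<le> (\<Sum>m\<in>G. 1 / (1 + (real (g m) / L)\<^sup>2))"
    proof (rule sum_mono)
      fix m assume "m \<in> G"
      have "(real (g m) / L)\<^sup>2 \<le> (\<bar>real_of_int m - r\<bar> / L)\<^sup>2"
        using g[OF \<open>m \<in> G\<close>] L by (intro power_mono divide_right_mono) auto
      then show "?f m \<le> 1 / (1 + (real (g m) / L)\<^sup>2)"
        by (intro divide_left_mono) (auto simp: power_divide add_pos_nonneg)
    qed
    also have "\<dots> = (\<Sum>j\<in>g ` G. 1 / (1 + (real j / L)\<^sup>2))"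
      by (simp add: sum.reindex[OF inj])
    also have "\<dots> \<le> 1 + 2 * L" by (rule sum_cauchy_density_nat_set) (use L G in auto)
    finally show ?thesis .
  qed
  have 1: "(\<Sum>m\<in>{m\<in>F. r \<le> of_int m}. ?f m) \<le> 1 + 2 * L"
    by (rule gen[where g = "\<lambda>m. nat (m - \<lceil>r\<rceil>)"])
       (use F in \<open>auto simp: inj_on_def ceiling_le_iff\<close>, linarith+)
  have 2: "(\<Sum>m\<in>{m\<in>F. of_int m < r}. ?f m) \<le> 1 + 2 * L"
    by (rule gen[where g = "\<lambda>m. nat (\<lfloor>r\<rfloor> - m)"])
       (use F in \<open>auto simp: inj_on_def le_floor_iff\<close>, linarith+)
  have "F = {m\<in>F. r \<le> of_int m} \<union> {m\<in>F. of_int m < r}" by auto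
  then have "(\<Sum>m\<in>F. ?f m) = (\<Sum>m\<in>{m\<in>F. r \<le> of_int m}. ?f m) + (\<Sum>m\<in>{m\<in>F. of_int m < r}. ?f m)"
    using F by (subst sum.union_disjoint[symmetric]) auto
  with 1 2 show ?thesis by linarith
qed

lemma sum_cauchy_density_abs_int:
  fixes L r :: real
  assumes L: "L > 0" and F: "finite (F :: int set)"
  shows "(\<Sum>m\<in>F. 1 / (1 + ((\<bar>of_int m\<bar> - r) / L)\<^sup>2)) \<le> 4 + 8 * L"
proof -
  let ?P = "{m\<in>F. 0 \<le> m}" and ?N = "{m\<in>F. m < 0}"
  let ?f = "\<lambda>m. 1 / (1 + ((real_of_int m - r) / L)\<^sup>2)"
  have "F = ?P \<union> ?N" by auto
  then have "(\<Sum>m\<in>F. 1 / (1 + ((\<bar>of_int m\<bar> - r) / L)\<^sup>2))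
      = (\<Sum>m\<in>?P. 1 / (1 + ((\<bar>of_int m\<bar> - r) / L)\<^sup>2)) + (\<Sum>m\<in>?N. 1 / (1 + ((\<bar>of_int m\<bar> - r) / L)\<^sup>2))"
    using F by (subst sum.union_disjoint[symmetric]) auto
  also have "(\<Sum>m\<in>?P. 1 / (1 + ((\<bar>of_int m\<bar> - r) / L)\<^sup>2)) = (\<Sum>m\<in>?P. ?f m)"
    by (rule sum.cong) auto
  also have "(\<Sum>m\<in>?N. 1 / (1 + ((\<bar>of_int m\<bar> - r) / L)\<^sup>2)) = (\<Sum>m\<in>uminus ` ?N. ?f m)"
    by (subst sum.reindex) (auto intro!: sum.cong)
  also have "(\<Sum>m\<in>?P. ?f m) + (\<Sum>m\<in>uminus ` ?N. ?f m) \<le> (2 + 4 * L) + (2 + 4 * L)"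
    using F by (intro add_mono sum_cauchy_density_int[OF L]) auto
  finally show ?thesis by simp
qed

text \<open>With r^2 = 2 max(A, 0), the distance of m^2/2 from \<open>A\<close> is at least (|m| -
  r)^2 / 2. At resolution 1/l the level set thus has diameter of order \<open>L\<close>, and the
  prefactor \<open>l\<close> turns this into sqrt l, uniformly in \<open>A\<close>.\<close>

lemma sum_quadratic_phase_le:
  fixes l A :: real
  assumes l: "0 < l" "l \<le> 1" and F: "finite (F :: int set)"
  shows "(\<Sum>m\<in>F. l / (1 + l\<^sup>2 * ((of_int m)\<^sup>2 / 2 - A)\<^sup>2)) \<le> 48 * sqrt l"
proof -
  define r where "r = sqrt (2 * max A 0)"
  define L where "L = sqrt (2 / l)"
  have r0: "0 \<le> r" and r2: "r\<^sup>2 = 2 * max A 0" by (auto simp: r_def)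
  have L: "L > 0" "L\<^sup>2 = 2 / l" using l by (auto simp: L_def)
  have le: "l / (1 + l\<^sup>2 * ((of_int m)\<^sup>2 / 2 - A)\<^sup>2) \<le> 2 * l * (1 / (1 + ((\<bar>of_int m\<bar> - r) / L)\<^sup>2))"
    for m :: int
  proof -
    let ?x = "\<bar>real_of_int m\<bar>"
    have "(?x - r)\<^sup>2 / 2 \<le> \<bar>?x\<^sup>2 / 2 - A\<bar>"
    proof -
      have "(?x - r)\<^sup>2 \<le> \<bar>?x\<^sup>2 - r\<^sup>2\<bar>"
      proof -
        have "(?x - r)\<^sup>2 = \<bar>?x - r\<bar> * \<bar>?x - r\<bar>" by (simp add: power2_eq_square)
        also have "\<dots> \<le> \<bar>?x - r\<bar> * (?x + r)" using r0 by (intro mult_left_mono) auto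
        also have "\<dots> = \<bar>?x\<^sup>2 - r\<^sup>2\<bar>"
        proof -
          have "?x\<^sup>2 - r\<^sup>2 = (?x - r) * (?x + r)" by (simp add: power2_eq_square algebra_simps)
          then show ?thesis using r0 by (simp add: abs_mult)
        qed
        finally show ?thesis .
      qed
      also have "\<dots> \<le> \<bar>?x\<^sup>2 - 2 * A\<bar>" using r2 by (cases "A \<ge> 0") (auto simp: max_def)
      finally show ?thesis by linarith
    qed
    then have "((?x - r)\<^sup>2 / 2)\<^sup>2 \<le> \<bar>?x\<^sup>2 / 2 - A\<bar>\<^sup>2" by (intro power_mono) auto
    then have 1: "l\<^sup>2 * ((?x - r)\<^sup>2 / 2)\<^sup>2 \<le> l\<^sup>2 * ((of_int m)\<^sup>2 / 2 - A)\<^sup>2"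
      by (intro mult_left_mono) auto
    define y where "y = ((?x - r) / L)\<^sup>2"
    have y: "y = l * ((?x - r)\<^sup>2 / 2)" using L l by (simp add: y_def power_divide field_simps)
    have "y\<^sup>2 = l\<^sup>2 * ((?x - r)\<^sup>2 / 2)\<^sup>2" by (simp add: y power_mult_distrib power_divide)
    with 1 have "1 + y\<^sup>2 \<le> 1 + l\<^sup>2 * ((of_int m)\<^sup>2 / 2 - A)\<^sup>2" by simp
    \<comment> \<open>The decay in \<open>y\<close> is weakened from quadratic to linear, which
      turns the summand into the Cauchy density in (|m| - r) / L.\<close>
    moreover have "(1 + y) / 2 \<le> 1 + y\<^sup>2"
    proof -
      have "0 \<le> (y - 1/4)\<^sup>2" by simp
      then have "y / 2 \<le> y\<^sup>2 + 1/16" by (simp add: power2_eq_square algebra_simps)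
      then show ?thesis by simp
    qed
    moreover have "y \<ge> 0" by (simp add: y_def)
    ultimately have "l / (1 + l\<^sup>2 * ((of_int m)\<^sup>2 / 2 - A)\<^sup>2) \<le> l / ((1 + y) / 2)"
      using l by (intro divide_left_mono) (auto intro!: mult_pos_pos add_pos_nonneg)
    then show ?thesis by (simp add: y_def mult.commute)
  qed
  have "(\<Sum>m\<in>F. l / (1 + l\<^sup>2 * ((of_int m)\<^sup>2 / 2 - A)\<^sup>2))
      \<le> (\<Sum>m\<in>F. 2 * l * (1 / (1 + ((\<bar>of_int m\<bar> - r) / L)\<^sup>2)))"
    by (intro sum_mono le)
  also have "\<dots> = 2 * l * (\<Sum>m\<in>F. 1 / (1 + ((\<bar>of_int m\<bar> - r) / L)\<^sup>2))"
    by (simp add: sum_distrib_left)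
  also have "\<dots> \<le> 2 * l * (4 + 8 * L)"
    using l by (intro mult_left_mono sum_cauchy_density_abs_int[OF L(1) F]) auto
  also have "\<dots> \<le> 48 * sqrt l"
  proof -
    have "l * L = sqrt 2 * sqrt l"
    proof -
      have "l * L = sqrt (l\<^sup>2) * sqrt (2 / l)" using l by (simp add: L_def)
      also have "\<dots> = sqrt (l\<^sup>2 * (2 / l))" by (simp only: real_sqrt_mult)
      also have "l\<^sup>2 * (2 / l) = 2 * l" using l by (simp add: power2_eq_square)
      finally show ?thesis by (simp add: real_sqrt_mult)
    qed
    moreover have "l \<le> sqrt l" using l by (intro real_le_rsqrt) (simp add: power2_eq_square mult_left_le)
    moreover have "sqrt 2 * sqrt l \<le> 2 * sqrt l" 
      using l sqrt2_less_2 by (intro mult_right_mono) auto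
    ultimately have "2 * l * (4 + 8 * L) \<le> 8 * sqrt l + 16 * (2 * sqrt l)"
      by (simp add: algebra_simps)
    then show ?thesis using l by (smt (verit) real_sqrt_ge_zero)
  qed
  finally show ?thesis .
qed

text \<open>When |A| is at least N^2, the term m^2/2 is at most half of |A| and cannot cancel it. No
  level set has to be located, and counting at most 3N integers suffices.\<close>

lemma sum_quadratic_phase_far:
  fixes l A N :: real
  assumes l: "0 < l" and N: "1 \<le> N" and A: "N\<^sup>2 \<le> \<bar>A\<bar>"
    and F: "finite (F :: int set)" "\<And>m. m \<in> F \<Longrightarrow> \<bar>of_int m\<bar> \<le> N"
  shows "(\<Sum>m\<in>F. l / (1 + l\<^sup>2 * ((of_int m)\<^sup>2 / 2 - A)\<^sup>2)) \<le> 6 * sqrt l * (N / sqrt \<bar>A\<bar>)"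
proof -
  define x where "x = l * \<bar>A\<bar>"
  have A0: "\<bar>A\<bar> > 0" using N A by (smt (verit) one_le_power)
  have x: "x > 0" using l A0 by (simp add: x_def)
  have le: "l / (1 + l\<^sup>2 * ((of_int m)\<^sup>2 / 2 - A)\<^sup>2) \<le> 2 * sqrt l / sqrt \<bar>A\<bar>" if "m \<in> F" for m
  proof -
    have "(real_of_int m)\<^sup>2 \<le> N\<^sup>2" using F(2)[OF that] N by (intro power2_le_iff_abs_le[THEN iffD2]) auto
    then have "\<bar>A\<bar> / 2 \<le> \<bar>(of_int m)\<^sup>2 / 2 - A\<bar>" using A zero_le_power2[of "real_of_int m"] by linarith
    then have "(\<bar>A\<bar> / 2)\<^sup>2 \<le> \<bar>(of_int m)\<^sup>2 / 2 - A\<bar>\<^sup>2" by (intro power_mono) auto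
    then have "l\<^sup>2 * (\<bar>A\<bar> / 2)\<^sup>2 \<le> l\<^sup>2 * ((of_int m)\<^sup>2 / 2 - A)\<^sup>2" by (intro mult_left_mono) auto
    moreover have "l\<^sup>2 * (\<bar>A\<bar> / 2)\<^sup>2 = x\<^sup>2 / 4" by (simp add: x_def power_mult_distrib power_divide)
    ultimately have "l / (1 + l\<^sup>2 * ((of_int m)\<^sup>2 / 2 - A)\<^sup>2) \<le> l / (1 + x\<^sup>2 / 4)"
      using l by (intro divide_left_mono) (auto intro!: mult_pos_pos add_pos_nonneg)
    \<comment> \<open>Of the decay x^(-2) only x^(-1/2) is kept: this power extracts exactly sqrt l
      and leaves |A|^(-1/2).\<close>
    also have "\<dots> \<le> l * (2 / sqrt x)"
    proof -
      have s: "sqrt x > 0" "(sqrt x)\<^sup>2 = x" using x by auto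
      have "sqrt x / 2 \<le> 1 + x\<^sup>2 / 4"
      proof -
        have "0 \<le> (sqrt x - 1)\<^sup>2" "0 \<le> (x - 1)\<^sup>2" by simp_all
        then have "2 * sqrt x \<le> x + 1" "2 * x \<le> x\<^sup>2 + 1" using s by (simp_all add: power2_diff)
        then show ?thesis using zero_le_power2[of x] by linarith
      qed
      then have "1 / (1 + x\<^sup>2 / 4) \<le> 1 / (sqrt x / 2)" 
        using s by (intro divide_left_mono) (auto intro!: mult_pos_pos add_pos_nonneg)
      then have "l * (1 / (1 + x\<^sup>2 / 4)) \<le> l * (1 / (sqrt x / 2))" using l by (intro mult_left_mono) auto
      then show ?thesis by simp
    qed
    also have "\<dots> = 2 * sqrt l / sqrt \<bar>A\<bar>"
    proof -
      have "l * (2 / sqrt x) = 2 * (l / sqrt l) / sqrt \<bar>A\<bar>" by (simp add: x_def real_sqrt_mult)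
      then show ?thesis using l by (simp add: real_div_sqrt)
    qed
    finally show ?thesis .
  qed
  have card: "real (card F) \<le> 3 * N"
  proof -
    have "F \<subseteq> {-\<lfloor>N\<rfloor>..\<lfloor>N\<rfloor>}"
    proof
      fix m assume "m \<in> F"
      then have "of_int m \<le> N" "of_int (- m) \<le> N" using F(2)[of m] by auto
      then have "m \<le> \<lfloor>N\<rfloor>" "- m \<le> \<lfloor>N\<rfloor>" by (simp_all only: le_floor_iff)
      then show "m \<in> {-\<lfloor>N\<rfloor>..\<lfloor>N\<rfloor>}" by simp
    qed
    then have "card F \<le> card {-\<lfloor>N\<rfloor>..\<lfloor>N\<rfloor>}" by (intro card_mono) auto
    also have "\<dots> = nat (2 * \<lfloor>N\<rfloor> + 1)" by simp
    finally have "real (card F) \<le> real (nat (2 * \<lfloor>N\<rfloor> + 1))" by simp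
    also have "\<dots> \<le> 2 * N + 1" using N of_int_floor_le[of N] by simp
    finally show ?thesis using N by simp
  qed
  have "(\<Sum>m\<in>F. l / (1 + l\<^sup>2 * ((of_int m)\<^sup>2 / 2 - A)\<^sup>2)) \<le> real (card F) * (2 * sqrt l / sqrt \<bar>A\<bar>)"
    by (rule sum_bounded_above) (rule le)
  also have "\<dots> \<le> 3 * N * (2 * sqrt l / sqrt \<bar>A\<bar>)"
    using card l by (intro mult_right_mono) auto
  finally show ?thesis by (simp add: field_simps)
qed

text \<open>The two regimes are merged into one weight in \<open>A\<close>. Its decay beyond |A| of
  order N^2 records that |m| is at most \<open>N\<close>, and it is what makes the sum over the
  first frequency finite with the right power of \<open>N\<close>.\<close>

lemma sum_quadratic_phase_uniform:
  fixes l A N :: real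
  assumes l: "0 < l" "l \<le> 1" and N: "1 \<le> N"
    and F: "finite (F :: int set)" "\<And>m. m \<in> F \<Longrightarrow> \<bar>of_int m\<bar> \<le> N"
  shows "(\<Sum>m\<in>F. l / (1 + l\<^sup>2 * ((of_int m)\<^sup>2 / 2 - A)\<^sup>2)) \<le> 96 * sqrt l * (1 / sqrt (1 + \<bar>A\<bar> / N\<^sup>2))"
proof (cases "N\<^sup>2 \<le> \<bar>A\<bar>")
  case True
  have A0: "\<bar>A\<bar> > 0" using N True by (smt (verit) one_le_power)
  have "1 \<le> \<bar>A\<bar> / N\<^sup>2" using True N by simp
  then have "1 + \<bar>A\<bar> / N\<^sup>2 \<le> 4 * (\<bar>A\<bar> / N\<^sup>2)" by linarith
  then have "sqrt (1 + \<bar>A\<bar> / N\<^sup>2) \<le> sqrt (4 * (\<bar>A\<bar> / N\<^sup>2))" by (rule real_sqrt_le_mono)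
  also have "\<dots> = 2 * (sqrt \<bar>A\<bar> / N)" using N by (simp add: real_sqrt_mult real_sqrt_divide)
  finally have "1 / (2 * (sqrt \<bar>A\<bar> / N)) \<le> 1 / sqrt (1 + \<bar>A\<bar> / N\<^sup>2)"
    using A0 N by (intro divide_left_mono mult_pos_pos) (auto intro: add_pos_nonneg)
  then have "N / sqrt \<bar>A\<bar> \<le> 2 * (1 / sqrt (1 + \<bar>A\<bar> / N\<^sup>2))" using N A0 by (simp add: field_simps)
  then have "6 * sqrt l * (N / sqrt \<bar>A\<bar>) \<le> 6 * sqrt l * (2 * (1 / sqrt (1 + \<bar>A\<bar> / N\<^sup>2)))"
    using l by (intro mult_left_mono) auto
  also have "\<dots> \<le> 96 * sqrt l * (1 / sqrt (1 + \<bar>A\<bar> / N\<^sup>2))"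
  proof -
    have "0 \<le> sqrt l * (1 / sqrt (1 + \<bar>A\<bar> / N\<^sup>2))" using l by simp
    then show ?thesis by linarith
  qed
  finally show ?thesis using sum_quadratic_phase_far[OF l(1) N True F] by linarith
next
  case False
  then have "1 + \<bar>A\<bar> / N\<^sup>2 \<le> 4" using N by (simp add: field_simps)
  then have "sqrt (1 + \<bar>A\<bar> / N\<^sup>2) \<le> sqrt 4" by (rule real_sqrt_le_mono)
  then have "1 / 2 \<le> 1 / sqrt (1 + \<bar>A\<bar> / N\<^sup>2)"
    by (intro divide_left_mono) (auto intro!: mult_pos_pos add_pos_nonneg)
  then have "48 * sqrt l \<le> 96 * sqrt l * (1 / sqrt (1 + \<bar>A\<bar> / N\<^sup>2))"
    using l mult_left_mono[of "1/2" "1 / sqrt (1 + \<bar>A\<bar> / N\<^sup>2)" "96 * sqrt l"] by simp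
  then show ?thesis using sum_quadratic_phase_le[OF l F(1), of A] by linarith
qed

text \<open>
  Convexity of the quartic phase: its level sets have diameter of order \<open>\<surd>N\<close> when the level is known
  up to \<open>N\<^sup>2\<close>.
\<close>

lemma sum_quartic_phase_le:
  fixes c e tau N :: real
  assumes c: "0 < c" and e: "0 \<le> e" and N: "1 \<le> N" and F: "finite (F :: int set)"
  shows "(\<Sum>m\<in>F. 1 / sqrt (1 + \<bar>tau - c * ((of_int m)^4 + e * (of_int m)\<^sup>2)\<bar> / N\<^sup>2))
     \<le> (8 + 16 / sqrt (sqrt c)) * sqrt N"
proof -
  let ?g = "\<lambda>x::real. c * (x^4 + e * x\<^sup>2)"
  \<comment> \<open>For nonnegative \<open>tau\<close> this is the root of \<open>?g\<close> at
    level \<open>tau\<close>, and both sides agree. For negative \<open>tau\<close> the level is not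
    attained, and 0, where \<open>?g\<close> is smallest, takes its place.\<close>
  obtain r where r: "0 \<le> r" "\<And>x. 0 \<le> x \<Longrightarrow> \<bar>?g x - ?g r\<bar> \<le> \<bar>tau - ?g x\<bar>"
  proof (cases "tau \<ge> 0")
    case True
    have "\<exists>x\<ge>0. x \<le> 1 + tau / c \<and> ?g x = tau"
    proof (rule IVT')
      have "1 \<le> 1 + tau / c" using True c by simp
      then have "1 + tau / c \<le> (1 + tau / c)^4" by (rule self_le_power) simp
      moreover have "tau \<le> c * (1 + tau / c)" using True c by (simp add: field_simps)
      ultimately have "tau \<le> c * (1 + tau / c)^4" using c by (smt (verit) mult_left_mono)
      moreover have "0 \<le> c * (e * (1 + tau / c)\<^sup>2)" using c e by simp
      ultimately show "tau \<le> ?g (1 + tau / c)" by (simp add: distrib_left)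
    qed (use True c in \<open>auto intro!: continuous_intros\<close>)
    then show ?thesis using that by (metis abs_minus_commute order_refl)
  next
    case False
    show ?thesis
    proof (rule that[of 0])
      fix x :: real assume "0 \<le> x"
      have "0 \<le> ?g x" using c e by simp
      then show "\<bar>?g x - ?g 0\<bar> \<le> \<bar>tau - ?g x\<bar>" using False by simp
    qed simp
  qed
  \<comment> \<open>At distance \<open>L\<close> from \<open>r\<close> the quantity c (x - r)^4
    reaches N^2.\<close>
  define L where "L = sqrt N / sqrt (sqrt c)"
  have L: "L > 0" using N c by (simp add: L_def)
  have L2: "L\<^sup>2 = N / sqrt c" using N c by (simp add: L_def power_divide)
  have le: "1 / sqrt (1 + \<bar>tau - ?g (of_int m)\<bar> / N\<^sup>2) \<le> 2 * (1 / (1 + ((\<bar>of_int m\<bar> - r) / L)\<^sup>2))"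
    for m :: int
  proof -
    let ?x = "\<bar>real_of_int m\<bar>"
    \<comment> \<open>The difference of the two phases factors, and each factor dominates a power of
      |x - r|. Convexity enters through \<open>e\<close> being nonnegative.\<close>
    have "c * (?x - r)^4 \<le> \<bar>?g ?x - ?g r\<bar>"
    proof -
      have "?g ?x - ?g r = c * ((?x - r) * ((?x + r) * (?x\<^sup>2 + r\<^sup>2 + e)))"
        by (simp add: power2_eq_square power4_eq_xxxx algebra_simps)
      then have "\<bar>?g ?x - ?g r\<bar> = c * (\<bar>?x - r\<bar> * ((?x + r) * (?x\<^sup>2 + r\<^sup>2 + e)))"
        using c e r by (simp add: abs_mult)
      moreover have "c * (\<bar>?x - r\<bar> * (\<bar>?x - r\<bar> * (?x - r)\<^sup>2)) \<le> c * (\<bar>?x - r\<bar> * ((?x + r) * (?x\<^sup>2 + r\<^sup>2 + e)))"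
      proof (intro mult_left_mono mult_mono)
        show "\<bar>?x - r\<bar> \<le> ?x + r" using r(1) by auto
        show "(?x - r)\<^sup>2 \<le> ?x\<^sup>2 + r\<^sup>2 + e" 
          using mult_nonneg_nonneg[OF abs_ge_zero r(1), of "real_of_int m"] e
          by (simp add: power2_diff)
      qed (use c e r(1) in auto)
      moreover have "\<bar>?x - r\<bar> * (\<bar>?x - r\<bar> * (?x - r)\<^sup>2) = (?x - r)^4"
        by (simp add: power2_eq_square power4_eq_xxxx flip: mult.assoc)
      ultimately show ?thesis by simp
    qed
    also have "\<dots> \<le> \<bar>tau - ?g (of_int m)\<bar>" using r(2)[of ?x] by simp
    finally have g: "c * (?x - r)^4 / N\<^sup>2 \<le> \<bar>tau - ?g (of_int m)\<bar> / N\<^sup>2"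
      by (intro divide_right_mono) auto
    define y where "y = ((?x - r) / L)\<^sup>2"
    have y0: "y \<ge> 0" by (simp add: y_def)
    have "y = (?x - r)\<^sup>2 * sqrt c / N" using L2 by (simp add: y_def power_divide)
    then have "y\<^sup>2 = ((?x - r)\<^sup>2)\<^sup>2 * c / N\<^sup>2"
      using c by (simp add: power_divide power_mult_distrib)
    also have "\<dots> = c * (?x - r)^4 / N\<^sup>2" by (simp flip: power_mult)
    finally have y2: "1 + y\<^sup>2 \<le> 1 + \<bar>tau - ?g (of_int m)\<bar> / N\<^sup>2" using g by simp
    have "((1 + y) / 2)\<^sup>2 \<le> 1 + y\<^sup>2"
    proof -
      have "0 \<le> (y - 1)\<^sup>2" by simp
      then have "2 * y \<le> 1 + y\<^sup>2" by (simp add: power2_diff)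
      moreover have "((1 + y) / 2)\<^sup>2 = (1 + 2 * y + y\<^sup>2) / 4" by (simp add: power_divide power2_sum)
      moreover have "(1 + 2 * y + z) / 4 \<le> 1 + z" if "2 * y \<le> 1 + z" "0 \<le> z" for z
        using that by (simp add: field_simps)
      ultimately show ?thesis using zero_le_power2[of y] by metis
    qed
    with y2 have "(1 + y) / 2 \<le> sqrt (1 + \<bar>tau - ?g (of_int m)\<bar> / N\<^sup>2)"
      by (intro real_le_rsqrt) linarith
    then have "1 / sqrt (1 + \<bar>tau - ?g (of_int m)\<bar> / N\<^sup>2) \<le> 1 / ((1 + y) / 2)"
      using y0 by (intro divide_left_mono) (auto intro!: mult_pos_pos add_pos_nonneg)
    then show ?thesis by (simp add: y_def)
  qed
  have "(\<Sum>m\<in>F. 1 / sqrt (1 + \<bar>tau - ?g (of_int m)\<bar> / N\<^sup>2))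
      \<le> (\<Sum>m\<in>F. 2 * (1 / (1 + ((\<bar>of_int m\<bar> - r) / L)\<^sup>2)))"
    by (intro sum_mono le)
  also have "\<dots> = 2 * (\<Sum>m\<in>F. (1 / (1 + ((\<bar>of_int m\<bar> - r) / L)\<^sup>2)))"
    by (simp add: sum_distrib_left)
  also have "\<dots> \<le> 2 * (4 + 8 * L)"
    by (intro mult_left_mono sum_cauchy_density_abs_int[OF L F]) auto
  also have "\<dots> \<le> (8 + 16 / sqrt (sqrt c)) * sqrt N"
  proof -
    have "8 \<le> 8 * sqrt N" using N by simp
    then show ?thesis by (simp add: L_def algebra_simps)
  qed
  finally show ?thesis .
qed

text \<open>For a fixed first frequency the sum over the second one sees the quadratic phase at the
  level \<open>tau\<close> minus the quartic part. It leaves the weight in this level, which the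
  convexity of the quartic part makes summable. Enlarging the set of pairs to a product is harmless
  since all terms are nonnegative.\<close>

lemma sum_phase_le:
  fixes c e tau N l :: real
  assumes c: "0 < c" and e: "0 \<le> e" and N: "1 \<le> N" and l: "0 < l" "l \<le> 1"
    and A: "finite A" "\<And>m1 m2. (m1, m2) \<in> A \<Longrightarrow> \<bar>of_int m2\<bar> \<le> N"
  shows "(\<Sum>(m1, m2)\<in>A. l / (1 + l\<^sup>2 * (c * ((of_int m1)^4 + e * (of_int m1)\<^sup>2) + (of_int m2)\<^sup>2 / 2 - tau)\<^sup>2))
     \<le> 96 * (8 + 16 / sqrt (sqrt c)) * (sqrt l * sqrt N)"
proof -
  let ?g = "\<lambda>m1 :: int. c * ((of_int m1)^4 + e * (of_int m1)\<^sup>2)"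
  let ?h = "\<lambda>m1 m2 :: int. l / (1 + l\<^sup>2 * ((of_int m2)\<^sup>2 / 2 - (tau - ?g m1))\<^sup>2)"
  have "(\<Sum>(m1, m2)\<in>A. l / (1 + l\<^sup>2 * (?g m1 + (of_int m2)\<^sup>2 / 2 - tau)\<^sup>2)) = (\<Sum>(m1, m2)\<in>A. ?h m1 m2)"
    by (simp add: algebra_simps)
  also have "\<dots> \<le> (\<Sum>(m1, m2)\<in>fst ` A \<times> snd ` A. ?h m1 m2)"
    using A(1) l
    by (intro sum_mono2) (auto simp: image_iff Bex_def intro!: divide_nonneg_nonneg add_nonneg_nonneg)
  also have "\<dots> = (\<Sum>m1\<in>fst ` A. \<Sum>m2\<in>snd ` A. ?h m1 m2)" by (simp add: sum.cartesian_product)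
  also have "\<dots> \<le> (\<Sum>m1\<in>fst ` A. 96 * sqrt l * (1 / sqrt (1 + \<bar>tau - ?g m1\<bar> / N\<^sup>2)))"
    using A by (intro sum_mono sum_quadratic_phase_uniform[OF l N]) auto
  also have "\<dots> = 96 * sqrt l * (\<Sum>m1\<in>fst ` A. 1 / sqrt (1 + \<bar>tau - ?g m1\<bar> / N\<^sup>2))"
    by (simp add: sum_distrib_left)
  also have "\<dots> \<le> 96 * sqrt l * ((8 + 16 / sqrt (sqrt c)) * sqrt N)"
    using A(1) l by (intro mult_left_mono sum_quartic_phase_le[OF c e N]) auto
  finally show ?thesis by (simp add: mult_ac)
qed

section \<open>Exponential sums on short time intervals\<close>

text \<open>Explicit antiderivatives on the two halves of the tent are glued at \<open>c\<close>.
  The boundary terms combine into a second difference divided by the square of the frequency, which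
  is the source of the quadratic decay.\<close>

lemma tent_window_has_integral:
  fixes c h \<theta> :: real
  assumes h: "0 < h" and \<theta>: "\<theta> \<noteq> 0"
  defines "E \<equiv> \<lambda>t::real. exp (- \<i> * \<theta> * t)"
  shows "((\<lambda>t. (1 - \<bar>t - c\<bar> / h) *\<^sub>R E t) has_integral
    (E (c + h) + E (c - h) - 2 * E c) / (h * (- \<i> * \<theta>)\<^sup>2)) {c - h..c + h}"
proof -
  define \<kappa> :: complex where "\<kappa> = - \<i> * \<theta>"
  have \<kappa>: "\<kappa> \<noteq> 0" using \<theta> by (simp add: \<kappa>_def)
  have E: "(E has_vector_derivative \<kappa> * E t) (at t within S)" for t S
    unfolding E_def \<kappa>_def
    by (rule has_vector_derivative_real_field) (auto intro!: derivative_eq_intros)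
  have hc: "complex_of_real h \<noteq> 0" using h by simp
  let ?G1 = "\<lambda>t::real. (1 - (t - c) / h) *\<^sub>R E t / \<kappa> + E t / (h * \<kappa>\<^sup>2)"
  let ?G2 = "\<lambda>t::real. (1 + (t - c) / h) *\<^sub>R E t / \<kappa> - E t / (h * \<kappa>\<^sup>2)"
  have 1: "((\<lambda>t. (1 - (t - c) / h) *\<^sub>R E t) has_integral ?G1 (c + h) - ?G1 c) {c..c + h}"
  proof (rule fundamental_theorem_of_calculus)
    fix t
    show "(?G1 has_vector_derivative (1 - (t - c) / h) *\<^sub>R E t) (at t within {c..c + h})"
      using \<kappa> h by (auto intro!: derivative_eq_intros E simp: field_simps scaleR_conv_of_real power2_eq_square)
  qed (use h in auto)
  have 2: "((\<lambda>t. (1 + (t - c) / h) *\<^sub>R E t) has_integral ?G2 c - ?G2 (c - h)) {c - h..c}"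
  proof (rule fundamental_theorem_of_calculus)
    fix t
    show "(?G2 has_vector_derivative (1 + (t - c) / h) *\<^sub>R E t) (at t within {c - h..c})"
      using \<kappa> h by (auto intro!: derivative_eq_intros E simp: field_simps scaleR_conv_of_real power2_eq_square)
  qed (use h in auto)
  have 3: "((\<lambda>t. (1 - \<bar>t - c\<bar> / h) *\<^sub>R E t) has_integral ?G1 (c + h) - ?G1 c) {c..c + h}"
    by (rule has_integral_eq[OF _ 1]) auto
  have 4: "((\<lambda>t. (1 - \<bar>t - c\<bar> / h) *\<^sub>R E t) has_integral ?G2 c - ?G2 (c - h)) {c - h..c}"
    by (rule has_integral_eq[OF _ 2]) (auto simp: abs_if diff_divide_distrib)
  have "((\<lambda>t. (1 - \<bar>t - c\<bar> / h) *\<^sub>R E t) has_integral (?G2 c - ?G2 (c - h)) + (?G1 (c + h) - ?G1 c)) {c - h..c + h}"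
    by (rule has_integral_combine[OF _ _ 4 3]) (use h in auto)
  moreover have "(?G2 c - ?G2 (c - h)) + (?G1 (c + h) - ?G1 c)
      = (E (c + h) + E (c - h) - 2 * E c) / (h * \<kappa>\<^sup>2)"
    using h \<kappa> hc by (simp add: divide_simps) (simp add: algebra_simps)
  ultimately show ?thesis by (simp add: \<kappa>_def)
qed

text \<open>The trivial bound governs small frequencies and the second difference large ones. Adding
  both produces a smooth kernel, the one in which the lattice counts are phrased.\<close>

lemma norm_tent_window_le:
  fixes c h \<theta> :: real
  assumes h: "0 < h"
  shows "cmod (integral {c - h..c + h} (\<lambda>t. (1 - \<bar>t - c\<bar> / h) *\<^sub>R cis (- (t * \<theta>))))
     \<le> 6 * (h / (1 + h\<^sup>2 * \<theta>\<^sup>2))"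
proof -
  let ?I = "integral {c - h..c + h} (\<lambda>t. (1 - \<bar>t - c\<bar> / h) *\<^sub>R cis (- (t * \<theta>)))"
  have 1: "cmod ?I \<le> 2 * h"
  proof -
    have "cmod ?I \<le> 1 * (c + h - (c - h))"
      by (rule integral_bound) (use h in \<open>auto intro!: continuous_intros simp: abs_le_iff field_simps\<close>)
    then show ?thesis by simp
  qed
  have 2: "\<theta>\<^sup>2 * h * cmod ?I \<le> 4"
  proof (cases "\<theta> = 0")
    case False
    let ?E = "\<lambda>t::real. exp (- \<i> * \<theta> * t)"
    have E: "cis (- (t * \<theta>)) = ?E t" for t by (simp add: cis_conv_exp mult_ac)
    have n: "cmod (?E t) = 1" for t by (simp flip: E)
    have "?I = (?E (c + h) + ?E (c - h) - 2 * ?E c) / (h * (- \<i> * \<theta>)\<^sup>2)"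
      using integral_unique[OF tent_window_has_integral[OF h False, of c]] by (simp add: E)
    also have "cmod \<dots> = cmod (?E (c + h) + ?E (c - h) - 2 * ?E c) / (h * \<theta>\<^sup>2)"
      using h by (simp add: norm_divide norm_mult norm_power)
    also have "\<dots> \<le> 4 / (h * \<theta>\<^sup>2)"
    proof (rule divide_right_mono)
      have "cmod (x + y - 2 * z) \<le> cmod x + cmod y + 2 * cmod z" for x y z
        using norm_triangle_ineq4[of "x + y" "2 * z"] norm_triangle_ineq[of x y] by (simp add: norm_mult)
      from this[of "?E (c + h)" "?E (c - h)" "?E c"]
      show "cmod (?E (c + h) + ?E (c - h) - 2 * ?E c) \<le> 4" unfolding n by simp
    qed (use h in auto)
    finally show ?thesis using h False by (simp add: field_simps)
  qed simp
  have "(1 + h\<^sup>2 * \<theta>\<^sup>2) * cmod ?I = cmod ?I + h * (\<theta>\<^sup>2 * h * cmod ?I)"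
    by (simp add: algebra_simps power2_eq_square)
  also have "\<dots> \<le> 2 * h + h * 4"
    using 1 2 h by (intro add_mono mult_left_mono) auto
  finally have "(1 + h\<^sup>2 * \<theta>\<^sup>2) * cmod ?I \<le> 6 * h" by simp
  moreover have "1 + h\<^sup>2 * \<theta>\<^sup>2 > 0" by (simp add: add_pos_nonneg)
  ultimately show ?thesis by (simp add: field_simps)
qed

text \<open>
  Schur's test for the Gram matrix of the exponentials; the sharp cut-off in time is replaced by a
  tent window, whose Fourier transform decays quadratically.
\<close>

lemma integral_exponential_sum_le:
  fixes b :: "'a \<Rightarrow> complex" and \<theta> :: "'a \<Rightarrow> real" and p q B :: real
  assumes pq: "p < q" and A: "finite A"
    and B: "\<And>x. x \<in> A \<Longrightarrow> (\<Sum>y\<in>A. (q - p) / (1 + (q - p)\<^sup>2 * (\<theta> x - \<theta> y)\<^sup>2)) \<le> B"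
  shows "integral {p..q} (\<lambda>t. (cmod (\<Sum>x\<in>A. b x * cis (- (t * \<theta> x))))\<^sup>2) \<le> 12 * B * (\<Sum>x\<in>A. (cmod (b x))\<^sup>2)"
proof -
  define h where "h = q - p"
  \<comment> \<open>The tent is centred at the midpoint and its half-width \<open>h\<close> is the
    whole length of the interval, so it is at least 1/2 on the interval itself.\<close>
  define c where "c = (p + q) / 2"
  define f where "f t = (\<Sum>x\<in>A. b x * cis (- (t * \<theta> x)))" for t
  define w where "w t = 1 - \<bar>t - c\<bar> / h" for t
  define K where "K x y = h / (1 + h\<^sup>2 * (\<theta> x - \<theta> y)\<^sup>2)" for x y
  have h: "h > 0" using pq by (simp add: h_def)
  have K0: "K x y \<ge> 0" for x y using h by (simp add: K_def add_nonneg_nonneg)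
  have Ksym: "K x y = K y x" for x y by (simp add: K_def power2_commute)
  have cont: "continuous_on S f" "continuous_on S w" for S
    unfolding f_def w_def using h by (auto intro!: continuous_intros)
  have w0: "w t \<ge> 0" if "t \<in> {c - h..c + h}" for t
    using that h by (auto simp: w_def abs_le_iff field_simps)
  have w1: "w t \<ge> 1/2" if "t \<in> {p..q}" for t
  proof -
    have "\<bar>t - c\<bar> \<le> h / 2" using that by (auto simp: c_def h_def abs_le_iff field_simps)
    then show ?thesis using h by (simp add: w_def field_simps)
  qed
  have sub: "{p..q} \<subseteq> {c - h..c + h}" using pq by (auto simp: c_def h_def field_simps)
  have "integral {p..q} (\<lambda>t. (cmod (f t))\<^sup>2) \<le> integral {p..q} (\<lambda>t. 2 * (w t * (cmod (f t))\<^sup>2))"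
  proof (rule integral_le)
    fix t assume "t \<in> {p..q}"
    then have "1/2 * (cmod (f t))\<^sup>2 \<le> w t * (cmod (f t))\<^sup>2" using w1 by (intro mult_right_mono) auto
    then show "(cmod (f t))\<^sup>2 \<le> 2 * (w t * (cmod (f t))\<^sup>2)" by simp
  qed (auto intro!: integrable_continuous_interval continuous_intros cont)
  also have "\<dots> \<le> integral {c - h..c + h} (\<lambda>t. 2 * (w t * (cmod (f t))\<^sup>2))"
    by (rule integral_subset_le[OF sub])
       (auto intro!: integrable_continuous_interval continuous_intros cont mult_nonneg_nonneg w0)
  also have "\<dots> = 2 * integral {c - h..c + h} (\<lambda>t. w t * (cmod (f t))\<^sup>2)" by simp
  also have "integral {c - h..c + h} (\<lambda>t. w t * (cmod (f t))\<^sup>2)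
      = Re (integral {c - h..c + h} (\<lambda>t. w t *\<^sub>R (f t * cnj (f t))))"
  proof -
    have "(\<lambda>t. w t *\<^sub>R (f t * cnj (f t))) integrable_on {c - h..c + h}"
      by (intro integrable_continuous_interval continuous_intros cont)
    from integral_linear[OF this bounded_linear_Re]
    show ?thesis by (simp add: o_def complex_norm_square[symmetric])
  qed
  also have "\<dots> \<le> cmod (integral {c - h..c + h} (\<lambda>t. w t *\<^sub>R (f t * cnj (f t))))"
    by (rule complex_Re_le_cmod)
  also have "integral {c - h..c + h} (\<lambda>t. w t *\<^sub>R (f t * cnj (f t)))
     = (\<Sum>x\<in>A. \<Sum>y\<in>A. b x * cnj (b y) * integral {c - h..c + h} (\<lambda>t. w t *\<^sub>R cis (- (t * (\<theta> x - \<theta> y)))))"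
  proof -
    have "w t *\<^sub>R (f t * cnj (f t))
       = (\<Sum>x\<in>A. \<Sum>y\<in>A. b x * cnj (b y) * (w t *\<^sub>R cis (- (t * (\<theta> x - \<theta> y)))))" for t
    proof -
      have "cis (- (t * \<theta> x)) * cnj (cis (- (t * \<theta> y))) = cis (- (t * (\<theta> x - \<theta> y)))" for x y
        by (simp add: cis_cnj cis_mult algebra_simps)
      then have "w t *\<^sub>R (b x * cis (- (t * \<theta> x)) * cnj (b y * cis (- (t * \<theta> y))))
          = b x * cnj (b y) * (w t *\<^sub>R cis (- (t * (\<theta> x - \<theta> y))))" for x y
        by (metis (no_types, lifting) complex_cnj_mult mult.assoc mult.left_commute mult_scaleR_right)
      then show ?thesis
        unfolding f_def cnj_sum sum_product scaleR_sum_right by (intro sum.cong refl)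
    qed
    moreover have "(\<lambda>t. w t *\<^sub>R cis (- (t * (\<theta> x - \<theta> y)))) integrable_on {c - h..c + h}" for x y
      by (intro integrable_continuous_interval continuous_intros cont)
    ultimately show ?thesis
      using A by (simp add: integral_sum integrable_sum integrable_on_mult_right del: mult_scaleR_right)
  qed
  also have "2 * cmod \<dots> \<le> 2 * (\<Sum>x\<in>A. \<Sum>y\<in>A. cmod (b x) * cmod (b y) * (6 * K x y))"
  proof (intro mult_left_mono order.trans[OF norm_sum] sum_mono)
    fix x y
    have "cmod (integral {c - h..c + h} (\<lambda>t. w t *\<^sub>R cis (- (t * (\<theta> x - \<theta> y))))) \<le> 6 * K x y"
      unfolding w_def K_def by (rule norm_tent_window_le[OF h])
    then show "cmod (b x * cnj (b y) * integral {c - h..c + h} (\<lambda>t. w t *\<^sub>R cis (- (t * (\<theta> x - \<theta> y)))))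
      \<le> cmod (b x) * cmod (b y) * (6 * K x y)"
      by (simp add: norm_mult mult_left_mono)
  qed auto
  \<comment> \<open>The product of two coefficients is split into squares. As the kernel is
    symmetric, both halves are row sums, which the hypothesis bounds by \<open>B\<close>.\<close>
  also have "\<dots> \<le> 2 * (\<Sum>x\<in>A. \<Sum>y\<in>A. 3 * ((cmod (b x))\<^sup>2 * K x y) + 3 * ((cmod (b y))\<^sup>2 * K y x))"
  proof (intro mult_left_mono sum_mono)
    fix x y
    have "0 \<le> (cmod (b x) - cmod (b y))\<^sup>2" by simp
    then have "2 * (cmod (b x) * cmod (b y)) \<le> (cmod (b x))\<^sup>2 + (cmod (b y))\<^sup>2"
      by (simp add: power2_diff)
    then have "2 * (cmod (b x) * cmod (b y)) * (3 * K x y) \<le> ((cmod (b x))\<^sup>2 + (cmod (b y))\<^sup>2) * (3 * K x y)"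
      using K0 by (intro mult_right_mono) auto
    then show "cmod (b x) * cmod (b y) * (6 * K x y) \<le> 3 * ((cmod (b x))\<^sup>2 * K x y) + 3 * ((cmod (b y))\<^sup>2 * K y x)"
      by (simp add: Ksym[of y x] algebra_simps)
  qed auto
  also have "\<dots> = 12 * (\<Sum>x\<in>A. (cmod (b x))\<^sup>2 * (\<Sum>y\<in>A. K x y))"
  proof -
    have "(\<Sum>x\<in>A. \<Sum>y\<in>A. (cmod (b y))\<^sup>2 * K y x) = (\<Sum>x\<in>A. \<Sum>y\<in>A. (cmod (b x))\<^sup>2 * K x y)"
      by (rule sum.swap)
    then show ?thesis by (simp add: sum.distrib sum_distrib_left[symmetric])
  qed
  also have "\<dots> \<le> 12 * (\<Sum>x\<in>A. (cmod (b x))\<^sup>2 * B)"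
    by (intro mult_left_mono sum_mono) (use B in \<open>auto simp: K_def h_def\<close>)
  also have "\<dots> = 12 * B * (\<Sum>x\<in>A. (cmod (b x))\<^sup>2)"
    by (simp flip: sum_distrib_right)
  finally show ?thesis by (simp only: f_def)
qed

section \<open>Characters of the torus\<close>

definition chr :: "int \<times> int \<Rightarrow> real \<times> real \<Rightarrow> complex" where
  "chr n z = cis (of_int (fst n) * fst z + of_int (snd n) * snd z)"

lemma cmod_chr [simp]: "cmod (chr n z) = 1"
  by (simp add: chr_def)

lemma chr_add: "chr (n + m) z = chr n z * chr m z"
  by (simp add: chr_def cis_mult algebra_simps)

lemma chr_diff: "chr (n - m) z = chr n z * cnj (chr m z)"
  by (simp add: chr_def cis_cnj cis_mult algebra_simps)

lemma cnj_chr: "cnj (chr n z) = chr (- n) z"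
  by (simp add: chr_def cis_cnj algebra_simps)

lemma chr_borel [measurable]: "chr n \<in> borel_measurable borel"
  unfolding chr_def by (intro borel_measurable_continuous_onI continuous_intros)

lemma space_torus2: "space torus2 = {0..<2*pi} \<times> {0..<2*pi}"
  by (simp add: torus2_def torus_def space_pair_measure space_restrict_space)

lemma finite_measure_torus: "finite_measure torus"
  by (rule finite_measureI) (simp add: torus_def emeasure_restrict_space space_restrict_space)

interpretation torus: finite_measure torus
  by (rule finite_measure_torus)

interpretation torus_pair: pair_sigma_finite torus torus ..

lemma finite_measure_torus2: "finite_measure torus2"
  unfolding torus2_def by (rule finite_measure_pair_measure) (rule finite_measure_torus)+

interpretation torus2: finite_measure torus2
  by (rule finite_measure_torus2)

lemma borel_measurable_torus2I: "f \<in> borel_measurable borel \<Longrightarrow> f \<in> borel_measurable torus2"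
proof -
  assume f: "f \<in> borel_measurable borel"
  have "(\<lambda>x. x) \<in> borel_measurable torus"
    unfolding torus_def by (intro measurable_restrict_space1) simp
  then have "(\<lambda>z. (fst z, snd z)) \<in> torus2 \<rightarrow>\<^sub>M borel \<Otimes>\<^sub>M borel"
    unfolding torus2_def by (intro measurable_Pair measurable_compose[OF measurable_fst] measurable_compose[OF measurable_snd])
  then show ?thesis
    using measurable_compose[OF _ f, of "\<lambda>z. z" torus2] by (simp add: borel_prod)
qed

lemma chr_measurable [measurable]: "chr n \<in> borel_measurable torus2"
  by (intro borel_measurable_torus2I chr_borel)

lemma chr_integrable: "integrable torus2 (chr n)"
  by (rule torus2.integrable_const_bound[where B = 1]) auto

lemma integral_cis_torus: "(\<integral>x. cis (of_int k * x) \<partial>torus) = (if k = 0 then 2 * pi else 0)"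
proof -
  have 0: "(\<integral>x. 1 \<partial>torus) = complex_of_real (2 * pi)"
    by (simp add: torus_def measure_restrict_space space_restrict_space scaleR_conv_of_real)
  have "(\<integral>x. cis (of_int k * x) \<partial>torus) = (LBINT x:{0..<2*pi}. cis (of_int k * x))"
    unfolding torus_def set_lebesgue_integral_def by (subst integral_restrict_space) auto
  also have "\<dots> = (LBINT x=ereal 0..ereal (2*pi). cis (of_int k * x))"
    by (rule interval_integral_Ico[symmetric]) simp
  also have "\<dots> = 0" if k: "k \<noteq> 0"
  proof -
    have "(LBINT x=ereal 0..ereal (2*pi). cis (of_int k * x))
       = cis (of_int k * (2*pi)) / (\<i> * of_int k) - cis (of_int k * 0) / (\<i> * of_int k)"
    proof (rule interval_integral_FTC_finite)
      show "continuous_on {min 0 (2*pi)..max 0 (2*pi)} (\<lambda>x. cis (of_int k * x))"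
        by (intro continuous_intros)
      fix x
      have "((\<lambda>x::real. exp (\<i> * of_int k * x)) has_vector_derivative \<i> * of_int k * exp (\<i> * of_int k * x)) (at x within S)" for S
        by (rule has_vector_derivative_real_field) (auto intro!: derivative_eq_intros)
      then have "((\<lambda>x::real. exp (\<i> * of_int k * x) / (\<i> * of_int k)) has_vector_derivative (\<i> * of_int k * exp (\<i> * of_int k * x)) / (\<i> * of_int k)) (at x within S)" for S
        by (rule has_vector_derivative_divide)
      then show "((\<lambda>x. cis (of_int k * x) / (\<i> * of_int k)) has_vector_derivative cis (of_int k * x)) (at x within {min 0 (2*pi)..max 0 (2*pi)})"
        using k by (simp add: cis_conv_exp mult_ac)
    qed
    moreover have "cis (of_int k * (2*pi)) = 1"
      using cis_multiple_2pi[of "of_int k"] by (simp add: mult_ac)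
    ultimately show ?thesis by simp
  qed
  finally show ?thesis using 0 by auto
qed

lemma integral_chr: "(\<integral>z. chr n z \<partial>torus2) = (if n = 0 then of_real ((2 * pi)\<^sup>2) else 0)"
proof -
  have "(\<integral>z. chr n z \<partial>torus2) = (\<integral>x. (\<integral>y. chr n (x, y) \<partial>torus) \<partial>torus)"
    using chr_integrable[of n] torus_pair.integral_fst[of "\<lambda>x y. chr n (x, y)"]
    by (simp add: torus2_def)
  also have "\<dots> = (\<integral>x. cis (of_int (fst n) * x) * (\<integral>y. cis (of_int (snd n) * y) \<partial>torus) \<partial>torus)"
    by (simp add: chr_def cis_mult[symmetric])
  also have "\<dots> = (if n = 0 then of_real ((2 * pi)\<^sup>2) else 0)"
    by (auto simp: integral_cis_torus prod_eq_iff power2_eq_square)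
  finally show ?thesis .
qed

text \<open>Parseval's identity. In the form of a nonnegative integral it can be integrated in time
  without integrability conditions.\<close>

lemma nn_integral_trig_poly:
  assumes F: "finite F"
  shows "(\<integral>\<^sup>+z. ennreal ((cmod (\<Sum>n\<in>F. c n * chr n z))\<^sup>2) \<partial>torus2)
    = ennreal ((2*pi)\<^sup>2 * (\<Sum>n\<in>F. (cmod (c n))\<^sup>2))"
proof -
  let ?f = "\<lambda>z. \<Sum>n\<in>F. c n * chr n z"
  have m [measurable]: "?f \<in> borel_measurable torus2" by measurable
  have bd: "cmod (?f z) \<le> (\<Sum>n\<in>F. cmod (c n))" for z
    by (rule order.trans[OF norm_sum]) (simp add: norm_mult)
  have int: "integrable torus2 (\<lambda>z. (cmod (?f z))\<^sup>2)"
    by (rule torus2.integrable_const_bound[where B = "(\<Sum>n\<in>F. cmod (c n))\<^sup>2"])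
       (auto intro!: power_mono bd)
  have "complex_of_real (\<integral>z. (cmod (?f z))\<^sup>2 \<partial>torus2) = (\<integral>z. ?f z * cnj (?f z) \<partial>torus2)"
    unfolding complex_norm_square[symmetric] integral_complex_of_real[symmetric] of_real_power ..
  also have "\<dots> = (\<integral>z. (\<Sum>n\<in>F. \<Sum>m\<in>F. c n * cnj (c m) * chr (n - m) z) \<partial>torus2)"
    by (simp add: sum_product cnj_sum chr_diff mult_ac)
  also have "\<dots> = (\<Sum>n\<in>F. \<Sum>m\<in>F. c n * cnj (c m) * (if n - m = 0 then of_real ((2 * pi)\<^sup>2) else 0))"
    by (simp add: integral_chr chr_integrable integrable_mult_right Bochner_Integration.integral_sum Bochner_Integration.integrable_sum)
  also have "\<dots> = of_real ((2*pi)\<^sup>2 * (\<Sum>n\<in>F. (cmod (c n))\<^sup>2))"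
    using F by (simp add: sum_distrib_left complex_norm_square[symmetric] if_distrib sum.delta mult_ac cong: if_cong)
  finally have "(\<integral>z. (cmod (?f z))\<^sup>2 \<partial>torus2) = (2*pi)\<^sup>2 * (\<Sum>n\<in>F. (cmod (c n))\<^sup>2)"
    using of_real_eq_iff by blast
  then show ?thesis using nn_integral_eq_integral[OF int] by simp
qed

section \<open>Free waves\<close>

definition omega :: "real \<Rightarrow> int \<times> int \<Rightarrow> real" where
  "omega \<alpha> n = - \<alpha> * of_int (fst n) ^ 4 + (of_int (snd n))\<^sup>2"

text \<open>S(t) applied to the trigonometric polynomial with coefficients \<open>\<phi>\<close> on
  \<open>F\<close>. The coefficients are an argument so that a profile depending on time can be
  inserted later.\<close>

definition wave :: "real \<Rightarrow> (int \<times> int) set \<Rightarrow> (int \<times> int \<Rightarrow> complex) \<Rightarrow> real \<Rightarrow> real \<times> real \<Rightarrow> complex" where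
  "wave \<alpha> F \<phi> t z = (\<Sum>n\<in>F. \<phi> n * cis (- (t * omega \<alpha> n)) * chr n z)"

definition TI :: "real \<Rightarrow> real \<Rightarrow> real measure" where
  "TI p q = restrict_space lborel {p..q}"

definition PT :: "real \<Rightarrow> real \<Rightarrow> (real \<times> real \<times> real) measure" where
  "PT p q = TI p q \<Otimes>\<^sub>M torus2"

lemma space_TI: "space (TI p q) = {p..q}"
  by (simp add: TI_def space_restrict_space)

lemma measurable_TI: "f \<in> borel_measurable borel \<Longrightarrow> f \<in> borel_measurable (TI p q)"
  unfolding TI_def by (intro measurable_restrict_space1) simp

lemma measurable_TI_continuous: "continuous_on {p..q} f \<Longrightarrow> f \<in> borel_measurable (TI p q)"
  unfolding TI_def
  using borel_measurable_continuous_on_restrict[of "{p..q}" f]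
  by (simp add: measurable_cong_sets[OF sets_restrict_space_cong[OF sets_lborel] refl])

lemma finite_measure_TI: "finite_measure (TI p q)"
  by (rule finite_measureI) (cases "p \<le> q"; simp add: TI_def emeasure_restrict_space space_restrict_space)

interpretation TI: finite_measure "TI p q" for p q
  by (rule finite_measure_TI)

lemma finite_measure_PT: "finite_measure (PT p q)"
  unfolding PT_def by (rule finite_measure_pair_measure) (rule finite_measure_TI finite_measure_torus2)+

interpretation PT: finite_measure "PT p q" for p q
  by (rule finite_measure_PT)

lemma fst_PT [measurable]: "fst \<in> PT p q \<rightarrow>\<^sub>M TI p q"
  by (simp add: PT_def)

lemma snd_PT [measurable]: "snd \<in> PT p q \<rightarrow>\<^sub>M torus2"
  by (simp add: PT_def)

lemma nn_integral_PT:
  assumes "f \<in> borel_measurable (PT p q)"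
  shows "integral\<^sup>N (PT p q) f = (\<integral>\<^sup>+t. \<integral>\<^sup>+z. f (t, z) \<partial>torus2 \<partial>TI p q)"
  using assms unfolding PT_def by (simp add: torus2.nn_integral_fst)

lemma nn_integral_TI_continuous:
  assumes g: "continuous_on {p..q} g" and g0: "\<And>t. t \<in> {p..q} \<Longrightarrow> 0 \<le> g t"
  shows "(\<integral>\<^sup>+t. ennreal (g t) \<partial>TI p q) = ennreal (integral {p..q} g)"
proof -
  have si: "set_integrable lborel {p..q} g" by (rule borel_integrable_atLeastAtMost'[OF g])
  have "(\<integral>\<^sup>+t. ennreal (g t) \<partial>TI p q) = (\<integral>\<^sup>+t. ennreal (indicator {p..q} t *\<^sub>R g t) \<partial>lborel)"
    unfolding TI_def
    by (subst nn_integral_restrict_space) (auto intro!: nn_integral_cong simp: indicator_def)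
  also have "\<dots> = ennreal (LBINT t. indicator {p..q} t *\<^sub>R g t)"
    using si unfolding set_integrable_def
    by (intro nn_integral_eq_integral) (auto simp: indicator_def g0)
  also have "(LBINT t. indicator {p..q} t *\<^sub>R g t) = integral {p..q} g"
    using set_borel_integral_eq_integral(2)[OF si] by (simp add: set_lebesgue_integral_def)
  finally show ?thesis .
qed

lemma wave_measurable [measurable]:
  assumes [measurable]: "\<And>n. n \<in> F \<Longrightarrow> (\<lambda>t. a t n) \<in> borel_measurable (TI p q)"
  shows "(\<lambda>w. wave \<alpha> F (a (fst w)) (fst w) (snd w)) \<in> borel_measurable (PT p q)"
proof -
  have [measurable]: "(\<lambda>t. cis (- (t * omega \<alpha> n))) \<in> borel_measurable (TI p q)" for n
    by (intro measurable_TI borel_measurable_continuous_onI continuous_intros)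
  show ?thesis unfolding wave_def
    by (intro borel_measurable_sum borel_measurable_times) measurable
qed

section \<open>The \<open>L^4\<close> estimate for free waves in a slab\<close>

lemma wave_mult:
  assumes F: "finite F" "finite G"
  shows "wave \<alpha> F \<phi> t z * wave \<alpha> G \<psi> t z =
    (\<Sum>k\<in>(\<lambda>x. fst x + snd x) ` (F \<times> G).
      (\<Sum>x\<in>{x\<in>F \<times> G. fst x + snd x = k}. \<phi> (fst x) * \<psi> (snd x) * cis (- (t * (omega \<alpha> (fst x) + omega \<alpha> (snd x)))))
        * chr k z)"
proof -
  let ?g = "\<lambda>x. \<phi> (fst x) * \<psi> (snd x) * cis (- (t * (omega \<alpha> (fst x) + omega \<alpha> (snd x)))) * chr (fst x + snd x) z"
  have e: "(\<phi> n * cis (- (t * omega \<alpha> n)) * chr n z) * (\<psi> m * cis (- (t * omega \<alpha> m)) * chr m z) = ?g (n, m)" for n m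
  proof -
    have "cis (- (t * omega \<alpha> n)) * cis (- (t * omega \<alpha> m)) = cis (- (t * (omega \<alpha> n + omega \<alpha> m)))"
      by (simp add: cis_mult algebra_simps)
    then show ?thesis by (simp add: chr_add flip: \<open>cis (- (t * omega \<alpha> n)) * _ = _\<close>)
  qed
  have "wave \<alpha> F \<phi> t z * wave \<alpha> G \<psi> t z = (\<Sum>x\<in>F \<times> G. ?g x)"
    unfolding wave_def sum_product e by (simp add: sum.cartesian_product case_prod_beta)
  also have "\<dots> = (\<Sum>k\<in>(\<lambda>x. fst x + snd x) ` (F \<times> G). \<Sum>x\<in>{x\<in>F \<times> G. fst x + snd x = k}. ?g x)"
    by (rule sum.image_gen) (use F in auto)
  also have "\<dots> = (\<Sum>k\<in>(\<lambda>x. fst x + snd x) ` (F \<times> G).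
      (\<Sum>x\<in>{x\<in>F \<times> G. fst x + snd x = k}. \<phi> (fst x) * \<psi> (snd x) * cis (- (t * (omega \<alpha> (fst x) + omega \<alpha> (snd x)))))
        * chr k z)"
    by (rule sum.cong[OF refl], unfold sum_distrib_right) (rule sum.cong, auto)
  finally show ?thesis .
qed

lemma nn_integral_wave_mult:
  assumes F: "finite F" "finite G"
  shows "(\<integral>\<^sup>+z. ennreal ((cmod (wave \<alpha> F \<phi> t z * wave \<alpha> G \<psi> t z))\<^sup>2) \<partial>torus2) =
    ennreal ((2*pi)\<^sup>2 * (\<Sum>k\<in>(\<lambda>x. fst x + snd x) ` (F \<times> G).
      (cmod (\<Sum>x\<in>{x\<in>F \<times> G. fst x + snd x = k}. \<phi> (fst x) * \<psi> (snd x) * cis (- (t * (omega \<alpha> (fst x) + omega \<alpha> (snd x))))))\<^sup>2))"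
  unfolding wave_mult[OF F] by (rule nn_integral_trig_poly) (use F in auto)

text \<open>(2 pi)^2 is Parseval's constant and 12 comes from the tent window. The rest is the
  lattice count with \<open>c\<close> = -\<alpha>/8, the coefficient of the quartic term in the
  difference of two frequencies.\<close>

definition L4_const :: "real \<Rightarrow> real" where
  "L4_const \<alpha> = (2*pi)\<^sup>2 * (12 * (96 * (8 + 16 / sqrt (sqrt (- \<alpha> / 8)))))"

text \<open>In terms of sum and difference, the fourth powers become an even quartic in the
  difference whose quadratic coefficient is 6 times the square of the sum, hence nonnegative.
  Otherwise the sum enters only through a constant shift, which \<open>tau\<close> absorbs in the
  count.\<close>

lemma phase_sum_eq:
  fixes n m :: "int \<times> int"
  shows "omega \<alpha> n + omega \<alpha> m
    = (- \<alpha> / 8) * ((of_int (fst n - fst m))^4 + 6 * (of_int (fst n + fst m))\<^sup>2 * (of_int (fst n - fst m))\<^sup>2)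
      + (of_int (snd n - snd m))\<^sup>2 / 2 + ((- \<alpha> / 8) * (of_int (fst n + fst m))^4 + (of_int (snd n + snd m))\<^sup>2 / 2)"
  unfolding omega_def by (simp add: power2_eq_square power4_eq_xxxx field_simps)

text \<open>The fourth power of the \<open>L^4\<close> norm is the squared \<open>L^2\<close> norm
  of the squared wave. Parseval in space separates the output frequencies k, and for each k the time
  integral is that of an exponential sum over pairs with sum k. The differences of the second
  frequencies in such a pair are bounded by \<open>N\<close> wherever the slab lies.\<close>

lemma wave_L4_slab:
  assumes \<alpha>: "\<alpha> < 0" and F: "finite F" and N: "1 \<le> N"
    and slab: "\<And>n. n \<in> F \<Longrightarrow> j \<le> snd n \<and> snd n < j + int N"
    and pq: "p < q" "q - p \<le> 1"
  shows "(\<integral>\<^sup>+w. ennreal ((cmod (wave \<alpha> F \<phi> (fst w) (snd w)))^4) \<partial>PT p q)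
    \<le> ennreal (L4_const \<alpha> * (sqrt (q - p) * sqrt (real N)) * (\<Sum>n\<in>F. (cmod (\<phi> n))\<^sup>2)\<^sup>2)"
proof -
  define K where "K = (\<lambda>x. fst x + snd x) ` (F \<times> F)"
  define A where "A k = {x\<in>F \<times> F. fst x + snd x = k}" for k
  define \<theta> where "\<theta> x = omega \<alpha> (fst x) + omega \<alpha> (snd x)" for x
  define b where "b x = \<phi> (fst x) * \<phi> (snd x)" for x
  define B where "B = 96 * (8 + 16 / sqrt (sqrt (- \<alpha> / 8))) * (sqrt (q - p) * sqrt (real N))"
  have finA: "finite (A k)" for k using F by (simp add: A_def)
  have finK: "finite K" using F by (simp add: K_def)
  have count: "(\<Sum>y\<in>A k. (q - p) / (1 + (q - p)\<^sup>2 * (\<theta> x - \<theta> y)\<^sup>2)) \<le> B" for x k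
  proof -
    \<comment> \<open>Pairs in \<open>A k\<close> have a fixed sum and are determined by their
      difference, the variable in which the phase is convex.\<close>
    define D where "D y = (fst (fst y) - fst (snd y), snd (fst y) - snd (snd y))" for y :: "(int \<times> int) \<times> int \<times> int"
    define e where "e = 6 * (real_of_int (fst k))\<^sup>2"
    define tau where "tau = \<theta> x - ((- \<alpha> / 8) * (of_int (fst k))^4 + (of_int (snd k))\<^sup>2 / 2)"
    have inj: "inj_on D (A k)"
    proof (rule inj_onI)
      fix y y' assume "y \<in> A k" "y' \<in> A k" "D y = D y'"
      then have "fst y + snd y = fst y' + snd y'" "fst y - snd y = fst y' - snd y'"
        by (auto simp: A_def D_def prod_eq_iff)
      then show "y = y'" by (auto simp: prod_eq_iff)
    qed
    have th: "\<theta> y = (- \<alpha> / 8) * ((of_int (fst (D y)))^4 + e * (of_int (fst (D y)))\<^sup>2) + (of_int (snd (D y)))\<^sup>2 / 2 + (\<theta> x - tau)"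
      if "y \<in> A k" for y
    proof -
      have "fst k = fst (fst y) + fst (snd y)" "snd k = snd (fst y) + snd (snd y)" using that by (auto simp: A_def)
      then show ?thesis unfolding \<theta>_def[of y] phase_sum_eq by (simp add: D_def e_def tau_def)
    qed
    have "(\<Sum>y\<in>A k. (q - p) / (1 + (q - p)\<^sup>2 * (\<theta> x - \<theta> y)\<^sup>2))
       = (\<Sum>y\<in>A k. case D y of (m1, m2) \<Rightarrow> (q - p) / (1 + (q - p)\<^sup>2 *
           ((- \<alpha> / 8) * ((of_int m1)^4 + e * (of_int m1)\<^sup>2) + (of_int m2)\<^sup>2 / 2 - tau)\<^sup>2))"
    proof (rule sum.cong[OF refl])
      fix y assume y: "y \<in> A k"
      have "(\<theta> x - \<theta> y)\<^sup>2 = ((- \<alpha> / 8) * ((of_int (fst (D y)))^4 + e * (of_int (fst (D y)))\<^sup>2) + (of_int (snd (D y)))\<^sup>2 / 2 - tau)\<^sup>2"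
      proof -
        have "X + (a - tau) - a = X - tau" for X a :: real by simp
        then show ?thesis unfolding th[OF y] by (subst power2_commute) (simp only:)
      qed
      then show "(q - p) / (1 + (q - p)\<^sup>2 * (\<theta> x - \<theta> y)\<^sup>2) = (case D y of (m1, m2) \<Rightarrow> (q - p) / (1 + (q - p)\<^sup>2 *
           ((- \<alpha> / 8) * ((of_int m1)^4 + e * (of_int m1)\<^sup>2) + (of_int m2)\<^sup>2 / 2 - tau)\<^sup>2))"
        by (simp add: case_prod_beta)
    qed
    also have "\<dots> = (\<Sum>(m1, m2)\<in>D ` A k. (q - p) / (1 + (q - p)\<^sup>2 *
           ((- \<alpha> / 8) * ((of_int m1)^4 + e * (of_int m1)\<^sup>2) + (of_int m2)\<^sup>2 / 2 - tau)\<^sup>2))"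
      by (simp add: sum.reindex[OF inj] o_def)
    also have "\<dots> \<le> B" unfolding B_def
    proof (rule sum_phase_le)
      fix m1 m2 assume "(m1, m2) \<in> D ` A k"
      then obtain n m where nm: "n \<in> F" "m \<in> F" "m2 = snd n - snd m" by (auto simp: A_def D_def)
      then have "\<bar>m2\<bar> \<le> int N" using slab[of n] slab[of m] by auto
      then show "\<bar>real_of_int m2\<bar> \<le> real N" by linarith
    qed (use \<alpha> N pq finA in \<open>auto simp: e_def\<close>)
    finally show ?thesis .
  qed
  let ?h = "\<lambda>k t. (cmod (\<Sum>x\<in>A k. b x * cis (- (t * \<theta> x))))\<^sup>2"
  have [measurable]: "(\<lambda>w. wave \<alpha> F \<phi> (fst w) (snd w)) \<in> borel_measurable (PT p q)"
    using wave_measurable[of F "\<lambda>t. \<phi>"] by simp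
  have "(\<integral>\<^sup>+w. ennreal ((cmod (wave \<alpha> F \<phi> (fst w) (snd w)))^4) \<partial>PT p q)
      = (\<integral>\<^sup>+t. \<integral>\<^sup>+z. ennreal ((cmod (wave \<alpha> F \<phi> t z))^4) \<partial>torus2 \<partial>TI p q)"
    by (subst nn_integral_PT) auto
  also have "\<dots> = (\<integral>\<^sup>+t. ennreal ((2*pi)\<^sup>2 * (\<Sum>k\<in>K. ?h k t)) \<partial>TI p q)"
  proof (rule nn_integral_cong)
    fix t
    have "(cmod (wave \<alpha> F \<phi> t z))^4 = (cmod (wave \<alpha> F \<phi> t z * wave \<alpha> F \<phi> t z))\<^sup>2" for z
      by (simp add: norm_mult power2_eq_square power4_eq_xxxx)
    then show "(\<integral>\<^sup>+z. ennreal ((cmod (wave \<alpha> F \<phi> t z))^4) \<partial>torus2) = ennreal ((2*pi)\<^sup>2 * (\<Sum>k\<in>K. ?h k t))"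
      by (simp only: nn_integral_wave_mult[OF F F] K_def A_def b_def \<theta>_def)
  qed
  also have "\<dots> = ennreal (integral {p..q} (\<lambda>t. (2*pi)\<^sup>2 * (\<Sum>k\<in>K. ?h k t)))"
    by (rule nn_integral_TI_continuous)
       (auto intro!: continuous_intros sum_nonneg mult_nonneg_nonneg)
  also have "integral {p..q} (\<lambda>t. (2*pi)\<^sup>2 * (\<Sum>k\<in>K. ?h k t)) = (2*pi)\<^sup>2 * (\<Sum>k\<in>K. integral {p..q} (?h k))"
    using finK by (subst integral_mult_right, subst integral_sum) (auto intro!: integrable_continuous_interval continuous_intros)
  also have "\<dots> \<le> (2*pi)\<^sup>2 * (\<Sum>k\<in>K. 12 * B * (\<Sum>x\<in>A k. (cmod (b x))\<^sup>2))"
    by (intro mult_left_mono sum_mono integral_exponential_sum_le pq finA count) auto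
  also have "\<dots> = (2*pi)\<^sup>2 * (12 * B) * (\<Sum>k\<in>K. \<Sum>x\<in>A k. (cmod (b x))\<^sup>2)"
    by (simp add: sum_distrib_left mult_ac)
  also have "(\<Sum>k\<in>K. \<Sum>x\<in>A k. (cmod (b x))\<^sup>2) = (\<Sum>x\<in>F \<times> F. (cmod (b x))\<^sup>2)"
    unfolding K_def A_def by (rule sum.image_gen[symmetric]) (use F in auto)
  also have "\<dots> = (\<Sum>n\<in>F. (cmod (\<phi> n))\<^sup>2)\<^sup>2"
    by (simp add: b_def norm_mult power_mult_distrib power2_eq_square[of "sum _ _"] sum_product sum.cartesian_product case_prod_beta)
  finally show ?thesis by (simp add: B_def L4_const_def mult_ac ennreal_leI)
qed

section \<open>Bilinear bounds for free waves\<close>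

lemma weighted_sum_squared_le:
  fixes x w :: "'a \<Rightarrow> real"
  assumes w: "\<And>i. i \<in> I \<Longrightarrow> 0 < w i"
  shows "(\<Sum>i\<in>I. x i)\<^sup>2 \<le> (\<Sum>i\<in>I. 1 / w i) * (\<Sum>i\<in>I. w i * (x i)\<^sup>2)"
proof -
  have "(\<Sum>i\<in>I. x i)\<^sup>2 = (\<Sum>i\<in>I. sqrt (1 / w i) * (sqrt (w i) * x i))\<^sup>2"
    by (rule arg_cong[where f = "\<lambda>x. x\<^sup>2"], rule sum.cong[OF refl]) (use w in \<open>auto simp: real_sqrt_divide less_imp_neq[symmetric]\<close>)
  also have "\<dots> \<le> (\<Sum>i\<in>I. (sqrt (1 / w i))\<^sup>2) * (\<Sum>i\<in>I. (sqrt (w i) * x i)\<^sup>2)"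
    by (rule Cauchy_Schwarz_ineq_sum)
  also have "\<dots> = (\<Sum>i\<in>I. 1 / w i) * (\<Sum>i\<in>I. w i * (x i)\<^sup>2)"
    using w by (intro arg_cong2[where f = "(*)"] sum.cong) (auto simp: power_mult_distrib less_imp_le)
  finally show ?thesis .
qed

lemma nn_integral_mult_square_le:
  fixes f g :: "'a \<Rightarrow> complex"
  assumes [measurable]: "f \<in> borel_measurable M" "g \<in> borel_measurable M"
    and f: "(\<integral>\<^sup>+x. ennreal ((cmod (f x))^4) \<partial>M) \<le> ennreal (C * a\<^sup>2)"
    and g: "(\<integral>\<^sup>+x. ennreal ((cmod (g x))^4) \<partial>M) \<le> ennreal (C * b\<^sup>2)"
    and C: "0 \<le> C" "0 \<le> a" "0 \<le> b"
  shows "(\<integral>\<^sup>+x. ennreal ((cmod (f x * g x))\<^sup>2) \<partial>M) \<le> ennreal (C * a * b)"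
proof -
  let ?I = "\<integral>\<^sup>+x. ennreal ((cmod (f x))\<^sup>2) * ennreal ((cmod (g x))\<^sup>2) \<partial>M"
  have 4: "(ennreal (x\<^sup>2))\<^sup>2 = ennreal (x^4)" for x
    by (simp add: ennreal_power flip: power_mult)
  have "?I\<^sup>2 \<le> (\<integral>\<^sup>+x. (ennreal ((cmod (f x))\<^sup>2))\<^sup>2 \<partial>M) * (\<integral>\<^sup>+x. (ennreal ((cmod (g x))\<^sup>2))\<^sup>2 \<partial>M)"
    by (rule Cauchy_Schwarz_nn_integral) measurable
  also have "\<dots> \<le> ennreal (C * a\<^sup>2) * ennreal (C * b\<^sup>2)"
    unfolding 4 by (intro mult_mono f g) auto
  also have "\<dots> = (ennreal (C * a * b))\<^sup>2"
    using C by (simp add: ennreal_mult[symmetric] ennreal_power power2_eq_square mult_ac)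
  finally have sq: "?I\<^sup>2 \<le> (ennreal (C * a * b))\<^sup>2" .
  have "?I \<le> ennreal (C * a * b)"
  proof (cases ?I)
    case (real r)
    then have "r\<^sup>2 \<le> (C * a * b)\<^sup>2" using sq C by (simp add: ennreal_power)
    moreover have "0 \<le> C * a * b" using C by simp
    ultimately have "r \<le> C * a * b" by (rule power2_le_imp_le)
    then show ?thesis unfolding real by (rule ennreal_leI)
  next
    case top
    have "?I\<^sup>2 < top" by (rule le_less_trans[OF sq]) (simp add: ennreal_power C)
    with top show ?thesis by (simp add: power2_eq_square ennreal_mult_eq_top_iff)
  qed
  then show ?thesis
    using C by (simp add: norm_mult power_mult_distrib ennreal_mult)
qed

text \<open>
  Only the second frequency of \<open>\<psi>\<close> is localised.  Splitting \<open>\<phi>\<close> into slabs of comparable width in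
  that frequency makes the products with \<open>\<psi>\<close> almost orthogonal, and on a slab the \<open>L\<^sup>4\<close> bound does
  not see the position of the slab.
\<close>

lemma wave_mult_slab_decomposition:
  assumes F: "finite F" and G: "finite G" and N: "\<And>m. m \<in> G \<Longrightarrow> \<bar>snd m\<bar> \<le> int N"
  defines "\<sigma> \<equiv> \<lambda>n :: int \<times> int. snd n div (2 * int N + 1)"
  shows "(\<integral>\<^sup>+z. ennreal ((cmod (wave \<alpha> F \<phi> t z * wave \<alpha> G \<psi> t z))\<^sup>2) \<partial>torus2)
    \<le> (\<Sum>j\<in>\<sigma> ` F. 2 * (\<integral>\<^sup>+z. ennreal ((cmod (wave \<alpha> {n\<in>F. \<sigma> n = j} \<phi> t z * wave \<alpha> G \<psi> t z))\<^sup>2) \<partial>torus2))"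
proof -
  let ?W = "2 * int N + 1"
  define g where "g x = \<phi> (fst x) * \<psi> (snd x) * cis (- (t * (omega \<alpha> (fst x) + omega \<alpha> (snd x))))" for x
  define P where "P F' k = {x\<in>F' \<times> G. fst x + snd x = k}" for F' and k :: "int \<times> int"
  define K where "K F' = (\<lambda>x. fst x + snd x) ` (F' \<times> G)" for F' :: "(int \<times> int) set"
  define Fj where "Fj j = {n\<in>F. \<sigma> n = j}" for j
  have finP: "finite (P F' k)" if "finite F'" for F' k using that G by (simp add: P_def)
  have finK: "finite (K F)" using F G by (simp add: K_def)
  have I: "(\<integral>\<^sup>+z. ennreal ((cmod (wave \<alpha> F' \<phi> t z * wave \<alpha> G \<psi> t z))\<^sup>2) \<partial>torus2)
      = ennreal ((2*pi)\<^sup>2 * (\<Sum>k\<in>K F. (cmod (\<Sum>x\<in>P F' k. g x))\<^sup>2))" if "F' \<subseteq> F" for F'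
  proof -
    have "finite F'" using that F finite_subset by blast
    then have "(\<integral>\<^sup>+z. ennreal ((cmod (wave \<alpha> F' \<phi> t z * wave \<alpha> G \<psi> t z))\<^sup>2) \<partial>torus2)
      = ennreal ((2*pi)\<^sup>2 * (\<Sum>k\<in>K F'. (cmod (\<Sum>x\<in>P F' k. g x))\<^sup>2))"
      unfolding K_def P_def g_def by (rule nn_integral_wave_mult) (rule G)
    also have "(\<Sum>k\<in>K F'. (cmod (\<Sum>x\<in>P F' k. g x))\<^sup>2) = (\<Sum>k\<in>K F. (cmod (\<Sum>x\<in>P F' k. g x))\<^sup>2)"
    proof (rule sum.mono_neutral_left)
      show "K F' \<subseteq> K F" using that by (auto simp: K_def)
      show "\<forall>k\<in>K F - K F'. (cmod (\<Sum>x\<in>P F' k. g x))\<^sup>2 = 0"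
      proof
        fix k assume "k \<in> K F - K F'"
        then have "P F' k = {}" unfolding K_def P_def by blast
        then show "(cmod (\<Sum>x\<in>P F' k. g x))\<^sup>2 = 0" by simp
      qed
    qed (rule finK)
    finally show ?thesis .
  qed
  have main: "(cmod (\<Sum>x\<in>P F k. g x))\<^sup>2 \<le> (\<Sum>j\<in>\<sigma> ` F. 2 * (cmod (\<Sum>x\<in>P (Fj j) k. g x))\<^sup>2)" for k
  proof -
    \<comment> \<open>For an output k, the second frequency of n runs through a window of length 2N
      starting at \<open>snd k - int N\<close>. The slabs are wider than that, so the window meets
      at most two consecutive ones; this is the factor 2 in the conclusion.\<close>
    let ?T = "{(snd k - int N) div ?W, (snd k - int N) div ?W + 1}"
    let ?J = "\<sigma> ` F \<inter> ?T"
    have T: "\<sigma> n \<in> ?T" if "n + m = k" "m \<in> G" for n m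
    proof -
      have k: "snd k = snd n + snd m" using that by auto
      have "(snd k - int N) div ?W \<le> snd n div ?W"
        using N[OF that(2)] k by (intro zdiv_mono1) auto
      moreover have "snd n div ?W \<le> (snd k - int N + ?W) div ?W"
        using N[OF that(2)] k by (intro zdiv_mono1) auto
      moreover have "(snd k - int N + ?W) div ?W = (snd k - int N) div ?W + 1"
        by (rule div_add_self2) simp
      ultimately show ?thesis by (auto simp: \<sigma>_def)
    qed
    have "(\<Sum>x\<in>P F k. g x) = (\<Sum>j\<in>(\<lambda>x. \<sigma> (fst x)) ` P F k. \<Sum>x\<in>{x\<in>P F k. \<sigma> (fst x) = j}. g x)"
      by (rule sum.image_gen[OF finP[OF F]])
    also have "\<dots> = (\<Sum>j\<in>?J. \<Sum>x\<in>{x\<in>P F k. \<sigma> (fst x) = j}. g x)"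
    proof (rule sum.mono_neutral_left)
      show "(\<lambda>x. \<sigma> (fst x)) ` P F k \<subseteq> ?J"
      proof
        fix y assume "y \<in> (\<lambda>x. \<sigma> (fst x)) ` P F k"
        then obtain x where x: "x \<in> P F k" "y = \<sigma> (fst x)" by blast
        then have "fst x \<in> F" "snd x \<in> G" "fst x + snd x = k" by (simp_all add: P_def mem_Times_iff)
        then show "y \<in> ?J" using T[of "fst x" "snd x"] x(2) by blast
      qed
      show "\<forall>j\<in>?J - (\<lambda>x. \<sigma> (fst x)) ` P F k. (\<Sum>x\<in>{x\<in>P F k. \<sigma> (fst x) = j}. g x) = 0"
      proof
        fix j assume "j \<in> ?J - (\<lambda>x. \<sigma> (fst x)) ` P F k"
        then have "{x\<in>P F k. \<sigma> (fst x) = j} = {}" by blast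
        then show "(\<Sum>x\<in>{x\<in>P F k. \<sigma> (fst x) = j}. g x) = 0" by (simp only: sum.empty)
      qed
    qed simp
    also have "\<dots> = (\<Sum>j\<in>?J. \<Sum>x\<in>P (Fj j) k. g x)"
      by (intro sum.cong) (auto simp: P_def Fj_def)
    finally have "cmod (\<Sum>x\<in>P F k. g x) \<le> (\<Sum>j\<in>?J. cmod (\<Sum>x\<in>P (Fj j) k. g x))"
      by (simp add: norm_sum)
    then have "(cmod (\<Sum>x\<in>P F k. g x))\<^sup>2 \<le> (\<Sum>j\<in>?J. cmod (\<Sum>x\<in>P (Fj j) k. g x))\<^sup>2"
      by (intro power_mono) auto
    also have "\<dots> \<le> (\<Sum>j\<in>?J. (cmod (\<Sum>x\<in>P (Fj j) k. g x))\<^sup>2) * card ?J"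
      by (rule sum_squared_le_sum_of_squares)
    also have "\<dots> \<le> (\<Sum>j\<in>?J. (cmod (\<Sum>x\<in>P (Fj j) k. g x))\<^sup>2) * 2"
    proof (rule mult_left_mono)
      have "card ?J \<le> card ?T" by (intro card_mono) auto
      then show "real (card ?J) \<le> 2" by simp
    qed (simp add: sum_nonneg)
    also have "\<dots> \<le> (\<Sum>j\<in>\<sigma> ` F. (cmod (\<Sum>x\<in>P (Fj j) k. g x))\<^sup>2) * 2"
      using F by (intro mult_right_mono sum_mono2) auto
    finally show ?thesis by (simp add: sum_distrib_left mult.commute)
  qed
  have "(2*pi)\<^sup>2 * (\<Sum>k\<in>K F. (cmod (\<Sum>x\<in>P F k. g x))\<^sup>2)
    \<le> (2*pi)\<^sup>2 * (\<Sum>k\<in>K F. \<Sum>j\<in>\<sigma> ` F. 2 * (cmod (\<Sum>x\<in>P (Fj j) k. g x))\<^sup>2)"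
    by (intro mult_left_mono sum_mono main) auto
  also have "\<dots> = (\<Sum>j\<in>\<sigma> ` F. 2 * ((2*pi)\<^sup>2 * (\<Sum>k\<in>K F. (cmod (\<Sum>x\<in>P (Fj j) k. g x))\<^sup>2)))"
    by (subst sum.swap) (simp add: sum_distrib_left mult_ac)
  finally have "(\<integral>\<^sup>+z. ennreal ((cmod (wave \<alpha> F \<phi> t z * wave \<alpha> G \<psi> t z))\<^sup>2) \<partial>torus2)
    \<le> ennreal (\<Sum>j\<in>\<sigma> ` F. 2 * ((2*pi)\<^sup>2 * (\<Sum>k\<in>K F. (cmod (\<Sum>x\<in>P (Fj j) k. g x))\<^sup>2)))"
    unfolding I[OF subset_refl] by (rule ennreal_leI)
  also have "\<dots> = (\<Sum>j\<in>\<sigma> ` F. 2 * ennreal ((2*pi)\<^sup>2 * (\<Sum>k\<in>K F. (cmod (\<Sum>x\<in>P (Fj j) k. g x))\<^sup>2)))"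
  proof -
    have e: "ennreal (2 * x) = 2 * ennreal x" if "0 \<le> x" for x using that by (simp add: ennreal_mult)
    show ?thesis
      unfolding e[symmetric, OF mult_nonneg_nonneg[OF zero_le_power2 sum_nonneg[OF zero_le_power2]]]
      by (rule sum_ennreal[symmetric]) (auto intro!: mult_nonneg_nonneg sum_nonneg)
  qed
  also have "\<dots> = (\<Sum>j\<in>\<sigma> ` F. 2 * (\<integral>\<^sup>+z. ennreal ((cmod (wave \<alpha> (Fj j) \<phi> t z * wave \<alpha> G \<psi> t z))\<^sup>2) \<partial>torus2))"
    by (intro sum.cong refl arg_cong[where f = "(*) 2"] I[symmetric]) (auto simp: Fj_def)
  finally show ?thesis by (simp add: Fj_def)
qed

text \<open>Cauchy-Schwarz reduces each piece to the \<open>L^4\<close> norms of two waves in slabs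
  of the same width 2N + 1: a slab of \<phi>, and \<psi>, which fits in the slab starting at -N. The
  pieces of \<phi> are disjoint, so their \<open>L^2\<close> masses add up whatever the number of
  slabs.\<close>

lemma bilinear_localised:
  assumes \<alpha>: "\<alpha> < 0" and F: "finite F" and G: "finite G" and N: "\<And>m. m \<in> G \<Longrightarrow> \<bar>snd m\<bar> \<le> int N"
    and pq: "p < q" "q - p \<le> 1"
  shows "(\<integral>\<^sup>+w. ennreal ((cmod (wave \<alpha> F \<phi> (fst w) (snd w) * wave \<alpha> G \<psi> (fst w) (snd w)))\<^sup>2) \<partial>PT p q)
    \<le> ennreal (2 * L4_const \<alpha> * sqrt (q - p) * sqrt (real (2 * N + 1)) * (\<Sum>n\<in>F. (cmod (\<phi> n))\<^sup>2) * (\<Sum>n\<in>G. (cmod (\<psi> n))\<^sup>2))"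
proof -
  define W where "W = 2 * N + 1"
  define \<sigma> where "\<sigma> n = snd n div (2 * int N + 1)" for n :: "int \<times> int"
  define C where "C = L4_const \<alpha> * (sqrt (q - p) * sqrt (real W))"
  let ?U = "\<lambda>F w. wave \<alpha> F \<phi> (fst w) (snd w)" and ?V = "\<lambda>w. wave \<alpha> G \<psi> (fst w) (snd w)"
  have C0: "0 \<le> C" using \<alpha> pq by (simp add: C_def L4_const_def)
  have piece: "(\<integral>\<^sup>+w. ennreal ((cmod (?U {n\<in>F. \<sigma> n = j} w * ?V w))\<^sup>2) \<partial>PT p q)
     \<le> ennreal (C * (\<Sum>n\<in>{n\<in>F. \<sigma> n = j}. (cmod (\<phi> n))\<^sup>2) * (\<Sum>n\<in>G. (cmod (\<psi> n))\<^sup>2))" for j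
  proof (rule nn_integral_mult_square_le)
    show "(\<integral>\<^sup>+w. ennreal ((cmod (?U {n\<in>F. \<sigma> n = j} w))^4) \<partial>PT p q)
      \<le> ennreal (C * (\<Sum>n\<in>{n\<in>F. \<sigma> n = j}. (cmod (\<phi> n))\<^sup>2)\<^sup>2)"
      unfolding C_def
    proof (rule wave_L4_slab[OF \<alpha> _ _ _ pq, where j = "j * int W"])
      fix n assume "n \<in> {n\<in>F. \<sigma> n = j}"
      then have j: "j = snd n div int W" by (simp add: \<sigma>_def W_def add.commute)
      have "snd n = int W * (snd n div int W) + snd n mod int W" by simp
      moreover have "0 \<le> snd n mod int W" "snd n mod int W < int W" by (simp_all add: W_def)
      ultimately show "j * int W \<le> snd n \<and> snd n < j * int W + int W"
        unfolding j by (simp only: mult.commute[of _ "int W"]) linarith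
    qed (use F in \<open>auto simp: W_def\<close>)
    show "(\<integral>\<^sup>+w. ennreal ((cmod (?V w))^4) \<partial>PT p q) \<le> ennreal (C * (\<Sum>n\<in>G. (cmod (\<psi> n))\<^sup>2)\<^sup>2)"
      unfolding C_def
    proof (rule wave_L4_slab[OF \<alpha> G _ _ pq, where j = "- int N"])
      fix m assume "m \<in> G"
      from N[OF this] show "- int N \<le> snd m \<and> snd m < - int N + int W" by (auto simp: W_def)
    qed (auto simp: W_def)
  qed (auto intro!: sum_nonneg C0)
  have "(\<integral>\<^sup>+w. ennreal ((cmod (?U F w * ?V w))\<^sup>2) \<partial>PT p q)
      = (\<integral>\<^sup>+t. \<integral>\<^sup>+z. ennreal ((cmod (wave \<alpha> F \<phi> t z * wave \<alpha> G \<psi> t z))\<^sup>2) \<partial>torus2 \<partial>TI p q)"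
    by (subst nn_integral_PT) auto
  also have "\<dots> \<le> (\<integral>\<^sup>+t. (\<Sum>j\<in>\<sigma> ` F. 2 * (\<integral>\<^sup>+z. ennreal ((cmod (wave \<alpha> {n\<in>F. \<sigma> n = j} \<phi> t z * wave \<alpha> G \<psi> t z))\<^sup>2) \<partial>torus2)) \<partial>TI p q)"
    unfolding \<sigma>_def by (intro nn_integral_mono wave_mult_slab_decomposition F G N)
  also have "\<dots> = (\<Sum>j\<in>\<sigma> ` F. 2 * (\<integral>\<^sup>+t. \<integral>\<^sup>+z. ennreal ((cmod (wave \<alpha> {n\<in>F. \<sigma> n = j} \<phi> t z * wave \<alpha> G \<psi> t z))\<^sup>2) \<partial>torus2 \<partial>TI p q))"
  proof -
    have m: "(\<lambda>t. \<integral>\<^sup>+z. ennreal ((cmod (wave \<alpha> F' \<phi> t z * wave \<alpha> G \<psi> t z))\<^sup>2) \<partial>torus2) \<in> borel_measurable (TI p q)" for F'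
    proof (rule torus2.borel_measurable_nn_integral)
      have "(\<lambda>w. ennreal ((cmod (?U F' w * ?V w))\<^sup>2)) \<in> borel_measurable (PT p q)" by measurable
      then show "(\<lambda>(t, z). ennreal ((cmod (wave \<alpha> F' \<phi> t z * wave \<alpha> G \<psi> t z))\<^sup>2)) \<in> borel_measurable (TI p q \<Otimes>\<^sub>M torus2)"
        by (simp add: PT_def case_prod_beta')
    qed
    then show ?thesis by (subst nn_integral_sum) (auto simp: nn_integral_cmult)
  qed
  also have "\<dots> = (\<Sum>j\<in>\<sigma> ` F. 2 * (\<integral>\<^sup>+w. ennreal ((cmod (?U {n\<in>F. \<sigma> n = j} w * ?V w))\<^sup>2) \<partial>PT p q))"
    by (subst nn_integral_PT) auto
  also have "\<dots> \<le> (\<Sum>j\<in>\<sigma> ` F. 2 * ennreal (C * (\<Sum>n\<in>{n\<in>F. \<sigma> n = j}. (cmod (\<phi> n))\<^sup>2) * (\<Sum>n\<in>G. (cmod (\<psi> n))\<^sup>2)))"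
    by (intro sum_mono mult_left_mono piece) auto
  also have "\<dots> = (\<Sum>j\<in>\<sigma> ` F. ennreal (2 * (C * (\<Sum>n\<in>{n\<in>F. \<sigma> n = j}. (cmod (\<phi> n))\<^sup>2) * (\<Sum>n\<in>G. (cmod (\<psi> n))\<^sup>2))))"
    by (simp add: ennreal_mult')
  also have "\<dots> = ennreal (\<Sum>j\<in>\<sigma> ` F. 2 * (C * (\<Sum>n\<in>{n\<in>F. \<sigma> n = j}. (cmod (\<phi> n))\<^sup>2) * (\<Sum>n\<in>G. (cmod (\<psi> n))\<^sup>2)))"
    by (intro sum_ennreal) (auto intro!: mult_nonneg_nonneg sum_nonneg C0)
  also have "(\<Sum>j\<in>\<sigma> ` F. 2 * (C * (\<Sum>n\<in>{n\<in>F. \<sigma> n = j}. (cmod (\<phi> n))\<^sup>2) * (\<Sum>n\<in>G. (cmod (\<psi> n))\<^sup>2)))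
     = 2 * C * (\<Sum>j\<in>\<sigma> ` F. \<Sum>n\<in>{n\<in>F. \<sigma> n = j}. (cmod (\<phi> n))\<^sup>2) * (\<Sum>n\<in>G. (cmod (\<psi> n))\<^sup>2)"
    by (simp add: sum_distrib_left sum_distrib_right mult_ac)
  also have "(\<Sum>j\<in>\<sigma> ` F. \<Sum>n\<in>{n\<in>F. \<sigma> n = j}. (cmod (\<phi> n))\<^sup>2) = (\<Sum>n\<in>F. (cmod (\<phi> n))\<^sup>2)"
    by (rule sum.image_gen[OF F, symmetric])
  finally show ?thesis by (simp add: C_def W_def mult_ac)
qed

lemma sobolev_weight_pos: "sobolev_weight s n > 0"
  by (cases n) (simp add: sobolev_weight_def, smt (verit) zero_le_power2)

text \<open>A dyadic block of \<psi> at second frequency 2^i costs 2^(i/2), while the Sobolev weight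
  is worth 2^(2si) there. The quotient is \<rho>^i with \<rho> > 1 exactly when s > 1/4, and this
  gain pays for Cauchy-Schwarz over the blocks.\<close>

lemma bilinear_free:
  assumes \<alpha>: "\<alpha> < 0" and s: "s > 1 / 4"
  obtains C where "C > 0" and "\<And>F G \<phi> \<psi> p q. \<lbrakk>finite F; finite G; p < q; q - p \<le> 1\<rbrakk> \<Longrightarrow>
     (\<integral>\<^sup>+w. ennreal ((cmod (wave \<alpha> F \<phi> (fst w) (snd w) * wave \<alpha> G \<psi> (fst w) (snd w)))\<^sup>2) \<partial>PT p q)
    \<le> ennreal (C * sqrt (q - p) * (\<Sum>n\<in>F. (cmod (\<phi> n))\<^sup>2) * (\<Sum>n\<in>G. sobolev_weight s n * (cmod (\<psi> n))\<^sup>2))"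
proof
  define \<rho> where "\<rho> = 2 powr (2 * s - 1/2)"
  define R where "R = 1 / (1 - 1 / \<rho>)"
  define C where "C = R * (2 * L4_const \<alpha> * (3 * 2 powr s))"
  have \<rho>: "\<rho> > 1" using s by (simp add: \<rho>_def gr_one_powr)
  have R: "R > 0" using \<rho> by (simp add: R_def)
  have "L4_const \<alpha> > 0" using \<alpha> by (auto simp: L4_const_def intro!: mult_pos_pos add_pos_pos divide_pos_pos)
  then show C: "C > 0" using R by (simp add: C_def)
  fix F G :: "(int \<times> int) set" and \<phi> \<psi> :: "int \<times> int \<Rightarrow> complex" and p q :: real
  assume F: "finite F" and G: "finite G" and pq: "p < q" "q - p \<le> 1"
  \<comment> \<open>The shift by one assigns second frequency 0 to block 0 and keeps the logarithm
    away from the argument 0.\<close>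
  define d where "d m = floor_log (nat (\<bar>snd m\<bar> + 1))" for m :: "int \<times> int"
  let ?G = "\<lambda>i. {m\<in>G. d m = i}"
  let ?U = "\<lambda>w. wave \<alpha> F \<phi> (fst w) (snd w)" and ?V = "\<lambda>G w. wave \<alpha> G \<psi> (fst w) (snd w)"
  let ?S = "\<Sum>n\<in>F. (cmod (\<phi> n))\<^sup>2"
  have S0: "?S \<ge> 0" by (simp add: sum_nonneg)
  have d1: "2 ^ d m \<le> \<bar>snd m\<bar> + 1" and d2: "\<bar>snd m\<bar> < 2 ^ (d m + 1)" for m :: "int \<times> int"
  proof -
    have "(2::nat) ^ d m \<le> nat (\<bar>snd m\<bar> + 1)" unfolding d_def by (rule floor_log_exp2_le) simp
    then have "int (2 ^ d m) \<le> \<bar>snd m\<bar> + 1" by linarith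
    then show "2 ^ d m \<le> \<bar>snd m\<bar> + 1" by simp
    have "nat (\<bar>snd m\<bar> + 1) < 2 * 2 ^ d m" unfolding d_def by (rule floor_log_exp2_gt)
    then have "\<bar>snd m\<bar> + 1 < int (2 * 2 ^ d m)" by linarith
    then show "\<bar>snd m\<bar> < 2 ^ (d m + 1)" by simp
  qed
  have geo: "(\<Sum>i\<in>d ` G. 1 / \<rho> ^ i) \<le> R"
  proof -
    have "(\<Sum>i\<in>d ` G. (1 / \<rho>) ^ i) \<le> (\<Sum>i. (1 / \<rho>) ^ i)"
      using \<rho> G by (intro sum_le_suminf summable_geometric) auto
    also have "\<dots> = R" using \<rho> by (simp add: suminf_geometric R_def del: power_one_over)
    finally show ?thesis by (simp add: power_one_over)
  qed
  have pw: "(cmod (?U w * ?V G w))\<^sup>2 \<le> (\<Sum>i\<in>d ` G. R * \<rho> ^ i * (cmod (?U w * ?V (?G i) w))\<^sup>2)" for w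
  proof -
    have "?V G w = (\<Sum>i\<in>d ` G. ?V (?G i) w)"
      unfolding wave_def by (rule sum.image_gen[OF G])
    then have "cmod (?U w * ?V G w) \<le> (\<Sum>i\<in>d ` G. cmod (?U w * ?V (?G i) w))"
      by (simp add: sum_distrib_left norm_sum)
    then have "(cmod (?U w * ?V G w))\<^sup>2 \<le> (\<Sum>i\<in>d ` G. cmod (?U w * ?V (?G i) w))\<^sup>2"
      by (intro power_mono) auto
    also have "\<dots> \<le> (\<Sum>i\<in>d ` G. 1 / \<rho> ^ i) * (\<Sum>i\<in>d ` G. \<rho> ^ i * (cmod (?U w * ?V (?G i) w))\<^sup>2)"
      using \<rho> by (intro weighted_sum_squared_le) auto
    also have "\<dots> \<le> R * (\<Sum>i\<in>d ` G. \<rho> ^ i * (cmod (?U w * ?V (?G i) w))\<^sup>2)"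
      using \<rho> by (intro mult_right_mono geo sum_nonneg) auto
    finally show ?thesis by (simp add: sum_distrib_left mult_ac)
  qed
  let ?B = "\<lambda>i. 2 * L4_const \<alpha> * sqrt (q - p) * sqrt (real (2 * 2 ^ (i + 1) + 1)) * ?S * (\<Sum>n\<in>?G i. (cmod (\<psi> n))\<^sup>2)"
  have L0: "L4_const \<alpha> \<ge> 0" using \<open>L4_const \<alpha> > 0\<close> by simp
  have B0: "0 \<le> ?B i" for i
    using pq S0 L0 by (intro mult_nonneg_nonneg sum_nonneg) auto
  have "(\<integral>\<^sup>+w. ennreal ((cmod (?U w * ?V G w))\<^sup>2) \<partial>PT p q)
      \<le> (\<integral>\<^sup>+w. (\<Sum>i\<in>d ` G. ennreal (R * \<rho> ^ i) * ennreal ((cmod (?U w * ?V (?G i) w))\<^sup>2)) \<partial>PT p q)"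
  proof (rule nn_integral_mono)
    fix w
    have "ennreal ((cmod (?U w * ?V G w))\<^sup>2) \<le> ennreal (\<Sum>i\<in>d ` G. R * \<rho> ^ i * (cmod (?U w * ?V (?G i) w))\<^sup>2)"
      by (intro ennreal_leI pw)
    also have "\<dots> = (\<Sum>i\<in>d ` G. ennreal (R * \<rho> ^ i) * ennreal ((cmod (?U w * ?V (?G i) w))\<^sup>2))"
      using R \<rho> by (subst sum_ennreal[symmetric]) (auto simp: ennreal_mult[symmetric] intro!: sum.cong mult_nonneg_nonneg)
    finally show "ennreal ((cmod (?U w * ?V G w))\<^sup>2) \<le> (\<Sum>i\<in>d ` G. ennreal (R * \<rho> ^ i) * ennreal ((cmod (?U w * ?V (?G i) w))\<^sup>2))" .
  qed
  also have "\<dots> = (\<Sum>i\<in>d ` G. ennreal (R * \<rho> ^ i) * (\<integral>\<^sup>+w. ennreal ((cmod (?U w * ?V (?G i) w))\<^sup>2) \<partial>PT p q))"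
    by (subst nn_integral_sum) (auto simp: nn_integral_cmult)
  also have "\<dots> \<le> (\<Sum>i\<in>d ` G. ennreal (R * \<rho> ^ i) * ennreal (?B i))"
  proof (intro sum_mono mult_left_mono)
    fix i
    have N: "\<bar>snd m\<bar> \<le> int (2 ^ (i + 1))" if "m \<in> ?G i" for m
      using d2[of m] that by auto
    have G': "finite (?G i)" using G by simp
    show "(\<integral>\<^sup>+w. ennreal ((cmod (?U w * ?V (?G i) w))\<^sup>2) \<partial>PT p q) \<le> ennreal (?B i)"
      by (rule bilinear_localised[OF \<alpha> F G' N pq])
  qed auto
  also have "\<dots> = ennreal (\<Sum>i\<in>d ` G. R * \<rho> ^ i * ?B i)"
    using R \<rho> B0 by (subst sum_ennreal[symmetric]) (auto simp: ennreal_mult[symmetric] intro!: sum.cong mult_nonneg_nonneg)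
  also have "\<dots> \<le> ennreal (\<Sum>i\<in>d ` G. C * sqrt (q - p) * ?S * (\<Sum>n\<in>?G i. sobolev_weight s n * (cmod (\<psi> n))\<^sup>2))"
  proof (intro ennreal_leI sum_mono)
    fix i
    \<comment> \<open>The cost of block i times \<rho>^i is a multiple of 2^(2si). The weight
      dominates it because 2^i is at most |snd n| + 1 on the block.\<close>
    have key: "\<rho> ^ i * sqrt (real (2 * 2 ^ (i + 1) + 1)) \<le> 3 * 2 powr s * sobolev_weight s n" if "n \<in> ?G i" for n
    proof -
      have "sqrt (real (2 * 2 ^ (i + 1) + 1)) \<le> sqrt (9 * 2 ^ i)"
      proof (rule real_sqrt_le_mono)
        have "(1::real) \<le> 2 ^ i" by simp
        moreover have "real (2 * 2 ^ (i + 1) + 1) = 4 * 2 ^ i + 1" by simp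
        ultimately show "real (2 * 2 ^ (i + 1) + 1) \<le> 9 * 2 ^ i" by linarith
      qed
      also have "\<dots> = 3 * sqrt (2 ^ i)" by (simp add: real_sqrt_mult)
      also have "sqrt (2 ^ i) = 2 powr (1/2 * i)"
        by (simp add: powr_half_sqrt[symmetric] powr_powr powr_realpow[symmetric] mult.commute)
      finally have "\<rho> ^ i * sqrt (real (2 * 2 ^ (i + 1) + 1)) \<le> \<rho> ^ i * (3 * 2 powr (1/2 * i))"
        using \<rho> by (intro mult_left_mono) auto
      also have "\<dots> = 3 * (2 powr i) powr (2 * s)"
        by (simp add: \<rho>_def powr_realpow[symmetric] powr_powr powr_add[symmetric] algebra_simps)
      also have "(2::real) powr i = 2 ^ i" by (simp add: powr_realpow)
      also have "(2 ^ i) powr (2 * s) \<le> (\<bar>real_of_int (snd n)\<bar> + 1) powr (2 * s)"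
      proof (intro powr_mono2)
        have "real_of_int (2 ^ i) \<le> real_of_int (\<bar>snd n\<bar> + 1)" using d1[of n] that by (simp only: of_int_le_iff) auto
        then show "(2::real) ^ i \<le> \<bar>real_of_int (snd n)\<bar> + 1" by simp
      qed (use s in auto)
      also have "\<dots> = ((\<bar>real_of_int (snd n)\<bar> + 1)\<^sup>2) powr s"
        by (subst powr_powr[of _ 2, simplified, symmetric]) simp
      also have "\<dots> \<le> (2 * (1 + (of_int (fst n))\<^sup>2 + (of_int (snd n))\<^sup>2)) powr s"
      proof (intro powr_mono2)
        have "0 \<le> (\<bar>real_of_int (snd n)\<bar> - 1)\<^sup>2" by simp
        then have "(\<bar>real_of_int (snd n)\<bar> + 1)\<^sup>2 \<le> 2 * (1 + (of_int (snd n))\<^sup>2)"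
          unfolding power2_sum power2_diff by simp
        then show "(\<bar>real_of_int (snd n)\<bar> + 1)\<^sup>2 \<le> 2 * (1 + (of_int (fst n))\<^sup>2 + (of_int (snd n))\<^sup>2)"
          by (rule order.trans) simp
      qed (use s in auto)
      also have "\<dots> = 2 powr s * sobolev_weight s n"
        unfolding sobolev_weight_def case_prod_beta by (rule powr_mult)
      finally show ?thesis by simp
    qed
    have "R * \<rho> ^ i * ?B i = R * (2 * L4_const \<alpha>) * sqrt (q - p) * ?S *
        (\<Sum>n\<in>?G i. (\<rho> ^ i * sqrt (real (2 * 2 ^ (i + 1) + 1))) * (cmod (\<psi> n))\<^sup>2)"
      unfolding sum_distrib_left[symmetric] by (simp only: mult_ac)
    also have "\<dots> \<le> R * (2 * L4_const \<alpha>) * sqrt (q - p) * ?S *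
        (\<Sum>n\<in>?G i. (3 * 2 powr s * sobolev_weight s n) * (cmod (\<psi> n))\<^sup>2)"
      using R L0 pq S0 by (intro mult_left_mono sum_mono mult_right_mono key) auto
    also have "\<dots> = C * sqrt (q - p) * ?S * (\<Sum>n\<in>?G i. sobolev_weight s n * (cmod (\<psi> n))\<^sup>2)"
      unfolding C_def mult.assoc[of "3 * 2 powr s"] sum_distrib_left[symmetric] by (simp only: mult_ac)
    finally show "R * \<rho> ^ i * ?B i \<le> C * sqrt (q - p) * ?S * (\<Sum>n\<in>?G i. sobolev_weight s n * (cmod (\<psi> n))\<^sup>2)" .
  qed
  also have "(\<Sum>i\<in>d ` G. C * sqrt (q - p) * ?S * (\<Sum>n\<in>?G i. sobolev_weight s n * (cmod (\<psi> n))\<^sup>2))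
     = C * sqrt (q - p) * ?S * (\<Sum>n\<in>G. sobolev_weight s n * (cmod (\<psi> n))\<^sup>2)"
    by (simp only: sum_distrib_left[symmetric] sum.image_gen[OF G, of _ d, symmetric])
  finally show "(\<integral>\<^sup>+w. ennreal ((cmod (?U w * ?V G w))\<^sup>2) \<partial>PT p q)
    \<le> ennreal (C * sqrt (q - p) * ?S * (\<Sum>n\<in>G. sobolev_weight s n * (cmod (\<psi> n))\<^sup>2))" .
qed

section \<open>Profiles varying in time\<close>

lemma measurable_PT_subinterval:
  assumes "f \<in> borel_measurable (PT p q)" "{p'..q'} \<subseteq> {p..q}"
  shows "f \<in> borel_measurable (PT p' q')"
proof -
  have "(\<lambda>t. t) \<in> TI p' q' \<rightarrow>\<^sub>M TI p q"
    unfolding TI_def using assms(2)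
    by (intro measurable_restrict_space2 measurable_restrict_space1) (auto simp: space_restrict_space)
  then have "(\<lambda>w. (fst w, snd w)) \<in> PT p' q' \<rightarrow>\<^sub>M PT p q"
    unfolding PT_def by (intro measurable_Pair measurable_compose[OF measurable_fst] measurable_snd)
  from measurable_compose[OF this assms(1)] show ?thesis by simp
qed

lemma nn_integral_TI:
  assumes "g \<in> borel_measurable (TI p q)"
  shows "(\<integral>\<^sup>+t. g t \<partial>TI p q) = (\<integral>\<^sup>+t. g t * indicator {p..q} t \<partial>lborel)"
  unfolding TI_def by (subst nn_integral_restrict_space) auto

text \<open>The closed pieces overlap in their end points. A covering argument gives the inequality
  directly, without a discussion of null sets.\<close>

lemma nn_integral_TI_split:
  fixes g :: "real \<Rightarrow> ennreal"
  assumes g: "g \<in> borel_measurable (TI p q)" and pq: "p < q" and m: "0 < m"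
  defines "\<delta> \<equiv> (q - p) / real m"
  shows "(\<integral>\<^sup>+t. g t \<partial>TI p q) \<le> (\<Sum>j<m. \<integral>\<^sup>+t. g t \<partial>TI (p + real j * \<delta>) (p + real j * \<delta> + \<delta>))"
proof -
  define I where "I j = {p + real j * \<delta>..p + real j * \<delta> + \<delta>}" for j
  define h where "h t = g t * indicator {p..q} t" for t
  have \<delta>: "\<delta> > 0" "real m * \<delta> = q - p" using pq m by (simp_all add: \<delta>_def)
  have h [measurable]: "h \<in> borel_measurable lborel"
    using g unfolding h_def TI_def by (subst (asm) borel_measurable_restrict_space_iff_ennreal) auto
  have cover: "h t \<le> (\<Sum>j<m. h t * indicator (I j) t)" for t
  proof (cases "t \<in> {p..q}")
    case True
    have "\<exists>j<m. t \<in> I j"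
    proof (cases "t = q")
      case True
      have "real (m - 1) * \<delta> + \<delta> = q - p" using m \<delta> by (simp add: of_nat_diff algebra_simps)
      then have "t \<in> I (m - 1)" using True \<delta> by (auto simp: I_def)
      then show ?thesis using m by (intro exI[of _ "m - 1"]) auto
    next
      case False
      define j where "j = nat \<lfloor>(t - p) / \<delta>\<rfloor>"
      have t0: "0 \<le> (t - p) / \<delta>" using True \<delta> by simp
      then have j: "real j = real_of_int \<lfloor>(t - p) / \<delta>\<rfloor>" by (simp add: j_def)
      have "real j \<le> (t - p) / \<delta>" "(t - p) / \<delta> < real j + 1" unfolding j by linarith+
      then have b: "real j * \<delta> \<le> t - p" "t - p < (real j + 1) * \<delta>" using \<delta> by (simp_all add: field_simps)
      then have "t \<in> I j" by (auto simp: I_def algebra_simps)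
      moreover have "real j * \<delta> < real m * \<delta>" using b True False \<delta> by auto
      then have "j < m" using \<delta>(1) by (simp only: mult_less_cancel_right_pos of_nat_less_iff)
      ultimately show ?thesis by blast
    qed
    then obtain j where j: "j < m" "t \<in> I j" by blast
    have "h t = h t * indicator (I j) t" using j by simp
    also have "\<dots> \<le> (\<Sum>j<m. h t * indicator (I j) t)" using j by (intro member_le_sum) auto
    finally show ?thesis .
  qed (simp add: h_def)
  have "(\<integral>\<^sup>+t. g t \<partial>TI p q) = (\<integral>\<^sup>+t. h t \<partial>lborel)" unfolding h_def by (rule nn_integral_TI[OF g])
  also have "\<dots> \<le> (\<integral>\<^sup>+t. (\<Sum>j<m. h t * indicator (I j) t) \<partial>lborel)" by (intro nn_integral_mono cover)
  also have "\<dots> = (\<Sum>j<m. \<integral>\<^sup>+t. h t * indicator (I j) t \<partial>lborel)"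
    by (rule nn_integral_sum) (auto simp: I_def)
  also have "\<dots> \<le> (\<Sum>j<m. \<integral>\<^sup>+t. g t \<partial>TI (p + real j * \<delta>) (p + real j * \<delta> + \<delta>))"
  proof (rule sum_mono)
    fix j
    have "(\<integral>\<^sup>+t. h t * indicator (I j) t \<partial>lborel) \<le> (\<integral>\<^sup>+t. g t * indicator (I j) t \<partial>lborel)"
      by (intro nn_integral_mono) (auto simp: h_def indicator_def)
    also have "\<dots> = (\<integral>\<^sup>+t. g t \<partial>TI (p + real j * \<delta>) (p + real j * \<delta> + \<delta>))"
      unfolding TI_def by (subst nn_integral_restrict_space) (auto simp: I_def)
    finally show "(\<integral>\<^sup>+t. h t * indicator (I j) t \<partial>lborel) \<le> (\<integral>\<^sup>+t. g t \<partial>TI (p + real j * \<delta>) (p + real j * \<delta> + \<delta>))" .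
  qed
  finally show ?thesis .
qed

lemma nn_integral_PT_split:
  fixes f :: "_ \<Rightarrow> ennreal"
  assumes f: "f \<in> borel_measurable (PT p q)" and pq: "p < q" and m: "0 < m"
  defines "\<delta> \<equiv> (q - p) / real m"
  shows "integral\<^sup>N (PT p q) f \<le> (\<Sum>j<m. integral\<^sup>N (PT (p + real j * \<delta>) (p + real j * \<delta> + \<delta>)) f)"
proof -
  have "(\<lambda>t. \<integral>\<^sup>+z. f (t, z) \<partial>torus2) \<in> borel_measurable (TI p q)"
    using f unfolding PT_def by (intro torus2.borel_measurable_nn_integral) simp
  from nn_integral_TI_split[OF this pq m, folded \<delta>_def]
  have "integral\<^sup>N (PT p q) f \<le> (\<Sum>j<m. \<integral>\<^sup>+t. \<integral>\<^sup>+z. f (t, z) \<partial>torus2 \<partial>TI (p + real j * \<delta>) (p + real j * \<delta> + \<delta>))"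
    by (simp add: nn_integral_PT[OF f])
  also have "\<dots> = (\<Sum>j<m. integral\<^sup>N (PT (p + real j * \<delta>) (p + real j * \<delta> + \<delta>)) f)"
  proof (rule sum.cong[OF refl])
    fix j assume "j \<in> {..<m}"
    have "\<delta> > 0" "real m * \<delta> = q - p" using pq m by (simp_all add: \<delta>_def)
    moreover have "(real j + 1) * \<delta> \<le> real m * \<delta>"
      using \<open>j \<in> {..<m}\<close> \<open>\<delta> > 0\<close> by (intro mult_right_mono) auto
    ultimately have "{p + real j * \<delta>..p + real j * \<delta> + \<delta>} \<subseteq> {p..q}" by (auto simp: algebra_simps add_increasing2)
    from nn_integral_PT[OF measurable_PT_subinterval[OF f this]]
    show "(\<integral>\<^sup>+t. \<integral>\<^sup>+z. f (t, z) \<partial>torus2 \<partial>TI (p + real j * \<delta>) (p + real j * \<delta> + \<delta>))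
      = integral\<^sup>N (PT (p + real j * \<delta>) (p + real j * \<delta> + \<delta>)) f" by simp
  qed
  finally show ?thesis .
qed

section \<open>Freezing Hoelder continuous profiles\<close>

lemma wave_diff: "wave \<alpha> F (\<lambda>n. \<phi> n - \<psi> n) t z = wave \<alpha> F \<phi> t z - wave \<alpha> F \<psi> t z"
  by (simp add: wave_def algebra_simps sum_subtractf)

text \<open>Increments are measured relative to the length of the interval, which makes the
  condition scale invariant: a path minus its value at the left end of a short subinterval satisfies
  it there with a smaller constant. The exponent 3/4 is twice 3/8 because squared norms are
  compared. \<open>A\<close> bounds the family \<open>a\<close> jointly, \<open>M\<close> bounds
  each member of \<open>b\<close>.\<close>

definition hpair :: "real \<Rightarrow> nat set \<Rightarrow> (int \<times> int) set \<Rightarrow> (int \<times> int) set \<Rightarrow> real \<Rightarrow> real \<Rightarrow>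
    (nat \<Rightarrow> real \<Rightarrow> int \<times> int \<Rightarrow> complex) \<Rightarrow> (nat \<Rightarrow> real \<Rightarrow> int \<times> int \<Rightarrow> complex) \<Rightarrow> real \<Rightarrow> real \<Rightarrow> bool" where
  "hpair s J F G p q a b A M \<longleftrightarrow> p < q \<and> q - p \<le> 1 \<and> 0 \<le> A \<and> 0 \<le> M \<and>
     (\<forall>i\<in>J. \<forall>n\<in>F. continuous_on {p..q} (\<lambda>t. a i t n)) \<and>
     (\<forall>i\<in>J. \<forall>n\<in>G. continuous_on {p..q} (\<lambda>t. b i t n)) \<and>
     (\<forall>t\<in>{p..q}. (\<Sum>i\<in>J. \<Sum>n\<in>F. (cmod (a i t n))\<^sup>2) \<le> A) \<and>
     (\<forall>t\<in>{p..q}. \<forall>t'\<in>{p..q}. (\<Sum>i\<in>J. \<Sum>n\<in>F. (cmod (a i t n - a i t' n))\<^sup>2) \<le> A * (\<bar>t - t'\<bar> / (q - p)) powr (3/4)) \<and>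
     (\<forall>t\<in>{p..q}. \<forall>i\<in>J. (\<Sum>n\<in>G. sobolev_weight s n * (cmod (b i t n))\<^sup>2) \<le> M) \<and>
     (\<forall>t\<in>{p..q}. \<forall>t'\<in>{p..q}. \<forall>i\<in>J. (\<Sum>n\<in>G. sobolev_weight s n * (cmod (b i t n - b i t' n))\<^sup>2)
        \<le> M * (\<bar>t - t'\<bar> / (q - p)) powr (3/4))"

definition bilinear_sum :: "real \<Rightarrow> nat set \<Rightarrow> (int \<times> int) set \<Rightarrow> (int \<times> int) set \<Rightarrow> real \<Rightarrow> real \<Rightarrow>
    (nat \<Rightarrow> real \<Rightarrow> int \<times> int \<Rightarrow> complex) \<Rightarrow> (nat \<Rightarrow> real \<Rightarrow> int \<times> int \<Rightarrow> complex) \<Rightarrow> ennreal" where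
  "bilinear_sum \<alpha> J F G p q a b = (\<Sum>i\<in>J. \<integral>\<^sup>+w. ennreal ((cmod (wave \<alpha> F (a i (fst w)) (fst w) (snd w)
      * wave \<alpha> G (b i (fst w)) (fst w) (snd w)))\<^sup>2) \<partial>PT p q)"

lemma wave_measurable_cont:
  assumes "\<And>n. n \<in> F \<Longrightarrow> continuous_on {p..q} (\<lambda>t. a t n)"
  shows "(\<lambda>w. wave \<alpha> F (a (fst w)) (fst w) (snd w)) \<in> borel_measurable (PT p q)"
  by (intro wave_measurable measurable_TI_continuous assms)

lemma cmod_wave_square_le: "(cmod (wave \<alpha> F \<phi> t z))\<^sup>2 \<le> real (card F) * (\<Sum>n\<in>F. (cmod (\<phi> n))\<^sup>2)"
proof -
  have "cmod (wave \<alpha> F \<phi> t z) \<le> (\<Sum>n\<in>F. cmod (\<phi> n))"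
    unfolding wave_def by (rule order.trans[OF norm_sum]) (simp add: norm_mult)
  then have "(cmod (wave \<alpha> F \<phi> t z))\<^sup>2 \<le> (\<Sum>n\<in>F. cmod (\<phi> n))\<^sup>2" by (intro power_mono) auto
  also have "\<dots> \<le> (\<Sum>n\<in>F. (cmod (\<phi> n))\<^sup>2) * real (card F)" by (rule sum_squared_le_sum_of_squares)
  finally show ?thesis by (simp add: mult.commute)
qed

lemma sobolev_weight_ge_1: "0 \<le> s \<Longrightarrow> 1 \<le> sobolev_weight s n"
  by (cases n) (auto simp: sobolev_weight_def intro!: ge_one_powr_ge_zero)

text \<open>A priori finiteness, with a constant that grows with the number of frequencies. It
  serves only as the start of an iteration in whose limit it disappears.\<close>

lemma bilinear_sum_crude:
  assumes J: "finite J" and s: "0 \<le> s"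
  obtains E where "0 \<le> E" "\<And>p q a b A M. hpair s J F G p q a b A M \<Longrightarrow>
    bilinear_sum \<alpha> J F G p q a b \<le> ennreal (E * sqrt (q - p) * A * M)"
proof
  define \<kappa> where "\<kappa> = measure torus2 (space torus2)"
  define E where "E = real (card J) * (real (card F) * real (card G)) * \<kappa>"
  show "0 \<le> E" by (simp add: E_def \<kappa>_def)
  fix p q a b A M assume H: "hpair s J F G p q a b A M"
  then have pq: "p < q" "q - p \<le> 1" and AM: "0 \<le> A" "0 \<le> M" by (auto simp: hpair_def)
  let ?c = "real (card F) * A * (real (card G) * M)"
  have pw: "(cmod (wave \<alpha> F (a i t) t z * wave \<alpha> G (b i t) t z))\<^sup>2 \<le> ?c" if "i \<in> J" "t \<in> {p..q}" for i t z
  proof -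
    have "(\<Sum>n\<in>F. (cmod (a i t n))\<^sup>2) \<le> (\<Sum>i\<in>J. \<Sum>n\<in>F. (cmod (a i t n))\<^sup>2)"
      using J that by (intro member_le_sum) (auto intro!: sum_nonneg)
    also have "\<dots> \<le> A" using H that by (auto simp: hpair_def)
    finally have 1: "(cmod (wave \<alpha> F (a i t) t z))\<^sup>2 \<le> real (card F) * A"
      using cmod_wave_square_le[of \<alpha> F "a i t" t z] by (meson mult_left_mono of_nat_0_le_iff order_trans)
    have "(\<Sum>n\<in>G. (cmod (b i t n))\<^sup>2) \<le> (\<Sum>n\<in>G. sobolev_weight s n * (cmod (b i t n))\<^sup>2)"
      using sobolev_weight_ge_1[OF s] by (intro sum_mono) (simp add: mult_le_cancel_right1)
    also have "\<dots> \<le> M" using H that by (auto simp: hpair_def)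
    finally have 2: "(cmod (wave \<alpha> G (b i t) t z))\<^sup>2 \<le> real (card G) * M"
      using cmod_wave_square_le[of \<alpha> G "b i t" t z] by (meson mult_left_mono of_nat_0_le_iff order_trans)
    show ?thesis unfolding norm_mult power_mult_distrib using 1 2 AM by (intro mult_mono) auto
  qed
  have e: "emeasure (PT p q) (space (PT p q)) = ennreal ((q - p) * \<kappa>)"
  proof -
    have "emeasure (PT p q) (space (PT p q)) = emeasure (TI p q) (space (TI p q)) * emeasure torus2 (space torus2)"
      unfolding PT_def space_pair_measure by (rule torus2.emeasure_pair_measure_Times) auto
    also have "emeasure (TI p q) (space (TI p q)) = ennreal (q - p)"
      using pq by (simp add: TI_def emeasure_restrict_space space_restrict_space)
    also have "emeasure torus2 (space torus2) = ennreal \<kappa>" unfolding \<kappa>_def by (rule torus2.emeasure_eq_measure)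
    finally show ?thesis using pq by (simp add: ennreal_mult \<kappa>_def)
  qed
  have l: "q - p \<le> sqrt (q - p)" using pq by (intro real_le_rsqrt) (simp add: power2_eq_square mult_left_le)
  have "bilinear_sum \<alpha> J F G p q a b \<le> (\<Sum>i\<in>J. \<integral>\<^sup>+w. ennreal ?c \<partial>PT p q)"
    unfolding bilinear_sum_def
    by (intro sum_mono nn_integral_mono ennreal_leI pw) (auto simp: PT_def space_pair_measure space_TI)
  also have "\<dots> = (\<Sum>i\<in>J. ennreal (?c * ((q - p) * \<kappa>)))"
    using AM pq by (simp add: e ennreal_mult'[symmetric])
  also have "\<dots> = ennreal (\<Sum>i\<in>J. ?c * ((q - p) * \<kappa>))"
    using AM pq by (intro sum_ennreal) (auto simp: \<kappa>_def)
  also have "(\<Sum>i\<in>J. ?c * ((q - p) * \<kappa>)) = E * A * M * (q - p)" by (simp add: E_def)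
  also have "\<dots> \<le> E * A * M * sqrt (q - p)"
    using l AM \<open>0 \<le> E\<close> by (intro mult_left_mono) auto
  finally show "bilinear_sum \<alpha> J F G p q a b \<le> ennreal (E * sqrt (q - p) * A * M)"
    by (simp add: mult_ac ennreal_leI)
qed

text \<open>20736 is 12^4, the number of subintervals, and 1728 is 12^3.\<close>

lemma powr_3_4_20736: "(1 / 20736 :: real) powr (3/4) = 1 / 1728"
proof -
  have "(1 / 20736 :: real) = (1 / 12) powr (real 4)"
    by (subst powr_realpow) (simp_all add: power_divide)
  then have "(1 / 20736 :: real) powr (3/4) = ((1 / 12) powr (real 4)) powr (3/4)"
    by (rule arg_cong)
  also have "\<dots> = (1 / 12) powr (real 3)"
    by (simp add: powr_powr del: powr_numeral)
  also have "\<dots> = 1 / 1728" by (subst powr_realpow) (simp_all add: power_divide)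
  finally show ?thesis .
qed

text \<open>
  Passage from free waves to waves with Hoelder continuous profiles.  Freezing the profiles at the left
  end of \<open>12\<^sup>4\<close> equal subintervals gains the factor \<open>12 powr (- 3)\<close> on the squared increments, more
  than the \<open>12\<^sup>2\<close> lost by summing the square roots of the lengths.
\<close>

lemma bilinear_sum_improve:
  assumes J: "finite J" and F: "finite F" and G: "finite G" and s: "0 \<le> s" and C0: "0 \<le> C0" and E: "0 \<le> E"
    and free: "\<And>\<phi> \<psi> p q. \<lbrakk>p < q; q - p \<le> 1\<rbrakk> \<Longrightarrow>
     (\<integral>\<^sup>+w. ennreal ((cmod (wave \<alpha> F \<phi> (fst w) (snd w) * wave \<alpha> G \<psi> (fst w) (snd w)))\<^sup>2) \<partial>PT p q)
    \<le> ennreal (C0 * sqrt (q - p) * (\<Sum>n\<in>F. (cmod (\<phi> n))\<^sup>2) * (\<Sum>n\<in>G. sobolev_weight s n * (cmod (\<psi> n))\<^sup>2))"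
    and bound: "\<And>p q a b A M. hpair s J F G p q a b A M \<Longrightarrow>
      bilinear_sum \<alpha> J F G p q a b \<le> ennreal (E * sqrt (q - p) * A * M)"
    and H: "hpair s J F G p q a b A M"
  shows "bilinear_sum \<alpha> J F G p q a b \<le> ennreal ((432 * C0 + E / 2) * sqrt (q - p) * A * M)"
proof -
  define m :: nat where "m = 20736"
  define \<delta> where "\<delta> = (q - p) / real m"
  have pq: "p < q" "q - p \<le> 1" and AM: "0 \<le> A" "0 \<le> M" using H by (auto simp: hpair_def)
  have ca: "continuous_on {p..q} (\<lambda>t. a i t n)" if "i \<in> J" "n \<in> F" for i n using H that by (auto simp: hpair_def)
  have cb: "continuous_on {p..q} (\<lambda>t. b i t n)" if "i \<in> J" "n \<in> G" for i n using H that by (auto simp: hpair_def)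
  have a1: "(\<Sum>i\<in>J. \<Sum>n\<in>F. (cmod (a i t n))\<^sup>2) \<le> A" if "t \<in> {p..q}" for t using H that by (auto simp: hpair_def)
  have a2: "(\<Sum>i\<in>J. \<Sum>n\<in>F. (cmod (a i t n - a i t' n))\<^sup>2) \<le> A * (\<bar>t - t'\<bar> / (q - p)) powr (3/4)"
    if "t \<in> {p..q}" "t' \<in> {p..q}" for t t' using H that unfolding hpair_def by blast
  have b1: "(\<Sum>n\<in>G. sobolev_weight s n * (cmod (b i t n))\<^sup>2) \<le> M" if "i \<in> J" "t \<in> {p..q}" for i t
    using H that unfolding hpair_def by blast
  have b2: "(\<Sum>n\<in>G. sobolev_weight s n * (cmod (b i t n - b i t' n))\<^sup>2) \<le> M * (\<bar>t - t'\<bar> / (q - p)) powr (3/4)"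
    if "i \<in> J" "t \<in> {p..q}" "t' \<in> {p..q}" for i t t' using H that unfolding hpair_def by blast
  have \<delta>: "0 < \<delta>" "\<delta> \<le> 1" "q - p = 20736 * \<delta>" using pq by (simp_all add: \<delta>_def m_def)
  have sqrt\<delta>: "sqrt (q - p) = 144 * sqrt \<delta>"
  proof -
    have "sqrt (20736 :: real) = sqrt (144\<^sup>2)" by simp
    also have "\<dots> = 144" by (simp only: real_sqrt_abs)
    finally show ?thesis unfolding \<delta>(3) real_sqrt_mult by simp
  qed
  have resc: "(x / (q - p)) powr (3/4) = (x / \<delta>) powr (3/4) / 1728" if "0 \<le> x" for x
  proof -
    have "x / (q - p) = (x / \<delta>) * (1 / 20736)" using \<delta> by simp
    also have "\<dots> powr (3/4) = (x / \<delta>) powr (3/4) * (1 / 20736) powr (3/4)"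
      by (rule powr_mult)
    finally show ?thesis by (simp only: powr_3_4_20736)
  qed
  have resc1: "(x / \<delta>) powr (3/4) \<le> 1" if "0 \<le> x" "x \<le> \<delta>" for x
    using that \<delta> by (intro powr_le1) auto
  define l where "l j = p + real j * \<delta>" for j
  let ?U = "\<lambda>i w. wave \<alpha> F (a i (fst w)) (fst w) (snd w)" and ?V = "\<lambda>i w. wave \<alpha> G (b i (fst w)) (fst w) (snd w)"
  let ?f = "\<lambda>i w. ennreal ((cmod (?U i w * ?V i w))\<^sup>2)"
  have piece: "bilinear_sum \<alpha> J F G (l j) (l j + \<delta>) a b \<le> ennreal (3 * sqrt \<delta> * A * M * (C0 + 2 * (E / 1728)))"
    if j: "j < m" for j
  proof -
    let ?p = "l j" and ?q = "l j + \<delta>"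
    have "(real j + 1) * \<delta> \<le> real m * \<delta>" using j \<delta> by (intro mult_right_mono) auto
    then have sub: "{?p..?q} \<subseteq> {p..q}" using \<delta> by (auto simp: l_def m_def algebra_simps add_increasing2)
    have pin: "?p \<in> {?p..?q}" "?p \<in> {p..q}" using sub \<delta> by auto
    have tin: "t \<in> {p..q}" if "t \<in> {?p..?q}" for t using that sub by auto
    define a0 where "a0 i t n = a i ?p n" for i and t :: real and n
    define b0 where "b0 i t n = b i ?p n" for i and t :: real and n
    define a' where "a' i t n = a i t n - a0 i t n" for i t n
    define b' where "b' i t n = b i t n - b0 i t n" for i t n
    have Ha: "hpair s J F G ?p ?q a' b (A / 1728) M"
      unfolding hpair_def
    proof (intro conjI ballI)
      fix i n assume "i \<in> J" "n \<in> F"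
      then show "continuous_on {?p..?q} (\<lambda>t. a' i t n)" unfolding a'_def a0_def
        by (intro continuous_intros continuous_on_subset[OF ca sub])
    next
      fix i n assume "i \<in> J" "n \<in> G"
      then show "continuous_on {?p..?q} (\<lambda>t. b i t n)" by (intro continuous_on_subset[OF cb sub])
    next
      fix t assume t: "t \<in> {?p..?q}"
      have "(\<Sum>i\<in>J. \<Sum>n\<in>F. (cmod (a' i t n))\<^sup>2) \<le> A * (\<bar>t - ?p\<bar> / (q - p)) powr (3/4)"
        unfolding a'_def a0_def by (intro a2 tin t pin)
      also have "\<dots> \<le> A * (1 / 1728)"
        unfolding resc[OF abs_ge_zero] using t AM by (intro mult_left_mono divide_right_mono resc1) auto
      finally show "(\<Sum>i\<in>J. \<Sum>n\<in>F. (cmod (a' i t n))\<^sup>2) \<le> A / 1728" by simp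
      fix t' assume t': "t' \<in> {?p..?q}"
      have "(\<Sum>i\<in>J. \<Sum>n\<in>F. (cmod (a' i t n - a' i t' n))\<^sup>2) \<le> A * (\<bar>t - t'\<bar> / (q - p)) powr (3/4)"
        unfolding a'_def a0_def diff_diff_eq2 by (simp, intro a2 tin t t')
      then show "(\<Sum>i\<in>J. \<Sum>n\<in>F. (cmod (a' i t n - a' i t' n))\<^sup>2) \<le> A / 1728 * (\<bar>t - t'\<bar> / (?q - ?p)) powr (3/4)"
        unfolding resc[OF abs_ge_zero] by simp
    next
      fix t i assume t: "t \<in> {?p..?q}" "i \<in> J"
      show "(\<Sum>n\<in>G. sobolev_weight s n * (cmod (b i t n))\<^sup>2) \<le> M" by (intro b1 tin t)
      fix t' assume t': "t' \<in> {?p..?q}"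
    next
      fix t t' i assume t: "t \<in> {?p..?q}" "t' \<in> {?p..?q}" "i \<in> J"
      have "(\<Sum>n\<in>G. sobolev_weight s n * (cmod (b i t n - b i t' n))\<^sup>2) \<le> M * (\<bar>t - t'\<bar> / (q - p)) powr (3/4)"
        by (intro b2 tin t)
      also have "\<dots> \<le> M * (\<bar>t - t'\<bar> / \<delta>) powr (3/4)"
        unfolding resc[OF abs_ge_zero] using AM by (intro mult_left_mono) auto
      finally show "(\<Sum>n\<in>G. sobolev_weight s n * (cmod (b i t n - b i t' n))\<^sup>2) \<le> M * (\<bar>t - t'\<bar> / (?q - ?p)) powr (3/4)"
        by simp
    qed (use \<delta> AM in auto)
    have Hb: "hpair s J F G ?p ?q a0 b' A (M / 1728)"
      unfolding hpair_def
    proof (intro conjI ballI)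
      fix i n assume "i \<in> J" "n \<in> F"
      then show "continuous_on {?p..?q} (\<lambda>t. a0 i t n)" unfolding a0_def by (intro continuous_intros)
    next
      fix i n assume "i \<in> J" "n \<in> G"
      then show "continuous_on {?p..?q} (\<lambda>t. b' i t n)" unfolding b'_def b0_def
        by (intro continuous_intros continuous_on_subset[OF cb sub])
    next
      fix t assume t: "t \<in> {?p..?q}"
      show "(\<Sum>i\<in>J. \<Sum>n\<in>F. (cmod (a0 i t n))\<^sup>2) \<le> A" unfolding a0_def by (intro a1 pin)
      fix t' assume t': "t' \<in> {?p..?q}"
      show "(\<Sum>i\<in>J. \<Sum>n\<in>F. (cmod (a0 i t n - a0 i t' n))\<^sup>2) \<le> A * (\<bar>t - t'\<bar> / (?q - ?p)) powr (3/4)"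
        unfolding a0_def using AM by simp
    next
      fix t i assume t: "t \<in> {?p..?q}" "i \<in> J"
      have "(\<Sum>n\<in>G. sobolev_weight s n * (cmod (b' i t n))\<^sup>2) \<le> M * (\<bar>t - ?p\<bar> / (q - p)) powr (3/4)"
        unfolding b'_def b0_def by (intro b2 tin t pin)
      also have "\<dots> \<le> M * (1 / 1728)"
        unfolding resc[OF abs_ge_zero] using t AM by (intro mult_left_mono divide_right_mono resc1) auto
      finally show "(\<Sum>n\<in>G. sobolev_weight s n * (cmod (b' i t n))\<^sup>2) \<le> M / 1728" by simp
    next
      fix t t' i assume t: "t \<in> {?p..?q}" "t' \<in> {?p..?q}" "i \<in> J"
      have "(\<Sum>n\<in>G. sobolev_weight s n * (cmod (b' i t n - b' i t' n))\<^sup>2) \<le> M * (\<bar>t - t'\<bar> / (q - p)) powr (3/4)"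
        unfolding b'_def b0_def diff_diff_eq2 by (simp, intro b2 tin t)
      then show "(\<Sum>n\<in>G. sobolev_weight s n * (cmod (b' i t n - b' i t' n))\<^sup>2) \<le> M / 1728 * (\<bar>t - t'\<bar> / (?q - ?p)) powr (3/4)"
        unfolding resc[OF abs_ge_zero] by simp
    qed (use \<delta> AM in auto)
    have 1: "bilinear_sum \<alpha> J F G ?p ?q a0 b0 \<le> ennreal (C0 * sqrt \<delta> * A * M)"
    proof -
      have "bilinear_sum \<alpha> J F G ?p ?q a0 b0 \<le>
        (\<Sum>i\<in>J. ennreal (C0 * sqrt (?q - ?p) * (\<Sum>n\<in>F. (cmod (a i ?p n))\<^sup>2) * (\<Sum>n\<in>G. sobolev_weight s n * (cmod (b i ?p n))\<^sup>2)))"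
        unfolding bilinear_sum_def a0_def b0_def using \<delta> by (intro sum_mono free) auto
      also have "\<dots> \<le> (\<Sum>i\<in>J. ennreal (C0 * sqrt \<delta> * (\<Sum>n\<in>F. (cmod (a i ?p n))\<^sup>2) * M))"
        using \<delta> C0 b1[OF _ pin(2)]
        by (intro sum_mono ennreal_leI) (auto intro!: mult_left_mono mult_nonneg_nonneg sum_nonneg)
      also have "\<dots> = ennreal (\<Sum>i\<in>J. C0 * sqrt \<delta> * (\<Sum>n\<in>F. (cmod (a i ?p n))\<^sup>2) * M)"
        using \<delta> C0 AM by (intro sum_ennreal) (auto intro!: mult_nonneg_nonneg sum_nonneg)
      also have "(\<Sum>i\<in>J. C0 * sqrt \<delta> * (\<Sum>n\<in>F. (cmod (a i ?p n))\<^sup>2) * M)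
          = C0 * sqrt \<delta> * (\<Sum>i\<in>J. \<Sum>n\<in>F. (cmod (a i ?p n))\<^sup>2) * M"
        by (simp only: sum_distrib_left sum_distrib_right)
      also have "\<dots> \<le> C0 * sqrt \<delta> * A * M"
        using \<delta> C0 AM a1[OF pin(2)] by (intro mult_right_mono mult_left_mono) auto
      finally show ?thesis by (simp add: ennreal_leI)
    qed
    have 2: "bilinear_sum \<alpha> J F G ?p ?q a' b \<le> ennreal (E * sqrt \<delta> * (A / 1728) * M)"
      using bound[OF Ha] by simp
    have 3: "bilinear_sum \<alpha> J F G ?p ?q a0 b' \<le> ennreal (E * sqrt \<delta> * A * (M / 1728))"
      using bound[OF Hb] by simp
    \<comment> \<open>One factor at a time is replaced by its error, so each error term gains the
      factor 1/1728 once while the other factor keeps its bound. The 3 is the cost of squaring a sum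
      of three terms.\<close>
    have split: "bilinear_sum \<alpha> J F G ?p ?q a b
      \<le> 3 * (bilinear_sum \<alpha> J F G ?p ?q a0 b0 + bilinear_sum \<alpha> J F G ?p ?q a' b + bilinear_sum \<alpha> J F G ?p ?q a0 b')"
    proof -
      let ?g = "\<lambda>a b i w. ennreal ((cmod (wave \<alpha> F (a i (fst w)) (fst w) (snd w) * wave \<alpha> G (b i (fst w)) (fst w) (snd w)))\<^sup>2)"
      have tri: "ennreal ((cmod (u * v))\<^sup>2) \<le> 3 * (ennreal ((cmod (u0 * v0))\<^sup>2) + ennreal ((cmod ((u - u0) * v))\<^sup>2) + ennreal ((cmod (u0 * (v - v0)))\<^sup>2))"
        for u v u0 v0 :: complex
      proof -
        have sq3: "(x + y + z)\<^sup>2 \<le> 3 * (x\<^sup>2 + y\<^sup>2 + z\<^sup>2)" for x y z :: real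
        proof -
          have "0 \<le> (x - y)\<^sup>2 + (y - z)\<^sup>2 + (x - z)\<^sup>2" by simp
          then show ?thesis by (simp add: power2_eq_square algebra_simps)
        qed
        have "u * v = u0 * v0 + (u - u0) * v + u0 * (v - v0)" by (simp add: algebra_simps)
        then have "cmod (u * v) \<le> cmod (u0 * v0) + cmod ((u - u0) * v) + cmod (u0 * (v - v0))"
          by (metis norm_triangle_le norm_triangle_ineq add_right_mono)
        then have "(cmod (u * v))\<^sup>2 \<le> (cmod (u0 * v0) + cmod ((u - u0) * v) + cmod (u0 * (v - v0)))\<^sup>2"
          by (intro power_mono) auto
        also note sq3
        finally have "ennreal ((cmod (u * v))\<^sup>2) \<le> ennreal (3 * ((cmod (u0 * v0))\<^sup>2 + (cmod ((u - u0) * v))\<^sup>2 + (cmod (u0 * (v - v0)))\<^sup>2))"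
          by (rule ennreal_leI)
        moreover have "ennreal (3 * (x + y + z)) = 3 * (ennreal x + ennreal y + ennreal z)"
          if "0 \<le> x" "0 \<le> y" "0 \<le> z" for x y z
          using that by (simp add: ennreal_mult)
        ultimately show ?thesis by simp
      qed
      have "?g a b i w \<le> 3 * (?g a0 b0 i w + ?g a' b i w + ?g a0 b' i w)" for i w
        unfolding a'_def b'_def wave_diff by (rule tri)
      then have "bilinear_sum \<alpha> J F G ?p ?q a b \<le> (\<Sum>i\<in>J. \<integral>\<^sup>+w. 3 * (?g a0 b0 i w + ?g a' b i w + ?g a0 b' i w) \<partial>PT ?p ?q)"
        unfolding bilinear_sum_def by (intro sum_mono nn_integral_mono)
      also have "\<dots> = (\<Sum>i\<in>J. 3 * ((\<integral>\<^sup>+w. ?g a0 b0 i w \<partial>PT ?p ?q) + (\<integral>\<^sup>+w. ?g a' b i w \<partial>PT ?p ?q) + (\<integral>\<^sup>+w. ?g a0 b' i w \<partial>PT ?p ?q)))"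
      proof (rule sum.cong[OF refl])
        fix i assume i: "i \<in> J"
        have m1 [measurable]: "(\<lambda>w. wave \<alpha> F (a0 i (fst w)) (fst w) (snd w)) \<in> borel_measurable (PT ?p ?q)"
          "(\<lambda>w. wave \<alpha> F (a' i (fst w)) (fst w) (snd w)) \<in> borel_measurable (PT ?p ?q)"
          "(\<lambda>w. wave \<alpha> G (b0 i (fst w)) (fst w) (snd w)) \<in> borel_measurable (PT ?p ?q)"
          "(\<lambda>w. wave \<alpha> G (b' i (fst w)) (fst w) (snd w)) \<in> borel_measurable (PT ?p ?q)"
          "(\<lambda>w. wave \<alpha> G (b i (fst w)) (fst w) (snd w)) \<in> borel_measurable (PT ?p ?q)"
          using Ha Hb i unfolding hpair_def
          by (auto intro!: wave_measurable_cont) (auto simp: a0_def b0_def)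
        show "(\<integral>\<^sup>+w. 3 * (?g a0 b0 i w + ?g a' b i w + ?g a0 b' i w) \<partial>PT ?p ?q)
          = 3 * ((\<integral>\<^sup>+w. ?g a0 b0 i w \<partial>PT ?p ?q) + (\<integral>\<^sup>+w. ?g a' b i w \<partial>PT ?p ?q) + (\<integral>\<^sup>+w. ?g a0 b' i w \<partial>PT ?p ?q))"
          by (subst nn_integral_cmult, measurable, subst nn_integral_add, measurable, subst nn_integral_add, measurable)
      qed
      finally show ?thesis by (simp add: bilinear_sum_def sum_distrib_left sum.distrib)
    qed
    also have "\<dots> \<le> 3 * (ennreal (C0 * sqrt \<delta> * A * M) + ennreal (E * sqrt \<delta> * (A / 1728) * M) + ennreal (E * sqrt \<delta> * A * (M / 1728)))"
      by (intro mult_left_mono add_mono 1 2 3) auto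
    also have "\<dots> = ennreal (3 * (C0 * sqrt \<delta> * A * M + E * sqrt \<delta> * (A / 1728) * M + E * sqrt \<delta> * A * (M / 1728)))"
    proof -
      have "ennreal (3 * (x + y + z)) = 3 * (ennreal x + ennreal y + ennreal z)"
        if "0 \<le> x" "0 \<le> y" "0 \<le> z" for x y z
        using that by (simp add: ennreal_mult)
      from this[symmetric] show ?thesis by this (use C0 E AM \<delta> in auto)
    qed
    also have "3 * (C0 * sqrt \<delta> * A * M + E * sqrt \<delta> * (A / 1728) * M + E * sqrt \<delta> * A * (M / 1728)) = 3 * sqrt \<delta> * A * M * (C0 + 2 * (E / 1728))"
      by (simp add: algebra_simps)
    finally show ?thesis .
  qed
  have "bilinear_sum \<alpha> J F G p q a b = (\<Sum>i\<in>J. integral\<^sup>N (PT p q) (?f i))"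
    by (simp add: bilinear_sum_def)
  also have "\<dots> \<le> (\<Sum>i\<in>J. \<Sum>j<m. integral\<^sup>N (PT (p + real j * \<delta>) (p + real j * \<delta> + \<delta>)) (?f i))"
  proof (rule sum_mono)
    fix i assume i: "i \<in> J"
    have [measurable]: "?U i \<in> borel_measurable (PT p q)" "?V i \<in> borel_measurable (PT p q)"
      using i by (auto intro!: wave_measurable_cont ca cb)
    show "integral\<^sup>N (PT p q) (?f i) \<le> (\<Sum>j<m. integral\<^sup>N (PT (p + real j * \<delta>) (p + real j * \<delta> + \<delta>)) (?f i))"
      unfolding \<delta>_def by (rule nn_integral_PT_split) (use pq in \<open>auto simp: m_def\<close>)
  qed
  also have "\<dots> = (\<Sum>j<m. bilinear_sum \<alpha> J F G (l j) (l j + \<delta>) a b)"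
    unfolding bilinear_sum_def l_def by (rule sum.swap)
  also have "\<dots> \<le> (\<Sum>j<m. ennreal (3 * sqrt \<delta> * A * M * (C0 + 2 * (E / 1728))))"
    by (intro sum_mono piece) auto
  also have "\<dots> = ennreal (real m * (3 * sqrt \<delta> * A * M * (C0 + 2 * (E / 1728))))"
    by (simp add: ennreal_mult'' ennreal_of_nat_eq_real_of_nat[symmetric] AM C0 E \<delta>(1) less_imp_le)
  \<comment> \<open>As sqrt \<delta> is sqrt (q - p) / 144, the 12^4 pieces contribute 3 * 144 = 432
    in total, and 432 * 2 / 1728 = 1/2 is the contraction factor for \<open>E\<close>.\<close>
  also have "real m * (3 * sqrt \<delta> * A * M * (C0 + 2 * (E / 1728))) = (432 * C0 + E / 2) * sqrt (q - p) * A * M"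
    unfolding sqrt\<delta> m_def by (simp add: algebra_simps)
  finally show ?thesis .
qed

text \<open>The improvement step maps a constant \<open>E\<close> to 432 C0 + E/2, a contraction
  with fixed point 864 C0. Iterating from the crude constant and passing to the limit removes all
  dependence on the frequency sets.\<close>

lemma bilinear_holder:
  assumes \<alpha>: "\<alpha> < 0" and s: "s > 1 / 4"
  obtains C where "C > 0" and "\<And>J F G p q a b A M. \<lbrakk>finite J; finite F; finite G; hpair s J F G p q a b A M\<rbrakk> \<Longrightarrow>
    bilinear_sum \<alpha> J F G p q a b \<le> ennreal (C * sqrt (q - p) * A * M)"
proof -
  obtain C0 where C0: "C0 > 0" and free: "\<And>F G \<phi> \<psi> p q. \<lbrakk>finite F; finite G; p < q; q - p \<le> 1\<rbrakk> \<Longrightarrow>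
     (\<integral>\<^sup>+w. ennreal ((cmod (wave \<alpha> F \<phi> (fst w) (snd w) * wave \<alpha> G \<psi> (fst w) (snd w)))\<^sup>2) \<partial>PT p q)
    \<le> ennreal (C0 * sqrt (q - p) * (\<Sum>n\<in>F. (cmod (\<phi> n))\<^sup>2) * (\<Sum>n\<in>G. sobolev_weight s n * (cmod (\<psi> n))\<^sup>2))"
    using bilinear_free[OF \<alpha> s] by blast
  show thesis
  proof (rule that[of "864 * C0"])
    fix J F G p q a b A M
    assume fin: "finite J" "finite F" "finite G" and H: "hpair s J F G p q a b A M"
    have AM: "0 \<le> A" "0 \<le> M" "p < q" using H by (auto simp: hpair_def)
    obtain E0 where E0: "0 \<le> E0" "\<And>p q a b A M. hpair s J F G p q a b A M \<Longrightarrow>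
        bilinear_sum \<alpha> J F G p q a b \<le> ennreal (E0 * sqrt (q - p) * A * M)"
      using bilinear_sum_crude[OF fin(1), of s] s by (metis less_imp_le order_less_trans zero_less_divide_1_iff zero_less_numeral)
    have *: "bilinear_sum \<alpha> J F G p q a b \<le> ennreal ((864 * C0 + E0 / 2 ^ r) * sqrt (q - p) * A * M)"
      if "hpair s J F G p q a b A M" for p q a b A M r
      using that
    proof (induction r arbitrary: p q a b A M)
      case 0
      then have AM: "0 \<le> A" "0 \<le> M" "p < q" by (auto simp: hpair_def)
      have "E0 * sqrt (q - p) * A * M \<le> (864 * C0 + E0 / 2 ^ 0) * sqrt (q - p) * A * M"
        using AM C0 by (intro mult_right_mono) auto
      then show ?case using E0(2)[OF 0] ennreal_leI order_trans by blast
    next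
      case (Suc r)
      have "bilinear_sum \<alpha> J F G p q a b \<le> ennreal ((432 * C0 + (864 * C0 + E0 / 2 ^ r) / 2) * sqrt (q - p) * A * M)"
        by (rule bilinear_sum_improve[OF fin _ _ _ free[OF fin(2,3)] Suc.IH Suc.prems]) (use s C0 E0 in auto)
      then show ?case by (simp add: field_simps)
    qed
    have "(\<lambda>r. ennreal ((864 * C0 + E0 * (1 / 2) ^ r) * sqrt (q - p) * A * M))
       \<longlonglongrightarrow> ennreal ((864 * C0 + E0 * 0) * sqrt (q - p) * A * M)"
      by (intro tendsto_intros tendsto_ennrealI LIMSEQ_power_zero) auto
    then show "bilinear_sum \<alpha> J F G p q a b \<le> ennreal (864 * C0 * sqrt (q - p) * A * M)"
      using *[OF H] by (intro LIMSEQ_le_const) (auto simp: power_one_over)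
  qed (use C0 in simp)
qed

section \<open>Fourier series in weighted sequence spaces\<close>

lemma borel_measurable_cnj [measurable (raw)]:
  "f \<in> borel_measurable M \<Longrightarrow> (\<lambda>x. cnj (f x)) \<in> borel_measurable M"
  by (rule measurable_compose[of f M borel cnj]) (auto intro!: borel_measurable_continuous_onI continuous_intros)

lemma four_powr: "(4::real) powr x = (2 powr x)\<^sup>2"
  using powr_mult[of 2 2 x] by (simp add: power2_eq_square)

lemma fatou_bound:
  fixes g :: "nat \<Rightarrow> 'a \<Rightarrow> ennreal"
  assumes [measurable]: "\<And>j. g j \<in> borel_measurable M"
    and lim: "AE x in M. (\<lambda>j. g j x) \<longlonglongrightarrow> h x"
    and bd: "\<And>j. k \<le> j \<Longrightarrow> integral\<^sup>N M (g j) \<le> B"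
  shows "integral\<^sup>N M h \<le> B"
proof -
  have "integral\<^sup>N M h = (\<integral>\<^sup>+x. liminf (\<lambda>j. g j x) \<partial>M)"
    by (rule nn_integral_cong_AE) (use lim in \<open>eventually_elim, simp add: lim_imp_Liminf\<close>)
  also have "\<dots> \<le> liminf (\<lambda>j. integral\<^sup>N M (g j))" by (rule nn_integral_liminf) simp
  also have "\<dots> \<le> liminf (\<lambda>j::nat. B)"
    by (rule Liminf_mono) (use bd in \<open>auto simp: eventually_sequentially\<close>)
  also have "\<dots> = B" by (simp add: Liminf_const)
  finally show ?thesis .
qed

text \<open>The norm in the weighted sequence space is at most \<open>M\<close>. As a relation over
  finite sets of frequencies it includes summability and passes to coefficientwise limits at
  once.\<close>

definition hb :: "real \<Rightarrow> (int \<times> int \<Rightarrow> complex) \<Rightarrow> real \<Rightarrow> bool" where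
  "hb s c M \<longleftrightarrow> 0 \<le> M \<and> (\<forall>F. finite F \<longrightarrow> (\<Sum>n\<in>F. sobolev_weight s n * (cmod (c n))\<^sup>2) \<le> M\<^sup>2)"

lemma hbI: "0 \<le> M \<Longrightarrow> (\<And>F. finite F \<Longrightarrow> (\<Sum>n\<in>F. sobolev_weight s n * (cmod (c n))\<^sup>2) \<le> M\<^sup>2) \<Longrightarrow> hb s c M"
  by (simp add: hb_def)

lemma hbD: "hb s c M \<Longrightarrow> finite F \<Longrightarrow> (\<Sum>n\<in>F. sobolev_weight s n * (cmod (c n))\<^sup>2) \<le> M\<^sup>2"
  by (simp add: hb_def)

lemma hb_nonneg: "hb s c M \<Longrightarrow> 0 \<le> M"
  by (simp add: hb_def)

lemma sobolev_weight_0 [simp]: "sobolev_weight 0 n = 1"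
  using sobolev_weight_pos[of 0 n] by (cases n) (auto simp: sobolev_weight_def)

lemma hb_mono: "hb s c M \<Longrightarrow> M \<le> M' \<Longrightarrow> hb s c M'"
  unfolding hb_def by (meson order.trans power_mono)

lemma hb_cong_cmod: "hb s c M \<Longrightarrow> (\<And>n. cmod (c' n) \<le> cmod (c n)) \<Longrightarrow> hb s c' M"
  unfolding hb_def
  by (meson order.trans sum_mono mult_left_mono power_mono norm_ge_zero less_imp_le[OF sobolev_weight_pos])

lemma L2_set_hb:
  "sqrt (\<Sum>n\<in>F. sobolev_weight s n * (cmod (c n))\<^sup>2) = L2_set (\<lambda>n. sqrt (sobolev_weight s n) * cmod (c n)) F"
  by (simp add: L2_set_def power_mult_distrib less_imp_le[OF sobolev_weight_pos])

lemma hb_iff_L2_set: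
  "hb s c M \<longleftrightarrow> 0 \<le> M \<and> (\<forall>F. finite F \<longrightarrow> L2_set (\<lambda>n. sqrt (sobolev_weight s n) * cmod (c n)) F \<le> M)"
proof -
  have "sqrt (\<Sum>n\<in>F. sobolev_weight s n * (cmod (c n))\<^sup>2) \<le> M \<longleftrightarrow> (\<Sum>n\<in>F. sobolev_weight s n * (cmod (c n))\<^sup>2) \<le> M\<^sup>2" if "0 \<le> M" for F
    using real_sqrt_le_iff[of _ "M\<^sup>2"] that by simp
  then show ?thesis unfolding hb_def L2_set_hb[symmetric] by blast
qed

lemma hb_add:
  assumes "hb s c M" "hb s d M'"
  shows "hb s (\<lambda>n. c n + d n) (M + M')"
  unfolding hb_iff_L2_set
proof (intro conjI allI impI)
  show "0 \<le> M + M'" using assms by (auto simp: hb_def)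
  fix F :: "(int \<times> int) set" assume F: "finite F"
  let ?w = "\<lambda>n. sqrt (sobolev_weight s n)"
  have "L2_set (\<lambda>n. ?w n * cmod (c n + d n)) F \<le> L2_set (\<lambda>n. ?w n * cmod (c n) + ?w n * cmod (d n)) F"
    by (intro L2_set_mono) (auto simp: distrib_left[symmetric] norm_triangle_ineq less_imp_le[OF sobolev_weight_pos] intro!: mult_left_mono)
  also have "\<dots> \<le> L2_set (\<lambda>n. ?w n * cmod (c n)) F + L2_set (\<lambda>n. ?w n * cmod (d n)) F"
    by (rule L2_set_triangle_ineq)
  also have "\<dots> \<le> M + M'" using assms F by (intro add_mono) (auto simp: hb_iff_L2_set)
  finally show "L2_set (\<lambda>n. ?w n * cmod (c n + d n)) F \<le> M + M'" .
qed

lemma hb_scale: "hb s c M \<Longrightarrow> hb s (\<lambda>n. k * c n) (cmod k * M)"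
  unfolding hb_def
  by (auto simp: norm_mult power_mult_distrib mult.left_commute[of _ "(cmod k)\<^sup>2"] sum_distrib_left[symmetric] intro!: mult_left_mono)

lemma hb_zero: "0 \<le> M \<Longrightarrow> hb s (\<lambda>n. 0) M"
  by (simp add: hb_def)

lemma hb_component:
  assumes "0 \<le> s" "hb s c M"
  shows "cmod (c n) \<le> M"
proof -
  have "(cmod (c n))\<^sup>2 \<le> sobolev_weight s n * (cmod (c n))\<^sup>2"
    using sobolev_weight_ge_1[OF assms(1)] by (simp add: mult_le_cancel_right1)
  also have "\<dots> \<le> M\<^sup>2" using hbD[OF assms(2), of "{n}"] by simp
  finally show ?thesis using hb_nonneg[OF assms(2)] by (rule power2_le_imp_le)
qed

lemma hb_0_of_hb: "0 \<le> s \<Longrightarrow> hb s c M \<Longrightarrow> hb 0 c M"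
proof (rule hbI)
  fix F :: "(int \<times> int) set" assume s: "0 \<le> s" "hb s c M" and F: "finite F"
  have "(\<Sum>n\<in>F. sobolev_weight 0 n * (cmod (c n))\<^sup>2) \<le> (\<Sum>n\<in>F. sobolev_weight s n * (cmod (c n))\<^sup>2)"
    using sobolev_weight_ge_1[OF s(1)] by (intro sum_mono) (simp add: mult_le_cancel_right1)
  also have "\<dots> \<le> M\<^sup>2" by (rule hbD[OF s(2) F])
  finally show "(\<Sum>n\<in>F. sobolev_weight 0 n * (cmod (c n))\<^sup>2) \<le> M\<^sup>2" .
qed (simp add: hb_nonneg)

lemma hb_limit:
  assumes "\<And>n. (\<lambda>j. c j n) \<longlonglongrightarrow> d n" and "\<And>j. k \<le> j \<Longrightarrow> hb s (c j) M"
  shows "hb s d M"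
proof (rule hbI)
  show "0 \<le> M" using assms(2)[OF order_refl] by (rule hb_nonneg)
  fix F :: "(int \<times> int) set" assume F: "finite F"
  have "(\<lambda>j. \<Sum>n\<in>F. sobolev_weight s n * (cmod (c j n))\<^sup>2) \<longlonglongrightarrow> (\<Sum>n\<in>F. sobolev_weight s n * (cmod (d n))\<^sup>2)"
    by (intro tendsto_intros assms(1))
  then show "(\<Sum>n\<in>F. sobolev_weight s n * (cmod (d n))\<^sup>2) \<le> M\<^sup>2"
    using hbD[OF assms(2) F] by (intro LIMSEQ_le_const2) auto
qed

section \<open>Synthesis of functions from dyadic partial sums\<close>

definition fbox :: "nat \<Rightarrow> (int \<times> int) set" where
  "fbox K = {- int K..int K} \<times> {- int K..int K}"

lemma finite_fbox [simp]: "finite (fbox K)"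
  by (simp add: fbox_def)

lemma fbox_mono: "K \<le> L \<Longrightarrow> fbox K \<subseteq> fbox L"
  by (auto simp: fbox_def)

lemma mem_fbox_pow: "\<exists>j. n \<in> fbox (2 ^ j)"
proof -
  obtain j where "nat (\<bar>fst n\<bar> + \<bar>snd n\<bar>) < 2 ^ j" using less_exp by blast
  then have "\<bar>fst n\<bar> + \<bar>snd n\<bar> \<le> int (2 ^ j)" by linarith
  then show ?thesis by (intro exI[of _ j]) (auto simp: fbox_def mem_Times_iff)
qed

definition tpoly :: "nat \<Rightarrow> (int \<times> int \<Rightarrow> complex) \<Rightarrow> real \<times> real \<Rightarrow> complex" where
  "tpoly K c z = (\<Sum>n\<in>fbox K. c n * chr n z)"

text \<open>
  The partial sums over dyadic boxes converge almost everywhere as soon as the coefficients are in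
  \<open>h\<^sup>s\<close> with \<open>s > 0\<close>; no maximal function is needed.
\<close>

definition synth :: "(int \<times> int \<Rightarrow> complex) \<Rightarrow> real \<times> real \<Rightarrow> complex" where
  "synth c z = lim (\<lambda>j. tpoly (2 ^ j) c z)"

lemma tpoly_measurable [measurable]: "tpoly K c \<in> borel_measurable torus2"
  unfolding tpoly_def by measurable

lemma synth_measurable [measurable]: "synth c \<in> borel_measurable torus2"
  unfolding synth_def by measurable

lemma tail_weight:
  assumes "n \<notin> fbox (2 ^ i)" "0 \<le> s"
  shows "(4 ^ i) powr s \<le> sobolev_weight s n"
proof -
  have "int (2 ^ i) < \<bar>fst n\<bar> \<or> int (2 ^ i) < \<bar>snd n\<bar>" using assms(1) by (auto simp: fbox_def mem_Times_iff)
  then have "(int (2 ^ i))\<^sup>2 \<le> (fst n)\<^sup>2 \<or> (int (2 ^ i))\<^sup>2 \<le> (snd n)\<^sup>2"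
    by (metis abs_of_nat abs_le_square_iff less_imp_le)
  then have "(int (2 ^ i))\<^sup>2 \<le> 1 + (fst n)\<^sup>2 + (snd n)\<^sup>2"
    using zero_le_power2[of "fst n"] zero_le_power2[of "snd n"] by linarith
  then have "real_of_int ((int (2 ^ i))\<^sup>2) \<le> real_of_int (1 + (fst n)\<^sup>2 + (snd n)\<^sup>2)" by (simp only: of_int_le_iff)
  moreover have "real_of_int ((int (2 ^ i))\<^sup>2) = 4 ^ i"
  proof -
    have "((2::real) ^ i)\<^sup>2 = (2\<^sup>2) ^ i" by (simp only: power_mult[symmetric] mult.commute)
    then show ?thesis by simp
  qed
  ultimately show ?thesis using assms(2)
    by (cases n) (auto simp: sobolev_weight_def intro!: powr_mono2)
qed

lemma tpoly_diff_bound: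
  assumes "hb s c M" "0 \<le> s" "i \<le> j"
  shows "(\<integral>\<^sup>+z. ennreal ((cmod (tpoly (2 ^ j) c z - tpoly (2 ^ i) c z))\<^sup>2) \<partial>torus2) \<le> ennreal ((2*pi)\<^sup>2 * (M\<^sup>2 * (4 powr (- s)) ^ i))"
proof -
  have sub: "fbox (2 ^ i) \<subseteq> fbox (2 ^ j)" using assms(3) by (intro fbox_mono power_increasing) auto
  let ?D = "fbox (2 ^ j) - fbox (2 ^ i)"
  have "tpoly (2 ^ j) c z - tpoly (2 ^ i) c z = (\<Sum>n\<in>?D. c n * chr n z)" for z
    unfolding tpoly_def using sub by (simp add: sum_diff)
  then have "(\<integral>\<^sup>+z. ennreal ((cmod (tpoly (2 ^ j) c z - tpoly (2 ^ i) c z))\<^sup>2) \<partial>torus2) = ennreal ((2*pi)\<^sup>2 * (\<Sum>n\<in>?D. (cmod (c n))\<^sup>2))"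
    by (simp add: nn_integral_trig_poly)
  also have "\<dots> \<le> ennreal ((2*pi)\<^sup>2 * (M\<^sup>2 * (4 powr (- s)) ^ i))"
  proof (intro ennreal_leI mult_left_mono)
    have e: "(4 powr (- s)) ^ i * (4 ^ i) powr s = 1"
    proof -
      have "(4 ^ i) powr s = (4 powr s) ^ i" by (induction i) (auto simp: powr_mult)
      then show ?thesis by (simp add: power_mult_distrib[symmetric] powr_minus)
    qed
    have "(\<Sum>n\<in>?D. (cmod (c n))\<^sup>2) \<le> (\<Sum>n\<in>?D. (4 powr (- s)) ^ i * (sobolev_weight s n * (cmod (c n))\<^sup>2))"
    proof (rule sum_mono)
      fix n assume n: "n \<in> ?D"
      have "1 \<le> (4 powr (- s)) ^ i * sobolev_weight s n"
        unfolding e[symmetric] using tail_weight[of n i s] n assms(2) by (intro mult_left_mono) auto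
      then have "1 * (cmod (c n))\<^sup>2 \<le> ((4 powr (- s)) ^ i * sobolev_weight s n) * (cmod (c n))\<^sup>2"
        by (intro mult_right_mono) auto
      then show "(cmod (c n))\<^sup>2 \<le> (4 powr (- s)) ^ i * (sobolev_weight s n * (cmod (c n))\<^sup>2)" by (simp add: mult.assoc)
    qed
    also have "\<dots> \<le> (4 powr (- s)) ^ i * M\<^sup>2"
      unfolding sum_distrib_left[symmetric] by (intro mult_left_mono hbD[OF assms(1)]) auto
    finally show "(\<Sum>n\<in>?D. (cmod (c n))\<^sup>2) \<le> M\<^sup>2 * (4 powr (- s)) ^ i" by (simp add: mult.commute)
  qed auto
  finally show ?thesis .
qed

text \<open>The increments between consecutive dyadic sums decay like 2^(-sj) in \<open>L^2\<close>,
  hence in \<open>L^1\<close>, as the torus has finite measure. The sum of their absolute values is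
  therefore integrable and finite almost everywhere, and there the increments are absolutely
  summable.\<close>

lemma synth_AE:
  assumes c: "hb s c M" and s: "0 < s"
  shows "AE z in torus2. (\<lambda>j. tpoly (2 ^ j) c z) \<longlonglongrightarrow> synth c z"
proof -
  define \<rho> where "\<rho> = 2 powr s"
  have \<rho>: "\<rho> > 1" using s by (simp add: \<rho>_def gr_one_powr)
  define \<kappa> where "\<kappa> = measure torus2 (space torus2)"
  define d where "d j z = cmod (tpoly (2 ^ Suc j) c z - tpoly (2 ^ j) c z)" for j z
  have [measurable]: "d j \<in> borel_measurable torus2" for j unfolding d_def by measurable
  have \<rho>4: "\<rho> ^ j * (4 powr (- s)) ^ j = (1 / \<rho>) ^ j" for j
  proof -
    have "(4::real) powr (-s) = 1 / (\<rho> * \<rho>)" by (simp add: four_powr \<rho>_def powr_minus power2_eq_square divide_inverse)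
    then show ?thesis using \<rho> by (simp add: power_mult_distrib power_divide)
  qed
  let ?K = "\<kappa> + (2*pi)\<^sup>2 * M\<^sup>2"
  have \<kappa>0: "0 \<le> \<kappa>" by (simp add: \<kappa>_def)
  have dj: "(\<integral>\<^sup>+z. ennreal (d j z) \<partial>torus2) \<le> ennreal (?K * (1 / \<rho>) ^ j)" for j
  proof -
    have "(\<integral>\<^sup>+z. ennreal (d j z) \<partial>torus2) \<le> (\<integral>\<^sup>+z. ennreal ((1 / \<rho>) ^ j) + ennreal (\<rho> ^ j) * ennreal ((d j z)\<^sup>2) \<partial>torus2)"
    proof (rule nn_integral_mono)
      fix z
      have d0: "0 \<le> d j z" by (simp add: d_def)
      \<comment> \<open>The arithmetic-geometric mean inequality with weight \<rho>^j: the integral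
        of the squared increment decays like \<rho>^(-2j), so both terms end up of size
        \<rho>^(-j).\<close>
      have "d j z \<le> (1 / \<rho>) ^ j + \<rho> ^ j * (d j z)\<^sup>2"
      proof -
        let ?x = "\<rho> ^ j"
        have x: "?x > 0" using \<rho> by simp
        have "0 \<le> (?x * d j z - 1)\<^sup>2" by simp
        then have "2 * (?x * d j z) \<le> 1 + ?x * (?x * (d j z)\<^sup>2)" by (simp add: power2_eq_square algebra_simps)
        moreover have "0 \<le> ?x * d j z" using x d0 by simp
        ultimately have "?x * d j z \<le> 1 + ?x * (?x * (d j z)\<^sup>2)" by linarith
        then have "d j z \<le> (1 + ?x * (?x * (d j z)\<^sup>2)) / ?x" using x by (simp add: field_simps)
        also have "\<dots> = 1 / ?x + ?x * (d j z)\<^sup>2" using x by (simp add: add_divide_distrib)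
        finally show ?thesis by (simp add: power_one_over)
      qed
      then have "ennreal (d j z) \<le> ennreal ((1 / \<rho>) ^ j + \<rho> ^ j * (d j z)\<^sup>2)" by (rule ennreal_leI)
      also have "\<dots> = ennreal ((1 / \<rho>) ^ j) + ennreal (\<rho> ^ j) * ennreal ((d j z)\<^sup>2)"
        using \<rho> by (subst ennreal_plus) (auto simp: ennreal_mult)
      finally show "ennreal (d j z) \<le> ennreal ((1 / \<rho>) ^ j) + ennreal (\<rho> ^ j) * ennreal ((d j z)\<^sup>2)" .
    qed
    also have "\<dots> = ennreal ((1 / \<rho>) ^ j) * ennreal \<kappa> + ennreal (\<rho> ^ j) * (\<integral>\<^sup>+z. ennreal ((d j z)\<^sup>2) \<partial>torus2)"
      by (subst nn_integral_add) (auto simp: nn_integral_cmult torus2.emeasure_eq_measure \<kappa>_def)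
    also have "\<dots> \<le> ennreal ((1 / \<rho>) ^ j) * ennreal \<kappa> + ennreal (\<rho> ^ j) * ennreal ((2*pi)\<^sup>2 * (M\<^sup>2 * (4 powr (- s)) ^ j))"
      unfolding d_def using s by (intro add_left_mono mult_left_mono tpoly_diff_bound[OF c]) auto
    also have "\<dots> = ennreal ((1 / \<rho>) ^ j * \<kappa> + \<rho> ^ j * ((2*pi)\<^sup>2 * (M\<^sup>2 * (4 powr (- s)) ^ j)))"
      using \<rho> \<kappa>0 by (subst ennreal_plus) (auto simp: ennreal_mult)
    also have "(1 / \<rho>) ^ j * \<kappa> + \<rho> ^ j * ((2*pi)\<^sup>2 * (M\<^sup>2 * (4 powr (- s)) ^ j)) = ?K * (1 / \<rho>) ^ j"
      unfolding \<rho>4[symmetric] by (simp add: algebra_simps)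
    finally show ?thesis .
  qed
  have "(\<integral>\<^sup>+z. (\<Sum>j. ennreal (d j z)) \<partial>torus2) = (\<Sum>j. \<integral>\<^sup>+z. ennreal (d j z) \<partial>torus2)"
    by (rule nn_integral_suminf) simp
  also have "\<dots> \<le> (\<Sum>j. ennreal (?K * (1 / \<rho>) ^ j))"
    by (intro suminf_le dj) auto
  also have "\<dots> < \<infinity>"
  proof -
    have "summable (\<lambda>j. ?K * (1 / \<rho>) ^ j)" using \<rho> by (intro summable_mult summable_geometric) auto
    then have "(\<Sum>j. ennreal (?K * (1 / \<rho>) ^ j)) = ennreal (\<Sum>j. ?K * (1 / \<rho>) ^ j)"
      using \<rho> \<kappa>0 by (intro suminf_ennreal2) auto
    then show ?thesis by simp
  qed
  finally have "AE z in torus2. (\<Sum>j. ennreal (d j z)) \<noteq> \<infinity>"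
    by (intro nn_integral_PInf_AE) auto
  then show ?thesis
  proof eventually_elim
    case (elim z)
    have "summable (\<lambda>j. d j z)"
      by (rule summable_suminf_not_top) (use elim in \<open>auto simp: d_def\<close>)
    then have "summable (\<lambda>j. tpoly (2 ^ Suc j) c z - tpoly (2 ^ j) c z)"
      unfolding d_def by (rule summable_norm_cancel)
    then have "convergent (\<lambda>j. \<Sum>i<j. tpoly (2 ^ Suc i) c z - tpoly (2 ^ i) c z)"
      by (simp only: summable_iff_convergent)
    then have "convergent (\<lambda>j. tpoly (2 ^ j) c z - tpoly (2 ^ 0) c z)"
      by (simp only: sum_lessThan_telescope[where f = "\<lambda>i. tpoly (2 ^ i) c z"])
    then have "convergent (\<lambda>j. tpoly (2 ^ j) c z)"
      by (simp only: convergent_diff_const_right_iff)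
    then show ?case unfolding synth_def by (simp add: convergent_LIMSEQ_iff)
  qed
qed

lemma synth_tpoly_L2:
  assumes c: "hb s c M" and s: "0 < s"
  shows "(\<integral>\<^sup>+z. ennreal ((cmod (synth c z - tpoly (2 ^ i) c z))\<^sup>2) \<partial>torus2) \<le> ennreal ((2*pi)\<^sup>2 * (M\<^sup>2 * (4 powr (- s)) ^ i))"
proof (rule fatou_bound)
  show "AE z in torus2. (\<lambda>j. ennreal ((cmod (tpoly (2 ^ j) c z - tpoly (2 ^ i) c z))\<^sup>2)) \<longlonglongrightarrow> ennreal ((cmod (synth c z - tpoly (2 ^ i) c z))\<^sup>2)"
    using synth_AE[OF c s] by eventually_elim (intro tendsto_intros tendsto_ennrealI)
  show "(\<integral>\<^sup>+z. ennreal ((cmod (tpoly (2 ^ j) c z - tpoly (2 ^ i) c z))\<^sup>2) \<partial>torus2) \<le> ennreal ((2*pi)\<^sup>2 * (M\<^sup>2 * (4 powr (- s)) ^ i))" if "i \<le> j" for j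
    using tpoly_diff_bound[OF c _ that] s by simp
qed measurable

lemma synth_L2:
  assumes c: "hb s c M" and s: "0 < s"
  shows "(\<integral>\<^sup>+z. ennreal ((cmod (synth c z))\<^sup>2) \<partial>torus2) \<le> ennreal ((2*pi)\<^sup>2 * M\<^sup>2)"
proof (rule fatou_bound[where k = 0])
  show "AE z in torus2. (\<lambda>j. ennreal ((cmod (tpoly (2 ^ j) c z))\<^sup>2)) \<longlonglongrightarrow> ennreal ((cmod (synth c z))\<^sup>2)"
    using synth_AE[OF c s] by eventually_elim (intro tendsto_intros tendsto_ennrealI)
  fix j
  have "(\<integral>\<^sup>+z. ennreal ((cmod (tpoly (2 ^ j) c z))\<^sup>2) \<partial>torus2) = ennreal ((2*pi)\<^sup>2 * (\<Sum>n\<in>fbox (2 ^ j). (cmod (c n))\<^sup>2))"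
    by (simp add: tpoly_def nn_integral_trig_poly)
  also have "\<dots> \<le> ennreal ((2*pi)\<^sup>2 * M\<^sup>2)"
    using hbD[OF hb_0_of_hb[OF _ c], of "fbox (2 ^ j)"] s by (intro ennreal_leI mult_left_mono) auto
  finally show "(\<integral>\<^sup>+z. ennreal ((cmod (tpoly (2 ^ j) c z))\<^sup>2) \<partial>torus2) \<le> ennreal ((2*pi)\<^sup>2 * M\<^sup>2)" .
qed measurable

lemma L2_imp_L1:
  fixes f :: "real \<times> real \<Rightarrow> complex"
  assumes [measurable]: "f \<in> borel_measurable torus2" and f: "integrable torus2 (\<lambda>z. (cmod (f z))\<^sup>2)"
  shows "integrable torus2 f"
proof (rule Bochner_Integration.integrable_bound)
  show "integrable torus2 (\<lambda>z. 1 + (cmod (f z))\<^sup>2)" using f by simp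
  have "cmod (f z) \<le> 1 + (cmod (f z))\<^sup>2" for z
  proof -
    have "0 \<le> (cmod (f z) - 1)\<^sup>2" by simp
    then have "2 * cmod (f z) \<le> 1 + (cmod (f z))\<^sup>2" by (simp add: power2_diff)
    moreover have "0 \<le> cmod (f z)" by simp
    ultimately show ?thesis by linarith
  qed
  then show "AE z in torus2. norm (f z) \<le> norm (1 + (cmod (f z))\<^sup>2)" by (simp add: add_nonneg_nonneg)
qed simp

lemma synth_square_integrable:
  assumes c: "hb s c M" and s: "0 < s"
  shows "integrable torus2 (\<lambda>z. (cmod (synth c z))\<^sup>2)"
proof (rule integrableI_bounded)
  show "(\<integral>\<^sup>+z. ennreal (norm ((cmod (synth c z))\<^sup>2)) \<partial>torus2) < \<infinity>"
    using synth_L2[OF c s] by (simp add: order_le_less_trans)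
qed simp

section \<open>Fourier coefficients of integrable functions\<close>

lemma fourier_coeff_chr: "fourier_coeff f n = (\<integral>z. f z * cnj (chr n z) \<partial>torus2) / of_real ((2*pi)\<^sup>2)"
proof -
  have e: "exp (- \<i> * complex_of_real x) = cnj (cis x)" for x
    by (simp only: cis_cnj) (simp add: cis_conv_exp)
  show ?thesis
    unfolding fourier_coeff_def chr_def e[symmetric] by (cases n) (simp add: case_prod_beta')
qed

lemma integrable_mult_chr:
  assumes "integrable torus2 f"
  shows "integrable torus2 (\<lambda>z. f z * cnj (chr n z))" "integrable torus2 (\<lambda>z. f z * chr n z)"
  using assms by (auto intro!: Bochner_Integration.integrable_bound[OF assms] simp: norm_mult)

lemma fourier_coeff_add:
  assumes "integrable torus2 f" "integrable torus2 g"
  shows "fourier_coeff (\<lambda>z. f z + g z) n = fourier_coeff f n + fourier_coeff g n"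
  using integrable_mult_chr[OF assms(1)] integrable_mult_chr[OF assms(2)]
  by (simp add: fourier_coeff_chr distrib_right add_divide_distrib)

lemma fourier_coeff_diff:
  assumes "integrable torus2 f" "integrable torus2 g"
  shows "fourier_coeff (\<lambda>z. f z - g z) n = fourier_coeff f n - fourier_coeff g n"
  using integrable_mult_chr[OF assms(1)] integrable_mult_chr[OF assms(2)]
  by (simp add: fourier_coeff_chr left_diff_distrib diff_divide_distrib)

lemma fourier_coeff_scale: "fourier_coeff (\<lambda>z. k * f z) n = k * fourier_coeff f n"
  by (simp add: fourier_coeff_chr mult.assoc)

lemma fourier_coeff_cong_AE:
  assumes "AE z in torus2. f z = g z" "f \<in> borel_measurable torus2" "g \<in> borel_measurable torus2"
  shows "fourier_coeff f = fourier_coeff g"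
proof
  fix n
  have "(\<integral>z. f z * cnj (chr n z) \<partial>torus2) = (\<integral>z. g z * cnj (chr n z) \<partial>torus2)"
    using assms by (intro integral_cong_AE) (auto elim: eventually_mono)
  then show "fourier_coeff f n = fourier_coeff g n" by (simp add: fourier_coeff_chr)
qed

lemma fourier_coeff_trig_poly:
  assumes F: "finite F"
  shows "fourier_coeff (\<lambda>z. \<Sum>m\<in>F. c m * chr m z) n = (if n \<in> F then c n else 0)"
proof -
  have "(\<integral>z. (\<Sum>m\<in>F. c m * chr m z) * cnj (chr n z) \<partial>torus2) = (\<integral>z. (\<Sum>m\<in>F. c m * chr (m - n) z) \<partial>torus2)"
    by (simp add: sum_distrib_right chr_diff mult.assoc)
  also have "\<dots> = (\<Sum>m\<in>F. c m * (if m = n then of_real ((2*pi)\<^sup>2) else 0))"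
    by (simp add: Bochner_Integration.integral_sum chr_integrable integral_chr)
  also have "\<dots> = (if n \<in> F then c n * of_real ((2*pi)\<^sup>2) else 0)"
    using F by (simp add: if_distrib[of "(*) _"] sum.delta cong: if_cong)
  finally show ?thesis by (simp add: fourier_coeff_chr)
qed

lemma cmod_fourier_coeff_le:
  assumes [measurable]: "f \<in> borel_measurable torus2"
    and f: "(\<integral>\<^sup>+z. ennreal ((cmod (f z))\<^sup>2) \<partial>torus2) \<le> ennreal ((2*pi)\<^sup>2 * B\<^sup>2)" and B: "0 \<le> B"
  shows "cmod (fourier_coeff f n) \<le> B"
proof -
  have "emeasure torus2 (space torus2) = ennreal ((2*pi)\<^sup>2)"
    using nn_integral_trig_poly[of "{0}" "\<lambda>_. 1"] by (simp add: norm_mult)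
  then have I: "(\<integral>\<^sup>+z. (ennreal 1)\<^sup>2 \<partial>torus2) = ennreal ((2*pi)\<^sup>2)" by simp
  have sq: "(ennreal (cmod x))\<^sup>2 = ennreal ((cmod x)\<^sup>2)" for x by (simp add: ennreal_power)
  have "(\<integral>\<^sup>+z. ennreal (cmod (f z)) * ennreal 1 \<partial>torus2)\<^sup>2 \<le> (\<integral>\<^sup>+z. (ennreal (cmod (f z)))\<^sup>2 \<partial>torus2) * (\<integral>\<^sup>+z. (ennreal 1)\<^sup>2 \<partial>torus2)"
    by (rule Cauchy_Schwarz_nn_integral) measurable
  also have "\<dots> \<le> ennreal ((2*pi)\<^sup>2 * B\<^sup>2) * ennreal ((2*pi)\<^sup>2)"
    unfolding I sq by (intro mult_right_mono f) auto
  also have "\<dots> = ennreal (((2*pi)\<^sup>2 * B)\<^sup>2)"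
    by (subst ennreal_mult[symmetric]) (auto simp: power2_eq_square mult_ac B)
  finally have 1: "(\<integral>\<^sup>+z. ennreal (cmod (f z)) \<partial>torus2)\<^sup>2 \<le> ennreal (((2*pi)\<^sup>2 * B)\<^sup>2)" by simp
  have "ennreal (cmod (\<integral>z. f z * cnj (chr n z) \<partial>torus2)) \<le> (\<integral>\<^sup>+z. ennreal (cmod (f z)) \<partial>torus2)"
    using integral_norm_bound_ennreal[of torus2 "\<lambda>z. f z * cnj (chr n z)"]
    by (cases "integrable torus2 (\<lambda>z. f z * cnj (chr n z))") (auto simp: norm_mult not_integrable_integral_eq)
  then have "(ennreal (cmod (\<integral>z. f z * cnj (chr n z) \<partial>torus2)))\<^sup>2 \<le> (\<integral>\<^sup>+z. ennreal (cmod (f z)) \<partial>torus2)\<^sup>2"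
    by (rule power_mono) simp
  then have "ennreal ((cmod (\<integral>z. f z * cnj (chr n z) \<partial>torus2))\<^sup>2) \<le> ennreal (((2*pi)\<^sup>2 * B)\<^sup>2)"
    unfolding sq using 1 by (rule order.trans)
  then have "(cmod (\<integral>z. f z * cnj (chr n z) \<partial>torus2))\<^sup>2 \<le> ((2*pi)\<^sup>2 * B)\<^sup>2" by (subst (asm) ennreal_le_iff) auto
  then have "cmod (\<integral>z. f z * cnj (chr n z) \<partial>torus2) \<le> (2*pi)\<^sup>2 * B" by (rule power2_le_imp_le) (use B in auto)
  then show ?thesis by (simp add: fourier_coeff_chr norm_divide norm_power field_simps)
qed

text \<open>A partial sum over a box that contains n has exactly the coefficient \<open>c n\<close>.
  The remainder is small in \<open>L^2\<close>, which controls every coefficient.\<close>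

lemma fourier_coeff_synth:
  assumes c: "hb s c M" and s: "0 < s"
  shows "fourier_coeff (synth c) n = c n"
proof -
  have M: "0 \<le> M" using c by (rule hb_nonneg)
  define r where "r = 2 powr (- s)"
  have r: "0 < r" "r < 1" using s by (auto simp: r_def powr_minus inverse_less_1_iff gr_one_powr)
  have r2: "(4 powr (- s)) ^ j = (r ^ j)\<^sup>2" for j
  proof -
    have "(4::real) powr (-s) = r\<^sup>2" by (simp add: r_def four_powr)
    then show ?thesis by (simp add: power_mult[symmetric] mult.commute)
  qed
  obtain j0 where j0: "n \<in> fbox (2 ^ j0)" using mem_fbox_pow by blast
  have int: "integrable torus2 (synth c)" by (intro L2_imp_L1 synth_square_integrable[OF c s]) simp
  have intp: "integrable torus2 (tpoly K c)" for K
    unfolding tpoly_def by (intro Bochner_Integration.integrable_sum integrable_mult_right chr_integrable)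
  have "cmod (fourier_coeff (synth c) n - c n) \<le> M * r ^ j" if "j0 \<le> j" for j
  proof -
    have "fbox (2 ^ j0) \<subseteq> fbox (2 ^ j)" using that by (intro fbox_mono power_increasing) auto
    then have "fourier_coeff (tpoly (2 ^ j) c) n = c n"
      using j0 fourier_coeff_trig_poly[of "fbox (2 ^ j)" c n] by (auto simp: tpoly_def[abs_def])
    then have "fourier_coeff (synth c) n - c n = fourier_coeff (\<lambda>z. synth c z - tpoly (2 ^ j) c z) n"
      by (simp add: fourier_coeff_diff int intp)
    also have "cmod \<dots> \<le> M * r ^ j"
    proof (rule cmod_fourier_coeff_le)
      show "(\<integral>\<^sup>+z. ennreal ((cmod (synth c z - tpoly (2 ^ j) c z))\<^sup>2) \<partial>torus2) \<le> ennreal ((2*pi)\<^sup>2 * (M * r ^ j)\<^sup>2)"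
        using synth_tpoly_L2[OF c s, of j] by (simp add: r2 power_mult_distrib)
    qed (use M r in auto)
    finally show ?thesis .
  qed
  moreover have "(\<lambda>j. M * r ^ j) \<longlonglongrightarrow> M * 0"
    using r by (intro tendsto_intros LIMSEQ_power_zero) auto
  ultimately have "cmod (fourier_coeff (synth c) n - c n) \<le> 0"
    by (intro LIMSEQ_le_const[of "\<lambda>j. M * r ^ j" 0]) auto
  then show ?thesis by simp
qed

section \<open>Completeness of the characters\<close>

inductive trigp :: "(real \<times> real \<Rightarrow> complex) \<Rightarrow> bool" where
  trigp_chr: "trigp (chr n)"
| trigp_add: "trigp g \<Longrightarrow> trigp h \<Longrightarrow> trigp (\<lambda>z. g z + h z)"
| trigp_scale: "trigp h \<Longrightarrow> trigp (\<lambda>z. c * h z)"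

lemma trigp_const: "trigp (\<lambda>z. c)"
proof -
  have "chr 0 = (\<lambda>z. 1)" by (auto simp: chr_def)
  then show ?thesis using trigp_scale[OF trigp_chr[of 0], of c] by simp
qed

lemma trigp_mult:
  assumes "trigp g" "trigp h"
  shows "trigp (\<lambda>z. g z * h z)"
  using assms(1)
proof induction
  case (trigp_chr n)
  show ?case using assms(2)
  proof induction
    case (trigp_chr m)
    have "(\<lambda>z. chr n z * chr m z) = chr (n + m)" by (auto simp: chr_add)
    then show ?case by (simp add: trigp.trigp_chr)
  next
    case (trigp_add g h)
    then show ?case using trigp.trigp_add by (simp add: distrib_left)
  next
    case (trigp_scale h c)
    then show ?case using trigp.trigp_scale[of "\<lambda>z. chr n z * h z" c] by (simp add: mult.left_commute)
  qed
next
  case (trigp_add g h)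
  then show ?case using trigp.trigp_add by (simp add: distrib_right)
next
  case (trigp_scale h' c)
  then show ?case using trigp.trigp_scale[of "\<lambda>z. h' z * h z" c] by (simp add: mult.assoc)
qed

text \<open>A real linear functional of the two circle coordinates is a combination of the cosines
  and sines of the angles, hence of four characters. Since characters multiply to characters, the
  real polynomials supplied by Stone-Weierstrass stay within the span of the characters.\<close>

lemma trigp_real_polynomial:
  fixes P :: "complex \<times> complex \<Rightarrow> real"
  assumes "real_polynomial_function P"
  shows "trigp (\<lambda>z. complex_of_real (P (cis (fst z), cis (snd z))))"
  using assms
proof induction
  case (linear L)
  interpret L: bounded_linear L by fact
  have e: "L (a, b) = Re a * L (1, 0) + Im a * L (\<i>, 0) + Re b * L (0, 1) + Im b * L (0, \<i>)" for a b
  proof -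
    have "(a, b) = Re a *\<^sub>R (1, 0) + Im a *\<^sub>R (\<i>, 0) + Re b *\<^sub>R (0, 1) + Im b *\<^sub>R (0, \<i>)"
      by (simp add: complex_eq_iff)
    then show ?thesis by (simp only: L.add L.scaleR real_scaleR_def)
  qed
  have c: "complex_of_real (cos x) = (cis x + cis (- x)) / 2" "complex_of_real (sin x) = (cis x - cis (- x)) / (2 * \<i>)" for x
    by (auto simp: complex_eq_iff)
  have r: "trigp (\<lambda>z. complex_of_real (cos (fst z)))" "trigp (\<lambda>z. complex_of_real (sin (fst z)))"
    "trigp (\<lambda>z. complex_of_real (cos (snd z)))" "trigp (\<lambda>z. complex_of_real (sin (snd z)))"
  proof -
    have chr: "chr (1, 0) = (\<lambda>z. cis (fst z))" "chr (-1, 0) = (\<lambda>z. cis (- fst z))"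
      "chr (0, 1) = (\<lambda>z. cis (snd z))" "chr (0, -1) = (\<lambda>z. cis (- snd z))"
      by (auto simp: chr_def)
    have "trigp (\<lambda>z. (1/2) * cis (fst z) + (1/2) * cis (- fst z))" "trigp (\<lambda>z. (1 / (2 * \<i>)) * cis (fst z) + (- 1 / (2 * \<i>)) * cis (- fst z))"
      "trigp (\<lambda>z. (1/2) * cis (snd z) + (1/2) * cis (- snd z))" "trigp (\<lambda>z. (1 / (2 * \<i>)) * cis (snd z) + (- 1 / (2 * \<i>)) * cis (- snd z))"
      by (intro trigp_add trigp_scale trigp_chr[of "(1, 0)", unfolded chr] trigp_chr[of "(-1, 0)", unfolded chr]
            trigp_chr[of "(0, 1)", unfolded chr] trigp_chr[of "(0, -1)", unfolded chr])+
    then show "trigp (\<lambda>z. complex_of_real (cos (fst z)))" "trigp (\<lambda>z. complex_of_real (sin (fst z)))"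
      "trigp (\<lambda>z. complex_of_real (cos (snd z)))" "trigp (\<lambda>z. complex_of_real (sin (snd z)))"
      unfolding c by (simp_all add: algebra_simps add_divide_distrib diff_divide_distrib)
  qed
  have "trigp (\<lambda>z. complex_of_real (cos (fst z)) * of_real (L (1, 0)) + complex_of_real (sin (fst z)) * of_real (L (\<i>, 0))
      + complex_of_real (cos (snd z)) * of_real (L (0, 1)) + complex_of_real (sin (snd z)) * of_real (L (0, \<i>)))"
    by (intro trigp_add trigp_mult r trigp_const)
  then show ?case by (subst e) simp
next
  case (const c)
  show ?case by (rule trigp_const)
next
  case (add f g)
  then show ?case using trigp_add by simp
next
  case (mult f g)
  then show ?case using trigp_mult by simp
qed

text \<open>Stone-Weierstrass on the product of two unit circles gives completeness of the characters.\<close>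

lemma integral_orthogonal_continuous:
  fixes f :: "real \<times> real \<Rightarrow> complex" and H :: "complex \<times> complex \<Rightarrow> real"
  assumes f: "integrable torus2 f" and z: "\<And>n. fourier_coeff f n = 0" and H: "continuous_on UNIV H"
  shows "(\<integral>z. f z * of_real (H (cis (fst z), cis (snd z))) \<partial>torus2) = 0"
proof -
  define S :: "(complex \<times> complex) set" where "S = sphere 0 1 \<times> sphere 0 1"
  have S: "compact S" unfolding S_def by (intro compact_Times compact_sphere)
  have inS: "(cis (fst z), cis (snd z)) \<in> S" for z :: "real \<times> real" by (simp add: S_def)
  have [measurable]: "f \<in> borel_measurable torus2" using f by auto
  have trig0: "integrable torus2 (\<lambda>z. f z * h z) \<and> (\<integral>z. f z * h z \<partial>torus2) = 0" if "trigp h" for h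
    using that
  proof induction
    case (trigp_chr n)
    have "fourier_coeff f (- n) = 0" by (rule z)
    then show ?case using integrable_mult_chr[OF f] by (simp add: fourier_coeff_chr cnj_chr)
  next
    case (trigp_add g h)
    then show ?case by (simp add: distrib_left)
  next
    case (trigp_scale h c)
    then show ?case by (simp add: mult.left_commute)
  qed
  let ?h = "\<lambda>z. complex_of_real (H (cis (fst z), cis (snd z)))"
  define C where "C = (\<integral>z. cmod (f z) \<partial>torus2)"
  have C0: "0 \<le> C" by (simp add: C_def)
  have intn: "integrable torus2 (\<lambda>z. cmod (f z))" using f by simp
  have hm [measurable]: "?h \<in> borel_measurable torus2"
    by (intro borel_measurable_torus2I borel_measurable_continuous_onI continuous_intros continuous_on_compose2[OF H]) auto
  obtain B where B: "\<And>w. w \<in> S \<Longrightarrow> \<bar>H w\<bar> \<le> B"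
    using compact_imp_bounded[OF compact_continuous_image[OF continuous_on_subset[OF H] S]]
    by (auto simp: bounded_iff)
  have inth: "integrable torus2 (\<lambda>z. f z * ?h z)"
  proof (rule Bochner_Integration.integrable_bound)
    show "integrable torus2 (\<lambda>z. B * cmod (f z))" using intn by simp
    show "AE z in torus2. norm (f z * ?h z) \<le> norm (B * cmod (f z))"
    proof (rule AE_I2)
      fix z
      have "\<bar>H (cis (fst z), cis (snd z))\<bar> \<le> \<bar>B\<bar>" using B[OF inS[of z]] by linarith
      from mult_left_mono[OF this, of "cmod (f z)"]
      show "norm (f z * ?h z) \<le> norm (B * cmod (f z))" by (simp add: norm_mult abs_mult mult.commute)
    qed
  qed simp
  have "cmod (\<integral>z. f z * ?h z \<partial>torus2) \<le> e * C" if e: "0 < e" for e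
  proof -
    obtain P where P: "real_polynomial_function P" "\<And>w. w \<in> S \<Longrightarrow> \<bar>H w - P w\<bar> < e"
      using Stone_Weierstrass_real_polynomial_function[OF S continuous_on_subset[OF H] e] by blast
    let ?p = "\<lambda>z. complex_of_real (P (cis (fst z), cis (snd z)))"
    note p = trig0[OF trigp_real_polynomial[OF P(1)]]
    have "(\<integral>z. f z * ?h z \<partial>torus2) = (\<integral>z. f z * ?h z - f z * ?p z \<partial>torus2)"
      using p inth by simp
    also have "cmod \<dots> \<le> (\<integral>z. e * cmod (f z) \<partial>torus2)"
    proof (rule order.trans[OF integral_norm_bound integral_mono])
      fix z
      have "cmod (?h z - ?p z) \<le> e"
        using P(2)[OF inS[of z]] by (simp flip: of_real_diff)
      from mult_left_mono[OF this, of "cmod (f z)"]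
      show "cmod (f z * ?h z - f z * ?p z) \<le> e * cmod (f z)"
        by (simp add: mult.commute flip: right_diff_distrib norm_mult)
    qed (use p inth intn in auto)
    finally show ?thesis by (simp add: C_def)
  qed
  then have le: "cmod (\<integral>z. f z * ?h z \<partial>torus2) \<le> inverse (real (Suc j)) * C" for j by simp
  have "(\<lambda>j. inverse (real (Suc j)) * C) \<longlonglongrightarrow> 0 * C" by (intro tendsto_intros LIMSEQ_inverse_real_of_nat)
  then have "cmod (\<integral>z. f z * ?h z \<partial>torus2) \<le> 0"
    using le by (intro LIMSEQ_le_const[of "\<lambda>j. inverse (real (Suc j)) * C" 0]) auto
  then show ?thesis by simp
qed

text \<open>\<open>K\<close> is transported by the injective map \<open>\<Phi>\<close> to the
  product of two circles, where its image is compact. The cut-offs \<open>H j\<close>, functions of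
  the distance to this image, are continuous also across the glued edges of the square and decrease
  to the indicator.\<close>

lemma integral_orthogonal_compact:
  fixes f :: "real \<times> real \<Rightarrow> complex"
  assumes f: "integrable torus2 f" and z: "\<And>n. fourier_coeff f n = 0"
    and K: "compact K" "K \<subseteq> {0..<2*pi} \<times> {0..<2*pi}"
  shows "(\<integral>z. indicator K z *\<^sub>R f z \<partial>torus2) = 0"
proof (cases "K = {}")
  case False
  define \<Phi> where "\<Phi> z = (cis (fst z), cis (snd z))" for z :: "real \<times> real"
  define L where "L = \<Phi> ` K"
  have L: "compact L" "L \<noteq> {}"
    unfolding L_def \<Phi>_def using K False by (auto intro!: compact_continuous_image continuous_intros)
  have inj: "x = y" if "cis x = cis y" "0 \<le> x" "x < 2*pi" "0 \<le> y" "y < 2*pi" for x y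
  proof -
    have "cos x = cos y" "sin x = sin y" using that(1) by (auto simp: complex_eq_iff)
    then show ?thesis using that sin_cos_eq_iff by (metis Arg2pi_unique complex_eq_iff that cis_conv_exp mult.left_neutral of_real_1 zero_less_one)
  qed
  have mem: "\<Phi> z \<in> L \<longleftrightarrow> z \<in> K" if "z \<in> space torus2" for z
  proof
    assume "\<Phi> z \<in> L"
    then obtain w where w: "w \<in> K" "\<Phi> z = \<Phi> w" by (auto simp: L_def)
    then have "w \<in> {0..<2*pi} \<times> {0..<2*pi}" using K by auto
    then have "fst z = fst w" "snd z = snd w"
      using that w(2) by (auto simp: space_torus2 \<Phi>_def intro!: inj)
    then have "z = w" by (simp add: prod_eq_iff)
    then show "z \<in> K" using w(1) by simp
  qed (simp add: L_def)
  define H where "H j w = max 0 (1 - real j * infdist w L)" for j w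
  have H01: "0 \<le> H j w" "H j w \<le> 1" for j w by (auto simp: H_def infdist_nonneg)
  have lim: "(\<lambda>j. H j (\<Phi> z)) \<longlonglongrightarrow> indicator K z" if "z \<in> space torus2" for z
  proof (cases "z \<in> K")
    case True
    then have "infdist (\<Phi> z) L = 0" by (simp add: L_def)
    then show ?thesis using True by (simp add: H_def)
  next
    case False
    then have "infdist (\<Phi> z) L > 0"
      using mem[OF that] L by (intro infdist_pos_not_in_closed compact_imp_closed) auto
    then obtain j0 where j0: "1 < real j0 * infdist (\<Phi> z) L" using ex_less_of_nat_mult by blast
    have "\<forall>\<^sub>F j in sequentially. H j (\<Phi> z) = 0"
      unfolding eventually_sequentially
    proof (intro exI[of _ j0] allI impI)
      fix j assume "j0 \<le> j"
      then have "real j0 * infdist (\<Phi> z) L \<le> real j * infdist (\<Phi> z) L" by (intro mult_right_mono) (auto simp: infdist_nonneg)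
      then show "H j (\<Phi> z) = 0" using j0 by (simp add: H_def)
    qed
    then show ?thesis using False by (simp add: tendsto_eventually)
  qed
  have [measurable]: "f \<in> borel_measurable torus2" using f by auto
  have Hc: "continuous_on UNIV (H j)" for j unfolding H_def by (intro continuous_intros)
  have Hm [measurable]: "(\<lambda>z. complex_of_real (H j (\<Phi> z))) \<in> borel_measurable torus2" for j
    unfolding \<Phi>_def
    by (intro borel_measurable_torus2I borel_measurable_continuous_onI continuous_intros continuous_on_compose2[OF Hc]) auto
  have Km [measurable]: "(\<lambda>z. indicator K z :: real) \<in> borel_measurable torus2"
    using K by (intro borel_measurable_torus2I borel_measurable_indicator borel_compact)
  have "(\<lambda>j. \<integral>z. f z * of_real (H j (\<Phi> z)) \<partial>torus2) \<longlonglongrightarrow> (\<integral>z. indicator K z *\<^sub>R f z \<partial>torus2)"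
  proof (rule integral_dominated_convergence)
    show "integrable torus2 (\<lambda>z. cmod (f z))" using f by simp
    show "AE z in torus2. (\<lambda>j. f z * of_real (H j (\<Phi> z))) \<longlonglongrightarrow> indicator K z *\<^sub>R f z"
    proof (rule AE_I2)
      fix z assume "z \<in> space torus2"
      then have "(\<lambda>j. f z * of_real (H j (\<Phi> z))) \<longlonglongrightarrow> f z * of_real (indicator K z)"
        by (intro tendsto_intros lim)
      then show "(\<lambda>j. f z * of_real (H j (\<Phi> z))) \<longlonglongrightarrow> indicator K z *\<^sub>R f z"
        by (simp add: scaleR_conv_of_real mult.commute)
    qed
    show "AE z in torus2. norm (f z * of_real (H j (\<Phi> z))) \<le> cmod (f z)" for j
      using H01 by (intro AE_I2) (simp add: norm_mult mult_left_le)
  qed measurable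
  moreover have "(\<integral>z. f z * of_real (H j (\<Phi> z)) \<partial>torus2) = 0" for j
    unfolding \<Phi>_def by (rule integral_orthogonal_continuous[OF f z Hc])
  ultimately show ?thesis by (simp add: LIMSEQ_const_iff)
qed simp

lemma sets_torus2_imp_borel: "A \<in> sets torus2 \<Longrightarrow> A \<in> sets borel"
proof -
  assume "A \<in> sets torus2"
  then have "A \<in> sigma_sets (space torus \<times> space torus) {a \<times> b |a b. a \<in> sets torus \<and> b \<in> sets torus}"
    by (simp add: torus2_def sets_pair_measure)
  then show ?thesis
  proof induction
    case (Basic a)
    then obtain x y where "a = x \<times> y" "x \<in> sets torus" "y \<in> sets torus" by blast
    moreover then have "x \<in> sets borel" "y \<in> sets borel"
      by (auto simp: torus_def sets_restrict_space_iff)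
    ultimately show ?case by (metis borel_prod pair_measureI)
  next
    case (Compl a)
    have "space torus \<times> space torus \<in> sets (borel \<Otimes>\<^sub>M borel :: (real \<times> real) measure)"
      by (intro pair_measureI) (auto simp: torus_def space_restrict_space)
    from sets.Diff[OF this[unfolded borel_prod] Compl.IH] show ?case .
  qed auto
qed

text \<open>The half-open square is not compact, so a closed set is exhausted by its compact parts
  that keep away from the edges at 2 pi. Dynkin's argument, with complements and disjoint unions,
  carries the vanishing from the open sets to all Borel sets.\<close>

lemma integral_orthogonal_borel:
  fixes f :: "real \<times> real \<Rightarrow> complex"
  assumes f: "integrable torus2 f" and z: "\<And>n. fourier_coeff f n = 0" and E: "E \<in> sets borel"
  shows "(\<integral>z. indicator E z *\<^sub>R f z \<partial>torus2) = 0"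
proof -
  let ?m = "\<lambda>E. \<integral>z. indicator E z *\<^sub>R f z \<partial>torus2"
  have [measurable]: "f \<in> borel_measurable torus2" using f by auto
  have im [measurable]: "(\<lambda>z. indicator A z :: real) \<in> borel_measurable torus2" if "A \<in> sets borel" for A
    using that by (intro borel_measurable_torus2I borel_measurable_indicator)
  have int: "integrable torus2 (\<lambda>z. indicator A z *\<^sub>R f z)" if [measurable]: "A \<in> sets borel" for A
    by (rule Bochner_Integration.integrable_bound[OF f]) (use im[OF that] in \<open>auto simp: indicator_def intro!: borel_measurable_scaleR\<close>)
  have closed: "?m C = 0" if C: "closed C" for C
  proof -
    define K where "K j = C \<inter> cbox (0, 0) (2*pi - 1 / real (Suc j), 2*pi - 1 / real (Suc j))" for j
    have K1: "compact (K j)" for j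
      unfolding K_def by (intro closed_Int_compact C compact_cbox)
    have K2: "K j \<subseteq> {0..<2*pi} \<times> {0..<2*pi}" for j
    proof
      fix z assume "z \<in> K j"
      then have "0 \<le> fst z" "fst z \<le> 2*pi - 1 / real (Suc j)" "0 \<le> snd z" "snd z \<le> 2*pi - 1 / real (Suc j)"
        by (auto simp: K_def cbox_Pair_eq mem_Times_iff)
      moreover have "0 < 1 / real (Suc j)" by simp
      ultimately have "0 \<le> fst z" "fst z < 2*pi" "0 \<le> snd z" "snd z < 2*pi" by linarith+
      then show "z \<in> {0..<2*pi} \<times> {0..<2*pi}" by (simp add: mem_Times_iff)
    qed
    note K = K1 K2
    have "(\<lambda>j. ?m (K j)) \<longlonglongrightarrow> ?m C"
    proof (rule integral_dominated_convergence)
      show "integrable torus2 (\<lambda>z. cmod (f z))" using f by simp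
      show "AE z in torus2. (\<lambda>j. indicator (K j) z *\<^sub>R f z) \<longlonglongrightarrow> indicator C z *\<^sub>R f z"
      proof (rule AE_I2)
        fix z assume "z \<in> space torus2"
        then have zz: "0 \<le> fst z" "fst z < 2*pi" "0 \<le> snd z" "snd z < 2*pi" by (auto simp: space_torus2)
        define d where "d = min (2*pi - fst z) (2*pi - snd z)"
        have d: "d > 0" using zz by (simp add: d_def)
        have "\<forall>\<^sub>F j in sequentially. inverse (real (Suc j)) < d"
          using LIMSEQ_inverse_real_of_nat d by (rule order_tendstoD)
        then have "\<forall>\<^sub>F j in sequentially. indicator (K j) z *\<^sub>R f z = indicator C z *\<^sub>R f z"
        proof eventually_elim
          case (elim j)
          then have "fst z \<le> 2*pi - 1 / real (Suc j)" "snd z \<le> 2*pi - 1 / real (Suc j)"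
            by (auto simp: d_def inverse_eq_divide)
          then have "z \<in> K j \<longleftrightarrow> z \<in> C" using zz by (cases z) (auto simp: K_def cbox_Pair_eq)
          then show ?case by (simp add: indicator_def)
        qed
        then show "(\<lambda>j. indicator (K j) z *\<^sub>R f z) \<longlonglongrightarrow> indicator C z *\<^sub>R f z" by (rule tendsto_eventually)
      qed
      show "AE z in torus2. norm (indicator (K j) z *\<^sub>R f z) \<le> cmod (f z)" for j
        by (intro AE_I2) (auto simp: indicator_def)
      show "(\<lambda>z. indicator C z *\<^sub>R f z) \<in> borel_measurable torus2" "\<And>j. (\<lambda>z. indicator (K j) z *\<^sub>R f z) \<in> borel_measurable torus2"
        using im[OF borel_closed[OF C]] im[OF borel_compact[OF K(1)]] by (auto intro!: borel_measurable_scaleR)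
    qed
    moreover have "?m (K j) = 0" for j by (rule integral_orthogonal_compact[OF f z K])
    ultimately show ?thesis by (simp add: LIMSEQ_const_iff)
  qed
  have cmp: "?m (UNIV - A) = 0" if "A \<in> sets borel" "?m A = 0" for A
  proof -
    have "?m UNIV = 0" by (rule closed) simp
    moreover have "?m (UNIV - A) = ?m UNIV - ?m A"
      by (subst Bochner_Integration.integral_diff[symmetric, OF int int]) (auto intro!: Bochner_Integration.integral_cong simp: that indicator_def)
    ultimately show ?thesis using that by simp
  qed
  have "Int_stable {S :: (real \<times> real) set. open S}" "{S. open S} \<subseteq> Pow (UNIV :: (real \<times> real) set)"
    "E \<in> sigma_sets UNIV {S. open S}"
    using E by (auto simp: Int_stable_def sets_borel)
  then show ?thesis
  proof (induction rule: sigma_sets_induct_disjoint)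
    case (basic A)
    then have "?m (UNIV - (UNIV - A)) = 0" by (intro cmp closed) (auto simp: Compl_eq_Diff_UNIV[symmetric])
    then show ?case by (simp add: double_diff)
  next
    case (compl A)
    then show ?case by (intro cmp) (auto simp: sets_borel)
  next
    case (union A)
    have A: "A i \<in> sets borel" for i using union(2) by (auto simp: sets_borel)
    have "(\<lambda>k. \<Sum>i<k. ?m (A i)) \<longlonglongrightarrow> ?m (\<Union>i. A i)"
    proof -
      have "(\<lambda>k. \<integral>z. indicator (\<Union>i<k. A i) z *\<^sub>R f z \<partial>torus2) \<longlonglongrightarrow> ?m (\<Union>i. A i)"
      proof (rule integral_dominated_convergence)
        show "integrable torus2 (\<lambda>z. cmod (f z))" using f by simp
        show "AE z in torus2. (\<lambda>k. indicator (\<Union>i<k. A i) z *\<^sub>R f z) \<longlonglongrightarrow> indicator (\<Union>i. A i) z *\<^sub>R f z"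
          by (intro AE_I2 tendsto_intros LIMSEQ_indicator_UN)
        show "AE z in torus2. norm (indicator (\<Union>i<k. A i) z *\<^sub>R f z) \<le> cmod (f z)" for k
          by (intro AE_I2) (auto simp: indicator_def)
        show "(\<lambda>z. indicator (\<Union>i. A i) z *\<^sub>R f z) \<in> borel_measurable torus2" "\<And>k. (\<lambda>z. indicator (\<Union>i<k. A i) z *\<^sub>R f z) \<in> borel_measurable torus2"
          using A by (auto intro!: borel_measurable_scaleR im)
      qed
      moreover have "(\<integral>z. indicator (\<Union>i<k. A i) z *\<^sub>R f z \<partial>torus2) = (\<Sum>i<k. ?m (A i))" for k
      proof -
        have "indicator (\<Union>i<k. A i) z = (\<Sum>i<k. indicator (A i) z :: real)" for z
          by (rule indicator_UN_disjoint) (use union(1) in \<open>auto simp: disjoint_family_on_def\<close>)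
        then show ?thesis
          unfolding scaleR_sum_left by (subst Bochner_Integration.integral_sum[symmetric, OF int[OF A]]) (simp only: scaleR_sum_left)
      qed
      ultimately show ?thesis by simp
    qed
    then show ?case using union(3) by (simp add: LIMSEQ_const_iff)
  qed simp
qed

text \<open>The integrals of \<open>f\<close> over all measurable sets vanish, so its real and
  imaginary parts are densities that agree with 0 almost everywhere.\<close>

theorem fourier_uniqueness:
  fixes f :: "real \<times> real \<Rightarrow> complex"
  assumes f: "integrable torus2 f" and z: "\<And>n. fourier_coeff f n = 0"
  shows "AE z in torus2. f z = 0"
proof -
  have 0: "(\<integral>z. indicator A z *\<^sub>R f z \<partial>torus2) = 0" if "A \<in> sets torus2" for A
    by (rule integral_orthogonal_borel[OF f z sets_torus2_imp_borel[OF that]])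
  have int: "integrable torus2 (\<lambda>z. indicator A z *\<^sub>R f z)" if "A \<in> sets torus2" for A
    using that f by (rule integrable_mult_indicator)
  have "AE z in torus2. Re (f z) = 0"
  proof (rule density_unique_real)
    fix A assume A: "A \<in> sets torus2"
    show "(LINT z:A|torus2. Re (f z)) = (LINT z:A|torus2. 0)"
      using integral_Re[OF int[OF A]] 0[OF A] by (simp add: set_lebesgue_integral_def)
  qed (use f in auto)
  moreover have "AE z in torus2. Im (f z) = 0"
  proof (rule density_unique_real)
    fix A assume A: "A \<in> sets torus2"
    show "(LINT z:A|torus2. Im (f z)) = (LINT z:A|torus2. 0)"
      using integral_Im[OF int[OF A]] 0[OF A] by (simp add: set_lebesgue_integral_def)
  qed (use f in auto)
  ultimately show ?thesis by eventually_elim (simp add: complex_eq_iff)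
qed

section \<open>Hoelder paths\<close>

lemma propagator_cis: "propagator \<alpha> t c n = cis (- (t * omega \<alpha> n)) * c n"
  by (cases n) (simp add: propagator_def omega_def cis_conv_exp)

lemma hb_propagator [simp]: "hb s (propagator \<alpha> t c) M \<longleftrightarrow> hb s c M"
  by (simp add: hb_def propagator_cis norm_mult)

lemma tpoly_propagator: "tpoly K (propagator \<alpha> t \<phi>) z = wave \<alpha> (fbox K) \<phi> t z"
  by (simp add: tpoly_def wave_def propagator_cis mult_ac)

text \<open>The function S(t) a(t) of time and space. \<open>lim\<close> gives it a value at every
  point, but that value is meaningful only almost everywhere.\<close>

definition U :: "real \<Rightarrow> (real \<Rightarrow> int \<times> int \<Rightarrow> complex) \<Rightarrow> real \<times> real \<times> real \<Rightarrow> complex" where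
  "U \<alpha> a w = synth (propagator \<alpha> (fst w) (a (fst w))) (snd w)"

lemma U_eq_lim: "U \<alpha> a w = lim (\<lambda>j. wave \<alpha> (fbox (2 ^ j)) (a (fst w)) (fst w) (snd w))"
  by (simp add: U_def synth_def tpoly_propagator)

lemma U_measurable:
  assumes "\<And>n. continuous_on {p..q} (\<lambda>t. a t n)"
  shows "U \<alpha> a \<in> borel_measurable (PT p q)"
  unfolding U_eq_lim[abs_def]
  by (intro borel_measurable_lim_metric wave_measurable_cont assms)

lemma U_AE:
  assumes c: "\<And>n. continuous_on {p..q} (\<lambda>t. a t n)" and s: "0 < s"
    and h: "\<And>t. t \<in> {p..q} \<Longrightarrow> \<exists>M. hb s (a t) M"
  shows "AE w in PT p q. (\<lambda>j. wave \<alpha> (fbox (2 ^ j)) (a (fst w)) (fst w) (snd w)) \<longlonglongrightarrow> U \<alpha> a w"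
proof -
  interpret pair_sigma_finite "TI p q" torus2 ..
  let ?V = "\<lambda>j w. wave \<alpha> (fbox (2 ^ j)) (a (fst w)) (fst w) (snd w)"
  have [measurable]: "?V j \<in> borel_measurable (PT p q)" for j by (intro wave_measurable_cont c)
  \<comment> \<open>The Cauchy property is used because the set where it holds is measurable without
    reference to the limit, as Fubini's theorem requires.\<close>
  have "AE w in TI p q \<Otimes>\<^sub>M torus2. Cauchy (\<lambda>j. ?V j w)"
  proof (rule AE_pair_measure)
    have "{w \<in> space (PT p q). Cauchy (\<lambda>j. ?V j w)} \<in> sets (PT p q)" by measurable
    then show "{w \<in> space (TI p q \<Otimes>\<^sub>M torus2). Cauchy (\<lambda>j. ?V j w)} \<in> sets (TI p q \<Otimes>\<^sub>M torus2)"
      by (simp add: PT_def)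
    show "AE t in TI p q. AE z in torus2. Cauchy (\<lambda>j. ?V j (t, z))"
    proof (rule AE_I2)
      fix t assume "t \<in> space (TI p q)"
      then obtain M where "hb s (a t) M" using h by (auto simp: space_TI)
      then have "AE z in torus2. (\<lambda>j. tpoly (2 ^ j) (propagator \<alpha> t (a t)) z) \<longlonglongrightarrow> synth (propagator \<alpha> t (a t)) z"
        by (intro synth_AE[OF _ s]) simp
      then show "AE z in torus2. Cauchy (\<lambda>j. ?V j (t, z))"
        by eventually_elim (simp add: tpoly_propagator LIMSEQ_imp_Cauchy)
    qed
  qed
  then show ?thesis unfolding PT_def[symmetric] U_eq_lim
    by eventually_elim (simp add: Cauchy_convergent_iff convergent_LIMSEQ_iff)
qed

text \<open>One constant serves for the supremum and for the Hoelder seminorm, so the least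
  admissible \<open>M\<close> is a norm. Unlike in \<open>hpair\<close>, increments are not
  rescaled, so restriction to a subinterval keeps the constant.\<close>

definition hpath :: "real \<Rightarrow> real \<Rightarrow> real \<Rightarrow> (real \<Rightarrow> int \<times> int \<Rightarrow> complex) \<Rightarrow> real \<Rightarrow> bool" where
  "hpath s p q a M \<longleftrightarrow> 0 \<le> M \<and> (\<forall>t\<in>{p..q}. hb s (a t) M) \<and>
     (\<forall>t\<in>{p..q}. \<forall>t'\<in>{p..q}. hb s (\<lambda>n. a t n - a t' n) (M * \<bar>t - t'\<bar> powr (3/8)))"

lemma holder_continuous_on:
  fixes f :: "real \<Rightarrow> 'a :: real_normed_vector"
  assumes "\<And>t t'. t \<in> S \<Longrightarrow> t' \<in> S \<Longrightarrow> norm (f t - f t') \<le> M * \<bar>t - t'\<bar> powr \<gamma>" and "0 < \<gamma>"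
  shows "continuous_on S f"
  unfolding continuous_on
proof
  fix t assume t: "t \<in> S"
  have "((\<lambda>x. f x - f t) \<longlongrightarrow> 0) (at t within S)"
  proof (rule Lim_null_comparison)
    show "\<forall>\<^sub>F x in at t within S. norm (f x - f t) \<le> M * \<bar>x - t\<bar> powr \<gamma>"
      unfolding eventually_at_filter using assms(1) t by (intro always_eventually) auto
    have "((\<lambda>x. \<bar>x - t\<bar>) \<longlongrightarrow> \<bar>t - t\<bar>) (at t within S)" by (intro tendsto_intros)
    then have "((\<lambda>x. \<bar>x - t\<bar> powr \<gamma>) \<longlongrightarrow> 0) (at t within S)"
      by (intro tendsto_zero_powrI[where b = \<gamma>]) (use assms(2) in auto)
    then show "((\<lambda>x. M * \<bar>x - t\<bar> powr \<gamma>) \<longlongrightarrow> 0) (at t within S)" by (rule tendsto_mult_right_zero)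
  qed
  then show "(f \<longlongrightarrow> f t) (at t within S)" by (simp add: LIM_zero_iff)
qed

lemma hpath_continuous:
  assumes "hpath s p q a M" "0 \<le> s"
  shows "continuous_on {p..q} (\<lambda>t. a t n)"
proof (rule holder_continuous_on)
  show "norm (a t n - a t' n) \<le> M * \<bar>t - t'\<bar> powr (3/8)" if "t \<in> {p..q}" "t' \<in> {p..q}" for t t'
    using assms that by (intro hb_component[where s = s]) (auto simp: hpath_def)
qed simp

lemma hpath_hb: "hpath s p q a M \<Longrightarrow> t \<in> {p..q} \<Longrightarrow> hb s (a t) M"
  by (auto simp: hpath_def)

lemma hpath_nonneg: "hpath s p q a M \<Longrightarrow> 0 \<le> M"
  by (auto simp: hpath_def)

lemma hpath_subinterval: "hpath s p q a M \<Longrightarrow> {p'..q'} \<subseteq> {p..q} \<Longrightarrow> hpath s p' q' a M"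
  unfolding hpath_def by blast

lemma hpath_restrict: "hpath s p q a M \<Longrightarrow> hpath s p q (\<lambda>t n. if n \<in> S then a t n else 0) M"
proof -
  assume a: "hpath s p q a M"
  have "hb s (\<lambda>n. (if n \<in> S then a t n else 0) - (if n \<in> S then a t' n else 0)) (M * \<bar>t - t'\<bar> powr (3/8))"
    if "t \<in> {p..q}" "t' \<in> {p..q}" for t t'
    by (rule hb_cong_cmod[of s "\<lambda>n. a t n - a t' n"]) (use a that in \<open>auto simp: hpath_def\<close>)
  moreover have "hb s (\<lambda>n. if n \<in> S then a t n else 0) M" if "t \<in> {p..q}" for t
    by (rule hb_cong_cmod[of s "a t"]) (use a that in \<open>auto simp: hpath_def\<close>)
  ultimately show ?thesis using a by (auto simp: hpath_def)
qed

lemma powr_3_8_square: "((x::real) powr (3/8))\<^sup>2 = x powr (3/4)"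
  by (simp add: power2_eq_square powr_add[symmetric])

text \<open>On an interval of length at most 1 the plain Hoelder condition implies the rescaled one,
  so truncations to boxes form an \<open>hpair\<close>. The constant does not depend on the box, and
  Fatou's lemma carries the bound over to the full series.\<close>

lemma bilinear_family:
  assumes \<alpha>: "\<alpha> < 0" and s: "s > 1 / 4"
  obtains C where "C > 0" and "\<And>(J :: nat set) p q a b A B. \<lbrakk>finite J; p < q; q - p \<le> 1; 0 \<le> A;
      \<And>i t. i \<in> J \<Longrightarrow> t \<in> {p..q} \<Longrightarrow> \<exists>K. hb s (a i t) K;
      \<And>t F. t \<in> {p..q} \<Longrightarrow> finite F \<Longrightarrow> (\<Sum>i\<in>J. \<Sum>n\<in>F. (cmod (a i t n))\<^sup>2) \<le> A;
      \<And>t t' F. t \<in> {p..q} \<Longrightarrow> t' \<in> {p..q} \<Longrightarrow> finite F \<Longrightarrow> (\<Sum>i\<in>J. \<Sum>n\<in>F. (cmod (a i t n - a i t' n))\<^sup>2) \<le> A * \<bar>t - t'\<bar> powr (3/4);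
      \<And>i. i \<in> J \<Longrightarrow> hpath s p q (b i) B\<rbrakk> \<Longrightarrow>
    (\<Sum>i\<in>J. \<integral>\<^sup>+w. ennreal ((cmod (U \<alpha> (a i) w * U \<alpha> (b i) w))\<^sup>2) \<partial>PT p q) \<le> ennreal (C * sqrt (q - p) * A * B\<^sup>2)"
proof -
  obtain C where C: "C > 0" and bil: "\<And>J F G p q a b A M. \<lbrakk>finite J; finite F; finite G; hpair s J F G p q a b A M\<rbrakk> \<Longrightarrow>
    bilinear_sum \<alpha> J F G p q a b \<le> ennreal (C * sqrt (q - p) * A * M)"
    using bilinear_holder[OF \<alpha> s] by blast
  show thesis
  proof (rule that[OF C])
    fix J :: "nat set" and p q :: real and a b :: "nat \<Rightarrow> real \<Rightarrow> int \<times> int \<Rightarrow> complex" and A B :: real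
    assume J: "finite J" and pq: "p < q" "q - p \<le> 1" and A: "0 \<le> A"
      and h0: "\<And>i t. i \<in> J \<Longrightarrow> t \<in> {p..q} \<Longrightarrow> \<exists>K. hb s (a i t) K"
      and h1: "\<And>t F. t \<in> {p..q} \<Longrightarrow> finite F \<Longrightarrow> (\<Sum>i\<in>J. \<Sum>n\<in>F. (cmod (a i t n))\<^sup>2) \<le> A"
      and h2: "\<And>t t' F. t \<in> {p..q} \<Longrightarrow> t' \<in> {p..q} \<Longrightarrow> finite F \<Longrightarrow> (\<Sum>i\<in>J. \<Sum>n\<in>F. (cmod (a i t n - a i t' n))\<^sup>2) \<le> A * \<bar>t - t'\<bar> powr (3/4)"
      and b: "\<And>i. i \<in> J \<Longrightarrow> hpath s p q (b i) B"
    have s0: "0 < s" using s by simp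
    have ca: "continuous_on {p..q} (\<lambda>t. a i t n)" if i: "i \<in> J" for i n
    proof (rule holder_continuous_on)
      fix t t' assume t: "t \<in> {p..q}" "t' \<in> {p..q}"
      have "(cmod (a i t n - a i t' n))\<^sup>2 \<le> (\<Sum>i\<in>J. (cmod (a i t n - a i t' n))\<^sup>2)"
        using J i by (intro member_le_sum) auto
      also have "\<dots> \<le> A * \<bar>t - t'\<bar> powr (3/4)" using h2[OF t, of "{n}"] by simp
      also have "\<dots> = (sqrt A * \<bar>t - t'\<bar> powr (3/8))\<^sup>2" using A by (simp add: power_mult_distrib powr_3_8_square)
      finally show "norm (a i t n - a i t' n) \<le> sqrt A * \<bar>t - t'\<bar> powr (3/8)"
        by (rule power2_le_imp_le) (use A in simp)
    qed simp
    have cb: "continuous_on {p..q} (\<lambda>t. b i t n)" if i: "i \<in> J" for i n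
      using hpath_continuous[OF b[OF i]] s0 by simp
    let ?W = "\<lambda>j a w. wave \<alpha> (fbox (2 ^ j)) (a (fst w)) (fst w) (snd w)"
    have [measurable]: "?W j (a i) \<in> borel_measurable (PT p q)" "?W j (b i) \<in> borel_measurable (PT p q)" if "i \<in> J" for i j
      using that by (auto intro!: wave_measurable_cont ca cb)
    have [measurable]: "U \<alpha> (a i) \<in> borel_measurable (PT p q)" "U \<alpha> (b i) \<in> borel_measurable (PT p q)" if "i \<in> J" for i
      using that by (auto intro!: U_measurable ca cb)
    have rescale: "\<bar>t - t'\<bar> powr (3/4) \<le> (\<bar>t - t'\<bar> / (q - p)) powr (3/4)" for t t'
    proof (intro powr_mono2)
      have "\<bar>t - t'\<bar> * (q - p) \<le> \<bar>t - t'\<bar> * 1" using pq by (intro mult_left_mono) auto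
      then show "\<bar>t - t'\<bar> \<le> \<bar>t - t'\<bar> / (q - p)" using pq by (simp add: pos_le_divide_eq)
    qed auto
    have H: "hpair s J (fbox K) (fbox K) p q a b A (B\<^sup>2)" for K
      unfolding hpair_def
    proof (intro conjI ballI)
      fix t t' assume t: "t \<in> {p..q}" "t' \<in> {p..q}"
      show "(\<Sum>i\<in>J. \<Sum>n\<in>fbox K. (cmod (a i t n - a i t' n))\<^sup>2) \<le> A * (\<bar>t - t'\<bar> / (q - p)) powr (3/4)"
        using h2[OF t finite_fbox] mult_left_mono[OF rescale A] by (rule order.trans)
      fix i assume i: "i \<in> J"
      have "(\<Sum>n\<in>fbox K. sobolev_weight s n * (cmod (b i t n - b i t' n))\<^sup>2) \<le> (B * \<bar>t - t'\<bar> powr (3/8))\<^sup>2"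
        using b[OF i] t by (intro hbD[where c = "\<lambda>n. b i t n - b i t' n"]) (auto simp: hpath_def)
      also have "\<dots> \<le> B\<^sup>2 * (\<bar>t - t'\<bar> / (q - p)) powr (3/4)"
        unfolding power_mult_distrib powr_3_8_square by (intro mult_left_mono rescale) auto
      finally show "(\<Sum>n\<in>fbox K. sobolev_weight s n * (cmod (b i t n - b i t' n))\<^sup>2) \<le> B\<^sup>2 * (\<bar>t - t'\<bar> / (q - p)) powr (3/4)" .
    next
      fix t i assume "t \<in> {p..q}" "i \<in> J"
      then show "(\<Sum>n\<in>fbox K. sobolev_weight s n * (cmod (b i t n))\<^sup>2) \<le> B\<^sup>2"
        by (intro hbD hpath_hb[OF b]) auto
    qed (use pq A ca cb h1 in auto)
    have "(\<Sum>i\<in>J. \<integral>\<^sup>+w. ennreal ((cmod (U \<alpha> (a i) w * U \<alpha> (b i) w))\<^sup>2) \<partial>PT p q)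
      = (\<integral>\<^sup>+w. (\<Sum>i\<in>J. ennreal ((cmod (U \<alpha> (a i) w * U \<alpha> (b i) w))\<^sup>2)) \<partial>PT p q)"
      by (subst nn_integral_sum) auto
    also have "\<dots> \<le> ennreal (C * sqrt (q - p) * A * B\<^sup>2)"
    proof (rule fatou_bound[where k = 0])
      show "(\<lambda>w. \<Sum>i\<in>J. ennreal ((cmod (?W j (a i) w * ?W j (b i) w))\<^sup>2)) \<in> borel_measurable (PT p q)" for j
        by (intro borel_measurable_sum) measurable
      have "AE w in PT p q. \<forall>i\<in>J. (\<lambda>j. ?W j (a i) w) \<longlonglongrightarrow> U \<alpha> (a i) w"
        by (intro AE_finite_allI[OF J] U_AE[OF ca s0 h0])
      moreover have "AE w in PT p q. \<forall>i\<in>J. (\<lambda>j. ?W j (b i) w) \<longlonglongrightarrow> U \<alpha> (b i) w"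
        by (intro AE_finite_allI[OF J] U_AE[OF cb s0]) (auto intro!: exI hpath_hb[OF b])
      ultimately show "AE w in PT p q. (\<lambda>j. \<Sum>i\<in>J. ennreal ((cmod (?W j (a i) w * ?W j (b i) w))\<^sup>2)) \<longlonglongrightarrow> (\<Sum>i\<in>J. ennreal ((cmod (U \<alpha> (a i) w * U \<alpha> (b i) w))\<^sup>2))"
        by eventually_elim (intro tendsto_sum tendsto_ennrealI tendsto_intros, auto)
      fix j
      have "(\<integral>\<^sup>+w. (\<Sum>i\<in>J. ennreal ((cmod (?W j (a i) w * ?W j (b i) w))\<^sup>2)) \<partial>PT p q) = bilinear_sum \<alpha> J (fbox (2 ^ j)) (fbox (2 ^ j)) p q a b"
        unfolding bilinear_sum_def by (rule nn_integral_sum) measurable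
      also have "\<dots> \<le> ennreal (C * sqrt (q - p) * A * B\<^sup>2)" by (intro bil J finite_fbox H)
      finally show "(\<integral>\<^sup>+w. (\<Sum>i\<in>J. ennreal ((cmod (?W j (a i) w * ?W j (b i) w))\<^sup>2)) \<partial>PT p q) \<le> ennreal (C * sqrt (q - p) * A * B\<^sup>2)" .
    qed
    finally show "(\<Sum>i\<in>J. \<integral>\<^sup>+w. ennreal ((cmod (U \<alpha> (a i) w * U \<alpha> (b i) w))\<^sup>2) \<partial>PT p q) \<le> ennreal (C * sqrt (q - p) * A * B\<^sup>2)" .
  qed
qed

lemma U_L2:
  assumes a: "hpath s p q a M" and s: "0 < s" and pq: "p \<le> q"
  shows "(\<integral>\<^sup>+w. ennreal ((cmod (U \<alpha> a w))\<^sup>2) \<partial>PT p q) \<le> ennreal ((2*pi)\<^sup>2 * M\<^sup>2 * (q - p))"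
proof -
  have [measurable]: "U \<alpha> a \<in> borel_measurable (PT p q)"
    using hpath_continuous[OF a] s by (intro U_measurable) simp
  have "(\<integral>\<^sup>+w. ennreal ((cmod (U \<alpha> a w))\<^sup>2) \<partial>PT p q) = (\<integral>\<^sup>+t. \<integral>\<^sup>+z. ennreal ((cmod (U \<alpha> a (t, z)))\<^sup>2) \<partial>torus2 \<partial>TI p q)"
    by (rule nn_integral_PT) measurable
  also have "\<dots> \<le> (\<integral>\<^sup>+t. ennreal ((2*pi)\<^sup>2 * M\<^sup>2) \<partial>TI p q)"
  proof (rule nn_integral_mono)
    fix t assume "t \<in> space (TI p q)"
    then have "hb s (propagator \<alpha> t (a t)) M" using hpath_hb[OF a] by (simp add: space_TI)
    then show "(\<integral>\<^sup>+z. ennreal ((cmod (U \<alpha> a (t, z)))\<^sup>2) \<partial>torus2) \<le> ennreal ((2*pi)\<^sup>2 * M\<^sup>2)"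
      unfolding U_def fst_conv snd_conv by (rule synth_L2[OF _ s])
  qed
  also have "\<dots> = ennreal ((2*pi)\<^sup>2 * M\<^sup>2 * (q - p))"
    using pq by (simp add: TI_def emeasure_restrict_space space_restrict_space ennreal_mult[symmetric])
  finally show ?thesis .
qed

text \<open>Almost everywhere only: where partial sums diverge, \<open>lim\<close> is an arbitrary
  value and need not be additive.\<close>

lemma U_add_AE:
  assumes a: "\<And>n. continuous_on {p..q} (\<lambda>t. a t n)" "\<And>t. t \<in> {p..q} \<Longrightarrow> \<exists>M. hb s (a t) M"
    and b: "\<And>n. continuous_on {p..q} (\<lambda>t. b t n)" "\<And>t. t \<in> {p..q} \<Longrightarrow> \<exists>M. hb s (b t) M"
    and s: "0 < s"
  shows "AE w in PT p q. U \<alpha> (\<lambda>t n. a t n + b t n) w = U \<alpha> a w + U \<alpha> b w"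
proof -
  have c: "\<And>n. continuous_on {p..q} (\<lambda>t. a t n + b t n)" by (intro continuous_intros a b)
  have h: "\<exists>M. hb s (\<lambda>n. a t n + b t n) M" if "t \<in> {p..q}" for t
    using a(2)[OF that] b(2)[OF that] hb_add by blast
  have "AE w in PT p q. (\<lambda>j. wave \<alpha> (fbox (2 ^ j)) (a (fst w)) (fst w) (snd w)) \<longlonglongrightarrow> U \<alpha> a w"
    by (rule U_AE[OF a(1) s a(2)])
  moreover have "AE w in PT p q. (\<lambda>j. wave \<alpha> (fbox (2 ^ j)) (b (fst w)) (fst w) (snd w)) \<longlonglongrightarrow> U \<alpha> b w"
    by (rule U_AE[OF b(1) s b(2)])
  moreover have "AE w in PT p q. (\<lambda>j. wave \<alpha> (fbox (2 ^ j)) (\<lambda>n. a (fst w) n + b (fst w) n) (fst w) (snd w)) \<longlonglongrightarrow> U \<alpha> (\<lambda>t n. a t n + b t n) w"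
    by (rule U_AE[OF c s h])
  ultimately show ?thesis
  proof eventually_elim
    case (elim w)
    have e: "wave \<alpha> F (\<lambda>n. a (fst w) n + b (fst w) n) t z = wave \<alpha> F (a (fst w)) t z + wave \<alpha> F (b (fst w)) t z" for F t z
      by (simp add: wave_def distrib_right sum.distrib)
    show ?case
      by (rule LIMSEQ_unique[OF elim(3)]) (simp only: e, intro tendsto_add elim)
  qed
qed

lemma U_scale_AE:
  assumes a: "\<And>n. continuous_on {p..q} (\<lambda>t. a t n)" "\<And>t. t \<in> {p..q} \<Longrightarrow> \<exists>M. hb s (a t) M"
    and s: "0 < s"
  shows "AE w in PT p q. U \<alpha> (\<lambda>t n. k * a t n) w = k * U \<alpha> a w"
proof -
  have c: "\<And>n. continuous_on {p..q} (\<lambda>t. k * a t n)" by (intro continuous_intros a)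
  have h: "\<exists>M. hb s (\<lambda>n. k * a t n) M" if "t \<in> {p..q}" for t
    using a(2)[OF that] hb_scale by blast
  have "AE w in PT p q. (\<lambda>j. wave \<alpha> (fbox (2 ^ j)) (a (fst w)) (fst w) (snd w)) \<longlonglongrightarrow> U \<alpha> a w"
    by (rule U_AE[OF a(1) s a(2)])
  moreover have "AE w in PT p q. (\<lambda>j. wave \<alpha> (fbox (2 ^ j)) (\<lambda>n. k * a (fst w) n) (fst w) (snd w)) \<longlonglongrightarrow> U \<alpha> (\<lambda>t n. k * a t n) w"
    by (rule U_AE[OF c s h])
  ultimately show ?thesis
  proof eventually_elim
    case (elim w)
    have e: "wave \<alpha> F (\<lambda>n. k * a (fst w) n) t z = k * wave \<alpha> F (a (fst w)) t z" for F t z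
      by (simp add: wave_def sum_distrib_left mult.assoc)
    show ?case
      by (rule LIMSEQ_unique[OF elim(2)]) (simp only: e, intro tendsto_mult tendsto_const elim)
  qed
qed

text \<open>With finitely many frequencies the partial sums are eventually constant, so the identity
  holds at every point and not just almost everywhere.\<close>

lemma synth_finite_support:
  assumes L: "finite L" and c: "\<And>n. n \<notin> L \<Longrightarrow> c n = 0"
  shows "synth c z = (\<Sum>n\<in>L. c n * chr n z)"
proof -
  have "\<exists>k. \<forall>n\<in>L. \<forall>j\<ge>k. n \<in> fbox (2 ^ j)"
  proof -
    obtain f where f: "\<And>n. n \<in> fbox (2 ^ f n)" using mem_fbox_pow by metis
    show ?thesis
    proof (intro exI[of _ "Max (insert 0 (f ` L))"] ballI allI impI)
      fix n j assume n: "n \<in> L" and j: "Max (insert 0 (f ` L)) \<le> j"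
      then have "f n \<le> j" using L by (simp add: Max_ge_iff)
      then show "n \<in> fbox (2 ^ j)" using f[of n] fbox_mono[of "2 ^ f n" "2 ^ j"] by (auto simp: power_increasing)
    qed
  qed
  then obtain k where k: "\<And>n j. n \<in> L \<Longrightarrow> k \<le> j \<Longrightarrow> n \<in> fbox (2 ^ j)" by blast
  have "tpoly (2 ^ j) c z = (\<Sum>n\<in>L. c n * chr n z)" if "k \<le> j" for j
    unfolding tpoly_def using k[OF _ that] c by (intro sum.mono_neutral_right) auto
  then have "\<forall>\<^sub>F j in sequentially. tpoly (2 ^ j) c z = (\<Sum>n\<in>L. c n * chr n z)"
    by (auto simp: eventually_sequentially)
  then have "(\<lambda>j. tpoly (2 ^ j) c z) \<longlonglongrightarrow> (\<Sum>n\<in>L. c n * chr n z)" by (rule tendsto_eventually)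
  then show ?thesis unfolding synth_def by (rule limI)
qed

lemma fourier_coeff_sum_chr:
  assumes X: "finite X"
  shows "fourier_coeff (\<lambda>z. \<Sum>x\<in>X. k x * chr (g x) z) n = (\<Sum>x\<in>X. if g x = n then k x else 0)"
proof -
  have "(\<integral>z. (\<Sum>x\<in>X. k x * chr (g x) z) * cnj (chr n z) \<partial>torus2) = (\<integral>z. (\<Sum>x\<in>X. k x * chr (g x - n) z) \<partial>torus2)"
    by (simp add: sum_distrib_right chr_diff mult.assoc)
  also have "\<dots> = (\<Sum>x\<in>X. k x * (if g x = n then of_real ((2*pi)\<^sup>2) else 0))"
    by (simp add: Bochner_Integration.integral_sum chr_integrable integral_chr)
  also have "\<dots> = (\<Sum>x\<in>X. if g x = n then k x else 0) * of_real ((2*pi)\<^sup>2)"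
    unfolding sum_distrib_right by (rule sum.cong) auto
  finally show ?thesis by (simp add: fourier_coeff_chr)
qed

text \<open>A coefficient of the integral of S(-r) G(r) over \<open>{p..q}\<close>, that is, of what
  this time interval contributes to the integral equation in the interaction picture.\<close>

definition ipic :: "real \<Rightarrow> real \<Rightarrow> real \<Rightarrow> (real \<times> real \<times> real \<Rightarrow> complex) \<Rightarrow> int \<times> int \<Rightarrow> complex" where
  "ipic \<alpha> p q G n = (\<integral>r. cis (r * omega \<alpha> n) * fourier_coeff (\<lambda>z. G (r, z)) n \<partial>TI p q)"

lemma cis_omega_measurable [measurable]: "(\<lambda>r. cis (r * omega \<alpha> n)) \<in> borel_measurable (TI p q)"
  by (intro measurable_TI borel_measurable_continuous_onI continuous_intros)

text \<open>Fubini's theorem. The slice of \<open>G\<close> at a single time need not be integrable;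
  its coefficient is then 0 by the convention for integrals, which concerns only a null set of
  times.\<close>

lemma ipic_integrand:
  fixes \<alpha> :: real
  assumes G: "integrable (PT p q) G"
  defines "H \<equiv> \<lambda>n w. cis (fst w * omega \<alpha> n) * (G w * cnj (chr n (snd w)))"
  shows "integrable (PT p q) (H n)"
    and "integrable (TI p q) (\<lambda>r. cis (r * omega \<alpha> n) * fourier_coeff (\<lambda>z. G (r, z)) n)"
    and "ipic \<alpha> p q G n = (\<integral>w. H n w \<partial>PT p q) / of_real ((2*pi)\<^sup>2)"
proof -
  interpret pair_sigma_finite "TI p q" torus2 ..
  have [measurable]: "G \<in> borel_measurable (PT p q)" using G by auto
  show iH: "integrable (PT p q) (H n)"
  proof (rule Bochner_Integration.integrable_bound[OF G])
    have [measurable]: "(\<lambda>w. cis (fst w * omega \<alpha> n)) \<in> borel_measurable (PT p q)"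
      by (rule measurable_compose[OF fst_PT cis_omega_measurable])
    have [measurable]: "(\<lambda>w. chr n (snd w)) \<in> borel_measurable (PT p q)"
      by (rule measurable_compose[OF snd_PT chr_measurable])
    show "H n \<in> borel_measurable (PT p q)" unfolding H_def by measurable
  qed (simp add: H_def norm_mult)
  have e: "cis (r * omega \<alpha> n) * fourier_coeff (\<lambda>z. G (r, z)) n = (\<integral>z. H n (r, z) \<partial>torus2) / of_real ((2*pi)\<^sup>2)" for r
    by (simp add: fourier_coeff_chr H_def)
  have "integrable (TI p q) (\<lambda>r. \<integral>z. H n (r, z) \<partial>torus2)"
    using iH integrable_fst'[of "H n"] by (simp add: PT_def)
  then show "integrable (TI p q) (\<lambda>r. cis (r * omega \<alpha> n) * fourier_coeff (\<lambda>z. G (r, z)) n)"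
    unfolding e by (rule integrable_divide)
  have "(\<integral>r. (\<integral>z. H n (r, z) \<partial>torus2) \<partial>TI p q) = (\<integral>w. H n w \<partial>PT p q)"
    using iH integral_fst'[of "H n"] by (simp add: PT_def)
  then show "ipic \<alpha> p q G n = (\<integral>w. H n w \<partial>PT p q) / of_real ((2*pi)\<^sup>2)"
    unfolding ipic_def e by simp
qed

text \<open>The dual function is the free wave whose profile is \<open>ipic\<close> itself: pairing
  it with \<open>G\<close> reproduces the sum of squares.\<close>

lemma ipic_duality:
  assumes G: "integrable (PT p q) G" and F: "finite F"
  shows "ennreal (\<Sum>n\<in>F. (cmod (ipic \<alpha> p q G n))\<^sup>2)
    \<le> (\<integral>\<^sup>+w. ennreal (cmod (G w)) * ennreal (cmod (wave \<alpha> F (ipic \<alpha> p q G) (fst w) (snd w))) \<partial>PT p q)"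
proof -
  let ?D = "ipic \<alpha> p q G"
  let ?W = "\<lambda>w. wave \<alpha> F ?D (fst w) (snd w)"
  let ?H = "\<lambda>n w. cis (fst w * omega \<alpha> n) * (G w * cnj (chr n (snd w)))"
  let ?S = "\<Sum>n\<in>F. (cmod (?D n))\<^sup>2"
  have W: "cnj (?W w) * G w = (\<Sum>n\<in>F. cnj (?D n) * ?H n w)" for w
    by (simp add: wave_def cnj_sum sum_distrib_left sum_distrib_right cis_cnj mult_ac)
  have "complex_of_real ?S = (\<Sum>n\<in>F. cnj (?D n) * ?D n)"
    by (simp add: complex_norm_square mult.commute del: of_real_power)
  also have "\<dots> = (\<Sum>n\<in>F. cnj (?D n) * (\<integral>w. ?H n w \<partial>PT p q)) / of_real ((2*pi)\<^sup>2)"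
    by (subst ipic_integrand(3)[OF G, of \<alpha>]) (simp add: sum_divide_distrib ipic_integrand(3)[OF G, symmetric])
  also have "(\<Sum>n\<in>F. cnj (?D n) * (\<integral>w. ?H n w \<partial>PT p q)) = (\<integral>w. cnj (?W w) * G w \<partial>PT p q)"
    unfolding W using ipic_integrand(1)[OF G] by (subst Bochner_Integration.integral_sum) auto
  finally have S: "complex_of_real ?S * of_real ((2*pi)\<^sup>2) = (\<integral>w. cnj (?W w) * G w \<partial>PT p q)" by simp
  have "1 \<le> (2*pi)\<^sup>2" using pi_gt3 by (intro one_le_power) simp
  then have "?S * 1 \<le> ?S * (2*pi)\<^sup>2" by (rule mult_left_mono) (simp add: sum_nonneg)
  then have "?S \<le> ?S * (2*pi)\<^sup>2" by simp
  also have "\<dots> = cmod (complex_of_real ?S * of_real ((2*pi)\<^sup>2))"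
    by (simp only: norm_mult norm_of_real) (simp add: sum_nonneg)
  also have "\<dots> = cmod (\<integral>w. cnj (?W w) * G w \<partial>PT p q)" by (simp only: S)
  finally have "ennreal ?S \<le> ennreal (cmod (\<integral>w. cnj (?W w) * G w \<partial>PT p q))" by (rule ennreal_leI)
  also have "\<dots> \<le> (\<integral>\<^sup>+w. ennreal (norm (cnj (?W w) * G w)) \<partial>PT p q)"
    unfolding W by (intro integral_norm_bound_ennreal Bochner_Integration.integrable_sum integrable_mult_right ipic_integrand(1)[OF G])
  also have "\<dots> = (\<integral>\<^sup>+w. ennreal (cmod (G w)) * ennreal (cmod (?W w)) \<partial>PT p q)"
    by (simp add: norm_mult ennreal_mult' mult.commute)
  finally show ?thesis .
qed

section \<open>The trilinear estimate\<close>

text \<open>The maximum norm shifted by one, so that frequency 0 has height 3^0 and belongs to the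
  lowest shell.\<close>

definition hgt :: "int \<times> int \<Rightarrow> nat" where
  "hgt n = 1 + max (nat \<bar>fst n\<bar>) (nat \<bar>snd n\<bar>)"

lemma hgt_triangle: "hgt (n1 - n2 + n3) \<le> hgt n1 + hgt n2 + hgt n3"
proof -
  have le: "nat \<bar>fst n\<bar> + 1 \<le> hgt n" "nat \<bar>snd n\<bar> + 1 \<le> hgt n" for n by (simp_all add: hgt_def)
  have *: "nat \<bar>x - y + z\<bar> \<le> nat \<bar>x\<bar> + nat \<bar>y\<bar> + nat \<bar>z\<bar>" for x y z :: int by linarith
  have "nat \<bar>fst (n1 - n2 + n3)\<bar> + 1 \<le> hgt n1 + hgt n2 + hgt n3"
    using *[of "fst n1" "fst n2" "fst n3"] le(1)[of n1] le(1)[of n2] le(1)[of n3] by simp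
  moreover have "nat \<bar>snd (n1 - n2 + n3)\<bar> + 1 \<le> hgt n1 + hgt n2 + hgt n3"
    using *[of "snd n1" "snd n2" "snd n3"] le(2)[of n1] le(2)[of n2] le(2)[of n3] by simp
  ultimately show ?thesis unfolding hgt_def[of "n1 - n2 + n3"] by (simp add: max_def)
qed

lemma finite_hgt_less: "finite {n. hgt n < K}"
proof (rule finite_subset)
  show "{n. hgt n < K} \<subseteq> fbox K" by (auto simp: hgt_def fbox_def)
qed simp

lemma sobolev_weight_hgt:
  assumes "0 \<le> s"
  shows "sobolev_weight s n \<le> 2 powr s * real (hgt n) powr (2 * s)"
    and "real (hgt n) powr (2 * s) \<le> 2 powr s * sobolev_weight s n"
proof -
  define x y :: real where "x = \<bar>of_int (fst n)\<bar>" and "y = \<bar>of_int (snd n)\<bar>"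
  define h where "h = 1 + max x y"
  have h: "real (hgt n) = h" by (simp add: hgt_def h_def x_def y_def)
  have xy: "0 \<le> x" "0 \<le> y" by (auto simp: x_def y_def)
  then have h0: "0 < h" by (simp add: h_def)
  have w: "sobolev_weight s n = (1 + x\<^sup>2 + y\<^sup>2) powr s"
    by (cases n) (simp add: sobolev_weight_def x_def y_def)
  have hp: "h powr (2 * s) = (h\<^sup>2) powr s" using h0 by (simp add: powr_powr[symmetric] powr_numeral)
  have 1: "1 + x\<^sup>2 + y\<^sup>2 \<le> 2 * h\<^sup>2"
  proof -
    have "x\<^sup>2 \<le> (max x y)\<^sup>2" "y\<^sup>2 \<le> (max x y)\<^sup>2" using xy by (auto intro!: power_mono)
    moreover have "h\<^sup>2 = 1 + 2 * max x y + (max x y)\<^sup>2" by (simp add: h_def power2_sum)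
    ultimately show ?thesis using xy by (smt (verit))
  qed
  have 2: "h\<^sup>2 \<le> 2 * (1 + x\<^sup>2 + y\<^sup>2)"
  proof -
    have "(max x y)\<^sup>2 \<le> x\<^sup>2 + y\<^sup>2" by (simp add: max_def)
    moreover have "h\<^sup>2 = 1 + 2 * max x y + (max x y)\<^sup>2" by (simp add: h_def power2_sum)
    moreover have "2 * max x y \<le> 1 + (max x y)\<^sup>2"
      using zero_le_power2[of "max x y - 1"] by (simp add: power2_diff)
    ultimately show ?thesis by (smt (verit))
  qed
  show "sobolev_weight s n \<le> 2 powr s * real (hgt n) powr (2 * s)"
    unfolding w h hp powr_mult[symmetric] using assms 1 by (intro powr_mono2) (auto simp: add_nonneg_nonneg)
  show "real (hgt n) powr (2 * s) \<le> 2 powr s * sobolev_weight s n"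
    unfolding w h hp powr_mult[symmetric] using assms 2 by (intro powr_mono2) auto
qed

lemma powr_three_power:
  fixes s :: real
  shows "(3 ^ i) powr (2 * s) = (9 powr s) ^ i"
proof -
  have "(3::real) powr (2 * s) = 9 powr s"
    using powr_powr[of 3 2 s] by (simp add: powr_numeral)
  then show ?thesis by (induction i) (simp_all add: powr_mult)
qed

text \<open>9^s accounts for the factor 3 in the condition 3^i \<le> 3 \<open>hgt n\<close>, and 2^s
  for comparing the height with the Sobolev weight. The quotient is a geometric sum of ratio 9^s in
  units of its last term.\<close>

definition level_const :: "real \<Rightarrow> real" where
  "level_const s = 9 powr s * 2 powr s * (9 powr s / (9 powr s - 1))"

text \<open>A frequency counts in all levels i up to about the logarithm of its height in base 3.
  The powers of 9^s over these levels are dominated by the last one, which is comparable to the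
  Sobolev weight.\<close>

lemma level_sum_le:
  assumes s: "0 < s" and J: "finite J"
  shows "(\<Sum>i\<in>J. if 3 ^ i \<le> 3 * hgt n then (9 powr s) ^ i else 0) \<le> level_const s * sobolev_weight s n"
proof -
  define r where "r = 9 powr s"
  have r: "1 < r" using s by (simp add: r_def gr_one_powr)
  define J' where "J' = {i\<in>J. 3 ^ i \<le> 3 * hgt n}"
  have J': "finite J'" using J by (simp add: J'_def)
  have "(\<Sum>i\<in>J. if 3 ^ i \<le> 3 * hgt n then r ^ i else 0) = (\<Sum>i\<in>J'. r ^ i)"
    unfolding J'_def by (rule sum.inter_filter[symmetric, OF J])
  also have "\<dots> \<le> level_const s * sobolev_weight s n"
  proof (cases "J' = {}")
    case True
    then show ?thesis using r less_imp_le[OF sobolev_weight_pos[of s n]] by (simp add: level_const_def r_def)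
  next
    case False
    define m where "m = Max J'"
    have m: "m \<in> J'" using False J' by (simp add: m_def)
    then have m3: "3 ^ m \<le> 3 * hgt n" by (simp add: J'_def)
    have "(\<Sum>i\<in>J'. r ^ i) \<le> (\<Sum>i\<le>m. r ^ i)"
      using r J' by (intro sum_mono2) (auto simp: m_def)
    also have "\<dots> \<le> r ^ m * (r / (r - 1))"
      using r by (simp add: sum_gp0 divide_right_mono field_simps)
    also have "\<dots> \<le> (9 powr s * (2 powr s * sobolev_weight s n)) * (r / (r - 1))"
    proof (rule mult_right_mono)
      have "r ^ m = (3 ^ m) powr (2 * s)" by (simp add: r_def powr_three_power)
      also have "\<dots> \<le> (3 * real (hgt n)) powr (2 * s)"
      proof (rule powr_mono2)
        have "real (3 ^ m) \<le> real (3 * hgt n)" using m3 by (simp only: of_nat_le_iff)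
        then show "(3::real) ^ m \<le> 3 * real (hgt n)" by simp
      qed (use s in auto)
      also have "\<dots> = 9 powr s * real (hgt n) powr (2 * s)"
        using powr_three_power[of 1 s] by (simp add: powr_mult)
      also have "\<dots> \<le> 9 powr s * (2 powr s * sobolev_weight s n)"
        using sobolev_weight_hgt(2)[of s n] s by (intro mult_left_mono) auto
      finally show "r ^ m \<le> 9 powr s * (2 powr s * sobolev_weight s n)" .
    qed (use r in auto)
    finally show ?thesis by (simp add: level_const_def r_def mult_ac)
  qed
  finally show ?thesis unfolding r_def .
qed

definition restr :: "(int \<times> int) set \<Rightarrow> (real \<Rightarrow> int \<times> int \<Rightarrow> complex) \<Rightarrow> real \<Rightarrow> int \<times> int \<Rightarrow> complex" where
  "restr S a t n = (if n \<in> S then a t n else 0)"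

text \<open>The frequencies of height at least 3^(i-1), written without a predecessor; for i = 0
  these are all frequencies.\<close>

definition hiS :: "nat \<Rightarrow> (int \<times> int) set" where
  "hiS i = {n. 3 ^ i \<le> 3 * hgt n}"

definition prod3 :: "real \<Rightarrow> (real \<Rightarrow> int \<times> int \<Rightarrow> complex) \<Rightarrow> (real \<Rightarrow> int \<times> int \<Rightarrow> complex) \<Rightarrow>
    (real \<Rightarrow> int \<times> int \<Rightarrow> complex) \<Rightarrow> real \<times> real \<times> real \<Rightarrow> complex" where
  "prod3 \<alpha> a b c w = U \<alpha> a w * cnj (U \<alpha> b w) * U \<alpha> c w"

lemma hpath_restr: "hpath s p q a M \<Longrightarrow> hpath s p q (restr S a) M"
  unfolding restr_def[abs_def] by (rule hpath_restrict)

text \<open>An output frequency is an alternating sum of three inputs, so inputs of height below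
  3^(i-1) cannot reach height 3^i; hence the powers of 3. The low sets are finite, so the product is
  a trigonometric polynomial and its coefficients can be read off.\<close>

lemma low_product_coeff:
  assumes n: "3 ^ i \<le> hgt n"
  shows "fourier_coeff (\<lambda>z. prod3 \<alpha> (restr (- hiS i) a) (restr (- hiS i) b) (restr (- hiS i) c) (r, z)) n = 0"
proof -
  define L where "L = - hiS i"
  have "L \<subseteq> {n. hgt n < 3 ^ i}" by (auto simp: L_def hiS_def)
  then have L: "finite L" using finite_hgt_less by (rule finite_subset)
  have Lh: "3 * hgt n < 3 ^ i" if "n \<in> L" for n using that by (simp add: L_def hiS_def)
  define f where "f a n = propagator \<alpha> r (restr L a r) n" for a n
  have U: "U \<alpha> (restr L a) (r, z) = (\<Sum>n\<in>L. f a n * chr n z)" for a z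
    unfolding U_def fst_conv snd_conv f_def
    by (rule synth_finite_support[OF L]) (simp add: propagator_cis restr_def)
  define k where "k x = f a (fst x) * cnj (f b (fst (snd x))) * f c (snd (snd x))" for x
  define g where "g x = fst x - fst (snd x) + snd (snd x)" for x :: "(int \<times> int) \<times> (int \<times> int) \<times> (int \<times> int)"
  have "prod3 \<alpha> (restr L a) (restr L b) (restr L c) (r, z) = (\<Sum>x\<in>L \<times> L \<times> L. k x * chr (g x) z)" for z
  proof -
    have "prod3 \<alpha> (restr L a) (restr L b) (restr L c) (r, z)
      = (\<Sum>n1\<in>L. \<Sum>n2\<in>L. \<Sum>n3\<in>L. f a n1 * cnj (f b n2) * f c n3 * chr (n1 - n2 + n3) z)"
      unfolding prod3_def U cnj_sum sum_product sum_distrib_right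
      by (intro sum.cong refl) (simp add: chr_add chr_diff sum_distrib_left mult_ac)
    also have "\<dots> = (\<Sum>x\<in>L \<times> L \<times> L. k x * chr (g x) z)"
      by (simp add: sum.cartesian_product k_def g_def case_prod_beta)
    finally show ?thesis .
  qed
  then have "fourier_coeff (\<lambda>z. prod3 \<alpha> (restr L a) (restr L b) (restr L c) (r, z)) n
     = (\<Sum>x\<in>L \<times> L \<times> L. if g x = n then k x else 0)"
    using fourier_coeff_sum_chr[of "L \<times> L \<times> L" k g n] L by simp
  also have "\<dots> = 0"
  proof (rule sum.neutral, intro ballI)
    fix x assume "x \<in> L \<times> L \<times> L"
    then have x: "fst x \<in> L" "fst (snd x) \<in> L" "snd (snd x) \<in> L" by auto
    have "3 * hgt (g x) < 3 * 3 ^ i"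
      using Lh[OF x(1)] Lh[OF x(2)] Lh[OF x(3)] hgt_triangle[of "fst x" "fst (snd x)" "snd (snd x)"]
      by (simp add: g_def)
    then show "(if g x = n then k x else 0) = 0" using n by auto
  qed
  finally show ?thesis unfolding L_def .
qed

lemma nn_integral_cs:
  fixes f g :: "'a \<Rightarrow> complex"
  assumes [measurable]: "f \<in> borel_measurable M" "g \<in> borel_measurable M"
    and f: "(\<integral>\<^sup>+x. ennreal ((cmod (f x))\<^sup>2) \<partial>M) \<le> ennreal a"
    and g: "(\<integral>\<^sup>+x. ennreal ((cmod (g x))\<^sup>2) \<partial>M) \<le> ennreal b"
    and ab: "0 \<le> a" "0 \<le> b"
  shows "(\<integral>\<^sup>+x. ennreal (cmod (f x)) * ennreal (cmod (g x)) \<partial>M) \<le> ennreal (sqrt (a * b))"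
proof -
  let ?I = "\<integral>\<^sup>+x. ennreal (cmod (f x)) * ennreal (cmod (g x)) \<partial>M"
  have 2: "(ennreal (cmod x))\<^sup>2 = ennreal ((cmod x)\<^sup>2)" for x by (simp add: ennreal_power)
  have "?I\<^sup>2 \<le> (\<integral>\<^sup>+x. (ennreal (cmod (f x)))\<^sup>2 \<partial>M) * (\<integral>\<^sup>+x. (ennreal (cmod (g x)))\<^sup>2 \<partial>M)"
    by (rule Cauchy_Schwarz_nn_integral) measurable
  also have "\<dots> \<le> ennreal a * ennreal b"
    unfolding 2 by (intro mult_mono f g) auto
  also have "\<dots> = ennreal (a * b)" using ab by (simp add: ennreal_mult)
  finally have sq: "?I\<^sup>2 \<le> ennreal (a * b)" .
  show ?thesis
  proof (cases ?I)
    case (real r)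
    then have "r\<^sup>2 \<le> a * b" using sq ab by (simp add: ennreal_power)
    then have "r \<le> sqrt (a * b)" by (rule real_le_rsqrt)
    then show ?thesis unfolding real by (rule ennreal_leI)
  next
    case top
    have "?I\<^sup>2 < top" by (rule le_less_trans[OF sq]) simp
    with top show ?thesis by (simp add: power2_eq_square ennreal_mult_eq_top_iff)
  qed
qed

text \<open>Duality bounds \<open>S\<close> by roots that contain \<open>S\<close> again. The
  arithmetic-geometric mean inequality takes S/6 out of each of the three roots, so half of
  \<open>S\<close> is absorbed on the left.\<close>

lemma absorb_sqrt:
  fixes S u v w :: real
  assumes "S \<le> sqrt (S * u) + sqrt (S * v) + sqrt (S * w)" "0 \<le> S" "0 \<le> u" "0 \<le> v" "0 \<le> w"
  shows "S \<le> 3 * (u + v + w)"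
proof -
  have "6 * sqrt (S * x) \<le> S + 9 * x" if "0 \<le> x" for x
    using arith_geo_mean_sqrt[of "S / 3" "3 * x"] assms(2) that by (simp add: field_simps)
  moreover have "S \<le> 3 * (u + v + w)" if "6 * x \<le> S + 9 * u" "6 * y \<le> S + 9 * v" "6 * z \<le> S + 9 * w" "S \<le> x + y + z" for x y z
  proof -
    have "6 * S \<le> 6 * x + 6 * y + 6 * z" using that(4) by simp
    also have "\<dots> \<le> (S + 9 * u) + (S + 9 * v) + (S + 9 * w)" by (intro add_mono that)
    finally show ?thesis by (simp add: algebra_simps)
  qed
  ultimately show ?thesis using assms by blast
qed

text \<open>
  Families indexed by \<open>J\<close> are needed because the pieces of one path in different frequency levels only
  have a joint \<open>\<ell>\<^sup>2\<close> bound.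
\<close>

locale strichartz =
  fixes \<alpha> s C :: real
  assumes s: "s > 1 / 4" and C: "C > 0"
    and family: "\<And>(J :: nat set) p q a b A B. \<lbrakk>finite J; p < q; q - p \<le> 1; 0 \<le> A;
      \<And>i t. i \<in> J \<Longrightarrow> t \<in> {p..q} \<Longrightarrow> \<exists>K. hb s (a i t) K;
      \<And>t F. t \<in> {p..q} \<Longrightarrow> finite F \<Longrightarrow> (\<Sum>i\<in>J. \<Sum>n\<in>F. (cmod (a i t n))\<^sup>2) \<le> A;
      \<And>t t' F. t \<in> {p..q} \<Longrightarrow> t' \<in> {p..q} \<Longrightarrow> finite F \<Longrightarrow> (\<Sum>i\<in>J. \<Sum>n\<in>F. (cmod (a i t n - a i t' n))\<^sup>2) \<le> A * \<bar>t - t'\<bar> powr (3/4);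
      \<And>i. i \<in> J \<Longrightarrow> hpath s p q (b i) B\<rbrakk> \<Longrightarrow>
    (\<Sum>i\<in>J. \<integral>\<^sup>+w. ennreal ((cmod (U \<alpha> (a i) w * U \<alpha> (b i) w))\<^sup>2) \<partial>PT p q) \<le> ennreal (C * sqrt (q - p) * A * B\<^sup>2)"
begin

section \<open>Products of waves and frequency shells\<close>

lemma s0: "0 < s" "0 \<le> s" using s by auto

lemma U_meas: "hpath s p q a A \<Longrightarrow> U \<alpha> a \<in> borel_measurable (PT p q)"
  using hpath_continuous s0 by (intro U_measurable) auto

lemma bilinear:
  assumes pq: "p < q" "q - p \<le> 1" and a: "hpath s p q a A" and b: "hpath s p q b B"
  shows "(\<integral>\<^sup>+w. ennreal ((cmod (U \<alpha> a w * U \<alpha> b w))\<^sup>2) \<partial>PT p q) \<le> ennreal (C * sqrt (q - p) * A\<^sup>2 * B\<^sup>2)"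
proof -
  have "(\<Sum>i\<in>{0::nat}. \<integral>\<^sup>+w. ennreal ((cmod (U \<alpha> a w * U \<alpha> b w))\<^sup>2) \<partial>PT p q) \<le> ennreal (C * sqrt (q - p) * A\<^sup>2 * B\<^sup>2)"
  proof (rule family[OF _ pq])
    fix t and F :: "(int \<times> int) set" assume t: "t \<in> {p..q}" and F: "finite F"
    show "(\<Sum>i\<in>{0::nat}. \<Sum>n\<in>F. (cmod (a t n))\<^sup>2) \<le> A\<^sup>2"
      using hbD[OF hb_0_of_hb[OF s0(2) hpath_hb[OF a t]] F] by simp
  next
    fix t t' and F :: "(int \<times> int) set" assume t: "t \<in> {p..q}" "t' \<in> {p..q}" and F: "finite F"
    have "hb s (\<lambda>n. a t n - a t' n) (A * \<bar>t - t'\<bar> powr (3/8))" using a t by (auto simp: hpath_def)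
    from hbD[OF hb_0_of_hb[OF s0(2) this] F]
    show "(\<Sum>i\<in>{0::nat}. \<Sum>n\<in>F. (cmod (a t n - a t' n))\<^sup>2) \<le> A\<^sup>2 * \<bar>t - t'\<bar> powr (3/4)"
      by (simp add: power_mult_distrib powr_3_8_square)
  qed (use a b hpath_hb[OF a] in auto)
  then show ?thesis by simp
qed

lemma prod3_measurable:
  assumes "hpath s p q a A" "hpath s p q b B" "hpath s p q c D"
  shows "prod3 \<alpha> a b c \<in> borel_measurable (PT p q)"
  unfolding prod3_def[abs_def]
  by (intro borel_measurable_times borel_measurable_cnj U_meas[OF assms(1)] U_meas[OF assms(2)] U_meas[OF assms(3)])

text \<open>The product of two of the waves and the third wave are both square integrable over time
  and space.\<close>

lemma prod3_integrable:
  assumes pq: "p < q" "q - p \<le> 1" and a: "hpath s p q a A" and b: "hpath s p q b B" and c: "hpath s p q c D"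
  shows "integrable (PT p q) (prod3 \<alpha> a b c)"
proof (rule integrableI_bounded)
  note [measurable] = U_meas[OF a] U_meas[OF b] U_meas[OF c]
  show "prod3 \<alpha> a b c \<in> borel_measurable (PT p q)" by (rule prod3_measurable[OF a b c])
  have "(\<integral>\<^sup>+w. ennreal (norm (prod3 \<alpha> a b c w)) \<partial>PT p q)
    \<le> (\<integral>\<^sup>+w. ennreal ((cmod (U \<alpha> a w * U \<alpha> b w))\<^sup>2) + ennreal ((cmod (U \<alpha> c w))\<^sup>2) \<partial>PT p q)"
  proof (rule nn_integral_mono)
    fix w
    let ?x = "cmod (U \<alpha> a w * U \<alpha> b w)" and ?y = "cmod (U \<alpha> c w)"
    have "0 \<le> (?x - ?y)\<^sup>2" by simp
    then have "2 * (?x * ?y) \<le> ?x\<^sup>2 + ?y\<^sup>2" by (simp add: power2_diff)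
    moreover have "0 \<le> ?x * ?y" by simp
    ultimately have "?x * ?y \<le> ?x\<^sup>2 + ?y\<^sup>2" by linarith
    then show "ennreal (norm (prod3 \<alpha> a b c w)) \<le> ennreal (?x\<^sup>2) + ennreal (?y\<^sup>2)"
      by (simp add: prod3_def norm_mult ennreal_plus[symmetric] del: ennreal_plus)
  qed
  also have "\<dots> = (\<integral>\<^sup>+w. ennreal ((cmod (U \<alpha> a w * U \<alpha> b w))\<^sup>2) \<partial>PT p q) + (\<integral>\<^sup>+w. ennreal ((cmod (U \<alpha> c w))\<^sup>2) \<partial>PT p q)"
    by (rule nn_integral_add) measurable
  also have "\<dots> < \<infinity>"
    using bilinear[OF pq a b] U_L2[OF c s0(1), of \<alpha>] pq by (auto simp: less_top[symmetric] top_unique)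
  finally show "(\<integral>\<^sup>+w. ennreal (norm (prod3 \<alpha> a b c w)) \<partial>PT p q) < \<infinity>" .
qed

text \<open>The parts of \<open>a\<close> above level i, multiplied by the square root of 9^(si),
  form one family whose joint \<open>l^2\<close> mass is controlled by the Sobolev norm of
  \<open>a\<close>. The bilinear bound spends no derivative on such a family, so the weighted sum
  over all levels costs no more than a single product.\<close>

lemma high_family:
  assumes pq: "p < q" "q - p \<le> 1" and J: "finite J" and a: "hpath s p q a A"
    and b: "\<And>i. i \<in> J \<Longrightarrow> hpath s p q (b i) B"
  shows "(\<Sum>i\<in>J. ennreal ((9 powr s) ^ i) * (\<integral>\<^sup>+w. ennreal ((cmod (U \<alpha> (restr (hiS i) a) w * U \<alpha> (b i) w))\<^sup>2) \<partial>PT p q))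
    \<le> ennreal (C * sqrt (q - p) * (level_const s * A\<^sup>2) * B\<^sup>2)"
proof -
  define r where "r = 9 powr s"
  have r: "1 < r" using s0 by (simp add: r_def gr_one_powr)
  define k where "k i = complex_of_real (sqrt (r ^ i))" for i
  have k: "(cmod (k i))\<^sup>2 = r ^ i" for i using r by (simp add: k_def)
  define g where "g i t n = k i * restr (hiS i) a t n" for i t n
  have lev: "(\<Sum>i\<in>J. \<Sum>n\<in>F. (cmod (k i * (if n \<in> hiS i then f n else 0)))\<^sup>2) \<le> level_const s * M\<^sup>2"
    if F: "finite F" and f: "hb s f M" for F and f :: "int \<times> int \<Rightarrow> complex" and M
  proof -
    have "(\<Sum>i\<in>J. \<Sum>n\<in>F. (cmod (k i * (if n \<in> hiS i then f n else 0)))\<^sup>2)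
      = (\<Sum>n\<in>F. (\<Sum>i\<in>J. if 3 ^ i \<le> 3 * hgt n then r ^ i else 0) * (cmod (f n))\<^sup>2)"
      by (subst sum.swap) (auto intro!: sum.cong simp: sum_distrib_right norm_mult power_mult_distrib k hiS_def)
    also have "\<dots> \<le> (\<Sum>n\<in>F. (level_const s * sobolev_weight s n) * (cmod (f n))\<^sup>2)"
      unfolding r_def by (intro sum_mono mult_right_mono level_sum_le s0 J) auto
    also have "\<dots> = level_const s * (\<Sum>n\<in>F. sobolev_weight s n * (cmod (f n))\<^sup>2)"
      by (simp add: sum_distrib_left mult.assoc)
    also have "\<dots> \<le> level_const s * M\<^sup>2"
      using hbD[OF f F] r by (intro mult_left_mono) (auto simp: level_const_def r_def)
    finally show ?thesis .
  qed
  have l0: "0 \<le> level_const s" using r by (simp add: level_const_def r_def)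
  have hr: "hpath s p q (restr (hiS i) a) A" for i by (rule hpath_restr[OF a])
  have "(\<Sum>i\<in>J. ennreal (r ^ i) * (\<integral>\<^sup>+w. ennreal ((cmod (U \<alpha> (restr (hiS i) a) w * U \<alpha> (b i) w))\<^sup>2) \<partial>PT p q))
     = (\<Sum>i\<in>J. \<integral>\<^sup>+w. ennreal ((cmod (U \<alpha> (g i) w * U \<alpha> (b i) w))\<^sup>2) \<partial>PT p q)"
  proof (rule sum.cong[OF refl])
    fix i assume i: "i \<in> J"
    note [measurable] = U_meas[OF hr] U_meas[OF b[OF i]]
    have "AE w in PT p q. U \<alpha> (g i) w = k i * U \<alpha> (restr (hiS i) a) w"
      unfolding g_def using hpath_continuous[OF hr] hpath_hb[OF hr] s0
      by (intro U_scale_AE[where s = s]) (auto intro!: exI[of _ A])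
    then have "AE w in PT p q. ennreal ((cmod (U \<alpha> (g i) w * U \<alpha> (b i) w))\<^sup>2)
        = ennreal (r ^ i) * ennreal ((cmod (U \<alpha> (restr (hiS i) a) w * U \<alpha> (b i) w))\<^sup>2)"
    proof eventually_elim
      case (elim w)
      show ?case unfolding elim norm_mult power_mult_distrib k using r by (simp add: ennreal_mult mult.assoc)
    qed
    then have "(\<integral>\<^sup>+w. ennreal ((cmod (U \<alpha> (g i) w * U \<alpha> (b i) w))\<^sup>2) \<partial>PT p q)
      = (\<integral>\<^sup>+w. ennreal (r ^ i) * ennreal ((cmod (U \<alpha> (restr (hiS i) a) w * U \<alpha> (b i) w))\<^sup>2) \<partial>PT p q)"
      by (rule nn_integral_cong_AE)
    also have "\<dots> = ennreal (r ^ i) * (\<integral>\<^sup>+w. ennreal ((cmod (U \<alpha> (restr (hiS i) a) w * U \<alpha> (b i) w))\<^sup>2) \<partial>PT p q)"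
      by (rule nn_integral_cmult) measurable
    finally show "ennreal (r ^ i) * (\<integral>\<^sup>+w. ennreal ((cmod (U \<alpha> (restr (hiS i) a) w * U \<alpha> (b i) w))\<^sup>2) \<partial>PT p q)
      = (\<integral>\<^sup>+w. ennreal ((cmod (U \<alpha> (g i) w * U \<alpha> (b i) w))\<^sup>2) \<partial>PT p q)" by simp
  qed
  also have "\<dots> \<le> ennreal (C * sqrt (q - p) * (level_const s * A\<^sup>2) * B\<^sup>2)"
  proof (rule family[OF J pq])
    show "0 \<le> level_const s * A\<^sup>2" using l0 by simp
    show "\<exists>K. hb s (g i t) K" if "t \<in> {p..q}" for i t
      unfolding g_def using hb_scale[OF hpath_hb[OF hr that]] by blast
    show "(\<Sum>i\<in>J. \<Sum>n\<in>F. (cmod (g i t n))\<^sup>2) \<le> level_const s * A\<^sup>2" if "t \<in> {p..q}" "finite F" for t F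
      unfolding g_def restr_def by (rule lev[OF that(2) hpath_hb[OF a that(1)]])
    fix t t' and F :: "(int \<times> int) set" assume t: "t \<in> {p..q}" "t' \<in> {p..q}" and F: "finite F"
    have d: "hb s (\<lambda>n. a t n - a t' n) (A * \<bar>t - t'\<bar> powr (3/8))" using a t by (auto simp: hpath_def)
    have "g i t n - g i t' n = k i * (if n \<in> hiS i then a t n - a t' n else 0)" for i n
      by (simp add: g_def restr_def right_diff_distrib)
    then show "(\<Sum>i\<in>J. \<Sum>n\<in>F. (cmod (g i t n - g i t' n))\<^sup>2) \<le> level_const s * A\<^sup>2 * \<bar>t - t'\<bar> powr (3/4)"
      using lev[OF F d] by (simp add: power_mult_distrib powr_3_8_square mult.assoc)
  qed (rule b)
  finally show ?thesis by (simp add: r_def)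
qed

text \<open>At outputs of height at least 3^i the product of the three low parts does not
  contribute. The rest telescopes into three products, each with one high factor. Cauchy-Schwarz
  pairs that factor with one of its companions, which gives \<open>y1\<close>, \<open>y2\<close> and
  \<open>y3\<close>, and the dual wave with the other companion.\<close>

lemma shell_bound:
  assumes pq: "p < q" "q - p \<le> 1"
    and a: "hpath s p q a A" and b: "hpath s p q b B" and c: "hpath s p q c D"
    and F: "finite F" "\<And>n. n \<in> F \<Longrightarrow> 3 ^ i \<le> hgt n"
    and y1: "(\<integral>\<^sup>+w. ennreal ((cmod (U \<alpha> (restr (hiS i) a) w * U \<alpha> b w))\<^sup>2) \<partial>PT p q) \<le> ennreal y1"
    and y2: "(\<integral>\<^sup>+w. ennreal ((cmod (U \<alpha> (restr (hiS i) b) w * U \<alpha> (restr (- hiS i) a) w))\<^sup>2) \<partial>PT p q) \<le> ennreal y2"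
    and y3: "(\<integral>\<^sup>+w. ennreal ((cmod (U \<alpha> (restr (hiS i) c) w * U \<alpha> (restr (- hiS i) b) w))\<^sup>2) \<partial>PT p q) \<le> ennreal y3"
    and y: "0 \<le> y1" "0 \<le> y2" "0 \<le> y3"
  shows "(\<Sum>n\<in>F. (cmod (ipic \<alpha> p q (prod3 \<alpha> a b c) n))\<^sup>2) \<le> 3 * (C * sqrt (q - p) * (D\<^sup>2 * y1 + D\<^sup>2 * y2 + A\<^sup>2 * y3))"
proof -
  let ?H = "restr (hiS i)" and ?L = "restr (- hiS i)"
  define G where "G w = prod3 \<alpha> a b c w - prod3 \<alpha> (?L a) (?L b) (?L c) w" for w
  have I1: "integrable (PT p q) (prod3 \<alpha> a b c)" by (rule prod3_integrable[OF pq a b c])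
  have I2: "integrable (PT p q) (prod3 \<alpha> (?L a) (?L b) (?L c))"
    by (rule prod3_integrable[OF pq hpath_restr[OF a] hpath_restr[OF b] hpath_restr[OF c]])
  have IG: "integrable (PT p q) G" unfolding G_def[abs_def] using I1 I2 by simp
  have eq: "ipic \<alpha> p q (prod3 \<alpha> a b c) n = ipic \<alpha> p q G n" if "n \<in> F" for n
  proof -
    have "ipic \<alpha> p q (prod3 \<alpha> (?L a) (?L b) (?L c)) n = 0"
      unfolding ipic_def using low_product_coeff[OF F(2)[OF that]] by simp
    moreover have "ipic \<alpha> p q G n = ipic \<alpha> p q (prod3 \<alpha> a b c) n - ipic \<alpha> p q (prod3 \<alpha> (?L a) (?L b) (?L c)) n"
      unfolding ipic_integrand(3)[OF IG] ipic_integrand(3)[OF I1] ipic_integrand(3)[OF I2]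
      unfolding G_def left_diff_distrib right_diff_distrib
      by (subst Bochner_Integration.integral_diff[OF ipic_integrand(1)[OF I1] ipic_integrand(1)[OF I2]]) (simp add: diff_divide_distrib)
    ultimately show ?thesis by simp
  qed
  define S where "S = (\<Sum>n\<in>F. (cmod (ipic \<alpha> p q G n))\<^sup>2)"
  have S0: "0 \<le> S" by (simp add: S_def sum_nonneg)
  define d where "d n = (if n \<in> F then ipic \<alpha> p q G n else 0)" for n
  define K where "K = C * sqrt (q - p)"
  have K0: "0 \<le> K" using C pq by (simp add: K_def)
  \<comment> \<open>The dual wave is regarded as the wave of a constant path, so that the bilinear
    bound applies with its profile measured in \<open>l^2\<close> only.\<close>
  have W: "wave \<alpha> F (ipic \<alpha> p q G) (fst w) (snd w) = U \<alpha> (\<lambda>t. d) w" for w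
    unfolding U_def
    by (subst synth_finite_support[OF F(1)]) (auto simp: wave_def propagator_cis d_def mult_ac intro!: sum.cong)
  have hd: "\<exists>M. hb s d M"
  proof (intro exI hbI)
    let ?M = "\<Sum>n\<in>F. sobolev_weight s n * (cmod (d n))\<^sup>2"
    have M0: "0 \<le> ?M" by (intro sum_nonneg mult_nonneg_nonneg less_imp_le[OF sobolev_weight_pos]) auto
    then show "0 \<le> sqrt ?M" by simp
    fix F' :: "(int \<times> int) set" assume F': "finite F'"
    have "(\<Sum>n\<in>F'. sobolev_weight s n * (cmod (d n))\<^sup>2) = (\<Sum>n\<in>F' \<inter> F. sobolev_weight s n * (cmod (d n))\<^sup>2)"
      using F' by (intro sum.mono_neutral_right) (auto simp: d_def)
    also have "\<dots> \<le> ?M"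
      using F(1) by (intro sum_mono2) (auto intro!: mult_nonneg_nonneg less_imp_le[OF sobolev_weight_pos])
    finally show "(\<Sum>n\<in>F'. sobolev_weight s n * (cmod (d n))\<^sup>2) \<le> (sqrt ?M)\<^sup>2" using M0 by simp
  qed
  have dual: "(\<integral>\<^sup>+w. ennreal ((cmod (U \<alpha> (\<lambda>t. d) w * U \<alpha> e w))\<^sup>2) \<partial>PT p q) \<le> ennreal (S * (K * E\<^sup>2))"
    if e: "hpath s p q e E" for e E
  proof -
    have "(\<Sum>j\<in>{0::nat}. \<integral>\<^sup>+w. ennreal ((cmod (U \<alpha> (\<lambda>t. d) w * U \<alpha> e w))\<^sup>2) \<partial>PT p q) \<le> ennreal (C * sqrt (q - p) * S * E\<^sup>2)"
    proof (rule family[OF _ pq S0])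
      fix t and F' :: "(int \<times> int) set" assume F': "finite F'"
      have "(\<Sum>n\<in>F'. (cmod (d n))\<^sup>2) = (\<Sum>n\<in>F' \<inter> F. (cmod (d n))\<^sup>2)"
        using F' by (intro sum.mono_neutral_right) (auto simp: d_def)
      also have "\<dots> \<le> (\<Sum>n\<in>F. (cmod (d n))\<^sup>2)" using F(1) by (intro sum_mono2) auto
      also have "\<dots> = S" by (simp add: S_def d_def)
      finally show "(\<Sum>j\<in>{0::nat}. \<Sum>n\<in>F'. (cmod (d n))\<^sup>2) \<le> S" by simp
    qed (use e hd S0 in auto)
    then show ?thesis by (simp add: K_def mult_ac)
  qed
  note m = U_meas[OF a] U_meas[OF b] U_meas[OF c] U_meas[OF hpath_restr[OF a]] U_meas[OF hpath_restr[OF b]] U_meas[OF hpath_restr[OF c]]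
  have md: "U \<alpha> (\<lambda>t. d) \<in> borel_measurable (PT p q)" by (rule U_measurable) simp
  note [measurable] = m md
  have split: "AE w in PT p q. U \<alpha> f w = U \<alpha> (?H f) w + U \<alpha> (?L f) w" if f: "hpath s p q f E" for f E
  proof -
    have "AE w in PT p q. U \<alpha> (\<lambda>t n. ?H f t n + ?L f t n) w = U \<alpha> (?H f) w + U \<alpha> (?L f) w"
      using hpath_continuous[OF hpath_restr[OF f]] hpath_hb[OF hpath_restr[OF f]] s0
      by (intro U_add_AE[where s = s]) (auto intro!: exI[of _ E])
    moreover have "(\<lambda>t n. ?H f t n + ?L f t n) = f" by (intro ext) (simp add: restr_def)
    ultimately show ?thesis by simp
  qed
  let ?n = "\<lambda>x y w. ennreal (cmod (U \<alpha> (\<lambda>t. d) w * U \<alpha> x w)) * ennreal (cmod (y w))"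
  have "ennreal S \<le> (\<integral>\<^sup>+w. ennreal (cmod (G w)) * ennreal (cmod (U \<alpha> (\<lambda>t. d) w)) \<partial>PT p q)"
    unfolding S_def W[symmetric] by (rule ipic_duality[OF IG F(1)])
  also have "\<dots> \<le> (\<integral>\<^sup>+w. ?n c (\<lambda>w. U \<alpha> (?H a) w * U \<alpha> b w) w + ?n c (\<lambda>w. U \<alpha> (?H b) w * U \<alpha> (?L a) w) w
      + ?n (?L a) (\<lambda>w. U \<alpha> (?H c) w * U \<alpha> (?L b) w) w \<partial>PT p q)"
    using split[OF a] split[OF b] split[OF c]
  proof (intro nn_integral_mono_AE, eventually_elim)
    case (elim w)
    let ?d = "cmod (U \<alpha> (\<lambda>t. d) w)"
    \<comment> \<open>The factors are split one after the other. Those to the left of the high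
      factor are already low, those to its right are still whole.\<close>
    have "G w = U \<alpha> (?H a) w * cnj (U \<alpha> b w) * U \<alpha> c w + U \<alpha> (?L a) w * cnj (U \<alpha> (?H b) w) * U \<alpha> c w
        + U \<alpha> (?L a) w * cnj (U \<alpha> (?L b) w) * U \<alpha> (?H c) w"
      unfolding G_def prod3_def elim by (simp add: algebra_simps)
    then have "cmod (G w) \<le> cmod (U \<alpha> (?H a) w * cnj (U \<alpha> b w) * U \<alpha> c w) + cmod (U \<alpha> (?L a) w * cnj (U \<alpha> (?H b) w) * U \<alpha> c w)
        + cmod (U \<alpha> (?L a) w * cnj (U \<alpha> (?L b) w) * U \<alpha> (?H c) w)"
      by (metis norm_triangle_le norm_triangle_ineq add_right_mono)
    then have "cmod (G w) * ?d \<le> (cmod (U \<alpha> (?H a) w * cnj (U \<alpha> b w) * U \<alpha> c w) + cmod (U \<alpha> (?L a) w * cnj (U \<alpha> (?H b) w) * U \<alpha> c w)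
        + cmod (U \<alpha> (?L a) w * cnj (U \<alpha> (?L b) w) * U \<alpha> (?H c) w)) * ?d"
      by (rule mult_right_mono) simp
    also have "\<dots> = cmod (U \<alpha> (\<lambda>t. d) w * U \<alpha> c w) * cmod (U \<alpha> (?H a) w * U \<alpha> b w) + cmod (U \<alpha> (\<lambda>t. d) w * U \<alpha> c w) * cmod (U \<alpha> (?H b) w * U \<alpha> (?L a) w)
        + cmod (U \<alpha> (\<lambda>t. d) w * U \<alpha> (?L a) w) * cmod (U \<alpha> (?H c) w * U \<alpha> (?L b) w)"
      unfolding norm_mult complex_mod_cnj by (simp only: ring_distribs mult_ac)
    finally have "ennreal (cmod (G w) * ?d) \<le> ennreal (cmod (U \<alpha> (\<lambda>t. d) w * U \<alpha> c w) * cmod (U \<alpha> (?H a) w * U \<alpha> b w) + cmod (U \<alpha> (\<lambda>t. d) w * U \<alpha> c w) * cmod (U \<alpha> (?H b) w * U \<alpha> (?L a) w)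
        + cmod (U \<alpha> (\<lambda>t. d) w * U \<alpha> (?L a) w) * cmod (U \<alpha> (?H c) w * U \<alpha> (?L b) w))"
      by (rule ennreal_leI)
    then show ?case
      by (simp only: ennreal_plus ennreal_mult mult_nonneg_nonneg add_nonneg_nonneg norm_ge_zero)
  qed
  also have "\<dots> = (\<integral>\<^sup>+w. ?n c (\<lambda>w. U \<alpha> (?H a) w * U \<alpha> b w) w \<partial>PT p q) + (\<integral>\<^sup>+w. ?n c (\<lambda>w. U \<alpha> (?H b) w * U \<alpha> (?L a) w) w \<partial>PT p q)
      + (\<integral>\<^sup>+w. ?n (?L a) (\<lambda>w. U \<alpha> (?H c) w * U \<alpha> (?L b) w) w \<partial>PT p q)"
    by (subst nn_integral_add, measurable, subst nn_integral_add, measurable)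
  also have "\<dots> \<le> ennreal (sqrt (S * (K * D\<^sup>2) * y1)) + ennreal (sqrt (S * (K * D\<^sup>2) * y2)) + ennreal (sqrt (S * (K * A\<^sup>2) * y3))"
  proof (intro add_mono)
    show "(\<integral>\<^sup>+w. ?n c (\<lambda>w. U \<alpha> (?H a) w * U \<alpha> b w) w \<partial>PT p q) \<le> ennreal (sqrt (S * (K * D\<^sup>2) * y1))"
      by (rule nn_integral_cs[OF _ _ dual[OF c] y1 _ y(1)]) (measurable, use S0 K0 in simp)
    show "(\<integral>\<^sup>+w. ?n c (\<lambda>w. U \<alpha> (?H b) w * U \<alpha> (?L a) w) w \<partial>PT p q) \<le> ennreal (sqrt (S * (K * D\<^sup>2) * y2))"
      by (rule nn_integral_cs[OF _ _ dual[OF c] y2 _ y(2)]) (measurable, use S0 K0 in simp)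
    show "(\<integral>\<^sup>+w. ?n (?L a) (\<lambda>w. U \<alpha> (?H c) w * U \<alpha> (?L b) w) w \<partial>PT p q) \<le> ennreal (sqrt (S * (K * A\<^sup>2) * y3))"
      by (rule nn_integral_cs[OF _ _ dual[OF hpath_restr[OF a]] y3 _ y(3)]) (measurable, use S0 K0 in simp)
  qed
  also have "\<dots> = ennreal (sqrt (S * (K * D\<^sup>2 * y1)) + sqrt (S * (K * D\<^sup>2 * y2)) + sqrt (S * (K * A\<^sup>2 * y3)))"
    using S0 K0 y by (simp add: mult.assoc)
  finally have "S \<le> sqrt (S * (K * D\<^sup>2 * y1)) + sqrt (S * (K * D\<^sup>2 * y2)) + sqrt (S * (K * A\<^sup>2 * y3))"
    using S0 K0 y by (subst (asm) ennreal_le_iff) (auto intro!: add_nonneg_nonneg)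
  then have "S \<le> 3 * (K * D\<^sup>2 * y1 + K * D\<^sup>2 * y2 + K * A\<^sup>2 * y3)"
    by (rule absorb_sqrt) (use S0 K0 y in auto)
  moreover have "(\<Sum>n\<in>F. (cmod (ipic \<alpha> p q (prod3 \<alpha> a b c) n))\<^sup>2) = S"
    unfolding S_def by (rule sum.cong) (simp_all add: eq)
  ultimately show ?thesis by (simp add: K_def algebra_simps)
qed

text \<open>9 is 3 from the absorption of the roots times 3 for the number of products; 2^s and 9^s
  bound the weight on a shell. A square root of \<open>C\<close> comes from the dual pairing and
  another one from the high pairing.\<close>

definition tri_const :: real where
  "tri_const = sqrt (9 * 2 powr s * 9 powr s * level_const s) * C"

lemma tri_const_nonneg: "0 \<le> tri_const"
proof -
  have "1 \<le> 9 powr s" using s0 by (intro ge_one_powr_ge_zero) auto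
  then have "0 \<le> level_const s" by (simp add: level_const_def)
  then show ?thesis using C by (simp add: tri_const_def)
qed

text \<open>The output is cut into shells 3^i \<le> \<open>hgt n\<close> < 3^(i+1). On a shell the
  weight is of size 9^(si); \<open>high_family\<close> charges it to the high factor and sums over
  all shells at once. The estimate thus closes at the regularity of the inputs.\<close>

theorem trilinear:
  assumes pq: "p < q" "q - p \<le> 1"
    and a: "hpath s p q a A" and b: "hpath s p q b B" and c: "hpath s p q c D"
  shows "hb s (ipic \<alpha> p q (prod3 \<alpha> a b c)) (tri_const * sqrt (q - p) * A * B * D)"
proof (rule hbI)
  define r where "r = 9 powr s"
  have r: "1 < r" using s0 by (simp add: r_def gr_one_powr)
  have l0: "0 \<le> level_const s" using r by (simp add: level_const_def r_def)
  define K where "K = C * sqrt (q - p)"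
  have K0: "0 \<le> K" using C pq by (simp add: K_def)
  have ABD: "0 \<le> A" "0 \<le> B" "0 \<le> D" using a b c by (auto simp: hpath_def)
  show "0 \<le> tri_const * sqrt (q - p) * A * B * D"
    using tri_const_nonneg pq ABD by simp
  fix F :: "(int \<times> int) set" assume F: "finite F"
  let ?T = "ipic \<alpha> p q (prod3 \<alpha> a b c)"
  have "\<exists>i. 3 ^ i \<le> hgt n \<and> hgt n < 3 ^ (i + 1)" for n
    by (rule ex_power_ivl1) (simp_all add: hgt_def)
  then obtain lv where lv: "\<And>n. 3 ^ lv n \<le> hgt n" "\<And>n. hgt n < 3 ^ (lv n + 1)" by metis
  define J where "J = lv ` F"
  have J: "finite J" using F by (simp add: J_def)
  define Y where "Y x y i = (\<integral>\<^sup>+w. ennreal ((cmod (U \<alpha> (restr (hiS i) x) w * U \<alpha> (y i) w))\<^sup>2) \<partial>PT p q)" for x y and i :: nat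
  \<comment> \<open>Real numbers are needed for the absorption argument. Nothing is lost, because
    the bilinear bound makes these integrals finite.\<close>
  define yr where "yr x y i = enn2real (Y x y i)" for x y i
  have yr0: "0 \<le> yr x y i" for x y i by (simp add: yr_def)
  have Y: "Y x y i = ennreal (yr x y i)" if "hpath s p q x X" "hpath s p q (y i) Z" for x y i X Z
  proof -
    have "Y x y i \<le> ennreal (C * sqrt (q - p) * X\<^sup>2 * Z\<^sup>2)"
      unfolding Y_def by (rule bilinear[OF pq hpath_restr[OF that(1)] that(2)])
    then have "Y x y i < top" by (rule le_less_trans) simp
    then show ?thesis by (simp add: yr_def)
  qed
  have sumY: "(\<Sum>i\<in>J. r ^ i * yr x y i) \<le> K * (level_const s * X\<^sup>2) * Z\<^sup>2"
    if x: "hpath s p q x X" and y: "\<And>i. hpath s p q (y i) Z" for x y X Z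
  proof -
    have "ennreal (\<Sum>i\<in>J. r ^ i * yr x y i) = (\<Sum>i\<in>J. ennreal (r ^ i) * Y x y i)"
      using r by (subst sum_ennreal[symmetric]) (auto intro!: sum.cong simp: Y[OF x y] ennreal_mult yr0)
    also have "\<dots> \<le> ennreal (C * sqrt (q - p) * (level_const s * X\<^sup>2) * Z\<^sup>2)"
      unfolding Y_def r_def by (rule high_family[OF pq J x y])
    finally show ?thesis using K0 l0 by (subst (asm) ennreal_le_iff) (auto simp: K_def)
  qed
  let ?y1 = "yr a (\<lambda>i. b)" and ?y2 = "yr b (\<lambda>i. restr (- hiS i) a)" and ?y3 = "yr c (\<lambda>i. restr (- hiS i) b)"
  have "(\<Sum>n\<in>F. sobolev_weight s n * (cmod (?T n))\<^sup>2) = (\<Sum>i\<in>J. \<Sum>n\<in>{n\<in>F. lv n = i}. sobolev_weight s n * (cmod (?T n))\<^sup>2)"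
    unfolding J_def by (rule sum.image_gen[OF F])
  also have "\<dots> \<le> (\<Sum>i\<in>J. (2 powr s * r) * (r ^ i * (3 * (K * (D\<^sup>2 * ?y1 i + D\<^sup>2 * ?y2 i + A\<^sup>2 * ?y3 i)))))"
  proof (rule sum_mono)
    fix i
    have w: "sobolev_weight s n \<le> (2 powr s * r) * r ^ i" if "lv n = i" for n
    proof -
      have "sobolev_weight s n \<le> 2 powr s * real (hgt n) powr (2 * s)" by (rule sobolev_weight_hgt(1)) (rule s0)
      also have "real (hgt n) powr (2 * s) \<le> (3 ^ (i + 1)) powr (2 * s)"
      proof (rule powr_mono2)
        have "real (hgt n) \<le> real (3 ^ (i + 1))" using lv(2)[of n] that by (simp only: of_nat_le_iff)
        then show "real (hgt n) \<le> 3 ^ (i + 1)" by simp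
      qed (use s0 in auto)
      also have "\<dots> = r * r ^ i" unfolding powr_three_power by (simp add: r_def)
      finally show ?thesis by (simp add: mult.assoc)
    qed
    have "(\<Sum>n\<in>{n\<in>F. lv n = i}. sobolev_weight s n * (cmod (?T n))\<^sup>2) \<le> (\<Sum>n\<in>{n\<in>F. lv n = i}. ((2 powr s * r) * r ^ i) * (cmod (?T n))\<^sup>2)"
      by (intro sum_mono mult_right_mono w) auto
    also have "\<dots> = (2 powr s * r) * (r ^ i * (\<Sum>n\<in>{n\<in>F. lv n = i}. (cmod (?T n))\<^sup>2))"
      by (simp add: sum_distrib_left mult.assoc)
    also have "\<dots> \<le> (2 powr s * r) * (r ^ i * (3 * (K * (D\<^sup>2 * ?y1 i + D\<^sup>2 * ?y2 i + A\<^sup>2 * ?y3 i))))"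
    proof (intro mult_left_mono)
      show "(\<Sum>n\<in>{n\<in>F. lv n = i}. (cmod (?T n))\<^sup>2) \<le> 3 * (K * (D\<^sup>2 * ?y1 i + D\<^sup>2 * ?y2 i + A\<^sup>2 * ?y3 i))"
        unfolding K_def
      proof (rule shell_bound[OF pq a b c])
        show "3 ^ i \<le> hgt n" if "n \<in> {n\<in>F. lv n = i}" for n using that lv(1)[of n] by auto
        show "(\<integral>\<^sup>+w. ennreal ((cmod (U \<alpha> (restr (hiS i) a) w * U \<alpha> b w))\<^sup>2) \<partial>PT p q) \<le> ennreal (?y1 i)"
          using Y[OF a b, of i] by (simp add: Y_def)
        show "(\<integral>\<^sup>+w. ennreal ((cmod (U \<alpha> (restr (hiS i) b) w * U \<alpha> (restr (- hiS i) a) w))\<^sup>2) \<partial>PT p q) \<le> ennreal (?y2 i)"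
          using Y[OF b hpath_restr[OF a], of "\<lambda>i. - hiS i" i] Y[of b B "\<lambda>i. restr (- hiS i) a" i, OF b hpath_restr[OF a]] by (simp add: Y_def)
        show "(\<integral>\<^sup>+w. ennreal ((cmod (U \<alpha> (restr (hiS i) c) w * U \<alpha> (restr (- hiS i) b) w))\<^sup>2) \<partial>PT p q) \<le> ennreal (?y3 i)"
          using Y[of c D "\<lambda>i. restr (- hiS i) b" i, OF c hpath_restr[OF b]] by (simp add: Y_def)
      qed (use F in \<open>auto simp: yr0\<close>)
    qed (use r in auto)
    finally show "(\<Sum>n\<in>{n\<in>F. lv n = i}. sobolev_weight s n * (cmod (?T n))\<^sup>2)
      \<le> (2 powr s * r) * (r ^ i * (3 * (K * (D\<^sup>2 * ?y1 i + D\<^sup>2 * ?y2 i + A\<^sup>2 * ?y3 i))))" .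
  qed
  also have "\<dots> = (2 powr s * r * 3 * K) * (D\<^sup>2 * (\<Sum>i\<in>J. r ^ i * ?y1 i) + D\<^sup>2 * (\<Sum>i\<in>J. r ^ i * ?y2 i) + A\<^sup>2 * (\<Sum>i\<in>J. r ^ i * ?y3 i))"
  proof -
    have "(2 powr s * r) * (x * (3 * (K * (D\<^sup>2 * u + D\<^sup>2 * v + A\<^sup>2 * w)))) = (2 powr s * r * 3 * K) * (D\<^sup>2 * (x * u) + D\<^sup>2 * (x * v) + A\<^sup>2 * (x * w))"
      for x u v w by (simp only: ring_distribs mult_ac)
    then show ?thesis by (simp only: sum_distrib_left[symmetric] sum.distrib)
  qed
  also have "\<dots> \<le> (2 powr s * r * 3 * K) * (D\<^sup>2 * (K * (level_const s * A\<^sup>2) * B\<^sup>2) + D\<^sup>2 * (K * (level_const s * B\<^sup>2) * A\<^sup>2) + A\<^sup>2 * (K * (level_const s * D\<^sup>2) * B\<^sup>2))"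
    using r K0 by (intro mult_left_mono add_mono sumY a b c hpath_restr) auto
  also have "\<dots> = (9 * 2 powr s * r * level_const s) * K\<^sup>2 * (A * B * D)\<^sup>2"
  proof -
    have "(u * r * 3 * K) * (D\<^sup>2 * (K * (l * A\<^sup>2) * B\<^sup>2) + D\<^sup>2 * (K * (l * B\<^sup>2) * A\<^sup>2) + A\<^sup>2 * (K * (l * D\<^sup>2) * B\<^sup>2))
      = (9 * u * r * l) * K\<^sup>2 * (A * B * D)\<^sup>2" for u l :: real by algebra
    then show ?thesis .
  qed
  also have "\<dots> = (tri_const * sqrt (q - p) * A * B * D)\<^sup>2"
    using pq l0 r by (simp add: tri_const_def K_def r_def power_mult_distrib)
  finally show "(\<Sum>n\<in>F. sobolev_weight s n * (cmod (?T n))\<^sup>2) \<le> (tri_const * sqrt (q - p) * A * B * D)\<^sup>2" .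
qed

end

lemma strichartz_exists:
  assumes "\<alpha> < 0" "s > 1 / 4"
  obtains C where "strichartz \<alpha> s C"
proof -
  obtain C where C: "C > 0" "\<And>(J :: nat set) p q a b A B. \<lbrakk>finite J; p < q; q - p \<le> 1; 0 \<le> A;
      \<And>i t. i \<in> J \<Longrightarrow> t \<in> {p..q} \<Longrightarrow> \<exists>K. hb s (a i t) K;
      \<And>t F. t \<in> {p..q} \<Longrightarrow> finite F \<Longrightarrow> (\<Sum>i\<in>J. \<Sum>n\<in>F. (cmod (a i t n))\<^sup>2) \<le> A;
      \<And>t t' F. t \<in> {p..q} \<Longrightarrow> t' \<in> {p..q} \<Longrightarrow> finite F \<Longrightarrow> (\<Sum>i\<in>J. \<Sum>n\<in>F. (cmod (a i t n - a i t' n))\<^sup>2) \<le> A * \<bar>t - t'\<bar> powr (3/4);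
      \<And>i. i \<in> J \<Longrightarrow> hpath s p q (b i) B\<rbrakk> \<Longrightarrow>
    (\<Sum>i\<in>J. \<integral>\<^sup>+w. ennreal ((cmod (U \<alpha> (a i) w * U \<alpha> (b i) w))\<^sup>2) \<partial>PT p q) \<le> ennreal (C * sqrt (q - p) * A * B\<^sup>2)"
    using bilinear_family[OF assms] by blast
  show thesis
    by (rule that, unfold_locales) (use assms C in auto)
qed

section \<open>The solution space\<close>

lemma hb_tendsto:
  assumes "\<And>j. hb s c (M j)" "M \<longlonglongrightarrow> L"
  shows "hb s c L"
proof (rule hbI)
  show "0 \<le> L" using hb_nonneg[OF assms(1)] by (intro LIMSEQ_le_const[OF assms(2)]) auto
  fix F :: "(int \<times> int) set" assume F: "finite F"
  have "(\<lambda>j. (M j)\<^sup>2) \<longlonglongrightarrow> L\<^sup>2" by (intro tendsto_intros assms)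
  then show "(\<Sum>n\<in>F. sobolev_weight s n * (cmod (c n))\<^sup>2) \<le> L\<^sup>2"
    using hbD[OF assms(1) F] by (intro LIMSEQ_le_const) auto
qed

lemma hb_0_imp_zero: "0 \<le> s \<Longrightarrow> hb s c 0 \<Longrightarrow> c n = 0"
  using hb_component[of s c 0 n] by simp

lemma hpath_tendsto:
  assumes "\<And>j. hpath s p q a (M j)" "M \<longlonglongrightarrow> L"
  shows "hpath s p q a L"
  unfolding hpath_def
proof (intro conjI ballI)
  show "0 \<le> L" using hpath_nonneg[OF assms(1)] by (intro LIMSEQ_le_const[OF assms(2)]) auto
  fix t assume t: "t \<in> {p..q}"
  show "hb s (a t) L" by (rule hb_tendsto[OF hpath_hb[OF assms(1) t] assms(2)])
  fix t' assume t': "t' \<in> {p..q}"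
  show "hb s (\<lambda>n. a t n - a t' n) (L * \<bar>t - t'\<bar> powr (3/8))"
    by (rule hb_tendsto[where M = "\<lambda>j. M j * \<bar>t - t'\<bar> powr (3/8)"])
       (use assms(1) t t' in \<open>auto simp: hpath_def intro!: tendsto_intros assms(2)\<close>)
qed

lemma hpath_mono: "hpath s p q a M \<Longrightarrow> M \<le> M' \<Longrightarrow> hpath s p q a M'"
  unfolding hpath_def by (meson hb_mono order_trans mult_right_mono powr_ge_zero)

lemma hpath_cong: "(\<And>t. t \<in> {p..q} \<Longrightarrow> a t = b t) \<Longrightarrow> hpath s p q a M \<longleftrightarrow> hpath s p q b M"
  unfolding hpath_def by auto

lemma hpath_add:
  assumes "hpath s p q a M" "hpath s p q b M'"
  shows "hpath s p q (\<lambda>t n. a t n + b t n) (M + M')"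
  unfolding hpath_def
proof (intro conjI ballI)
  show "0 \<le> M + M'" using assms by (auto simp: hpath_def)
  fix t assume t: "t \<in> {p..q}"
  show "hb s (\<lambda>n. a t n + b t n) (M + M')" by (intro hb_add hpath_hb[OF assms(1) t] hpath_hb[OF assms(2) t])
  fix t' assume t': "t' \<in> {p..q}"
  have "hb s (\<lambda>n. (a t n - a t' n) + (b t n - b t' n)) (M * \<bar>t - t'\<bar> powr (3/8) + M' * \<bar>t - t'\<bar> powr (3/8))"
    using assms t t' by (intro hb_add) (auto simp: hpath_def)
  then show "hb s (\<lambda>n. a t n + b t n - (a t' n + b t' n)) ((M + M') * \<bar>t - t'\<bar> powr (3/8))"
    by (simp add: algebra_simps)
qed

lemma hpath_scale:
  assumes "hpath s p q a M"
  shows "hpath s p q (\<lambda>t n. k * a t n) (cmod k * M)"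
  unfolding hpath_def
proof (intro conjI ballI)
  show "0 \<le> cmod k * M" using assms by (auto simp: hpath_def)
  fix t assume t: "t \<in> {p..q}"
  show "hb s (\<lambda>n. k * a t n) (cmod k * M)" by (intro hb_scale hpath_hb[OF assms(1) t])
  fix t' assume t': "t' \<in> {p..q}"
  have "hb s (\<lambda>n. k * (a t n - a t' n)) (cmod k * (M * \<bar>t - t'\<bar> powr (3/8)))"
    using assms t t' by (intro hb_scale) (auto simp: hpath_def)
  then show "hb s (\<lambda>n. k * a t n - k * a t' n) (cmod k * M * \<bar>t - t'\<bar> powr (3/8))"
    by (simp add: right_diff_distrib mult.assoc)
qed

lemma hpath_diff:
  assumes "hpath s p q a M" "hpath s p q b M'"
  shows "hpath s p q (\<lambda>t n. a t n - b t n) (M + M')"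
  using hpath_add[OF assms(1) hpath_scale[OF assms(2), of "-1"]] by simp

lemma hpath_const: "hb s c M \<Longrightarrow> hpath s p q (\<lambda>t. c) M"
  unfolding hpath_def by (auto simp: hb_zero hb_nonneg)

lemma hpath_limit:
  assumes "\<And>t n. t \<in> {p..q} \<Longrightarrow> (\<lambda>j. a j t n) \<longlonglongrightarrow> b t n" and "\<And>j. k \<le> j \<Longrightarrow> hpath s p q (a j) M"
  shows "hpath s p q b M"
  unfolding hpath_def
proof (intro conjI ballI)
  show "0 \<le> M" using assms(2)[OF order_refl] by (rule hpath_nonneg)
  fix t assume t: "t \<in> {p..q}"
  show "hb s (b t) M"
    by (rule hb_limit[where c = "\<lambda>j. a j t" and k = k]) (use assms t hpath_hb in blast)+
  fix t' assume t': "t' \<in> {p..q}"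
  show "hb s (\<lambda>n. b t n - b t' n) (M * \<bar>t - t'\<bar> powr (3/8))"
    by (rule hb_limit[where c = "\<lambda>j n. a j t n - a j t' n" and k = k])
       (use assms(2) t t' in \<open>auto simp: hpath_def intro!: tendsto_intros assms(1)\<close>)
qed

text \<open>The limit is taken coefficient by coefficient. Letting only one index of a Cauchy
  difference tend to infinity preserves its Hoelder bound, which gives convergence in the path
  norm.\<close>

lemma hpath_complete:
  assumes s: "0 \<le> s" and a: "\<And>j. \<exists>M. hpath s p q (a j) M"
    and Cauchy: "\<And>\<epsilon>. 0 < \<epsilon> \<Longrightarrow> \<exists>K. \<forall>j\<ge>K. \<forall>k\<ge>K. hpath s p q (\<lambda>t n. a j t n - a k t n) \<epsilon>"
  obtains b where "\<exists>M. hpath s p q b M"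
    and "\<And>t n. t \<in> {p..q} \<Longrightarrow> (\<lambda>j. a j t n) \<longlonglongrightarrow> b t n"
    and "\<And>\<epsilon>. 0 < \<epsilon> \<Longrightarrow> \<exists>K. \<forall>j\<ge>K. hpath s p q (\<lambda>t n. a j t n - b t n) \<epsilon>"
proof -
  define b where "b t n = lim (\<lambda>j. a j t n)" for t n
  have lim: "(\<lambda>j. a j t n) \<longlonglongrightarrow> b t n" if t: "t \<in> {p..q}" for t n
  proof -
    have "Cauchy (\<lambda>j. a j t n)"
      unfolding Cauchy_def
    proof (intro allI impI)
      fix e :: real assume e: "0 < e"
      then obtain K where K: "\<forall>j\<ge>K. \<forall>k\<ge>K. hpath s p q (\<lambda>t n. a j t n - a k t n) (e / 2)"
        using Cauchy[of "e / 2"] by auto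
      show "\<exists>M. \<forall>m\<ge>M. \<forall>n'\<ge>M. dist (a m t n) (a n' t n) < e"
      proof (intro exI allI impI)
        fix m n' assume "K \<le> m" "K \<le> n'"
        then have "hpath s p q (\<lambda>t n. a m t n - a n' t n) (e / 2)" using K by blast
        from hb_component[OF s hpath_hb[OF this t], of n] e show "dist (a m t n) (a n' t n) < e"
          by (simp add: dist_norm)
      qed
    qed
    then show ?thesis unfolding b_def by (simp add: Cauchy_convergent_iff convergent_LIMSEQ_iff)
  qed
  have conv: "\<exists>K. \<forall>j\<ge>K. hpath s p q (\<lambda>t n. a j t n - b t n) \<epsilon>" if eps: "0 < \<epsilon>" for \<epsilon>
  proof -
    obtain K where K: "\<forall>j\<ge>K. \<forall>k\<ge>K. hpath s p q (\<lambda>t n. a j t n - a k t n) \<epsilon>" using Cauchy[OF eps] by blast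
    show ?thesis
    proof (intro exI allI impI)
      fix j assume j: "K \<le> j"
      show "hpath s p q (\<lambda>t n. a j t n - b t n) \<epsilon>"
      proof (rule hpath_limit[where a = "\<lambda>k t n. a j t n - a k t n" and k = K])
        show "(\<lambda>k. a j t n - a k t n) \<longlonglongrightarrow> a j t n - b t n" if "t \<in> {p..q}" for t n
          by (intro tendsto_intros lim that)
      qed (use K j in blast)
    qed
  qed
  have "\<exists>M. hpath s p q b M"
  proof -
    obtain K where K: "hpath s p q (\<lambda>t n. a K t n - b t n) 1" using conv[of 1] by auto
    obtain M where "hpath s p q (a K) M" using a by blast
    from hpath_diff[OF this K] show ?thesis by auto
  qed
  then show thesis using that lim conv by blast
qed

section \<open>Sobolev functions and their coefficients\<close>

lemma hb_imp_summable:
  assumes "hb s c M"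
  shows "(\<lambda>n. sobolev_weight s n * (cmod (c n))\<^sup>2) summable_on UNIV"
    and "(\<Sum>\<^sub>\<infinity>n. sobolev_weight s n * (cmod (c n))\<^sup>2) \<le> M\<^sup>2"
proof -
  have nn: "0 \<le> sobolev_weight s n * (cmod (c n))\<^sup>2" for n
    using less_imp_le[OF sobolev_weight_pos] by simp
  show sm: "(\<lambda>n. sobolev_weight s n * (cmod (c n))\<^sup>2) summable_on UNIV"
    by (rule nonneg_bdd_above_summable_on) (use nn hbD[OF assms] in \<open>auto intro!: bdd_aboveI2[where M = "M\<^sup>2"]\<close>)
  show "(\<Sum>\<^sub>\<infinity>n. sobolev_weight s n * (cmod (c n))\<^sup>2) \<le> M\<^sup>2"
    by (rule infsum_le_finite_sums[OF sm]) (use hbD[OF assms] in auto)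
qed

lemma hb_of_summable:
  assumes "(\<lambda>n. sobolev_weight s n * (cmod (c n))\<^sup>2) summable_on UNIV"
  shows "hb s c (sqrt (\<Sum>\<^sub>\<infinity>n. sobolev_weight s n * (cmod (c n))\<^sup>2))"
proof -
  have nn: "0 \<le> sobolev_weight s n * (cmod (c n))\<^sup>2" for n
    using less_imp_le[OF sobolev_weight_pos] by simp
  have "0 \<le> (\<Sum>\<^sub>\<infinity>n. sobolev_weight s n * (cmod (c n))\<^sup>2)" by (rule infsum_nonneg) (rule nn)
  then show ?thesis
    by (intro hbI) (auto intro!: finite_sum_le_infsum assms nn)
qed

lemma sobolev_iff:
  "f \<in> sobolev s \<longleftrightarrow> f \<in> borel_measurable torus2 \<and> integrable torus2 (\<lambda>z. (cmod (f z))\<^sup>2) \<and> (\<exists>M. hb s (fourier_coeff f) M)"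
  unfolding sobolev_def using hb_imp_summable(1) hb_of_summable by blast

lemma sobolev_hb: "f \<in> sobolev s \<Longrightarrow> hb s (fourier_coeff f) (sobolev_norm s f)"
  unfolding sobolev_norm_def sobolev_def using hb_of_summable by blast

lemma sobolev_norm_le: "hb s (fourier_coeff f) M \<Longrightarrow> sobolev_norm s f \<le> M"
  unfolding sobolev_norm_def
  by (rule real_le_lsqrt) (use hb_imp_summable(2) hb_nonneg in \<open>auto intro!: infsum_nonneg mult_nonneg_nonneg less_imp_le[OF sobolev_weight_pos]\<close>)

lemma sobolev_norm_nonneg: "0 \<le> sobolev_norm s f"
  unfolding sobolev_norm_def
  by (auto intro!: infsum_nonneg mult_nonneg_nonneg less_imp_le[OF sobolev_weight_pos])

lemma sobolev_integrable: "f \<in> sobolev s \<Longrightarrow> integrable torus2 f"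
  by (rule L2_imp_L1) (auto simp: sobolev_def)

lemma sobolev_measurable: "f \<in> sobolev s \<Longrightarrow> f \<in> borel_measurable torus2"
  by (simp add: sobolev_def)

lemma fourier_coeff_add_sobolev:
  "f \<in> sobolev s \<Longrightarrow> g \<in> sobolev s \<Longrightarrow> fourier_coeff (\<lambda>z. f z + g z) = (\<lambda>n. fourier_coeff f n + fourier_coeff g n)"
  by (rule ext) (intro fourier_coeff_add sobolev_integrable)

lemma fourier_coeff_diff_sobolev:
  "f \<in> sobolev s \<Longrightarrow> g \<in> sobolev s \<Longrightarrow> fourier_coeff (\<lambda>z. f z - g z) = (\<lambda>n. fourier_coeff f n - fourier_coeff g n)"
  by (rule ext) (intro fourier_coeff_diff sobolev_integrable)

lemma sobolev_scale:
  assumes "f \<in> sobolev s"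
  shows "(\<lambda>z. k * f z) \<in> sobolev s"
  unfolding sobolev_iff
proof (intro conjI)
  show "\<exists>M. hb s (fourier_coeff (\<lambda>z. k * f z)) M"
  proof -
    have "fourier_coeff (\<lambda>z. k * f z) = (\<lambda>n. k * fourier_coeff f n)" by (rule ext) (rule fourier_coeff_scale)
    then show ?thesis using hb_scale[OF sobolev_hb[OF assms], of k] by auto
  qed
  show "(\<lambda>z. k * f z) \<in> borel_measurable torus2" using sobolev_measurable[OF assms] by simp
  show "integrable torus2 (\<lambda>z. (cmod (k * f z))\<^sup>2)"
    using assms by (simp add: norm_mult power_mult_distrib sobolev_def)
qed

lemma sobolev_add:
  assumes f: "f \<in> sobolev s" and g: "g \<in> sobolev s"
  shows "(\<lambda>z. f z + g z) \<in> sobolev s"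
  unfolding sobolev_iff
proof (intro conjI)
  note [measurable] = sobolev_measurable[OF f] sobolev_measurable[OF g]
  show "\<exists>M. hb s (fourier_coeff (\<lambda>z. f z + g z)) M"
    unfolding fourier_coeff_add_sobolev[OF f g] using hb_add[OF sobolev_hb[OF f] sobolev_hb[OF g]] by blast
  show "(\<lambda>z. f z + g z) \<in> borel_measurable torus2" by measurable
  show "integrable torus2 (\<lambda>z. (cmod (f z + g z))\<^sup>2)"
  proof (rule Bochner_Integration.integrable_bound)
    show "integrable torus2 (\<lambda>z. 2 * (cmod (f z))\<^sup>2 + 2 * (cmod (g z))\<^sup>2)"
      using f g by (auto simp: sobolev_def)
    show "AE z in torus2. norm ((cmod (f z + g z))\<^sup>2) \<le> norm (2 * (cmod (f z))\<^sup>2 + 2 * (cmod (g z))\<^sup>2)"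
    proof (rule AE_I2)
      fix z
      have "(cmod (f z + g z))\<^sup>2 \<le> (cmod (f z) + cmod (g z))\<^sup>2" by (intro power_mono norm_triangle_ineq) auto
      also have "\<dots> \<le> 2 * (cmod (f z))\<^sup>2 + 2 * (cmod (g z))\<^sup>2"
        using zero_le_power2[of "cmod (f z) - cmod (g z)"] by (simp add: power2_sum power2_diff)
      finally show "norm ((cmod (f z + g z))\<^sup>2) \<le> norm (2 * (cmod (f z))\<^sup>2 + 2 * (cmod (g z))\<^sup>2)" by simp
    qed
  qed measurable
qed

lemma sobolev_diff: "f \<in> sobolev s \<Longrightarrow> g \<in> sobolev s \<Longrightarrow> (\<lambda>z. f z - g z) \<in> sobolev s"
  using sobolev_add[OF _ sobolev_scale[of g s "-1"], of f] by simp

lemma sobolev_zero: "(\<lambda>z. 0) \<in> sobolev s"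
proof -
  have "fourier_coeff (\<lambda>z. 0) = (\<lambda>n. 0)" by (auto simp: fourier_coeff_chr)
  then show ?thesis by (auto simp: sobolev_iff intro!: exI[of _ 0] hb_zero)
qed

lemma sobolev_eq_AE:
  assumes f: "f \<in> sobolev s" and g: "g \<in> sobolev s" and eq: "fourier_coeff f = fourier_coeff g"
  shows "AE z in torus2. f z = g z"
proof -
  have "AE z in torus2. f z - g z = 0"
  proof (rule fourier_uniqueness)
    show "integrable torus2 (\<lambda>z. f z - g z)" using sobolev_integrable[OF sobolev_diff[OF f g]] .
    show "fourier_coeff (\<lambda>z. f z - g z) n = 0" for n by (simp add: fourier_coeff_diff_sobolev[OF f g] eq)
  qed
  then show ?thesis by eventually_elim simp
qed

lemma synth_sobolev:
  assumes "hb s c M" "0 < s"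
  shows "synth c \<in> sobolev s" and "fourier_coeff (synth c) = c"
proof -
  show fc: "fourier_coeff (synth c) = c" using fourier_coeff_synth[OF assms] by auto
  show "synth c \<in> sobolev s"
    unfolding sobolev_iff fc using assms synth_square_integrable[OF assms] by auto
qed

text \<open>Continuity is strong, not uniform in the frequency. A finite set \<open>F\<close>
  carries the squared norm up to e^2/8; there finitely many continuous terms are small, and outside
  it the crude factor 4 still leaves only e^2/2.\<close>

lemma propagator_strongly_continuous:
  assumes c: "hb s c M" and e: "0 < e"
  shows "\<forall>\<^sub>F r in nhds t. hb s (\<lambda>n. (cis (- (r * omega \<alpha> n)) - cis (- (t * omega \<alpha> n))) * c n) e"
proof -
  let ?g = "\<lambda>n. sobolev_weight s n * (cmod (c n))\<^sup>2"
  let ?S = "\<Sum>\<^sub>\<infinity>n. ?g n"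
  let ?d = "\<lambda>r n. (cis (- (r * omega \<alpha> n)) - cis (- (t * omega \<alpha> n))) * c n"
  have nn: "0 \<le> ?g n" for n using less_imp_le[OF sobolev_weight_pos] by simp
  have sm: "?g summable_on UNIV" by (rule hb_imp_summable[OF c])
  then have "(?g has_sum ?S) UNIV" by (rule has_sum_infsum)
  then have "((\<lambda>F. sum ?g F) \<longlongrightarrow> ?S) (finite_subsets_at_top UNIV)" by (simp add: has_sum_def)
  moreover have "?S - e\<^sup>2 / 8 < ?S" using e by simp
  ultimately have "\<forall>\<^sub>F F in finite_subsets_at_top UNIV. ?S - e\<^sup>2 / 8 < sum ?g F" by (rule order_tendstoD)
  then obtain F where F: "finite F" "?S - e\<^sup>2 / 8 < sum ?g F"
    by (auto simp: eventually_finite_subsets_at_top)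
  have tail: "sum ?g G \<le> e\<^sup>2 / 8" if "finite G" "G \<inter> F = {}" for G
  proof -
    have "sum ?g G + sum ?g F = sum ?g (G \<union> F)" using that F by (simp add: sum.union_disjoint)
    also have "\<dots> \<le> ?S" using that F by (intro finite_sum_le_infsum sm nn) auto
    finally show ?thesis using F by linarith
  qed
  let ?h = "\<lambda>r. \<Sum>n\<in>F. sobolev_weight s n * (cmod (?d r n))\<^sup>2"
  have "continuous_on UNIV ?h" by (intro continuous_intros)
  then have "isCont ?h t" by (simp add: continuous_on_eq_continuous_at)
  then have "(?h \<longlongrightarrow> ?h t) (nhds t)" unfolding isCont_def by (rule tendsto_at_iff_tendsto_nhds[THEN iffD1])
  then have "(?h \<longlongrightarrow> 0) (nhds t)" by simp
  then have "\<forall>\<^sub>F r in nhds t. ?h r < e\<^sup>2 / 2" using e by (intro order_tendstoD) auto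
  then show ?thesis
  proof eventually_elim
    case (elim r)
    show ?case
    proof (rule hbI)
      fix G :: "(int \<times> int) set" assume G: "finite G"
      have "(\<Sum>n\<in>G. sobolev_weight s n * (cmod (?d r n))\<^sup>2)
         = (\<Sum>n\<in>G \<inter> F. sobolev_weight s n * (cmod (?d r n))\<^sup>2) + (\<Sum>n\<in>G - F. sobolev_weight s n * (cmod (?d r n))\<^sup>2)"
        using G by (subst sum.union_disjoint[symmetric]) (auto intro!: sum.cong)
      also have "\<dots> \<le> ?h r + (\<Sum>n\<in>G - F. 4 * ?g n)"
      proof (intro add_mono sum_mono2 sum_mono)
        fix n
        have "cmod (?d r n) \<le> 2 * cmod (c n)"
          unfolding norm_mult using norm_triangle_ineq4[of "cis (- (r * omega \<alpha> n))" "cis (- (t * omega \<alpha> n))"]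
          by (intro mult_right_mono) auto
        then have "(cmod (?d r n))\<^sup>2 \<le> (2 * cmod (c n))\<^sup>2" by (intro power_mono) auto
        from mult_left_mono[OF this less_imp_le[OF sobolev_weight_pos[of s n]]]
        show "sobolev_weight s n * (cmod (?d r n))\<^sup>2 \<le> 4 * ?g n"
          by (simp only: power_mult_distrib) simp
      qed (use F in \<open>auto intro!: mult_nonneg_nonneg less_imp_le[OF sobolev_weight_pos]\<close>)
      also have "(\<Sum>n\<in>G - F. 4 * ?g n) = 4 * sum ?g (G - F)" by (rule sum_distrib_left[symmetric])
      also have "sum ?g (G - F) \<le> e\<^sup>2 / 8" using G by (intro tail) auto
      finally show "(\<Sum>n\<in>G. sobolev_weight s n * (cmod (?d r n))\<^sup>2) \<le> e\<^sup>2" using elim by linarith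
    qed (use e in simp)
  qed
qed

definition ipath :: "real \<Rightarrow> (real \<Rightarrow> real \<times> real \<Rightarrow> complex) \<Rightarrow> real \<Rightarrow> int \<times> int \<Rightarrow> complex" where
  "ipath \<alpha> u t n = cis (t * omega \<alpha> n) * fourier_coeff (u t) n"

lemma fourier_coeff_ipath: "fourier_coeff (u t) n = cis (- (t * omega \<alpha> n)) * ipath \<alpha> u t n"
  by (simp add: ipath_def cis_mult mult.assoc[symmetric])

lemma hb_ipath: "hb s (ipath \<alpha> u t) M \<longleftrightarrow> hb s (fourier_coeff (u t)) M"
  by (simp add: hb_def ipath_def norm_mult)

text \<open>With profile a, the difference of two states is S(r) (a(r) - a(t)) + (S(r) - S(t)) a(t).
  The Hoelder bound controls the former term, strong continuity of the propagator the
  latter.\<close>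

lemma C_sobolevI:
  assumes u: "\<And>t. t \<in> {-T..T} \<Longrightarrow> u t \<in> sobolev s" and h: "hpath s (-T) T (ipath \<alpha> u) M"
  shows "u \<in> C_sobolev s T"
  unfolding C_sobolev_def
proof (intro CollectI ballI conjI u)
  fix t assume t: "t \<in> {-T..T}"
  let ?a = "ipath \<alpha> u"
  show "((\<lambda>r. sobolev_norm s (\<lambda>z. u r z - u t z)) \<longlongrightarrow> 0) (at t within {-T..T})"
    unfolding tendsto_iff
  proof (intro allI impI)
    fix e :: real assume e: "0 < e"
    have "\<forall>\<^sub>F r in nhds t. hb s (\<lambda>n. (cis (- (r * omega \<alpha> n)) - cis (- (t * omega \<alpha> n))) * ?a t n) (e / 3)"
      using e by (intro propagator_strongly_continuous[OF hpath_hb[OF h t]]) auto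
    then have 1: "\<forall>\<^sub>F r in at t within {-T..T}. hb s (\<lambda>n. (cis (- (r * omega \<alpha> n)) - cis (- (t * omega \<alpha> n))) * ?a t n) (e / 3)"
      by (rule filter_leD[OF at_within_le_nhds])
    have "((\<lambda>r. \<bar>r - t\<bar>) \<longlongrightarrow> \<bar>t - t\<bar>) (at t within {-T..T})" by (intro tendsto_intros)
    then have "((\<lambda>r. \<bar>r - t\<bar> powr (3/8)) \<longlongrightarrow> 0) (at t within {-T..T})"
      by (intro tendsto_zero_powrI[where b = "3/8"]) auto
    then have "((\<lambda>r. M * \<bar>r - t\<bar> powr (3/8)) \<longlongrightarrow> 0) (at t within {-T..T})" by (rule tendsto_mult_right_zero)
    then have 2: "\<forall>\<^sub>F r in at t within {-T..T}. M * \<bar>r - t\<bar> powr (3/8) < e / 3"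
      using e by (intro order_tendstoD) auto
    have 3: "\<forall>\<^sub>F r in at t within {-T..T}. r \<in> {-T..T}" by (simp add: eventually_at_filter)
    show "\<forall>\<^sub>F r in at t within {-T..T}. dist (sobolev_norm s (\<lambda>z. u r z - u t z)) 0 < e"
      using 1 2 3
    proof eventually_elim
      case (elim r)
      have "hb s (\<lambda>n. ?a r n - ?a t n) (M * \<bar>r - t\<bar> powr (3/8))" using h t elim(3) by (auto simp: hpath_def)
      then have "hb s (\<lambda>n. ?a r n - ?a t n) (e / 3)" by (rule hb_mono) (use elim(2) in simp)
      then have "hb s (\<lambda>n. cis (- (r * omega \<alpha> n)) * (?a r n - ?a t n)) (e / 3)"
        by (rule hb_cong_cmod) (simp add: norm_mult)
      from hb_add[OF this elim(1)]
      have "hb s (\<lambda>n. cis (- (r * omega \<alpha> n)) * ?a r n - cis (- (t * omega \<alpha> n)) * ?a t n) (e / 3 + e / 3)"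
        by (simp add: algebra_simps)
      then have "hb s (fourier_coeff (\<lambda>z. u r z - u t z)) (e / 3 + e / 3)"
        using fourier_coeff_diff_sobolev[OF u[OF elim(3)] u[OF t]] by (simp only: fourier_coeff_ipath[of _ _ _ \<alpha>])
      then have "sobolev_norm s (\<lambda>z. u r z - u t z) \<le> e / 3 + e / 3" by (rule sobolev_norm_le)
      then show ?case using e sobolev_norm_nonneg[of s "\<lambda>z. u r z - u t z"] by simp
    qed
  qed
qed

section \<open>The Banach space in which solutions are unique\<close>

definition X_space :: "real \<Rightarrow> real \<Rightarrow> real \<Rightarrow> (real \<Rightarrow> real \<times> real \<Rightarrow> complex) set" where
  "X_space \<alpha> s T = {u. (\<forall>t\<in>{-T..T}. u t \<in> sobolev s) \<and> (\<exists>M. hpath s (-T) T (ipath \<alpha> u) M)}"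

text \<open>The maximum, rather than the sum, of the supremum and the Hoelder seminorm of the
  profile.\<close>

definition X_norm :: "real \<Rightarrow> real \<Rightarrow> real \<Rightarrow> (real \<Rightarrow> real \<times> real \<Rightarrow> complex) \<Rightarrow> real" where
  "X_norm \<alpha> s T u = Inf {M. hpath s (-T) T (ipath \<alpha> u) M}"

lemma X_norm_le: "hpath s (-T) T (ipath \<alpha> u) M \<Longrightarrow> X_norm \<alpha> s T u \<le> M"
  unfolding X_norm_def by (rule cInf_lower) (auto intro!: bdd_belowI[where m = 0] dest: hpath_nonneg)

text \<open>Bounds in \<open>hpath\<close> are stable under limits of the constant, so the infimum
  is attained and the norm can itself be used as a bound.\<close>

lemma X_norm_hpath:
  assumes "u \<in> X_space \<alpha> s T"
  shows "hpath s (-T) T (ipath \<alpha> u) (X_norm \<alpha> s T u)"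
proof (rule hpath_tendsto)
  let ?S = "{M. hpath s (-T) T (ipath \<alpha> u) M}"
  have ne: "?S \<noteq> {}" using assms by (auto simp: X_space_def)
  fix j
  have "Inf ?S < X_norm \<alpha> s T u + inverse (real (Suc j))" by (simp add: X_norm_def)
  then obtain M where "M \<in> ?S" "M < X_norm \<alpha> s T u + inverse (real (Suc j))" using cInf_lessD[OF ne] by blast
  then show "hpath s (-T) T (ipath \<alpha> u) (X_norm \<alpha> s T u + inverse (real (Suc j)))"
    by (auto intro: hpath_mono)
next
  have "(\<lambda>j. X_norm \<alpha> s T u + inverse (real (Suc j))) \<longlonglongrightarrow> X_norm \<alpha> s T u + 0"
    by (intro tendsto_intros LIMSEQ_inverse_real_of_nat)
  then show "(\<lambda>j. X_norm \<alpha> s T u + inverse (real (Suc j))) \<longlonglongrightarrow> X_norm \<alpha> s T u" by simp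
qed

lemma ipath_add:
  assumes "u t \<in> sobolev s" "v t \<in> sobolev s"
  shows "ipath \<alpha> (\<lambda>t z. u t z + v t z) t = (\<lambda>n. ipath \<alpha> u t n + ipath \<alpha> v t n)"
  using fourier_coeff_add_sobolev[OF assms] by (auto simp: ipath_def distrib_left)

lemma ipath_diff:
  assumes "u t \<in> sobolev s" "v t \<in> sobolev s"
  shows "ipath \<alpha> (\<lambda>t z. u t z - v t z) t = (\<lambda>n. ipath \<alpha> u t n - ipath \<alpha> v t n)"
  using fourier_coeff_diff_sobolev[OF assms] by (auto simp: ipath_def right_diff_distrib)

lemma ipath_scale: "ipath \<alpha> (\<lambda>t z. k * u t z) = (\<lambda>t n. k * ipath \<alpha> u t n)"
  by (intro ext) (simp add: ipath_def fourier_coeff_scale)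

lemma ipath_zero: "ipath \<alpha> (\<lambda>t z. 0) = (\<lambda>t n. 0)"
  by (intro ext) (simp add: ipath_def fourier_coeff_chr)

text \<open>Synthesis by \<open>U\<close> is inverse to taking the profile by \<open>ipath\<close>,
  so statements about coefficient paths transfer to paths of functions.\<close>

lemma U_sobolev:
  assumes "hpath s p q a M" "0 < s" "t \<in> {p..q}"
  shows "(\<lambda>z. U \<alpha> a (t, z)) \<in> sobolev s" and "ipath \<alpha> (\<lambda>t z. U \<alpha> a (t, z)) t = a t"
proof -
  have e: "(\<lambda>z. U \<alpha> a (t, z)) = synth (propagator \<alpha> t (a t))" by (auto simp: U_def)
  have h: "hb s (propagator \<alpha> t (a t)) M" using hpath_hb[OF assms(1,3)] by simp
  show "(\<lambda>z. U \<alpha> a (t, z)) \<in> sobolev s" unfolding e by (rule synth_sobolev[OF h assms(2)])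
  show "ipath \<alpha> (\<lambda>t z. U \<alpha> a (t, z)) t = a t"
  proof
    fix n
    have "fourier_coeff (\<lambda>z. U \<alpha> a (t, z)) n = cis (- (t * omega \<alpha> n)) * a t n"
      unfolding e synth_sobolev(2)[OF h assms(2)] by (rule propagator_cis)
    then show "ipath \<alpha> (\<lambda>t z. U \<alpha> a (t, z)) t n = a t n"
      by (simp add: ipath_def cis_mult mult.assoc[symmetric])
  qed
qed

lemma U_in_X_space:
  assumes "hpath s (-T) T a M" "0 < s"
  shows "(\<lambda>t z. U \<alpha> a (t, z)) \<in> X_space \<alpha> s T"
proof -
  have "hpath s (-T) T (ipath \<alpha> (\<lambda>t z. U \<alpha> a (t, z))) M"
    using assms by (subst hpath_cong[OF U_sobolev(2)[OF assms]])
  then show ?thesis using U_sobolev(1)[OF assms] by (auto simp: X_space_def)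
qed

lemma X_space_add:
  assumes "u \<in> X_space \<alpha> s T" "v \<in> X_space \<alpha> s T"
  shows "(\<lambda>t z. u t z + v t z) \<in> X_space \<alpha> s T"
    and "X_norm \<alpha> s T (\<lambda>t z. u t z + v t z) \<le> X_norm \<alpha> s T u + X_norm \<alpha> s T v"
proof -
  have "hpath s (-T) T (ipath \<alpha> (\<lambda>t z. u t z + v t z)) (X_norm \<alpha> s T u + X_norm \<alpha> s T v)"
    using hpath_add[OF X_norm_hpath[OF assms(1)] X_norm_hpath[OF assms(2)]]
    by (subst hpath_cong[OF ipath_add]) (use assms in \<open>auto simp: X_space_def\<close>)
  then show "(\<lambda>t z. u t z + v t z) \<in> X_space \<alpha> s T"
    and "X_norm \<alpha> s T (\<lambda>t z. u t z + v t z) \<le> X_norm \<alpha> s T u + X_norm \<alpha> s T v"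
    using assms by (auto simp: X_space_def sobolev_add intro: X_norm_le)
qed

lemma X_space_scale:
  assumes "u \<in> X_space \<alpha> s T"
  shows "(\<lambda>t z. k * u t z) \<in> X_space \<alpha> s T"
    and "X_norm \<alpha> s T (\<lambda>t z. k * u t z) \<le> cmod k * X_norm \<alpha> s T u"
proof -
  have "hpath s (-T) T (ipath \<alpha> (\<lambda>t z. k * u t z)) (cmod k * X_norm \<alpha> s T u)"
    unfolding ipath_scale by (rule hpath_scale[OF X_norm_hpath[OF assms]])
  then show "(\<lambda>t z. k * u t z) \<in> X_space \<alpha> s T" and "X_norm \<alpha> s T (\<lambda>t z. k * u t z) \<le> cmod k * X_norm \<alpha> s T u"
    using assms by (auto simp: X_space_def sobolev_scale intro: X_norm_le)
qed

lemma X_norm_scale: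
  assumes "u \<in> X_space \<alpha> s T"
  shows "X_norm \<alpha> s T (\<lambda>t z. k * u t z) = cmod k * X_norm \<alpha> s T u"
proof (cases "k = 0")
  case True
  have "X_norm \<alpha> s T (\<lambda>t z. k * u t z) \<le> 0" using X_space_scale(2)[OF assms, of k] True by simp
  moreover have "0 \<le> X_norm \<alpha> s T (\<lambda>t z. k * u t z)"
    using hpath_nonneg[OF X_norm_hpath[OF X_space_scale(1)[OF assms]]] .
  ultimately show ?thesis using True by simp
next
  case False
  have "X_norm \<alpha> s T u \<le> cmod (inverse k) * X_norm \<alpha> s T (\<lambda>t z. k * u t z)"
    using X_space_scale(2)[OF X_space_scale(1)[OF assms, of k], of "inverse k"] False
    by (simp add: mult.assoc[symmetric])
  then have "cmod k * X_norm \<alpha> s T u \<le> cmod k * (cmod (inverse k) * X_norm \<alpha> s T (\<lambda>t z. k * u t z))"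
    by (rule mult_left_mono) simp
  also have "\<dots> = X_norm \<alpha> s T (\<lambda>t z. k * u t z)" using False by (simp add: norm_inverse)
  finally show ?thesis using X_space_scale(2)[OF assms, of k] by simp
qed

lemma X_space_diff:
  assumes "u \<in> X_space \<alpha> s T" "v \<in> X_space \<alpha> s T"
  shows "(\<lambda>t z. u t z - v t z) \<in> X_space \<alpha> s T"
  using X_space_add(1)[OF assms(1) X_space_scale(1)[OF assms(2), of "-1"]] by simp

lemma X_norm_zero_iff:
  assumes u: "u \<in> X_space \<alpha> s T" and s: "0 \<le> s"
  shows "X_norm \<alpha> s T u = 0 \<longleftrightarrow> same_path T u (\<lambda>t z. 0)"
proof
  assume 0: "X_norm \<alpha> s T u = 0"
  show "same_path T u (\<lambda>t z. 0)"
    unfolding same_path_def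
  proof
    fix t assume t: "t \<in> {-T..T}"
    have "hb s (ipath \<alpha> u t) 0" using hpath_hb[OF X_norm_hpath[OF u] t] 0 by simp
    then have "fourier_coeff (u t) n = 0" for n
      using hb_0_imp_zero[OF s, of "fourier_coeff (u t)"] by (simp add: hb_ipath)
    then show "AE z in torus2. u t z = 0"
      using u t by (intro fourier_uniqueness sobolev_integrable[of _ s]) (auto simp: X_space_def)
  qed
next
  assume 0: "same_path T u (\<lambda>t z. 0)"
  have "ipath \<alpha> u t = (\<lambda>n. 0)" if t: "t \<in> {-T..T}" for t
  proof -
    have "fourier_coeff (u t) = fourier_coeff (\<lambda>z. 0)"
      using 0 t u by (intro fourier_coeff_cong_AE) (auto simp: same_path_def X_space_def intro: sobolev_measurable)
    then show ?thesis by (auto simp: ipath_def fourier_coeff_chr)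
  qed
  then have "hpath s (-T) T (ipath \<alpha> u) 0"
    by (subst hpath_cong[where b = "\<lambda>t n. 0"]) (auto intro!: hpath_const hb_zero)
  then have "X_norm \<alpha> s T u \<le> 0" by (rule X_norm_le)
  then show "X_norm \<alpha> s T u = 0" using hpath_nonneg[OF X_norm_hpath[OF u]] by simp
qed

text \<open>Completeness is inherited from Hoelder paths of coefficients, and the limit path is
  turned back into functions by \<open>U\<close>. Closure under equality almost everywhere holds
  because the profile sees only Fourier coefficients.\<close>

lemma X_space_banach:
  assumes s: "0 < s" and T: "0 < T"
  shows "banach_embedded_in_C_sobolev s T (X_space \<alpha> s T) (X_norm \<alpha> s T)"
  unfolding banach_embedded_in_C_sobolev_def
proof (intro conjI ballI allI impI)
  show "X_space \<alpha> s T \<subseteq> C_sobolev s T"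
    using C_sobolevI[of T _ s \<alpha>] by (force simp: X_space_def)
  show "v \<in> X_space \<alpha> s T" if u: "u \<in> X_space \<alpha> s T" and v: "v \<in> C_sobolev s T" and uv: "same_path T u v" for u v
  proof -
    have vs: "v t \<in> sobolev s" if "t \<in> {-T..T}" for t using v that by (simp add: C_sobolev_def)
    have "fourier_coeff (u t) = fourier_coeff (v t)" if t: "t \<in> {-T..T}" for t
      using uv u vs t by (intro fourier_coeff_cong_AE) (auto simp: same_path_def X_space_def intro: sobolev_measurable)
    then have "ipath \<alpha> u t = ipath \<alpha> v t" if "t \<in> {-T..T}" for t using that by (auto simp: ipath_def)
    then have "hpath s (-T) T (ipath \<alpha> v) (X_norm \<alpha> s T u)"
      using X_norm_hpath[OF u] by (subst hpath_cong[where b = "ipath \<alpha> u"]) auto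
    then show ?thesis using vs by (auto simp: X_space_def)
  qed
  show "(\<lambda>t z. 0) \<in> X_space \<alpha> s T"
    by (auto simp: X_space_def sobolev_zero ipath_zero intro!: exI[of _ 0] hpath_const hb_zero)
  show "\<exists>C. \<forall>u\<in>X_space \<alpha> s T. C_sobolev_norm s T u \<le> C * X_norm \<alpha> s T u"
  proof (intro exI[of _ 1] ballI)
    fix u assume u: "u \<in> X_space \<alpha> s T"
    show "C_sobolev_norm s T u \<le> 1 * X_norm \<alpha> s T u"
      unfolding C_sobolev_norm_def
    proof (rule cSUP_least)
      fix t assume t: "t \<in> {-T..T}"
      have "hb s (fourier_coeff (u t)) (X_norm \<alpha> s T u)"
        using hpath_hb[OF X_norm_hpath[OF u] t] by (simp add: hb_ipath)
      then show "sobolev_norm s (u t) \<le> 1 * X_norm \<alpha> s T u" using sobolev_norm_le by simp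
    qed (use T in auto)
  qed
  fix w :: "nat \<Rightarrow> real \<Rightarrow> real \<times> real \<Rightarrow> complex"
  assume w: "(\<forall>k. w k \<in> X_space \<alpha> s T) \<and> (\<forall>\<epsilon>>0. \<exists>K. \<forall>j\<ge>K. \<forall>k\<ge>K. X_norm \<alpha> s T (\<lambda>t z. w j t z - w k t z) < \<epsilon>)"
  have wX: "w k \<in> X_space \<alpha> s T" for k using w by blast
  have ws: "w k t \<in> sobolev s" if "t \<in> {-T..T}" for k t using wX[of k] that by (simp add: X_space_def)
  obtain b where b: "\<exists>M. hpath s (-T) T b M"
    and lim: "\<And>\<epsilon>. 0 < \<epsilon> \<Longrightarrow> \<exists>K. \<forall>j\<ge>K. hpath s (-T) T (\<lambda>t n. ipath \<alpha> (w j) t n - b t n) \<epsilon>"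
  proof (rule hpath_complete[of s "-T" T "\<lambda>j. ipath \<alpha> (w j)"])
    show "\<exists>M. hpath s (-T) T (ipath \<alpha> (w j)) M" for j using wX[of j] by (simp add: X_space_def)
    fix \<epsilon> :: real assume "0 < \<epsilon>"
    then obtain K where K: "\<forall>j\<ge>K. \<forall>k\<ge>K. X_norm \<alpha> s T (\<lambda>t z. w j t z - w k t z) < \<epsilon>" using w by blast
    show "\<exists>K. \<forall>j\<ge>K. \<forall>k\<ge>K. hpath s (-T) T (\<lambda>t n. ipath \<alpha> (w j) t n - ipath \<alpha> (w k) t n) \<epsilon>"
    proof (intro exI allI impI)
      fix j k assume "K \<le> j" "K \<le> k"
      then have "X_norm \<alpha> s T (\<lambda>t z. w j t z - w k t z) \<le> \<epsilon>" using K by (simp add: less_imp_le)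
      then have "hpath s (-T) T (ipath \<alpha> (\<lambda>t z. w j t z - w k t z)) \<epsilon>"
        using X_norm_hpath[OF X_space_diff[OF wX[of j] wX[of k]]] by (rule hpath_mono[rotated])
      then show "hpath s (-T) T (\<lambda>t n. ipath \<alpha> (w j) t n - ipath \<alpha> (w k) t n) \<epsilon>"
        by (subst (asm) hpath_cong[OF ipath_diff[OF ws ws]])
    qed
  qed (use s in auto)
  obtain M where M: "hpath s (-T) T b M" using b by blast
  let ?u = "\<lambda>t z. U \<alpha> b (t, z)"
  show "\<exists>u\<in>X_space \<alpha> s T. (\<lambda>k. X_norm \<alpha> s T (\<lambda>t z. w k t z - u t z)) \<longlonglongrightarrow> 0"
  proof (rule bexI[of _ ?u])
    show uX: "?u \<in> X_space \<alpha> s T" by (rule U_in_X_space[OF M s])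
    show "(\<lambda>k. X_norm \<alpha> s T (\<lambda>t z. w k t z - ?u t z)) \<longlonglongrightarrow> 0"
      unfolding LIMSEQ_iff
    proof (intro allI impI)
      fix e :: real assume e: "0 < e"
      then obtain K where K: "\<forall>j\<ge>K. hpath s (-T) T (\<lambda>t n. ipath \<alpha> (w j) t n - b t n) (e / 2)" using lim[of "e / 2"] by auto
      show "\<exists>K. \<forall>k\<ge>K. norm (X_norm \<alpha> s T (\<lambda>t z. w k t z - ?u t z) - 0) < e"
      proof (intro exI allI impI)
        fix k assume "K \<le> k"
        then have "hpath s (-T) T (\<lambda>t n. ipath \<alpha> (w k) t n - b t n) (e / 2)" using K by blast
        then have "hpath s (-T) T (ipath \<alpha> (\<lambda>t z. w k t z - ?u t z)) (e / 2)"
          using ipath_diff[OF ws U_sobolev(1)[OF M s]] U_sobolev(2)[OF M s]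
          by (subst hpath_cong[where b = "\<lambda>t n. ipath \<alpha> (w k) t n - b t n"]) auto
        then have "X_norm \<alpha> s T (\<lambda>t z. w k t z - ?u t z) \<le> e / 2" by (rule X_norm_le)
        then show "norm (X_norm \<alpha> s T (\<lambda>t z. w k t z - ?u t z) - 0) < e"
          using e hpath_nonneg[OF X_norm_hpath[OF X_space_diff[OF wX[of k] uX]]] by simp
      qed
    qed
  qed
qed (use s X_space_add X_space_scale X_norm_scale X_norm_zero_iff hpath_nonneg[OF X_norm_hpath] in auto)

section \<open>The integral equation\<close>

lemma sobolev_synth_AE:
  assumes f: "f \<in> sobolev s" and s: "0 < s"
  shows "AE z in torus2. f z = synth (fourier_coeff f) z"
  using synth_sobolev[OF sobolev_hb[OF f] s] by (intro sobolev_eq_AE[OF f]) auto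

text \<open>At each fixed time \<open>u r\<close> agrees almost everywhere with the synthesised
  wave, hence so do the cubic terms. The identity covers times at which they are not integrable,
  since both coefficients then take the same default value.\<close>

lemma fourier_coeff_cubic:
  assumes u: "u r \<in> sobolev s" and s: "0 < s"
  shows "fourier_coeff (cubic (u r)) = fourier_coeff (\<lambda>z. prod3 \<alpha> (ipath \<alpha> u) (ipath \<alpha> u) (ipath \<alpha> u) (r, z))"
proof (rule fourier_coeff_cong_AE)
  have e: "U \<alpha> (ipath \<alpha> u) (r, z) = synth (fourier_coeff (u r)) z" for z
  proof -
    have "propagator \<alpha> r (ipath \<alpha> u r) = fourier_coeff (u r)"
      by (rule ext) (simp add: propagator_cis fourier_coeff_ipath[of u r _ \<alpha>])
    then show ?thesis by (simp add: U_def)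
  qed
  note [measurable] = sobolev_measurable[OF u]
  show "AE z in torus2. cubic (u r) z = prod3 \<alpha> (ipath \<alpha> u) (ipath \<alpha> u) (ipath \<alpha> u) (r, z)"
    using sobolev_synth_AE[OF u s]
  proof eventually_elim
    case (elim z)
    have "complex_of_real ((cmod w)\<^sup>2) = w * cnj w" for w
      by (rule complex_norm_square)
    then show ?case unfolding cubic_def prod3_def e elim[symmetric] by simp
  qed
  show "cubic (u r) \<in> borel_measurable torus2" unfolding cubic_def by measurable
  show "(\<lambda>z. prod3 \<alpha> (ipath \<alpha> u) (ipath \<alpha> u) (ipath \<alpha> u) (r, z)) \<in> borel_measurable torus2"
    unfolding prod3_def e by measurable
qed

section \<open>The Duhamel integral in the interaction picture\<close>

definition integrand :: "real \<Rightarrow> (real \<Rightarrow> int \<times> int \<Rightarrow> complex) \<Rightarrow> int \<times> int \<Rightarrow> real \<Rightarrow> complex" where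
  "integrand \<alpha> a n r = cis (r * omega \<alpha> n) * fourier_coeff (\<lambda>z. prod3 \<alpha> a a a (r, z)) n"

text \<open>Free of the factor -\<i> \<sigma> and of S(t): the former is restored in the equation,
  the latter cancels in the interaction picture.\<close>

definition duhamel :: "real \<Rightarrow> (real \<Rightarrow> int \<times> int \<Rightarrow> complex) \<Rightarrow> real \<Rightarrow> int \<times> int \<Rightarrow> complex" where
  "duhamel \<alpha> a t n = (LBINT r=0..t. integrand \<alpha> a n r)"

lemma duhamel_0 [simp]: "duhamel \<alpha> a 0 n = 0"
  by (simp add: duhamel_def zero_ereal_def)

lemma eighth_root_small:
  fixes x :: real
  assumes "0 < x"
  obtains h where "0 < h" "h \<le> 1" "h powr (1/8) \<le> x"
proof
  let ?h = "min 1 (x ^ 8)"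
  show "0 < ?h" "?h \<le> 1" using assms by auto
  have "?h powr (1/8) \<le> (x ^ 8) powr (1/8)" using assms by (intro powr_mono2) auto
  also have "\<dots> = (x powr real 8) powr (1/8)" using assms by (subst powr_realpow) auto
  also have "\<dots> = x" using assms by (simp add: powr_powr del: powr_numeral)
  finally show "?h powr (1/8) \<le> x" .
qed

text \<open>Increments of order 1/2 exceed what exponent 3/8 requires. The surplus, the power 1/8 of
  the length, is the small factor behind the contraction. Vanishing at \<open>t0\<close> turns the
  bound on increments into one on the values, as the interval has length at most 1.\<close>

lemma hpath_of_increments:
  assumes t0: "t0 \<in> {p..q}" "\<And>n. v t0 n = 0" and pq: "q - p \<le> 1" and L: "0 \<le> L"
    and inc: "\<And>t t'. t \<in> {p..q} \<Longrightarrow> t' \<in> {p..q} \<Longrightarrow> t' < t \<Longrightarrow> hb s (\<lambda>n. v t n - v t' n) (L * sqrt (t - t'))"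
  shows "hpath s p q v (L * (q - p) powr (1/8))"
proof -
  let ?K = "L * (q - p) powr (1/8)"
  have K: "0 \<le> ?K" using L by simp
  have d: "hb s (\<lambda>n. v t n - v t' n) (?K * \<bar>t - t'\<bar> powr (3/8))" if t: "t \<in> {p..q}" "t' \<in> {p..q}" for t t'
  proof -
    have pos: "hb s (\<lambda>n. v t n - v t' n) (?K * \<bar>t - t'\<bar> powr (3/8))" if t: "t \<in> {p..q}" "t' \<in> {p..q}" "t' < t" for t t'
    proof (rule hb_mono[OF inc[OF t]])
      have "sqrt (t - t') = (t - t') powr (1/8 + 3/8)" using t by (simp add: powr_half_sqrt)
      also have "\<dots> = (t - t') powr (1/8) * (t - t') powr (3/8)" by (rule powr_add)
      also have "\<dots> \<le> (q - p) powr (1/8) * (t - t') powr (3/8)"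
        using t by (intro mult_right_mono powr_mono2) auto
      finally have "L * sqrt (t - t') \<le> L * ((q - p) powr (1/8) * (t - t') powr (3/8))" using L by (intro mult_left_mono)
      then show "L * sqrt (t - t') \<le> ?K * \<bar>t - t'\<bar> powr (3/8)" using t by (simp add: mult.assoc)
    qed
    consider "t' < t" | "t = t'" | "t < t'" by linarith
    then show ?thesis
    proof cases
      case 1
      then show ?thesis using pos t by blast
    next
      case 2
      then show ?thesis using hb_zero by simp
    next
      case 3
      show ?thesis
        by (rule hb_cong_cmod[of s "\<lambda>n. v t' n - v t n"])
           (use pos[OF t(2) t(1) 3] in \<open>simp_all add: norm_minus_commute abs_minus_commute\<close>)
    qed
  qed
  have "hb s (v t) ?K" if t: "t \<in> {p..q}" for t
  proof -
    have "\<bar>t - t0\<bar> powr (3/8) \<le> 1" using t t0 pq by (intro powr_le1) auto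
    then have "?K * \<bar>t - t0\<bar> powr (3/8) \<le> ?K * 1" using K by (intro mult_left_mono)
    then show ?thesis using hb_mono[OF d[OF t t0(1)]] t0(2) by simp
  qed
  then show ?thesis using d K by (simp add: hpath_def)
qed

context strichartz
begin

lemma integrand_set_integrable:
  assumes pq: "p < q" "q - p \<le> 1" and a: "hpath s p q a A"
  shows "set_integrable lborel {p..q} (integrand \<alpha> a n)"
proof -
  have "integrable (TI p q) (integrand \<alpha> a n)"
    unfolding integrand_def[abs_def] by (rule ipic_integrand(2)[OF prod3_integrable[OF pq a a a]])
  then show ?thesis
    unfolding TI_def set_integrable_def by (subst (asm) integrable_restrict_space) auto
qed

lemma duhamel_increment:
  assumes T: "0 < T" "2 * T \<le> 1" and a: "hpath s (-T) T a A" and t: "t \<in> {-T..T}" "t' \<in> {-T..T}" "t' < t"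
  shows "duhamel \<alpha> a t n - duhamel \<alpha> a t' n = ipic \<alpha> t' t (prod3 \<alpha> a a a) n"
proof -
  let ?f = "integrand \<alpha> a n"
  have si: "set_integrable lborel {-T..T} ?f" using T by (intro integrand_set_integrable[OF _ _ a]) auto
  have "(LBINT r=ereal 0..ereal t'. ?f r) + (LBINT r=ereal t'..ereal t. ?f r) = (LBINT r=ereal 0..ereal t. ?f r)"
  proof (rule interval_integral_sum)
    \<comment> \<open>Integrability on the hull of 0 and the two times covers all orders in which
      these three can occur.\<close>
    define lo hi where "lo = min 0 (min t' t)" and "hi = max 0 (max t' t)"
    have lohi: "lo \<le> hi" "-T \<le> lo" "hi \<le> T" using t T by (auto simp: lo_def hi_def)
    have "set_integrable lborel (einterval (ereal lo) (ereal hi)) ?f"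
      by (rule set_integrable_subset[OF si]) (use lohi in \<open>auto simp: einterval_iff\<close>)
    then have "interval_lebesgue_integrable lborel (ereal lo) (ereal hi) ?f"
      using lohi by (simp add: interval_lebesgue_integrable_def)
    then show "interval_lebesgue_integrable lborel (min (ereal 0) (min (ereal t') (ereal t))) (max (ereal 0) (max (ereal t') (ereal t))) ?f"
      by (simp only: lo_def hi_def ereal_min ereal_max)
  qed
  moreover have "(LBINT r=ereal t'..ereal t. ?f r) = ipic \<alpha> t' t (prod3 \<alpha> a a a) n"
  proof -
    have "(LBINT r=ereal t'..ereal t. ?f r) = (LBINT r:{t'..t}. ?f r)" using t by (intro interval_integral_Icc) simp
    also have "\<dots> = (\<integral>r. ?f r \<partial>TI t' t)"
      unfolding TI_def set_lebesgue_integral_def by (subst integral_restrict_space) auto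
    finally show ?thesis by (simp add: ipic_def integrand_def)
  qed
  ultimately show ?thesis unfolding duhamel_def zero_ereal_def by (simp add: algebra_simps)
qed

text \<open>The difference of the cubic terms telescopes into three products that contain the
  difference of the paths once each. The additivity of \<open>U\<close> behind it holds almost
  everywhere, which suffices under the integral.\<close>

lemma ipic_cubic_diff:
  assumes pq: "p < q" "q - p \<le> 1" and a: "hpath s p q a A" and b: "hpath s p q b A"
    and w: "hpath s p q (\<lambda>t n. a t n - b t n) W"
  shows "hb s (\<lambda>n. ipic \<alpha> p q (prod3 \<alpha> a a a) n - ipic \<alpha> p q (prod3 \<alpha> b b b) n) (3 * tri_const * A\<^sup>2 * W * sqrt (q - p))"
proof -
  let ?w = "\<lambda>t n. a t n - b t n"
  have eq: "ipic \<alpha> p q (prod3 \<alpha> a a a) n - ipic \<alpha> p q (prod3 \<alpha> b b b) n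
     = ipic \<alpha> p q (prod3 \<alpha> ?w a a) n + ipic \<alpha> p q (prod3 \<alpha> b ?w a) n + ipic \<alpha> p q (prod3 \<alpha> b b ?w) n" for n
  proof -
    let ?H = "\<lambda>G w. cis (fst w * omega \<alpha> n) * (G w * cnj (chr n (snd w)))"
    note I = prod3_integrable[OF pq a a a] prod3_integrable[OF pq b b b] prod3_integrable[OF pq w a a]
      prod3_integrable[OF pq b w a] prod3_integrable[OF pq b b w]
    have s1: "AE x in PT p q. U \<alpha> (\<lambda>t n. ?w t n + b t n) x = U \<alpha> ?w x + U \<alpha> b x"
      using hpath_continuous[OF w] hpath_hb[OF w] hpath_continuous[OF b] hpath_hb[OF b] s0
      by (intro U_add_AE[where s = s]) blast+
    have "(\<lambda>t n. ?w t n + b t n) = a" by (intro ext) simp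
    with s1 have "AE x in PT p q. U \<alpha> a x = U \<alpha> ?w x + U \<alpha> b x" by simp
    then have ae: "AE x in PT p q. ?H (prod3 \<alpha> a a a) x - ?H (prod3 \<alpha> b b b) x
       = ?H (prod3 \<alpha> ?w a a) x + ?H (prod3 \<alpha> b ?w a) x + ?H (prod3 \<alpha> b b ?w) x"
    proof eventually_elim
      case (elim x)
      show ?case unfolding prod3_def elim by (simp add: algebra_simps)
    qed
    have "(\<integral>x. ?H (prod3 \<alpha> a a a) x \<partial>PT p q) - (\<integral>x. ?H (prod3 \<alpha> b b b) x \<partial>PT p q)
       = (\<integral>x. ?H (prod3 \<alpha> a a a) x - ?H (prod3 \<alpha> b b b) x \<partial>PT p q)"
      by (rule Bochner_Integration.integral_diff[symmetric]) (rule I[THEN ipic_integrand(1)])+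
    also have "\<dots> = (\<integral>x. ?H (prod3 \<alpha> ?w a a) x + ?H (prod3 \<alpha> b ?w a) x + ?H (prod3 \<alpha> b b ?w) x \<partial>PT p q)"
      using I[THEN ipic_integrand(1)]
      by (intro integral_cong_AE ae borel_measurable_integrable Bochner_Integration.integrable_diff Bochner_Integration.integrable_add)
    also have "\<dots> = (\<integral>x. ?H (prod3 \<alpha> ?w a a) x \<partial>PT p q) + (\<integral>x. ?H (prod3 \<alpha> b ?w a) x \<partial>PT p q) + (\<integral>x. ?H (prod3 \<alpha> b b ?w) x \<partial>PT p q)"
      by (simp add: I[THEN ipic_integrand(1)[where \<alpha> = \<alpha> and n = n]])
    finally show ?thesis
      unfolding I[THEN ipic_integrand(3)] by (simp only: diff_divide_distrib[symmetric] add_divide_distrib[symmetric])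
  qed
  have "hb s (\<lambda>n. ipic \<alpha> p q (prod3 \<alpha> ?w a a) n + ipic \<alpha> p q (prod3 \<alpha> b ?w a) n + ipic \<alpha> p q (prod3 \<alpha> b b ?w) n)
    (tri_const * sqrt (q - p) * W * A * A + tri_const * sqrt (q - p) * A * W * A + tri_const * sqrt (q - p) * A * A * W)"
    by (intro hb_add trilinear[OF pq] a b w)
  then show ?thesis unfolding eq by (simp add: power2_eq_square algebra_simps)
qed

lemma duhamel_bound:
  assumes T: "0 < T" "2 * T \<le> 1" and a: "hpath s (-T) T a A"
  shows "hpath s (-T) T (duhamel \<alpha> a) (tri_const * A * A * A * (2 * T) powr (1/8))"
proof -
  have A: "0 \<le> A" using a by (rule hpath_nonneg)
  have "hpath s (-T) T (duhamel \<alpha> a) (tri_const * A * A * A * (T - - T) powr (1/8))"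
  proof (rule hpath_of_increments[where ?t0.0 = 0])
    fix t t' assume t: "t \<in> {-T..T}" "t' \<in> {-T..T}" "t' < t"
    have a': "hpath s t' t a A" by (rule hpath_subinterval[OF a]) (use t in auto)
    have "hb s (ipic \<alpha> t' t (prod3 \<alpha> a a a)) (tri_const * sqrt (t - t') * A * A * A)"
      by (rule trilinear[OF _ _ a' a' a']) (use t T in auto)
    then show "hb s (\<lambda>n. duhamel \<alpha> a t n - duhamel \<alpha> a t' n) (tri_const * A * A * A * sqrt (t - t'))"
      unfolding duhamel_increment[OF T a t] by (simp add: mult_ac)
  qed (use T A tri_const_nonneg in auto)
  then show ?thesis by simp
qed

lemma duhamel_diff_bound:
  assumes T: "0 < T" "2 * T \<le> 1" and a: "hpath s (-T) T a A" and b: "hpath s (-T) T b A"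
    and w: "hpath s (-T) T (\<lambda>t n. a t n - b t n) W"
  shows "hpath s (-T) T (\<lambda>t n. duhamel \<alpha> a t n - duhamel \<alpha> b t n) (3 * tri_const * A\<^sup>2 * W * (2 * T) powr (1/8))"
proof -
  have A: "0 \<le> A" "0 \<le> W" using a w by (auto dest: hpath_nonneg)
  have "hpath s (-T) T (\<lambda>t n. duhamel \<alpha> a t n - duhamel \<alpha> b t n) (3 * tri_const * A\<^sup>2 * W * (T - - T) powr (1/8))"
  proof (rule hpath_of_increments[where ?t0.0 = 0])
    fix t t' assume t: "t \<in> {-T..T}" "t' \<in> {-T..T}" "t' < t"
    have sub: "{t'..t} \<subseteq> {-T..T}" using t by auto
    have "hb s (\<lambda>n. ipic \<alpha> t' t (prod3 \<alpha> a a a) n - ipic \<alpha> t' t (prod3 \<alpha> b b b) n) (3 * tri_const * A\<^sup>2 * W * sqrt (t - t'))"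
      by (rule ipic_cubic_diff[OF _ _ hpath_subinterval[OF a sub] hpath_subinterval[OF b sub] hpath_subinterval[OF w sub]]) (use t T in auto)
    then show "hb s (\<lambda>n. duhamel \<alpha> a t n - duhamel \<alpha> b t n - (duhamel \<alpha> a t' n - duhamel \<alpha> b t' n)) (3 * tri_const * A\<^sup>2 * W * sqrt (t - t'))"
      unfolding duhamel_increment[OF T a t, symmetric] duhamel_increment[OF T b t, symmetric]
      by (simp add: algebra_simps)
  qed (use T A tri_const_nonneg in auto)
  then show ?thesis by simp
qed

section \<open>The integral equation for profiles: uniqueness, existence, dependence on the
  data\<close>

definition mild :: "real \<Rightarrow> real \<Rightarrow> (int \<times> int \<Rightarrow> complex) \<Rightarrow> (real \<Rightarrow> int \<times> int \<Rightarrow> complex) \<Rightarrow> bool" where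
  "mild \<sigma> T c a \<longleftrightarrow> (\<forall>t\<in>{-T..T}. \<forall>n. a t n = c n - \<i> * complex_of_real \<sigma> * duhamel \<alpha> a t n)"

text \<open>The bound \<open>A\<close> is not small in terms of \<open>T\<close>, so there need not
  be a contraction on the whole interval. On windows whose length depends on \<open>A\<close> the
  Hoelder bound of the difference can be halved without end, so the difference vanishes there, and
  steps of length h/2 spread this from time 0 over the interval.\<close>

lemma mild_unique:
  assumes T: "0 < T" "2 * T \<le> 1" and \<sigma>: "\<bar>\<sigma>\<bar> = 1"
    and a: "hpath s (-T) T a A" "mild \<sigma> T c a" and b: "hpath s (-T) T b A" "mild \<sigma> T c b"
    and t: "t \<in> {-T..T}"
  shows "a t = b t"
proof -
  define w where "w t n = a t n - b t n" for t n
  have A: "0 \<le> A" using a(1) by (rule hpath_nonneg)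
  have w: "hpath s (-T) T w (2 * A)" unfolding w_def using hpath_diff[OF a(1) b(1)] by simp
  have w_eq: "w t n = - (\<i> * complex_of_real \<sigma>) * (duhamel \<alpha> a t n - duhamel \<alpha> b t n)" if "t \<in> {-T..T}" for t n
  proof -
    have "a t n = c n - \<i> * complex_of_real \<sigma> * duhamel \<alpha> a t n" "b t n = c n - \<i> * complex_of_real \<sigma> * duhamel \<alpha> b t n"
      using a(2) b(2) that unfolding mild_def by blast+
    then show ?thesis unfolding w_def by (simp add: algebra_simps)
  qed
  let ?K = "3 * tri_const * A\<^sup>2"
  have K0: "0 \<le> ?K" using tri_const_nonneg A by simp
  then have "0 < 1 / (2 * (?K + 1))" by simp
  then obtain h where h: "0 < h" "h \<le> 1" "h powr (1/8) \<le> 1 / (2 * (?K + 1))" by (rule eighth_root_small)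
  have Kh: "?K * h powr (1/8) \<le> 1 / 2"
  proof -
    have "?K * h powr (1/8) \<le> ?K * (1 / (2 * (?K + 1)))" using h K0 by (intro mult_left_mono) auto
    also have "\<dots> \<le> 1 / 2" using K0 by (simp add: divide_simps)
    finally show ?thesis .
  qed
  have step: "w t n = 0" if t0: "t0 \<in> {-T..T}" "\<And>n. w t0 n = 0" and t: "t \<in> {-T..T}" "\<bar>t - t0\<bar> \<le> h / 2" for t t0 n
  proof -
    define p where "p = max (-T) (t0 - h / 2)"
    define q where "q = min T (t0 + h / 2)"
    have tb: "t \<le> t0 + h / 2" "t0 - h / 2 \<le> t" using t(2) by linarith+
    have pq: "p < q" "q - p \<le> h" "q - p \<le> 1" and sub: "{p..q} \<subseteq> {-T..T}" and tin: "t0 \<in> {p..q}" "t \<in> {p..q}"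
      using t0(1) t(1) tb h(1,2) T by (auto simp: p_def q_def)
    have improve: "hpath s p q w (W / 2)" if W: "hpath s p q w W" for W
    proof -
      have W0: "0 \<le> W" using W by (rule hpath_nonneg)
      have "hpath s p q w (?K * W * (q - p) powr (1/8))"
      proof (rule hpath_of_increments[where v = w and ?t0.0 = t0, OF tin(1) t0(2) pq(3)])
        fix u u' assume u: "u \<in> {p..q}" "u' \<in> {p..q}" "u' < u"
        have uT: "u \<in> {-T..T}" "u' \<in> {-T..T}" using u sub by auto
        have s1: "{u'..u} \<subseteq> {-T..T}" "{u'..u} \<subseteq> {p..q}" using u sub by auto
        have "hb s (\<lambda>n. ipic \<alpha> u' u (prod3 \<alpha> a a a) n - ipic \<alpha> u' u (prod3 \<alpha> b b b) n) (3 * tri_const * A\<^sup>2 * W * sqrt (u - u'))"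
          by (rule ipic_cubic_diff[OF _ _ hpath_subinterval[OF a(1) s1(1)] hpath_subinterval[OF b(1) s1(1)] hpath_subinterval[OF W s1(2), unfolded w_def]])
             (use u pq in auto)
        then have "hb s (\<lambda>n. - (\<i> * complex_of_real \<sigma>) * (ipic \<alpha> u' u (prod3 \<alpha> a a a) n - ipic \<alpha> u' u (prod3 \<alpha> b b b) n)) (3 * tri_const * A\<^sup>2 * W * sqrt (u - u'))"
          by (rule hb_cong_cmod) (simp add: norm_mult \<sigma>)
        moreover have "w u n - w u' n = - (\<i> * complex_of_real \<sigma>) * (ipic \<alpha> u' u (prod3 \<alpha> a a a) n - ipic \<alpha> u' u (prod3 \<alpha> b b b) n)" for n
          unfolding w_eq[OF uT(1)] w_eq[OF uT(2)] duhamel_increment[OF T a(1) uT u(3), symmetric] duhamel_increment[OF T b(1) uT u(3), symmetric]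
          by (simp add: algebra_simps)
        ultimately show "hb s (\<lambda>n. w u n - w u' n) (?K * W * sqrt (u - u'))" by simp
      qed (use K0 W0 in simp)
      then show ?thesis
      proof (rule hpath_mono)
        have "?K * (q - p) powr (1/8) \<le> ?K * h powr (1/8)" using pq K0 by (intro mult_left_mono powr_mono2) auto
        then have "?K * (q - p) powr (1/8) * W \<le> 1 / 2 * W" using Kh W0 by (intro mult_right_mono) auto
        then show "?K * W * (q - p) powr (1/8) \<le> W / 2" by (simp add: mult_ac)
      qed
    qed
    have "hpath s p q w (2 * A / 2 ^ k)" for k
    proof (induction k)
      case 0
      then show ?case using hpath_subinterval[OF w sub] by simp
    next
      case (Suc k)
      from improve[OF this] show ?case by (simp add: field_simps)
    qed
    then have "hpath s p q w (2 * A * (1 / 2) ^ k)" for k by (simp add: power_one_over)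
    moreover have "(\<lambda>k. 2 * A * (1 / 2) ^ k) \<longlonglongrightarrow> 2 * A * 0"
      by (intro tendsto_intros LIMSEQ_power_zero) auto
    ultimately have "hpath s p q w (2 * A * 0)" by (rule hpath_tendsto)
    then have "hb s (w t) 0" using hpath_hb[OF _ tin(2)] by fastforce
    then show ?thesis by (rule hb_0_imp_zero[OF s0(2)])
  qed
  have "w t n = 0" if "t \<in> {-T..T}" "\<bar>t\<bar> \<le> real j * (h / 2)" for t n j
    using that
  proof (induction j arbitrary: t n)
    case 0
    then show ?case using w_eq[of 0] T by simp
  next
    case (Suc j)
    \<comment> \<open>\<open>t\<close> is clamped to the range already covered, which moves it by at
      most h/2 and not away from 0.\<close>
    define t0 where "t0 = max (- (real j * (h / 2))) (min t (real j * (h / 2)))"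
    have jh: "0 \<le> real j * (h / 2)" using h by simp
    have bound: "\<bar>t\<bar> \<le> real j * (h / 2) + h / 2" using Suc.prems(2) by (simp add: algebra_simps add_divide_distrib)
    have "\<bar>t0\<bar> \<le> real j * (h / 2)" "\<bar>t0\<bar> \<le> \<bar>t\<bar>" "\<bar>t - t0\<bar> \<le> h / 2"
      unfolding t0_def using jh bound h by linarith+
    moreover have "t0 \<in> {-T..T}" using \<open>\<bar>t0\<bar> \<le> \<bar>t\<bar>\<close> Suc.prems(1) by (auto simp: abs_le_iff)
    ultimately show ?case using Suc.IH step[of t0 t n] Suc.prems(1) by blast
  qed
  moreover obtain j where "\<bar>t\<bar> \<le> real j * (h / 2)"
    using ex_less_of_nat_mult[of "h / 2" "\<bar>t\<bar>"] h by (meson half_gt_zero less_imp_le)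
  ultimately have "w t n = 0" for n using t by blast
  then show ?thesis by (auto simp: w_def)
qed

text \<open>Picard iteration in the ball of radius 2R around 0. The threshold 1/6 makes the
  nonlinear part at most R/3, so the ball is preserved, and with the 3 from the telescoped cubic
  difference the contraction factor is 1/2.\<close>

lemma mild_exists:
  assumes T: "0 < T" "2 * T \<le> 1" and \<sigma>: "\<bar>\<sigma>\<bar> = 1"
    and c: "hb s c R" and small: "tri_const * (2 * R)\<^sup>2 * (2 * T) powr (1/8) \<le> 1 / 6"
  shows "\<exists>a. hpath s (-T) T a (2 * R) \<and> mild \<sigma> T c a"
proof -
  define M where "M = 2 * R"
  have R: "0 \<le> R" using c by (rule hb_nonneg)
  then have M: "0 \<le> M" by (simp add: M_def)
  define \<kappa> where "\<kappa> = tri_const * M\<^sup>2 * (2 * T) powr (1/8)"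
  have \<kappa>: "\<kappa> \<le> 1 / 6" using small by (simp add: \<kappa>_def M_def)
  define \<Gamma> where "\<Gamma> a t n = c n - \<i> * complex_of_real \<sigma> * duhamel \<alpha> a t n" for a t n
  have n1: "cmod (\<i> * complex_of_real \<sigma>) = 1" using \<sigma> by (simp add: norm_mult)
  have \<Gamma>_bound: "hpath s (-T) T (\<Gamma> a) M" if a: "hpath s (-T) T a M" for a
  proof -
    have "hpath s (-T) T (\<Gamma> a) (R + cmod (\<i> * complex_of_real \<sigma>) * (tri_const * M * M * M * (2 * T) powr (1/8)))"
      unfolding \<Gamma>_def[abs_def] by (intro hpath_diff hpath_const c hpath_scale duhamel_bound T a)
    moreover have "tri_const * M * M * M * (2 * T) powr (1/8) = \<kappa> * M" by (simp add: \<kappa>_def power2_eq_square)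
    moreover have "\<kappa> * M \<le> 1 / 6 * M" using \<kappa> M by (rule mult_right_mono)
    ultimately have "hpath s (-T) T (\<Gamma> a) (R + \<kappa> * M)" by (simp only: n1 mult_1_left)
    then show ?thesis by (rule hpath_mono) (use \<open>\<kappa> * M \<le> 1 / 6 * M\<close> R in \<open>simp add: M_def\<close>)
  qed
  have \<Gamma>_diff: "hpath s (-T) T (\<lambda>t n. \<Gamma> a t n - \<Gamma> b t n) (W / 2)"
    if ab: "hpath s (-T) T a M" "hpath s (-T) T b M" and w: "hpath s (-T) T (\<lambda>t n. a t n - b t n) W" for a b W
  proof -
    have W: "0 \<le> W" using w by (rule hpath_nonneg)
    have "hpath s (-T) T (\<lambda>t n. - (\<i> * complex_of_real \<sigma>) * (duhamel \<alpha> a t n - duhamel \<alpha> b t n))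
       (cmod (- (\<i> * complex_of_real \<sigma>)) * (3 * tri_const * M\<^sup>2 * W * (2 * T) powr (1/8)))"
      by (intro hpath_scale duhamel_diff_bound T ab w)
    moreover have "(\<lambda>t n. - (\<i> * complex_of_real \<sigma>) * (duhamel \<alpha> a t n - duhamel \<alpha> b t n)) = (\<lambda>t n. \<Gamma> a t n - \<Gamma> b t n)"
      by (intro ext) (simp add: \<Gamma>_def algebra_simps)
    moreover have "3 * tri_const * M\<^sup>2 * W * (2 * T) powr (1/8) = 3 * \<kappa> * W" by (simp add: \<kappa>_def mult_ac)
    moreover have "3 * \<kappa> * W \<le> 3 * (1/6) * W" using \<kappa> W by (intro mult_right_mono) auto
    ultimately show ?thesis unfolding norm_minus_cancel n1 by (auto elim!: hpath_mono)
  qed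
  define a where "a j = (\<Gamma> ^^ j) (\<lambda>t. c)" for j
  have a0: "a 0 = (\<lambda>t. c)" and aS: "a (Suc j) = \<Gamma> (a j)" for j by (simp_all add: a_def)
  have aM: "hpath s (-T) T (a j) M" for j
  proof (induction j)
    case 0
    have "hpath s (-T) T (\<lambda>t. c) R" by (rule hpath_const[OF c])
    then show ?case unfolding a0 by (rule hpath_mono) (use R in \<open>simp add: M_def\<close>)
  next
    case (Suc j)
    then show ?case unfolding aS by (rule \<Gamma>_bound)
  qed
  have a_step: "hpath s (-T) T (\<lambda>t n. a (Suc j) t n - a j t n) (2 * M / 2 ^ j)" for j
  proof (induction j)
    case 0
    show ?case using hpath_diff[OF aM[of "Suc 0"] aM[of 0]] by simp
  next
    case (Suc j)
    from \<Gamma>_diff[OF aM aM this] show ?case by (simp add: aS field_simps)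
  qed
  \<comment> \<open>The bound is the exact partial sum of the geometric series of the steps, so the
    induction on \<open>d\<close> closes with equality.\<close>
  have a_tel: "hpath s (-T) T (\<lambda>t n. a (k + d) t n - a k t n) (4 * M / 2 ^ k - 4 * M / 2 ^ (k + d))" for k d
  proof (induction d)
    case 0
    then show ?case by (auto intro!: hpath_const hb_zero)
  next
    case (Suc d)
    from hpath_add[OF a_step[of "k + d"] Suc]
    have "hpath s (-T) T (\<lambda>t n. a (k + Suc d) t n - a k t n) (2 * M / 2 ^ (k + d) + (4 * M / 2 ^ k - 4 * M / 2 ^ (k + d)))"
      by simp
    moreover have "2 * M / 2 ^ (k + d) + (4 * M / 2 ^ k - 4 * M / 2 ^ (k + d)) = 4 * M / 2 ^ k - 4 * M / 2 ^ (k + Suc d)"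
      by (simp add: field_simps)
    ultimately show ?case by simp
  qed
  have a_close: "hpath s (-T) T (\<lambda>t n. a j t n - a k t n) (8 * M / 2 ^ K)" if "K \<le> j" "K \<le> k" for j k K
  proof -
    have *: "hpath s (-T) T (\<lambda>t n. a j t n - a K t n) (4 * M / 2 ^ K)" if j: "K \<le> j" for j
    proof -
      have "hpath s (-T) T (\<lambda>t n. a (K + (j - K)) t n - a K t n) (4 * M / 2 ^ K)"
        by (rule hpath_mono[OF a_tel]) (use M in simp)
      then show ?thesis using j by simp
    qed
    have "hpath s (-T) T (\<lambda>t n. (a j t n - a K t n) - (a k t n - a K t n)) (4 * M / 2 ^ K + 4 * M / 2 ^ K)"
      by (intro hpath_diff * that)
    then show ?thesis by simp
  qed
  have small_tail: "\<exists>K. 8 * M / 2 ^ K \<le> \<epsilon>" if e: "0 < \<epsilon>" for \<epsilon>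
  proof -
    obtain K where K: "8 * M / \<epsilon> < 2 ^ K" using real_arch_pow[of 2 "8 * M / \<epsilon>"] by auto
    then have "8 * M / 2 ^ K \<le> \<epsilon>" using e by (simp add: field_simps)
    then show ?thesis ..
  qed
  obtain b where "\<exists>M. hpath s (-T) T b M"
    and lim: "\<And>t n. t \<in> {-T..T} \<Longrightarrow> (\<lambda>j. a j t n) \<longlonglongrightarrow> b t n"
    and conv: "\<And>\<epsilon>. 0 < \<epsilon> \<Longrightarrow> \<exists>K. \<forall>j\<ge>K. hpath s (-T) T (\<lambda>t n. a j t n - b t n) \<epsilon>"
  proof (rule hpath_complete[OF s0(2), of "-T" T a])
    show "\<exists>M. hpath s (-T) T (a j) M" for j using aM by blast
    fix \<epsilon> :: real assume "0 < \<epsilon>"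
    then obtain K where "8 * M / 2 ^ K \<le> \<epsilon>" using small_tail by blast
    then show "\<exists>K. \<forall>j\<ge>K. \<forall>k\<ge>K. hpath s (-T) T (\<lambda>t n. a j t n - a k t n) \<epsilon>"
      using hpath_mono[OF a_close] by blast
  qed blast
  have bM: "hpath s (-T) T b M" by (rule hpath_limit[where a = a and k = 0]) (use lim aM in auto)
  have "b t n = \<Gamma> b t n" if t: "t \<in> {-T..T}" for t n
  proof (rule LIMSEQ_unique)
    show "(\<lambda>j. a (Suc j) t n) \<longlonglongrightarrow> b t n" by (rule LIMSEQ_Suc[OF lim[OF t]])
    show "(\<lambda>j. a (Suc j) t n) \<longlonglongrightarrow> \<Gamma> b t n"
      unfolding LIMSEQ_iff
    proof (intro allI impI)
      fix e :: real assume e: "0 < e"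
      then obtain K where K: "\<forall>j\<ge>K. hpath s (-T) T (\<lambda>t n. a j t n - b t n) e" using conv by blast
      show "\<exists>K. \<forall>j\<ge>K. norm (a (Suc j) t n - \<Gamma> b t n) < e"
      proof (intro exI allI impI)
        fix j assume "K \<le> j"
        then have "hpath s (-T) T (\<lambda>t n. a j t n - b t n) e" using K by blast
        from \<Gamma>_diff[OF aM bM this] have "hpath s (-T) T (\<lambda>t n. \<Gamma> (a j) t n - \<Gamma> b t n) (e / 2)" .
        from hb_component[OF s0(2) hpath_hb[OF this t], of n] e
        show "norm (a (Suc j) t n - \<Gamma> b t n) < e" by (simp add: aS)
      qed
    qed
  qed
  then have "mild \<sigma> T c b" by (simp add: mild_def \<Gamma>_def)
  with bM show ?thesis unfolding M_def by blast
qed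

text \<open>A bound W on the difference improves to \<eta> + W/2, whose fixed point is 2 \<eta>.
  Iterating from the trivial bound 2M reaches it in the limit.\<close>

lemma mild_lipschitz:
  assumes T: "0 < T" "2 * T \<le> 1" and \<sigma>: "\<bar>\<sigma>\<bar> = 1" and small: "tri_const * M\<^sup>2 * (2 * T) powr (1/8) \<le> 1 / 6"
    and a: "hpath s (-T) T a M" "mild \<sigma> T c a" and b: "hpath s (-T) T b M" "mild \<sigma> T d b"
    and cd: "hb s (\<lambda>n. c n - d n) \<eta>"
  shows "hpath s (-T) T (\<lambda>t n. a t n - b t n) (2 * \<eta>)"
proof -
  have M: "0 \<le> M" using a(1) by (rule hpath_nonneg)
  have \<eta>: "0 \<le> \<eta>" using cd by (rule hb_nonneg)
  let ?w = "\<lambda>t n. a t n - b t n"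
  have n1: "cmod (- (\<i> * complex_of_real \<sigma>)) = 1" using \<sigma> by (simp add: norm_mult)
  have improve: "hpath s (-T) T ?w (\<eta> + W / 2)" if w: "hpath s (-T) T ?w W" for W
  proof -
    have W: "0 \<le> W" using w by (rule hpath_nonneg)
    have "hpath s (-T) T (\<lambda>t n. (c n - d n) + - (\<i> * complex_of_real \<sigma>) * (duhamel \<alpha> a t n - duhamel \<alpha> b t n))
       (\<eta> + cmod (- (\<i> * complex_of_real \<sigma>)) * (3 * tri_const * M\<^sup>2 * W * (2 * T) powr (1/8)))"
      by (intro hpath_add hpath_const cd hpath_scale duhamel_diff_bound T a b w)
    then have "hpath s (-T) T ?w (\<eta> + cmod (- (\<i> * complex_of_real \<sigma>)) * (3 * tri_const * M\<^sup>2 * W * (2 * T) powr (1/8)))"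
      by (subst hpath_cong[where b = "\<lambda>t n. (c n - d n) + - (\<i> * complex_of_real \<sigma>) * (duhamel \<alpha> a t n - duhamel \<alpha> b t n)"])
         (use a(2) b(2) in \<open>auto simp: mild_def algebra_simps\<close>)
    moreover have "3 * tri_const * M\<^sup>2 * W * (2 * T) powr (1/8) \<le> W / 2"
      using mult_right_mono[OF small W] by (simp add: mult_ac)
    ultimately show ?thesis unfolding n1 by (auto elim!: hpath_mono)
  qed
  have "hpath s (-T) T ?w (2 * \<eta> + 2 * M * (1 / 2) ^ k)" for k
  proof (induction k)
    case 0
    show ?case by (rule hpath_mono[OF hpath_diff[OF a(1) b(1)]]) (use \<eta> in simp)
  next
    case (Suc k)
    from improve[OF this] show ?case by (simp add: add_divide_distrib)
  qed
  moreover have "(\<lambda>k. 2 * \<eta> + 2 * M * (1 / 2) ^ k) \<longlonglongrightarrow> 2 * \<eta> + 2 * M * 0"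
    by (intro tendsto_intros LIMSEQ_power_zero) auto
  ultimately have "hpath s (-T) T ?w (2 * \<eta> + 2 * M * 0)" by (rule hpath_tendsto)
  then show ?thesis by simp
qed

text \<open>The cube is at most the sum of the square and the fourth power, and the fourth power is
  the bilinear bound for a path paired with itself.\<close>

lemma U_L3:
  assumes T: "0 < T" "2 * T \<le> 1" and a: "hpath s (-T) T a M"
  shows "(\<integral>\<^sup>+r\<in>{-T..T}. (\<integral>\<^sup>+z. ennreal ((cmod (U \<alpha> a (r, z))) ^ 3) \<partial>torus2) \<partial>lborel) < \<infinity>"
proof -
  have pq: "-T < T" "T - - T \<le> 1" using T by auto
  note [measurable] = U_meas[OF a]
  let ?g = "\<lambda>w. ennreal ((cmod (U \<alpha> a w)) ^ 3)"
  have gm: "?g \<in> borel_measurable (PT (-T) T)" by measurable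
  have "(\<lambda>r. \<integral>\<^sup>+z. ?g (r, z) \<partial>torus2) \<in> borel_measurable (TI (-T) T)"
    using gm unfolding PT_def by (intro torus2.borel_measurable_nn_integral) simp
  then have "(\<integral>\<^sup>+r\<in>{-T..T}. (\<integral>\<^sup>+z. ?g (r, z) \<partial>torus2) \<partial>lborel) = (\<integral>\<^sup>+r. \<integral>\<^sup>+z. ?g (r, z) \<partial>torus2 \<partial>TI (-T) T)"
    by (simp add: nn_integral_TI)
  also have "\<dots> = integral\<^sup>N (PT (-T) T) ?g" by (rule nn_integral_PT[OF gm, symmetric])
  also have "\<dots> \<le> (\<integral>\<^sup>+w. ennreal ((cmod (U \<alpha> a w))\<^sup>2) + ennreal ((cmod (U \<alpha> a w * U \<alpha> a w))\<^sup>2) \<partial>PT (-T) T)"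
  proof (rule nn_integral_mono)
    fix w
    let ?x = "cmod (U \<alpha> a w)"
    have "?x ^ 3 \<le> ?x\<^sup>2 + (?x * ?x)\<^sup>2"
    proof -
      have "0 \<le> ?x\<^sup>2 * ((?x - 1/2)\<^sup>2 + 3/4)" by (intro mult_nonneg_nonneg add_nonneg_nonneg) auto
      also have "\<dots> = ?x\<^sup>2 + (?x * ?x)\<^sup>2 - ?x ^ 3" by (simp add: power2_eq_square power3_eq_cube algebra_simps)
      finally show ?thesis by simp
    qed
    then show "?g w \<le> ennreal (?x\<^sup>2) + ennreal ((cmod (U \<alpha> a w * U \<alpha> a w))\<^sup>2)"
      by (simp add: norm_mult ennreal_plus[symmetric] ennreal_leI del: ennreal_plus)
  qed
  also have "\<dots> = (\<integral>\<^sup>+w. ennreal ((cmod (U \<alpha> a w))\<^sup>2) \<partial>PT (-T) T) + (\<integral>\<^sup>+w. ennreal ((cmod (U \<alpha> a w * U \<alpha> a w))\<^sup>2) \<partial>PT (-T) T)"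
    by (rule nn_integral_add) measurable
  also have "\<dots> < \<infinity>"
    using bilinear[OF pq a a] U_L2[OF a s0(1), of \<alpha>] T by (auto simp: less_top[symmetric] top_unique)
  finally show ?thesis .
qed

text \<open>The multiplier of S(t - r) splits into those of S(t) and S(-r). The former leaves the
  integral, and having modulus 1 at each frequency it can be cancelled from the equation.\<close>

lemma integral_equation_iff:
  assumes T: "0 < T" and u: "\<And>t. t \<in> {-T..T} \<Longrightarrow> u t \<in> sobolev s"
  shows "(\<forall>t\<in>{-T..T}. \<forall>n. fourier_coeff (u t) n = propagator \<alpha> t (fourier_coeff \<psi>) n
          - \<i> * complex_of_real \<sigma> * (LBINT r=0..t. propagator \<alpha> (t - r) (fourier_coeff (cubic (u r))) n))
     \<longleftrightarrow> mild \<sigma> T (fourier_coeff \<psi>) (ipath \<alpha> u)"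
proof -
  have "(fourier_coeff (u t) n = propagator \<alpha> t (fourier_coeff \<psi>) n
          - \<i> * complex_of_real \<sigma> * (LBINT r=0..t. propagator \<alpha> (t - r) (fourier_coeff (cubic (u r))) n))
     \<longleftrightarrow> ipath \<alpha> u t n = fourier_coeff \<psi> n - \<i> * complex_of_real \<sigma> * duhamel \<alpha> (ipath \<alpha> u) t n"
    if t: "t \<in> {-T..T}" for t n
  proof -
    let ?e = "cis (- (t * omega \<alpha> n))"
    have "(LBINT r=ereal 0..ereal t. propagator \<alpha> (t - r) (fourier_coeff (cubic (u r))) n)
      = (LBINT r=ereal 0..ereal t. ?e * integrand \<alpha> (ipath \<alpha> u) n r)"
    proof (rule interval_integral_cong)
      fix r assume "r \<in> einterval (min (ereal 0) (ereal t)) (max (ereal 0) (ereal t))"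
      then have r: "r \<in> {-T..T}" using t T by (auto simp: einterval_iff min_def max_def split: if_splits)
      have "cis (- ((t - r) * omega \<alpha> n)) = ?e * cis (r * omega \<alpha> n)"
        by (simp add: cis_mult algebra_simps)
      then show "propagator \<alpha> (t - r) (fourier_coeff (cubic (u r))) n = ?e * integrand \<alpha> (ipath \<alpha> u) n r"
        by (simp add: propagator_cis integrand_def fourier_coeff_cubic[where \<alpha> = \<alpha> and u = u and r = r and s = s, OF u[OF r] s0(1)])
    qed
    also have "\<dots> = ?e * duhamel \<alpha> (ipath \<alpha> u) t n"
      by (simp add: duhamel_def zero_ereal_def)
    finally have "(LBINT r=0..t. propagator \<alpha> (t - r) (fourier_coeff (cubic (u r))) n) = ?e * duhamel \<alpha> (ipath \<alpha> u) t n"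
      by (simp add: zero_ereal_def)
    then have "(fourier_coeff (u t) n = propagator \<alpha> t (fourier_coeff \<psi>) n
          - \<i> * complex_of_real \<sigma> * (LBINT r=0..t. propagator \<alpha> (t - r) (fourier_coeff (cubic (u r))) n))
      \<longleftrightarrow> ?e * ipath \<alpha> u t n = ?e * (fourier_coeff \<psi> n - \<i> * complex_of_real \<sigma> * duhamel \<alpha> (ipath \<alpha> u) t n)"
      by (simp add: fourier_coeff_ipath[of u t n \<alpha>] propagator_cis algebra_simps)
    then show ?thesis by simp
  qed
  then show ?thesis by (auto simp: mild_def)
qed

lemma duhamel_cong:
  assumes "\<And>t. t \<in> {-T..T} \<Longrightarrow> a t = b t" "t \<in> {-T..T}" "0 < T"
  shows "duhamel \<alpha> a t n = duhamel \<alpha> b t n"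
proof -
  have "(LBINT r=ereal 0..ereal t. integrand \<alpha> a n r) = (LBINT r=ereal 0..ereal t. integrand \<alpha> b n r)"
  proof (rule interval_integral_cong)
    fix r assume "r \<in> einterval (min (ereal 0) (ereal t)) (max (ereal 0) (ereal t))"
    then have r: "r \<in> {-T..T}" using assms by (auto simp: einterval_iff min_def max_def split: if_splits)
    then show "integrand \<alpha> a n r = integrand \<alpha> b n r"
      using assms(1) by (simp add: integrand_def prod3_def U_def)
  qed
  then show ?thesis by (simp add: duhamel_def zero_ereal_def)
qed

lemma mild_cong:
  assumes "\<And>t. t \<in> {-T..T} \<Longrightarrow> a t = b t" "0 < T"
  shows "mild \<sigma> T c a \<longleftrightarrow> mild \<sigma> T c b"
  unfolding mild_def using assms duhamel_cong[of T a b] by simp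

text \<open>The lifespan is chosen from \<open>R\<close> alone, which bounds all data in the unit
  ball around \<phi>, so these share one time interval. Their solutions lie in one ball of the path
  space, where the solution map is Lipschitz; uniqueness, in contrast, is proved against competitors
  of any norm.\<close>

theorem well_posed:
  assumes \<sigma>: "\<bar>\<sigma>\<bar> = 1"
  shows "locally_well_posed \<alpha> \<sigma> s"
  unfolding locally_well_posed_def
proof (rule exI[of _ "X_space \<alpha> s"], rule exI[of _ "X_norm \<alpha> s"], rule conjI)
  show "\<forall>T>0. banach_embedded_in_C_sobolev s T (X_space \<alpha> s T) (X_norm \<alpha> s T)"
    using X_space_banach[OF s0(1)] by blast
next
  show "\<forall>\<phi>\<in>sobolev s. \<exists>T>0. \<exists>\<delta>>0. \<exists>\<Phi>.
          let B = {\<psi> \<in> sobolev s. sobolev_norm s (\<lambda>z. \<psi> z - \<phi> z) < \<delta>} in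
            (\<forall>\<psi>\<in>B. \<Phi> \<psi> \<in> X_space \<alpha> s T \<and> solution_on \<alpha> \<sigma> s T \<psi> (\<Phi> \<psi>) \<and>
               (\<forall>v\<in>X_space \<alpha> s T. solution_on \<alpha> \<sigma> s T \<psi> v \<longrightarrow> same_path T v (\<Phi> \<psi>))) \<and>
            (\<forall>\<psi>\<in>B. \<forall>\<epsilon>>0. \<exists>\<eta>>0. \<forall>\<psi>'\<in>B. sobolev_norm s (\<lambda>z. \<psi>' z - \<psi> z) < \<eta> \<longrightarrow>
               C_sobolev_norm s T (\<lambda>t z. \<Phi> \<psi>' t z - \<Phi> \<psi> t z) < \<epsilon>)" (is "\<forall>\<phi>\<in>_. ?P \<phi>")
  proof
  fix \<phi> assume \<phi>: "\<phi> \<in> sobolev s"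
  \<comment> \<open>The added 1 is the radius of the ball \<open>B\<close> of admissible
    data.\<close>
  define R where "R = 1 + sobolev_norm s \<phi>"
  have R: "0 < R" using sobolev_norm_nonneg[of s \<phi>] by (simp add: R_def)
  let ?K = "tri_const * (2 * R)\<^sup>2"
  have K: "0 \<le> ?K" using tri_const_nonneg by simp
  then have "0 < 1 / (6 * (?K + 1))" by simp
  then obtain h where h: "0 < h" "h \<le> 1" "h powr (1/8) \<le> 1 / (6 * (?K + 1))" by (rule eighth_root_small)
  define T where "T = h / 2"
  have T: "0 < T" "2 * T \<le> 1" and Th: "2 * T = h" using h by (auto simp: T_def)
  have small: "?K * (2 * T) powr (1/8) \<le> 1 / 6"
  proof -
    have "?K * (2 * T) powr (1/8) \<le> ?K * (1 / (6 * (?K + 1)))" unfolding Th using h K by (intro mult_left_mono) auto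
    also have "\<dots> \<le> 1 / 6" using K by (simp add: divide_simps)
    finally show ?thesis .
  qed
  define B where "B = {\<psi> \<in> sobolev s. sobolev_norm s (\<lambda>z. \<psi> z - \<phi> z) < 1}"
  define S where "S \<psi> = (SOME a. hpath s (-T) T a (2 * R) \<and> mild \<sigma> T (fourier_coeff \<psi>) a)" for \<psi>
  define \<Phi> where "\<Phi> \<psi> = (\<lambda>t z. U \<alpha> (S \<psi>) (t, z))" for \<psi>
  have S: "hpath s (-T) T (S \<psi>) (2 * R)" "mild \<sigma> T (fourier_coeff \<psi>) (S \<psi>)" if \<psi>: "\<psi> \<in> B" for \<psi>
  proof -
    have \<psi>s: "\<psi> \<in> sobolev s" "sobolev_norm s (\<lambda>z. \<psi> z - \<phi> z) \<le> 1" using \<psi> by (auto simp: B_def)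
    have "hb s (fourier_coeff (\<lambda>z. \<psi> z - \<phi> z)) 1"
      using hb_mono[OF sobolev_hb[OF sobolev_diff[OF \<psi>s(1) \<phi>]] \<psi>s(2)] .
    from hb_add[OF this sobolev_hb[OF \<phi>]] have "hb s (fourier_coeff \<psi>) R"
      unfolding fourier_coeff_diff_sobolev[OF \<psi>s(1) \<phi>] by (simp add: R_def)
    from someI_ex[OF mild_exists[OF T \<sigma> this small]]
    show "hpath s (-T) T (S \<psi>) (2 * R)" "mild \<sigma> T (fourier_coeff \<psi>) (S \<psi>)" by (auto simp: S_def)
  qed
  have \<Phi>X: "\<Phi> \<psi> \<in> X_space \<alpha> s T" if "\<psi> \<in> B" for \<psi>
    unfolding \<Phi>_def by (rule U_in_X_space[OF S(1)[OF that] s0(1)])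
  have \<Phi>s: "\<Phi> \<psi> t \<in> sobolev s" if "\<psi> \<in> B" "t \<in> {-T..T}" for \<psi> t
    using \<Phi>X[OF that(1)] that(2) by (simp add: X_space_def)
  have \<Phi>i: "ipath \<alpha> (\<Phi> \<psi>) t = S \<psi> t" if "\<psi> \<in> B" "t \<in> {-T..T}" for \<psi> t
    unfolding \<Phi>_def by (rule U_sobolev(2)[OF S(1)[OF that(1)] s0(1) that(2)])
  have X_C: "u \<in> C_sobolev s T" if "u \<in> X_space \<alpha> s T" for u
    using X_space_banach[OF s0(1) T(1), of \<alpha>] that by (auto simp: banach_embedded_in_C_sobolev_def)
  have sol: "solution_on \<alpha> \<sigma> s T \<psi> (\<Phi> \<psi>)" if \<psi>: "\<psi> \<in> B" for \<psi>
    unfolding solution_on_def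
  proof (intro conjI)
    show "\<Phi> \<psi> \<in> C_sobolev s T" by (rule X_C[OF \<Phi>X[OF \<psi>]])
    show "(\<integral>\<^sup>+r\<in>{-T..T}. (\<integral>\<^sup>+z. ennreal ((cmod (\<Phi> \<psi> r z)) ^ 3) \<partial>torus2) \<partial>lborel) < \<infinity>"
      unfolding \<Phi>_def by (rule U_L3[OF T S(1)[OF \<psi>]])
    have "mild \<sigma> T (fourier_coeff \<psi>) (ipath \<alpha> (\<Phi> \<psi>))"
      using S(2)[OF \<psi>] by (subst mild_cong[OF \<Phi>i[OF \<psi>] T(1)])
    then show "\<forall>t\<in>{-T..T}. \<forall>n. fourier_coeff (\<Phi> \<psi> t) n = propagator \<alpha> t (fourier_coeff \<psi>) n
          - \<i> * complex_of_real \<sigma> * (LBINT r=0..t. propagator \<alpha> (t - r) (fourier_coeff (cubic (\<Phi> \<psi> r))) n)"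
      by (subst integral_equation_iff[OF T(1) \<Phi>s[OF \<psi>]])
  qed
  have uniq: "same_path T v (\<Phi> \<psi>)" if \<psi>: "\<psi> \<in> B" and v: "v \<in> X_space \<alpha> s T" "solution_on \<alpha> \<sigma> s T \<psi> v" for \<psi> v
    unfolding same_path_def
  proof
    fix t assume t: "t \<in> {-T..T}"
    have vs: "v t \<in> sobolev s" if "t \<in> {-T..T}" for t using v(1) that by (simp add: X_space_def)
    have mv: "mild \<sigma> T (fourier_coeff \<psi>) (ipath \<alpha> v)"
      by (rule integral_equation_iff[THEN iffD1, OF T(1) _ v(2)[unfolded solution_on_def, THEN conjunct2, THEN conjunct2]])
         (rule vs)
    \<comment> \<open>A competitor \<open>v\<close> may have any norm, and
      \<open>mild_unique\<close> asks for one bound valid for both paths.\<close>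
    define A where "A = max (X_norm \<alpha> s T v) (2 * R)"
    have "ipath \<alpha> v t = S \<psi> t"
    proof (rule mild_unique[OF T \<sigma> _ mv _ S(2)[OF \<psi>] t])
      show "hpath s (-T) T (ipath \<alpha> v) A" by (rule hpath_mono[OF X_norm_hpath[OF v(1)]]) (simp add: A_def)
      show "hpath s (-T) T (S \<psi>) A" by (rule hpath_mono[OF S(1)[OF \<psi>]]) (simp add: A_def)
    qed
    then have "ipath \<alpha> v t = ipath \<alpha> (\<Phi> \<psi>) t" using \<Phi>i[OF \<psi> t] by simp
    then have "fourier_coeff (v t) = fourier_coeff (\<Phi> \<psi> t)"
      by (intro ext) (simp add: fourier_coeff_ipath[of _ t _ \<alpha>])
    then show "AE z in torus2. v t z = \<Phi> \<psi> t z" by (rule sobolev_eq_AE[OF vs[OF t] \<Phi>s[OF \<psi> t]])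
  qed
  have dep: "\<exists>\<eta>>0. \<forall>\<psi>'\<in>B. sobolev_norm s (\<lambda>z. \<psi>' z - \<psi> z) < \<eta> \<longrightarrow>
      C_sobolev_norm s T (\<lambda>t z. \<Phi> \<psi>' t z - \<Phi> \<psi> t z) < \<epsilon>" if \<psi>: "\<psi> \<in> B" and e: "0 < \<epsilon>" for \<psi> \<epsilon>
  proof (intro exI conjI ballI impI)
    \<comment> \<open>The solution map has Lipschitz constant 2, so \<epsilon>/3 leaves room for the
      strict inequality after taking the supremum.\<close>
    show "0 < \<epsilon> / 3" using e by simp
    fix \<psi>' assume \<psi>': "\<psi>' \<in> B" and close: "sobolev_norm s (\<lambda>z. \<psi>' z - \<psi> z) < \<epsilon> / 3"
    have ss: "\<psi> \<in> sobolev s" "\<psi>' \<in> sobolev s" using \<psi> \<psi>' by (auto simp: B_def)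
    have "hb s (fourier_coeff (\<lambda>z. \<psi>' z - \<psi> z)) (\<epsilon> / 3)"
      by (rule hb_mono[OF sobolev_hb[OF sobolev_diff[OF ss(2,1)]]]) (use close in simp)
    then have cd: "hb s (\<lambda>n. fourier_coeff \<psi>' n - fourier_coeff \<psi> n) (\<epsilon> / 3)"
      by (simp only: fourier_coeff_diff_sobolev[OF ss(2,1)])
    have w: "hpath s (-T) T (\<lambda>t n. S \<psi>' t n - S \<psi> t n) (2 * (\<epsilon> / 3))"
      by (rule mild_lipschitz[OF T \<sigma> small S[OF \<psi>'] S[OF \<psi>] cd])
    have "C_sobolev_norm s T (\<lambda>t z. \<Phi> \<psi>' t z - \<Phi> \<psi> t z) \<le> 2 * (\<epsilon> / 3)"
      unfolding C_sobolev_norm_def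
    proof (rule cSUP_least)
      fix t assume t: "t \<in> {-T..T}"
      have "ipath \<alpha> (\<lambda>t z. \<Phi> \<psi>' t z - \<Phi> \<psi> t z) t = (\<lambda>n. S \<psi>' t n - S \<psi> t n)"
        by (simp only: ipath_diff[where u = "\<Phi> \<psi>'" and v = "\<Phi> \<psi>", OF \<Phi>s[OF \<psi>' t] \<Phi>s[OF \<psi> t]] \<Phi>i[OF \<psi>' t] \<Phi>i[OF \<psi> t])
      then have "hb s (fourier_coeff (\<lambda>z. \<Phi> \<psi>' t z - \<Phi> \<psi> t z)) (2 * (\<epsilon> / 3))"
        using hpath_hb[OF w t] hb_ipath[of s \<alpha> "\<lambda>t z. \<Phi> \<psi>' t z - \<Phi> \<psi> t z" t] by simp
      then show "sobolev_norm s (\<lambda>z. \<Phi> \<psi>' t z - \<Phi> \<psi> t z) \<le> 2 * (\<epsilon> / 3)" by (rule sobolev_norm_le)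
    qed (use T in auto)
    then show "C_sobolev_norm s T (\<lambda>t z. \<Phi> \<psi>' t z - \<Phi> \<psi> t z) < \<epsilon>" using e by simp
  qed
  show "?P \<phi>"
    unfolding Let_def
  proof (rule exI[of _ T], rule conjI[OF T(1)], rule exI[of _ "1::real"], rule conjI[OF zero_less_one],
      rule exI[of _ \<Phi>], fold B_def, rule conjI)
    show "\<forall>\<psi>\<in>B. \<Phi> \<psi> \<in> X_space \<alpha> s T \<and> solution_on \<alpha> \<sigma> s T \<psi> (\<Phi> \<psi>) \<and>
               (\<forall>v\<in>X_space \<alpha> s T. solution_on \<alpha> \<sigma> s T \<psi> v \<longrightarrow> same_path T v (\<Phi> \<psi>))"
      using \<Phi>X sol uniq by blast
    show "\<forall>\<psi>\<in>B. \<forall>\<epsilon>>0. \<exists>\<eta>>0. \<forall>\<psi>'\<in>B. sobolev_norm s (\<lambda>z. \<psi>' z - \<psi> z) < \<eta> \<longrightarrow>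
               C_sobolev_norm s T (\<lambda>t z. \<Phi> \<psi>' t z - \<Phi> \<psi> t z) < \<epsilon>"
      using dep by blast
  qed
  qed
qed

end

theorem theorem2p8:
  fixes \<alpha> \<sigma> s :: real
  assumes "\<alpha> < 0" and "\<sigma> = 1 \<or> \<sigma> = -1" and "s > 1 / 4"
  shows "locally_well_posed \<alpha> \<sigma> s"
proof -
  obtain C where "strichartz \<alpha> s C" using strichartz_exists[OF assms(1,3)] by blast
  then show ?thesis using assms(2) by (intro strichartz.well_posed) auto
qed

end
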